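(* Let $\alpha,\beta\in\mathbb{R}$, $p>2$, $c>0$, let $u\in\mathscr{S}_\alpha(c)$ be a critical point of $\mathcal{E}_\alpha|_{\mathscr{S}_\alpha(c)}$ and let $\omega\in\mathbb{R}$ denote its associated Lagrange multiplier, i.e. $$\langle\mathcal{E}_\alpha'(u),v\rangle_{X_\alpha^*,X_\alpha}+\omega\,\mathrm{Re}\,\langle u,v\rangle_{L^2}=0\quad\text{for every }v\in X_\alpha.$$ Then $u\in\mathrm{Dom}(-\Delta_\alpha)$ and the function $\mathbb{R}\ni t\mapsto e^{\mathrm{i}\omega t}u\in\mathrm{Dom}(-\Delta_\alpha)$ is a standing wave of the evolution equation $$\mathrm{i}\psi'(t)=-\Delta_\alpha\psi(t)-w_{\psi(t)}\psi(t)-\beta\psi(t)|\psi(t)|^{p-2}$$ in the sense that $$-\Delta_\alpha u+\omega u=w_uu+\beta u|u|^{p-2}\quad\text{a.e. on }\mathbb{R}^2.$$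
   Context: All function spaces consist of complex-valued functions defined a.e. on $\mathbb{R}^2$; sesquilinear forms are linear in the second entry. $\|\cdot\|_{\dot W^{1,2}}$ denotes the $L^2$ norm of the gradient. The pairing $\langle T,x\rangle_{X_\alpha^*,X_\alpha}$ denotes the real part of the duality pairing. For $\lambda>0$ let $G_\lambda(x)=\frac{1}{2\pi}K_0(\sqrt\lambda|x|)$, $x\in\mathbb{R}^2\setminus\{0\}$, where $K_0$ is the modified Bessel function of the second kind (so $-\Delta G_\lambda+\lambda G_\lambda=\delta_0$ in the sense of distributions). Let $\gamma$ be the Euler--Mascheroni constant, $\theta_\lambda=\frac{\gamma}{2\pi}+\frac1{2\pi}\log\frac{\sqrt\lambda}{2}$ and $\omega_\alpha=4e^{-4\pi\alpha-2\gamma}$. Energy space: $W^{1,2}_\alpha$ is the vector space $\{\phi+qG_\lambda:\phi\in W^{1,2}(\mathbb{R}^2),\ q\in\mathbb{C},\ \lambda>0\}$. For $u\in W^{1,2}_\alpha$ the coefficient $q$ is the same in every such decomposition, and for every $\lambda>0$ there is a unique $\phi_\lambda\in W^{1,2}$ with $u=\phi_\lambda+qG_\lambda$. For $u=\phi_u+q_uG_\lambda$ and $v=\phi_v+q_vG_\lambda$ (same $\lambda$) define $$H_\alpha[u,v]=\langle\phi_u,\phi_v\rangle_{\dot W^{1,2}}+\lambda\bigl(\langle\phi_u,\phi_v\rangle_{L^2}-\langle u,v\rangle_{L^2}\bigr)+(\alpha+\theta_\lambda)\overline{q_u}q_v,$$ which does not depend on $\lambda$, and $\mathcal{H}_\alpha(u)=H_\alpha[u,u]$.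 $W^{1,2}_\alpha$ is a Hilbert space with inner product $\langle u,v\rangle_{W^{1,2}_\alpha}=H_\alpha[u,v]+(1+\omega_\alpha)\langle u,v\rangle_{L^2}$; it embeds in $L^r$ for every $r\in[2,\infty)$. $X_\alpha$ is the Hilbert space of all $u\in W^{1,2}_\alpha$ with $\int\log(1+|x|)|u(x)|^2dx<\infty$, with inner product $\langle u,v\rangle_{X_\alpha}=\langle u,v\rangle_{W^{1,2}_\alpha}+\int\log(1+|x|)\overline{u(x)}v(x)dx$. The energy functional $\mathcal{E}_\alpha:X_\alpha\to\mathbb{R}$, which is of class $C^1$, is $$\mathcal{E}_\alpha(u)=\frac12\mathcal{H}_\alpha(u)+\frac14\iint\log(|x-y|)|u(x)|^2|u(y)|^2dx\,dy-\frac{\beta}{p}\|u\|_{L^p}^p,$$ and $\mathscr{S}_\alpha(c)=\{u\in X_\alpha:\|u\|_{L^2}^2=c\}$. For $u\in X_\alpha$, $w_u(x)=-\int_{\mathbb{R}^2}\log(|x-y|)|u(y)|^2dy$. The linear operator $-\Delta_\alpha:\mathrm{Dom}(-\Delta_\alpha)\to L^2_{\mathrm{loc}}$ has domain $$\mathrm{Dom}(-\Delta_\alpha)=\{\phi+qG_\lambda:\phi\in W^{2,2}_{\mathrm{loc}},\ q\in\mathbb{C},\ \lambda>0,\ (\alpha+\theta_\lambda)q=\phi(0)\}$$ and acts by $-\Delta_\alpha u=-\Delta\phi-q\lambda G_\lambda$ for $u=\phi+qG_\lambda\in\mathrm{Dom}(-\Delta_\alpha)$ (here $\phi(0)$ refers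 to the continuous representative of $\phi$). *)

theory Defs
  imports "HOL-Analysis.Analysis"
begin

text \<open>
  Functions defined a.e. on the plane are represented by total, Lebesgue measurable functions;
  every function space below is closed under modification on a Lebesgue null set, and
  identities between such functions are stated a.e.
\<close>

type_synonym plane = "real ^ 2"

definition L2 :: "(plane \<Rightarrow> complex) set" where
  "L2 = {f \<in> borel_measurable lebesgue. integrable lebesgue (\<lambda>x. (cmod (f x))\<^sup>2)}"

definition L2loc :: "(plane \<Rightarrow> complex) set" where
  "L2loc = {f \<in> borel_measurable lebesgue.
     \<forall>K. compact K \<longrightarrow> set_integrable lebesgue K (\<lambda>x. (cmod (f x))\<^sup>2)}"

definition L1loc :: "(plane \<Rightarrow> complex) set" where
  "L1loc = {f \<in> borel_measurable lebesgue. \<forall>K. compact K \<longrightarrow> set_integrable lebesgue K f}"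

definition inner_L2 :: "(plane \<Rightarrow> complex) \<Rightarrow> (plane \<Rightarrow> complex) \<Rightarrow> complex" where
  "inner_L2 f g = (LINT x|lebesgue. cnj (f x) * g x)"

definition classical_partial :: "2 \<Rightarrow> (plane \<Rightarrow> real) \<Rightarrow> plane \<Rightarrow> real" where
  "classical_partial i \<eta> x = frechet_derivative \<eta> (at x) (axis i 1)"

primrec C_class :: "nat \<Rightarrow> (plane \<Rightarrow> real) \<Rightarrow> bool" where
  "C_class 0 \<eta> \<longleftrightarrow> continuous_on UNIV \<eta>"
| "C_class (Suc k) \<eta> \<longleftrightarrow>
     \<eta> differentiable_on UNIV \<and> (\<forall>i. C_class k (classical_partial i \<eta>))"

definition test_functions :: "(plane \<Rightarrow> real) set" where
  "test_functions = {\<eta>. (\<forall>k. C_class k \<eta>) \<and> compact (closure {x. \<eta> x \<noteq> 0})}"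

definition has_weak_partial ::
  "2 \<Rightarrow> (plane \<Rightarrow> complex) \<Rightarrow> (plane \<Rightarrow> complex) \<Rightarrow> bool" where
  "has_weak_partial i f g \<longleftrightarrow> f \<in> L1loc \<and> g \<in> L1loc \<and>
     (\<forall>\<eta>\<in>test_functions.
        (LINT x|lebesgue. classical_partial i \<eta> x *\<^sub>R f x) = - (LINT x|lebesgue. \<eta> x *\<^sub>R g x))"

text \<open>Weak derivatives are unique up to null sets, so the choice below is immaterial.\<close>

definition weak_partial :: "2 \<Rightarrow> (plane \<Rightarrow> complex) \<Rightarrow> plane \<Rightarrow> complex" where
  "weak_partial i f = (SOME g. has_weak_partial i f g)"

definition weak_laplacian :: "(plane \<Rightarrow> complex) \<Rightarrow> plane \<Rightarrow> complex" where
  "weak_laplacian f x = (\<Sum>i\<in>UNIV. weak_partial i (weak_partial i f) x)"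

definition W12 :: "(plane \<Rightarrow> complex) set" where
  "W12 = {f \<in> L2. \<forall>i. \<exists>g\<in>L2. has_weak_partial i f g}"

definition W22loc :: "(plane \<Rightarrow> complex) set" where
  "W22loc = {f \<in> L2loc. \<forall>i. \<exists>g\<in>L2loc. has_weak_partial i f g \<and>
     (\<forall>j. \<exists>h\<in>L2loc. has_weak_partial j g h)}"

definition inner_grad :: "(plane \<Rightarrow> complex) \<Rightarrow> (plane \<Rightarrow> complex) \<Rightarrow> complex" where
  "inner_grad f g =
     (LINT x|lebesgue. (\<Sum>i\<in>UNIV. cnj (weak_partial i f x) * weak_partial i g x))"

text \<open>
  The modified Bessel function of the second kind of order \<open>0\<close>, for \<open>r > 0\<close>, by its
  standard integral representation.
\<close>

definition bessel_K0 :: "real \<Rightarrow> real" where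
  "bessel_K0 r = (LINT t:{0<..}|lborel. exp (- r * cosh t))"

definition green :: "real \<Rightarrow> plane \<Rightarrow> complex" where
  "green l x = of_real (bessel_K0 (sqrt l * norm x) / (2 * pi))"

definition theta :: "real \<Rightarrow> real" where
  "theta l = euler_mascheroni / (2 * pi) + ln (sqrt l / 2) / (2 * pi)"

definition omega_alpha :: "real \<Rightarrow> real" where
  "omega_alpha \<alpha> = 4 * exp (- 4 * pi * \<alpha> - 2 * euler_mascheroni)"

text \<open>The energy space does not depend on \<open>\<alpha>\<close> as a set; only its inner product does.\<close>

definition W12_alpha :: "(plane \<Rightarrow> complex) set" where
  "W12_alpha = {u. \<exists>\<phi>\<in>W12. \<exists>q. \<exists>l>0. AE x in lebesgue. u x = \<phi> x + q * green l x}"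

definition charge :: "(plane \<Rightarrow> complex) \<Rightarrow> complex" where
  "charge u = (THE q. \<exists>\<phi>\<in>W12. \<exists>l>0. AE x in lebesgue. u x = \<phi> x + q * green l x)"

definition regular_part :: "real \<Rightarrow> (plane \<Rightarrow> complex) \<Rightarrow> plane \<Rightarrow> complex" where
  "regular_part l u x = u x - charge u * green l x"

definition H_form_at ::
  "real \<Rightarrow> real \<Rightarrow> (plane \<Rightarrow> complex) \<Rightarrow> (plane \<Rightarrow> complex) \<Rightarrow> complex" where
  "H_form_at \<alpha> l u v =
     inner_grad (regular_part l u) (regular_part l v)
     + of_real l * (inner_L2 (regular_part l u) (regular_part l v) - inner_L2 u v)
     + of_real (\<alpha> + theta l) * cnj (charge u) * charge v"

text \<open>The value of \<open>H_form_at\<close> is the same for every \<open>l > 0\<close>; an arbitrary one is used.\<close>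

definition H_form ::
  "real \<Rightarrow> (plane \<Rightarrow> complex) \<Rightarrow> (plane \<Rightarrow> complex) \<Rightarrow> complex" where
  "H_form \<alpha> u v = H_form_at \<alpha> (SOME l. l > 0) u v"

definition inner_W12_alpha ::
  "real \<Rightarrow> (plane \<Rightarrow> complex) \<Rightarrow> (plane \<Rightarrow> complex) \<Rightarrow> complex" where
  "inner_W12_alpha \<alpha> u v = H_form \<alpha> u v + of_real (1 + omega_alpha \<alpha>) * inner_L2 u v"

definition X_space :: "(plane \<Rightarrow> complex) set" where
  "X_space = {u \<in> W12_alpha. integrable lebesgue (\<lambda>x. ln (1 + norm x) * (cmod (u x))\<^sup>2)}"

definition inner_X ::
  "real \<Rightarrow> (plane \<Rightarrow> complex) \<Rightarrow> (plane \<Rightarrow> complex) \<Rightarrow> complex" where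
  "inner_X \<alpha> u v = inner_W12_alpha \<alpha> u v
     + (LINT x|lebesgue. of_real (ln (1 + norm x)) * cnj (u x) * v x)"

definition norm_X :: "real \<Rightarrow> (plane \<Rightarrow> complex) \<Rightarrow> real" where
  "norm_X \<alpha> u = sqrt (Re (inner_X \<alpha> u u))"

definition energy :: "real \<Rightarrow> real \<Rightarrow> real \<Rightarrow> (plane \<Rightarrow> complex) \<Rightarrow> real" where
  "energy \<alpha> \<beta> p u =
     1 / 2 * Re (H_form \<alpha> u u)
     + 1 / 4 * (LINT x|lebesgue. LINT y|lebesgue.
                  ln (norm (x - y)) * (cmod (u x))\<^sup>2 * (cmod (u y))\<^sup>2)
     - \<beta> / p * (LINT x|lebesgue. cmod (u x) powr p)"

definition sphere_X :: "real \<Rightarrow> (plane \<Rightarrow> complex) set" where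
  "sphere_X c = {u \<in> X_space. (LINT x|lebesgue. (cmod (u x))\<^sup>2) = c}"

text \<open>
  \<open>has_X_derivative \<alpha> F T u\<close>: the bounded real-linear functional \<open>T\<close> on the space \<open>X_space\<close>,
  normed by \<open>norm_X \<alpha>\<close>, is the Frechet derivative of \<open>F\<close> at \<open>u\<close>.  Thus \<open>T v\<close> is the real part
  of the complex duality pairing of the derivative with \<open>v\<close>.
\<close>

definition has_X_derivative ::
  "real \<Rightarrow> ((plane \<Rightarrow> complex) \<Rightarrow> real) \<Rightarrow> ((plane \<Rightarrow> complex) \<Rightarrow> real)
     \<Rightarrow> (plane \<Rightarrow> complex) \<Rightarrow> bool" where
  "has_X_derivative \<alpha> F T u \<longleftrightarrow>
     (\<forall>v\<in>X_space. \<forall>w\<in>X_space. T (\<lambda>x. v x + w x) = T v + T w) \<and>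
     (\<forall>v\<in>X_space. \<forall>r. T (\<lambda>x. r *\<^sub>R v x) = r * T v) \<and>
     (\<exists>C. \<forall>v\<in>X_space. \<bar>T v\<bar> \<le> C * norm_X \<alpha> v) \<and>
     (\<forall>\<epsilon>>0. \<exists>\<delta>>0. \<forall>v\<in>X_space. norm_X \<alpha> v < \<delta> \<longrightarrow>
        \<bar>F (\<lambda>x. u x + v x) - F u - T v\<bar> \<le> \<epsilon> * norm_X \<alpha> v)"

definition log_potential :: "(plane \<Rightarrow> complex) \<Rightarrow> plane \<Rightarrow> real" where
  "log_potential u x = - (LINT y|lebesgue. ln (norm (x - y)) * (cmod (u y))\<^sup>2)"

definition continuous_rep :: "(plane \<Rightarrow> complex) \<Rightarrow> plane \<Rightarrow> complex" where
  "continuous_rep f = (THE g. continuous_on UNIV g \<and> (AE x in lebesgue. f x = g x))"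

definition dom_decomp ::
  "real \<Rightarrow> (plane \<Rightarrow> complex) \<Rightarrow> (plane \<Rightarrow> complex) \<Rightarrow> complex \<Rightarrow> real \<Rightarrow> bool" where
  "dom_decomp \<alpha> u \<phi> q l \<longleftrightarrow> \<phi> \<in> W22loc \<and> l > 0 \<and>
     of_real (\<alpha> + theta l) * q = continuous_rep \<phi> 0 \<and>
     (AE x in lebesgue. u x = \<phi> x + q * green l x)"

definition Dom_neg_Delta :: "real \<Rightarrow> (plane \<Rightarrow> complex) set" where
  "Dom_neg_Delta \<alpha> = {u. \<exists>\<phi> q l. dom_decomp \<alpha> u \<phi> q l}"

text \<open>For \<open>u\<close> in the domain, the result is a.e. the same for every admissible decomposition.\<close>

definition neg_Delta :: "real \<Rightarrow> (plane \<Rightarrow> complex) \<Rightarrow> plane \<Rightarrow> complex" where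
  "neg_Delta \<alpha> u =
     (let (\<phi>, q, l) = (SOME (\<phi>, q, l). dom_decomp \<alpha> u \<phi> q l)
      in (\<lambda>x. - weak_laplacian \<phi> x - q * of_real l * green l x))"

end

theory Submission
  imports Defs "HOL-Probability.Distributions"
begin

text \<open>
  Write \<open>u = \<psi> + q G\<close> with \<open>\<psi>\<close> in \<open>W12\<close>. Differentiating the energy along the lines \<open>u + t v\<close> turns
  criticality into the Euler-Lagrange identity for every \<open>v\<close>. Taking \<open>v\<close> to be a test function gives
  \<open>(l - laplace) \<psi> = F\<close> weakly, where \<open>F = (l - \<omega> + w + \<beta> |u|^(p - 2)) u\<close> is locally square
  integrable because \<open>w\<close> grows logarithmically and \<open>u\<close> lies in every \<open>L^r\<close>; hence \<open>\<psi>\<close> is in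
  \<open>W22loc\<close>, is continuous, and \<open>\<psi> 0\<close> is the integral of \<open>G F\<close>. Taking \<open>v = G\<close> identifies that
  integral with \<open>(\<alpha> + theta l) q\<close>, which is the boundary condition. For an arbitrary admissible
  decomposition, the equation for \<open>u\<close> tested with \<open>\<eta>\<close> differs from the asserted one only by a
  multiple of \<open>\<eta> 0\<close>, and a point mass is not a locally integrable function.

  Interior regularity is obtained by mollification: on test functions the \<open>L2\<close> norm of the Hessian
  is at most that of the Laplacian, and the sup norm is controlled by \<open>(l - laplace) \<eta>\<close> through \<open>G\<close>,
  so the mollified solutions, cut off, are Cauchy in \<open>W22\<close> and uniformly.
\<close>

section \<open>Smooth functions and test functions\<close>

text \<open>Several obstacles shape the proof. \<open>Gr\<close> is given only through the integral
  for \<open>bessel_K0\<close>, so it is rewritten as a superposition of heat kernels with weight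
  \<open>exp (- l * t)\<close>; the fundamental-solution property and the weak gradient of
  \<open>Gr l - Gr m\<close> then follow from Gaussians and Fubini. The logarithmic kernel is
  unbounded both at 0 and at infinity; it is split into logarithmic weights in each point and a
  square integrable local part, which is why densities are controlled in weighted L1 and in L2. The
  charge is well defined because in two dimensions cutoffs shrinking to the origin keep bounded
  Dirichlet energy: the Laplacian of a \<open>W12\<close> function carries no point mass, whereas
  that of a Green function does. Arbitrary decompositions have to be treated because
  \<open>neg_Delta\<close> selects one by \<open>SOME\<close>. The analysis is done for real
  functions with squared norms \<open>sq\<close>; complex statements are recovered from two real
  components.\<close>

abbreviation pd :: "2 \<Rightarrow> (plane \<Rightarrow> real) \<Rightarrow> plane \<Rightarrow> real" where
  "pd \<equiv> classical_partial"

definition smooth :: "(plane \<Rightarrow> real) \<Rightarrow> bool" where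
  "smooth f \<longleftrightarrow> (\<forall>k. C_class k f)"

definition laplace :: "(plane \<Rightarrow> real) \<Rightarrow> plane \<Rightarrow> real" where
  "laplace f x = (\<Sum>i\<in>UNIV. pd i (pd i f) x)"

lemma has_derivative_pd:
  assumes "f differentiable at x"
  shows "(f has_derivative (\<lambda>h. \<Sum>i\<in>UNIV. h $ i * pd i f x)) (at x)"
proof -
  let ?D = "frechet_derivative f (at x)"
  have D: "(f has_derivative ?D) (at x)"
    using assms by (simp add: frechet_derivative_works)
  then interpret D: bounded_linear ?D by (rule has_derivative_bounded_linear)
  have "?D h = (\<Sum>i\<in>UNIV. h $ i * pd i f x)" for h
  proof -
    have "?D h = ?D (\<Sum>i\<in>UNIV. (h $ i) *\<^sub>R axis i 1)"
      using basis_expansion[of h] by (simp add: scalar_mult_eq_scaleR)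
    also have "\<dots> = (\<Sum>i\<in>UNIV. h $ i * pd i f x)"
      by (simp add: D.sum D.scaleR classical_partial_def)
    finally show ?thesis .
  qed
  then have "?D = (\<lambda>h. \<Sum>i\<in>UNIV. h $ i * pd i f x)" by auto
  with D show ?thesis by simp
qed

lemma pd_eqI: "(f has_derivative f') (at x) \<Longrightarrow> pd i f x = f' (axis i 1)"
  unfolding classical_partial_def by (simp add: frechet_derivative_at[symmetric])

lemma axis_sum: "(\<Sum>j\<in>UNIV. (axis i 1 :: plane) $ j * d j) = (d i :: real)"
proof -
  have "(\<Sum>j\<in>UNIV. (axis i 1 :: plane) $ j * d j) = (\<Sum>j\<in>UNIV. if j = i then d j else 0)"
    by (rule sum.cong) (auto simp: axis_def)
  then show ?thesis by simp
qed

lemma pd_eq_sumI: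
  assumes "(f has_derivative (\<lambda>h. \<Sum>j\<in>UNIV. h $ j * d j x)) (at x)"
  shows "pd i f x = d i x"
  using pd_eqI[OF assms, of i] by (simp add: axis_sum)

text \<open>Guessing the partials \<open>d\<close> suffices: \<open>pd_eq_sumI\<close> identifies
  them with \<open>pd i f\<close>, so the regularity proofs below need a derivative formula but no
  evaluation of \<open>frechet_derivative\<close>.\<close>

lemma C_class_SucI:
  assumes "\<And>x. (f has_derivative (\<lambda>h. \<Sum>j\<in>UNIV. h $ j * d j x)) (at x)"
    and "\<And>i. C_class k (d i)"
  shows "C_class (Suc k) f"
proof -
  have "pd i f = d i" for i
    by (intro ext pd_eq_sumI assms(1))
  moreover have "f differentiable_on UNIV"
    using assms(1) by (auto simp: differentiable_on_def differentiable_def)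
  ultimately show ?thesis using assms(2) by simp
qed

lemma C_class_Suc_has_derivative:
  "C_class (Suc k) f \<Longrightarrow> (f has_derivative (\<lambda>h. \<Sum>j\<in>UNIV. h $ j * pd j f x)) (at x)"
  by (intro has_derivative_pd) (auto simp: differentiable_on_def)

lemma C_class_SucD: "C_class (Suc k) f \<Longrightarrow> C_class k f"
proof (induction k arbitrary: f)
  case 0
  then show ?case by (auto intro: differentiable_imp_continuous_on)
next
  case (Suc k)
  then show ?case by auto
qed

lemma C_class_continuous: "C_class k f \<Longrightarrow> continuous_on UNIV f"
  by (cases k) (auto intro: differentiable_imp_continuous_on)

lemma C_class_const: "C_class k (\<lambda>x. c)"
proof (induction k arbitrary: c)
  case (Suc k)
  show ?case
    by (rule C_class_SucI[where d="\<lambda>i x. 0"]) (use Suc in \<open>auto intro!: derivative_eq_intros\<close>)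
qed auto

lemma C_class_add:
  "C_class k f \<Longrightarrow> C_class k g \<Longrightarrow> C_class k (\<lambda>x. f x + g x)"
proof (induction k arbitrary: f g)
  case (Suc k)
  show ?case
  proof (rule C_class_SucI[where d="\<lambda>i x. pd i f x + pd i g x"])
    show "((\<lambda>x. f x + g x) has_derivative (\<lambda>h. \<Sum>j\<in>UNIV. h $ j * (pd j f x + pd j g x))) (at x)" for x
      by (rule derivative_eq_intros C_class_Suc_has_derivative[OF Suc.prems(1)]
        C_class_Suc_has_derivative[OF Suc.prems(2)])+ (simp add: sum.distrib distrib_left)
  qed (use Suc in auto)
qed (auto intro!: continuous_intros)

lemma C_class_mult:
  "C_class k f \<Longrightarrow> C_class k g \<Longrightarrow> C_class k (\<lambda>x. f x * g x)"
proof (induction k arbitrary: f g)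
  case (Suc k)
  show ?case
  proof (rule C_class_SucI[where d="\<lambda>i x. f x * pd i g x + pd i f x * g x"])
    show "((\<lambda>x. f x * g x) has_derivative (\<lambda>h. \<Sum>j\<in>UNIV. h $ j * (f x * pd j g x + pd j f x * g x))) (at x)" for x
      by (rule derivative_eq_intros C_class_Suc_has_derivative[OF Suc.prems(1)]
        C_class_Suc_has_derivative[OF Suc.prems(2)])+
       (simp add: sum_distrib_left sum_distrib_right sum.distrib algebra_simps)
    show "C_class k (\<lambda>x. f x * pd i g x + pd i f x * g x)" for i
      by (rule C_class_add; rule Suc.IH) (use Suc.prems C_class_SucD in auto)
  qed
qed (auto intro!: continuous_intros)

lemma smooth_pd: "smooth f \<Longrightarrow> smooth (pd i f)"
  unfolding smooth_def by (meson C_class.simps(2))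

lemma smooth_has_derivative:
  "smooth f \<Longrightarrow> (f has_derivative (\<lambda>h. \<Sum>j\<in>UNIV. h $ j * pd j f x)) (at x)"
  unfolding smooth_def using C_class_Suc_has_derivative by blast

lemma smooth_continuous: "smooth f \<Longrightarrow> continuous_on A f"
  unfolding smooth_def using C_class_continuous continuous_on_subset by blast

lemma smooth_const: "smooth (\<lambda>x. c)"
  by (simp add: smooth_def C_class_const)

lemma smooth_add: "smooth f \<Longrightarrow> smooth g \<Longrightarrow> smooth (\<lambda>x. f x + g x)"
  by (simp add: smooth_def C_class_add)

lemma smooth_mult: "smooth f \<Longrightarrow> smooth g \<Longrightarrow> smooth (\<lambda>x. f x * g x)"
  by (simp add: smooth_def C_class_mult)

lemma smooth_cmult: "smooth f \<Longrightarrow> smooth (\<lambda>x. c * f x)"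
  by (rule smooth_mult[OF smooth_const])

lemma smooth_diff: "smooth f \<Longrightarrow> smooth g \<Longrightarrow> smooth (\<lambda>x. f x - g x)"
  using smooth_add[of f "\<lambda>x. (-1) * g x"] smooth_cmult[of g "-1"] by simp

lemma smooth_power: "smooth f \<Longrightarrow> smooth (\<lambda>x. f x ^ n)"
  by (induction n) (auto intro: smooth_const smooth_mult)

text \<open>Induction on the order \<open>k\<close> fails for a single function, whose partials are
  different functions. It goes through for a family closed under taking partials, such as
  rescalings, the \<open>flat\<close> functions, or convolutions with a fixed function.\<close>

lemma smooth_coinduct:
  assumes "P f"
    and step: "\<And>f. P f \<Longrightarrow>
      \<exists>d. (\<forall>x. (f has_derivative (\<lambda>h. \<Sum>j\<in>UNIV. h $ j * d j x)) (at x)) \<and> (\<forall>i. P (d i))"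
  shows "smooth f"
proof -
  have "P f \<Longrightarrow> C_class k f" for k f
  proof (induction k arbitrary: f)
    case 0
    from step[OF this] have "isCont f x" for x
      by (blast intro: has_derivative_continuous)
    then show ?case by (simp add: continuous_at_imp_continuous_on)
  next
    case (Suc k)
    from step[OF Suc.prems] obtain d
      where "\<forall>x. (f has_derivative (\<lambda>h. \<Sum>j\<in>UNIV. h $ j * d j x)) (at x)" "\<forall>i. P (d i)" by blast
    then show ?case using Suc.IH by (intro C_class_SucI[of f d]) auto
  qed
  with assms(1) show ?thesis by (simp add: smooth_def)
qed

lemma pd_add: "smooth f \<Longrightarrow> smooth g \<Longrightarrow> pd i (\<lambda>x. f x + g x) = (\<lambda>x. pd i f x + pd i g x)"
  by (rule ext, rule trans, rule pd_eqI, rule derivative_eq_intros,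
    (erule smooth_has_derivative)+, rule refl) (simp add: axis_sum)

lemma pd_diff: "smooth f \<Longrightarrow> smooth g \<Longrightarrow> pd i (\<lambda>x. f x - g x) = (\<lambda>x. pd i f x - pd i g x)"
  by (rule ext, rule trans, rule pd_eqI, rule derivative_eq_intros,
    (erule smooth_has_derivative)+, rule refl) (simp add: axis_sum)

lemma pd_mult: "smooth f \<Longrightarrow> smooth g \<Longrightarrow>
    pd i (\<lambda>x. f x * g x) = (\<lambda>x. f x * pd i g x + pd i f x * g x)"
  by (rule ext, rule trans, rule pd_eqI, rule derivative_eq_intros,
    (erule smooth_has_derivative)+, rule refl) (simp add: axis_sum)

lemma pd_const: "pd i (\<lambda>x. c) = (\<lambda>x. 0)"
  using pd_eqI[OF has_derivative_const] by blast

lemma pd_cmult: "smooth f \<Longrightarrow> pd i (\<lambda>x. c * f x) = (\<lambda>x. c * pd i f x)"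
  using pd_mult[OF smooth_const, of f i c] by (simp add: pd_const)

lemma affine_has_derivative:
  assumes "smooth f"
  shows "((\<lambda>x. k * f (c *\<^sub>R x + a)) has_derivative
     (\<lambda>h. \<Sum>j\<in>UNIV. h $ j * ((k * c) * pd j f (c *\<^sub>R x + a)))) (at x)"
proof -
  have *: "((\<lambda>x. f (c *\<^sub>R x + a)) has_derivative
     (\<lambda>h. \<Sum>j\<in>UNIV. (c *\<^sub>R h) $ j * pd j f (c *\<^sub>R x + a))) (at x)"
    by (rule has_derivative_compose[where g=f, OF _ smooth_has_derivative[OF assms]])
      (auto intro!: derivative_eq_intros)
  show ?thesis
    by (rule has_derivative_eq_rhs, rule has_derivative_mult_right, rule *)
      (simp add: sum_distrib_left algebra_simps)
qed

text \<open>Each derivative produces a factor \<open>c\<close>; the scalar \<open>k\<close> in the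
  coinduction invariant absorbs it.\<close>

lemma smooth_affine:
  assumes "smooth f" shows "smooth (\<lambda>x. f (c *\<^sub>R x + a))"
proof (rule smooth_coinduct[where P="\<lambda>g. \<exists>f k. smooth f \<and> g = (\<lambda>x. k * f (c *\<^sub>R x + a))"])
  show "\<exists>f' k. smooth f' \<and> (\<lambda>x. f (c *\<^sub>R x + a)) = (\<lambda>x. k * f' (c *\<^sub>R x + a))"
    using assms by (intro exI[of _ f] exI[of _ 1]) auto
next
  fix g assume "\<exists>f k. smooth f \<and> g = (\<lambda>x. k * f (c *\<^sub>R x + a))"
  then obtain f k where f: "smooth f" "g = (\<lambda>x. k * f (c *\<^sub>R x + a))" by blast
  show "\<exists>d. (\<forall>x. (g has_derivative (\<lambda>h. \<Sum>j\<in>UNIV. h $ j * d j x)) (at x)) \<and>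
      (\<forall>i. \<exists>f k. smooth f \<and> d i = (\<lambda>x. k * f (c *\<^sub>R x + a)))"
    by (rule exI[of _ "\<lambda>j x. (k * c) * pd j f (c *\<^sub>R x + a)"])
      (use f affine_has_derivative[OF f(1)] smooth_pd[OF f(1)] in blast)
qed

lemma pd_affine: "smooth f \<Longrightarrow> pd i (\<lambda>x. f (c *\<^sub>R x + a)) = (\<lambda>x. c * pd i f (c *\<^sub>R x + a))"
  using pd_eqI[OF affine_has_derivative[of f 1 c a], where i=i] by (intro ext) (simp add: axis_sum)

text \<open>In finite dimension a compact closure of the support amounts to a bounded support. A
  radius is easier to enlarge, shift and combine than a compact set.\<close>

lemma test_iff: "\<eta> \<in> test_functions \<longleftrightarrow> smooth \<eta> \<and> (\<exists>R. \<forall>x. norm x > R \<longrightarrow> \<eta> x = 0)"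
proof
  assume "\<eta> \<in> test_functions"
  then have s: "smooth \<eta>" and c: "compact (closure {x. \<eta> x \<noteq> 0})"
    by (auto simp: test_functions_def smooth_def)
  from c obtain R where "\<forall>x\<in>closure {x. \<eta> x \<noteq> 0}. norm x \<le> R"
    using compact_imp_bounded bounded_iff by metis
  then have "\<forall>x. norm x > R \<longrightarrow> \<eta> x = 0"
    using closure_subset[of "{x. \<eta> x \<noteq> 0}"] by force
  with s show "smooth \<eta> \<and> (\<exists>R. \<forall>x. norm x > R \<longrightarrow> \<eta> x = 0)" by blast
next
  assume "smooth \<eta> \<and> (\<exists>R. \<forall>x. norm x > R \<longrightarrow> \<eta> x = 0)"
  then obtain R where s: "smooth \<eta>" and R: "\<And>x. norm x > R \<Longrightarrow> \<eta> x = 0" by blast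
  have "bounded {x. \<eta> x \<noteq> 0}"
    unfolding bounded_iff using R by (intro exI[of _ R]) (force simp: not_less[symmetric])
  then show "\<eta> \<in> test_functions"
    using s by (auto simp: test_functions_def smooth_def)
qed

lemma test_smooth: "\<eta> \<in> test_functions \<Longrightarrow> smooth \<eta>"
  by (simp add: test_iff)

lemma test_mult: "smooth f \<Longrightarrow> g \<in> test_functions \<Longrightarrow> (\<lambda>x. f x * g x) \<in> test_functions"
  unfolding test_iff by (auto intro: smooth_mult)

lemma test_add:
  assumes "f \<in> test_functions" "g \<in> test_functions"
  shows "(\<lambda>x. f x + g x) \<in> test_functions"
proof -
  from assms obtain R S where "\<forall>x. norm x > R \<longrightarrow> f x = 0" "\<forall>x. norm x > S \<longrightarrow> g x = 0"
    "smooth f" "smooth g" unfolding test_iff by blast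
  then show ?thesis unfolding test_iff by (auto intro!: smooth_add exI[of _ "max R S"])
qed

lemma test_cmult: "g \<in> test_functions \<Longrightarrow> (\<lambda>x. c * g x) \<in> test_functions"
  by (rule test_mult[OF smooth_const])

lemma test_diff: "f \<in> test_functions \<Longrightarrow> g \<in> test_functions \<Longrightarrow> (\<lambda>x. f x - g x) \<in> test_functions"
  using test_add[of f "\<lambda>x. (-1) * g x"] test_cmult[of g "-1"] by simp

lemma test_affine:
  assumes "\<eta> \<in> test_functions" "c \<noteq> 0"
  shows "(\<lambda>x. \<eta> (c *\<^sub>R x + a)) \<in> test_functions"
proof -
  from assms obtain R where s: "smooth \<eta>" and R: "\<And>x. norm x > R \<Longrightarrow> \<eta> x = 0"
    unfolding test_iff by blast
  have "\<eta> (c *\<^sub>R x + a) = 0" if "norm x > (R + norm a) / \<bar>c\<bar>" for x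
  proof (rule R)
    have "\<bar>c\<bar> * norm x > R + norm a" using that assms(2) by (simp add: field_simps)
    moreover have "norm (c *\<^sub>R x) \<le> norm (c *\<^sub>R x + a) + norm a"
      using norm_triangle_ineq4[of "c *\<^sub>R x + a" a] by simp
    ultimately show "norm (c *\<^sub>R x + a) > R" by simp
  qed
  then show ?thesis unfolding test_iff using smooth_affine[OF s] by blast
qed

text \<open>The strict inequality makes the exterior open, so \<open>f\<close> vanishes in a whole
  neighbourhood of \<open>x\<close>.\<close>

lemma pd_zero_outside:
  assumes "\<And>x. norm x > R \<Longrightarrow> f x = (0::real)" and "norm x > R"
  shows "pd i f x = 0"
proof -
  have "open {x::plane. norm x > R}" by (intro open_Collect_less continuous_intros)
  then have "(f has_derivative (\<lambda>h. 0)) (at x)"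
    by (rule has_derivative_transform_within_open[rotated, where f="\<lambda>x. 0"]) (use assms in auto)
  then show ?thesis by (rule pd_eqI)
qed

lemma test_pd: "\<eta> \<in> test_functions \<Longrightarrow> pd i \<eta> \<in> test_functions"
  unfolding test_iff using smooth_pd pd_zero_outside by metis

lemma smooth_laplace: "smooth f \<Longrightarrow> smooth (laplace f)"
  unfolding laplace_def[abs_def] UNIV_2 by (simp add: smooth_add smooth_pd)

lemma test_laplace: "\<eta> \<in> test_functions \<Longrightarrow> laplace \<eta> \<in> test_functions"
  unfolding laplace_def[abs_def] UNIV_2 by (simp add: test_add test_pd)

lemma laplace_mult:
  assumes "smooth f" "smooth g"
  shows "laplace (\<lambda>x. f x * g x) x
    = f x * laplace g x + 2 * (\<Sum>i\<in>UNIV. pd i f x * pd i g x) + laplace f x * g x"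
  unfolding laplace_def using assms
  by (simp add: pd_mult pd_add smooth_mult smooth_pd sum_2 algebra_simps)

lemma laplace_diff:
  assumes "smooth f" "smooth g"
  shows "laplace (\<lambda>x. f x - g x) x = laplace f x - laplace g x"
  unfolding laplace_def using assms by (simp add: pd_diff smooth_pd sum_subtractf)

lemma laplace_affine: "smooth f \<Longrightarrow> laplace (\<lambda>x. f (c *\<^sub>R x + a)) x = c\<^sup>2 * laplace f (c *\<^sub>R x + a)"
  unfolding laplace_def
  by (simp add: pd_affine pd_cmult smooth_affine smooth_pd sum_distrib_left power2_eq_square mult.assoc)

section \<open>Integrals of test functions and integration by parts\<close>

lemma continuous_csupp_integrable:
  fixes f :: "plane \<Rightarrow> 'b::{banach, second_countable_topology}"
  assumes "continuous_on UNIV f" "\<And>x. norm x > R \<Longrightarrow> f x = 0"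
  shows "integrable lborel f" "integrable lebesgue f"
proof -
  have "integrable lborel (\<lambda>x. indicator (cball 0 R) x *\<^sub>R f x)"
    by (rule borel_integrable_compact) (auto intro: continuous_on_subset[OF assms(1)])
  also have "(\<lambda>x. indicator (cball 0 R) x *\<^sub>R f x) = f"
    using assms(2) by (force simp: indicator_def dist_norm)
  finally show *: "integrable lborel f" .
  then show "integrable lebesgue f" by (subst integrable_completion) auto
qed

lemma continuous_csupp_bounded:
  fixes f :: "plane \<Rightarrow> real"
  assumes "continuous_on UNIV f" "\<And>x. norm x > R \<Longrightarrow> f x = 0"
  obtains B where "B > 0" "\<And>x. \<bar>f x\<bar> \<le> B"
proof -
  have "compact (f ` cball 0 R)"
    by (intro compact_continuous_image continuous_on_subset[OF assms(1)]) auto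
  then obtain B where B: "\<forall>y\<in>f ` cball 0 R. norm y \<le> B"
    using compact_imp_bounded bounded_iff by metis
  have "\<bar>f x\<bar> \<le> max B 1" for x
  proof (cases "norm x > R")
    case False
    then have "f x \<in> f ` cball 0 R" by (simp add: dist_norm)
    with B have "norm (f x) \<le> B" by blast
    then show ?thesis by simp
  qed (use assms(2) in simp)
  then show ?thesis by (intro that[of "max B 1"]) auto
qed

lemma test_continuous: "\<eta> \<in> test_functions \<Longrightarrow> continuous_on A \<eta>"
  by (simp add: test_smooth smooth_continuous)

lemma test_integrable:
  "\<eta> \<in> test_functions \<Longrightarrow> integrable lborel \<eta>" "\<eta> \<in> test_functions \<Longrightarrow> integrable lebesgue \<eta>"
  unfolding test_iff by (auto intro: continuous_csupp_integrable smooth_continuous)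

lemma test_bounded:
  assumes "\<eta> \<in> test_functions" obtains B where "B > 0" "\<And>x. \<bar>\<eta> x\<bar> \<le> B"
  using assms unfolding test_iff
  by (metis continuous_csupp_bounded smooth_continuous)

lemma test_supp:
  assumes "\<eta> \<in> test_functions" obtains R where "R > 0" "\<And>x. norm x > R \<Longrightarrow> \<eta> x = 0"
proof -
  from assms obtain R where "\<And>x. norm x > R \<Longrightarrow> \<eta> x = 0" unfolding test_iff by blast
  then show ?thesis by (intro that[of "max R 1"]) auto
qed

lemma test_borel: "\<eta> \<in> test_functions \<Longrightarrow> \<eta> \<in> borel_measurable borel"
  by (simp add: borel_measurable_continuous_onI test_continuous)

lemma lborel_lebesgue_integral:
  fixes f :: "plane \<Rightarrow> 'b::{banach, second_countable_topology}"
  shows "f \<in> borel_measurable borel \<Longrightarrow> integral\<^sup>L lebesgue f = integral\<^sup>L lborel f"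
  by (rule integral_completion) simp

lemma lborel_translation:
  fixes f :: "plane \<Rightarrow> 'b::{banach, second_countable_topology}"
  assumes "f \<in> borel_measurable borel"
  shows "(\<integral>x. f (x + a) \<partial>lborel) = (\<integral>x. f x \<partial>lborel)"
proof -
  have "(\<integral>x. f x \<partial>lborel) = (\<integral>x. f x \<partial>distr lborel borel ((+) a))"
    by (simp add: lborel_distr_plus)
  also have "\<dots> = (\<integral>x. f (a + x) \<partial>lborel)"
    by (rule integral_distr) (use assms in auto)
  finally show ?thesis by (simp add: add.commute)
qed

text \<open>The mean value inequality with bounds for the two partials, which exist because partials
  of test functions are test functions.\<close>

lemma test_mvt:
  assumes "\<eta> \<in> test_functions"
  obtains B where "B > 0" "\<And>x y. \<bar>\<eta> x - \<eta> y\<bar> \<le> B * norm (x - y)"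
proof -
  have "\<forall>i. \<exists>B. \<forall>x. \<bar>pd i \<eta> x\<bar> \<le> B"
    using test_bounded[OF test_pd[OF assms]] by meson
  then obtain B where B: "\<And>i x. \<bar>pd i \<eta> x\<bar> \<le> B i" by metis
  \<comment> \<open>The summand 1 makes the constant positive even for the zero function.\<close>
  define b where "b = B 1 + B 2 + 1"
  have B0: "B i \<ge> 0" for i using B[of i 0] by linarith
  have b: "b > 0" using B0[of 1] B0[of 2] by (simp add: b_def)
  have "norm (\<eta> x - \<eta> y) \<le> b * norm (x - y)" for x y
  proof (rule differentiable_bound[of UNIV])
    show "(\<eta> has_derivative (\<lambda>h. \<Sum>j\<in>UNIV. h $ j * pd j \<eta> z)) (at z within UNIV)" for z
      using smooth_has_derivative[OF test_smooth[OF assms]] by simp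
    show "onorm (\<lambda>h::plane. \<Sum>j\<in>UNIV. h $ j * pd j \<eta> z) \<le> b" for z
    proof (rule onorm_le)
      fix h :: plane
      have "norm (\<Sum>j\<in>UNIV. h $ j * pd j \<eta> z) \<le> (\<Sum>j\<in>UNIV. \<bar>h $ j\<bar> * \<bar>pd j \<eta> z\<bar>)"
        by (simp add: sum_2 abs_mult[symmetric])
      also have "\<dots> \<le> (\<Sum>j\<in>UNIV. norm h * B j)"
        by (intro sum_mono mult_mono B component_le_norm_cart) auto
      also have "\<dots> \<le> b * norm h" by (simp add: sum_2 b_def algebra_simps)
      finally show "norm (\<Sum>j\<in>UNIV. h $ j * pd j \<eta> z) \<le> b * norm h" .
    qed
  qed auto
  with b show ?thesis by (intro that[of b]) auto
qed

text \<open>Difference quotients in direction \<open>i\<close> have integral zero by translation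
  invariance of Lebesgue measure, and they converge dominatedly to the partial.\<close>

lemma integral_pd_zero:
  assumes "\<eta> \<in> test_functions"
  shows "(\<integral>x. pd i \<eta> x \<partial>lborel) = 0"
proof -
  obtain B where B: "B > 0" "\<And>x y. \<bar>\<eta> x - \<eta> y\<bar> \<le> B * norm (x - y)" using test_mvt[OF assms] by blast
  obtain R where R: "\<And>x. norm x > R \<Longrightarrow> \<eta> x = 0" using test_supp[OF assms] by blast
  define e :: plane where "e = axis i 1"
  have e1: "norm e = 1" by (simp add: e_def norm_axis_1)
  define h where "h n = 1 / real (Suc n)" for n
  have h: "h n > 0" "h n \<le> 1" for n by (auto simp: h_def)
  define s where "s n x = (\<eta> (x + h n *\<^sub>R e) - \<eta> x) / h n" for n x
  have [measurable]: "\<eta> \<in> borel_measurable borel" "pd i \<eta> \<in> borel_measurable borel"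
    using assms by (auto intro: test_borel test_pd)
  have int: "integrable lborel (\<lambda>x. \<eta> (x + h n *\<^sub>R e))" for n
    using test_integrable(1)[OF test_affine[OF assms, of 1 "h n *\<^sub>R e"]] by simp
  have zero: "(\<integral>x. s n x \<partial>lborel) = 0" for n
    using int[of n] test_integrable(1)[OF assms] lborel_translation[of \<eta> "h n *\<^sub>R e"]
    by (simp add: s_def Bochner_Integration.integral_diff)
  \<comment> \<open>The steps \<open>h n\<close> are at most 1, so all quotients vanish outside the
    ball of radius \<open>R + 1\<close>; on it the Lipschitz constant bounds them.\<close>
  have "(\<lambda>n. \<integral>x. s n x \<partial>lborel) \<longlonglongrightarrow> (\<integral>x. pd i \<eta> x \<partial>lborel)"
  proof (rule integral_dominated_convergence[where w="\<lambda>x. B * indicator (cball 0 (R+1)) x"])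
    show "integrable lborel (\<lambda>x::plane. B * indicator (cball 0 (R + 1)) x)"
      by (intro integrable_mult_right integrable_real_indicator) (use emeasure_bounded_finite[of "cball (0::plane) (R+1)"] in auto)
    show "AE x in lborel. (\<lambda>n. s n x) \<longlonglongrightarrow> pd i \<eta> x"
    proof (rule AE_I2)
      fix x
      have "((\<lambda>t. \<eta> (x + t *\<^sub>R e)) has_derivative (\<lambda>t. \<Sum>j\<in>UNIV. (t *\<^sub>R e) $ j * pd j \<eta> (x + 0 *\<^sub>R e))) (at 0)"
        by (rule has_derivative_compose[where g=\<eta>, OF _ smooth_has_derivative[OF test_smooth[OF assms]]])
          (auto intro!: derivative_eq_intros)
      also have "(\<lambda>t. \<Sum>j\<in>UNIV. (t *\<^sub>R e) $ j * pd j \<eta> (x + 0 *\<^sub>R e)) = (\<lambda>t. pd i \<eta> x * t)"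
        using axis_sum[of i "\<lambda>j. pd j \<eta> x"] by (auto simp: e_def mult.assoc sum_distrib_left[symmetric])
      finally have "DERIV (\<lambda>t. \<eta> (x + t *\<^sub>R e)) 0 :> pd i \<eta> x"
        by (simp add: has_field_derivative_def)
      then have L: "((\<lambda>t. (\<eta> (x + t *\<^sub>R e) - \<eta> x) / t) \<longlongrightarrow> pd i \<eta> x) (at 0)"
        by (simp add: DERIV_def)
      have "filterlim h (at 0) sequentially"
      proof -
        have "h \<longlonglongrightarrow> 0"
          using LIMSEQ_inverse_real_of_nat by (simp add: h_def[abs_def] inverse_eq_divide)
        moreover have "h n \<noteq> 0" for n using h(1)[of n] by simp
        ultimately show ?thesis by (simp add: filterlim_at)
      qed
      from filterlim_compose[OF L this] show "(\<lambda>n. s n x) \<longlonglongrightarrow> pd i \<eta> x"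
        by (simp add: s_def)
    qed
    show "AE x in lborel. norm (s n x) \<le> B * indicator (cball 0 (R+1)) x" for n
    proof (rule AE_I2)
      fix x
      have "\<bar>\<eta> (x + h n *\<^sub>R e) - \<eta> x\<bar> \<le> B * h n"
        using B(2)[of "x + h n *\<^sub>R e" x] e1 h[of n] by simp
      then have b: "norm (s n x) \<le> B" using h[of n] by (simp add: s_def field_simps)
      show "norm (s n x) \<le> B * indicator (cball 0 (R+1)) x"
      proof (cases "norm x \<le> R + 1")
        case False
        have "norm (x + h n *\<^sub>R e) \<ge> norm x - norm (h n *\<^sub>R e)"
          using norm_triangle_ineq4[of "x + h n *\<^sub>R e" "h n *\<^sub>R e"] by simp
        with False h[of n] e1 have "norm (x + h n *\<^sub>R e) > R" by simp
        then have "s n x = 0" using R False by (simp add: s_def)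
        then show ?thesis by (auto simp: indicator_def B(1) less_imp_le)
      qed (use b in auto)
    qed
  qed (auto simp: s_def)
  with zero show ?thesis by (simp add: LIMSEQ_const_iff)
qed

text \<open>The product of \<open>f\<close> and \<open>\<eta>\<close> is a test function even when
  \<open>f\<close> has unbounded support, so its partial integrates to zero.\<close>

lemma integral_by_parts:
  assumes "smooth f" "\<eta> \<in> test_functions"
  shows "(\<integral>x. pd i f x * \<eta> x \<partial>lborel) = - (\<integral>x. f x * pd i \<eta> x \<partial>lborel)"
proof -
  have t: "(\<lambda>x. f x * pd i \<eta> x) \<in> test_functions" "(\<lambda>x. pd i f x * \<eta> x) \<in> test_functions"
    using assms by (auto intro!: test_mult test_pd smooth_pd)
  have "0 = (\<integral>x. f x * pd i \<eta> x + pd i f x * \<eta> x \<partial>lborel)"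
    using integral_pd_zero[OF test_mult[OF assms], of i]
    by (simp add: pd_mult[OF assms(1) test_smooth[OF assms(2)]])
  then show ?thesis using t[THEN test_integrable(1)] by simp
qed

section \<open>Mollification\<close>

text \<open>The powers of \<open>1 / x\<close> produced by differentiating \<open>exp (- 1 / x)\<close> are absorbed into \<open>P\<close>, so the
  class is closed under differentiation.\<close>

definition flat :: "real poly \<Rightarrow> real \<Rightarrow> real" where
  "flat P x = (if x > 0 then poly P (1 / x) * exp (- (1 / x)) else 0)"

lemma poly_exp_tendsto_0: "((\<lambda>t. poly Q t * exp (- t)) \<longlongrightarrow> 0) (at_top :: real filter)"
proof -
  have "((\<lambda>t. \<Sum>i\<le>degree Q. coeff Q i * (t ^ i / exp t)) \<longlongrightarrow> 0) at_top"
    by (intro tendsto_null_sum tendsto_mult_right_zero tendsto_power_div_exp_0)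
  then show ?thesis
    by (simp add: poly_altdef sum_distrib_right exp_minus divide_inverse mult.assoc)
qed

text \<open>With \<open>t = 1 / x\<close>, differentiating \<open>P(t) * exp (- t)\<close> in
  \<open>x\<close> gives \<open>t^2 * (P - P')(t) * exp (- t)\<close>; the list
  \<open>[:0, 0, 1:]\<close> is the polynomial \<open>t^2\<close>. At 0 the exponential beats every
  polynomial in \<open>t\<close>.\<close>

lemma flat_DERIV: "DERIV (flat P) x :> flat ([:0, 0, 1:] * (P - pderiv P)) x"
proof -
  consider "x > 0" | "x < 0" | "x = 0" by linarith
  then show ?thesis
  proof cases
    case 1
    have "DERIV (\<lambda>x. poly P (1 / x) * exp (- (1 / x))) x :>
        poly P (1 / x) * (exp (- (1 / x)) * (1 / x\<^sup>2)) + (poly (pderiv P) (1 / x) * (- 1 / x\<^sup>2)) * exp (- (1 / x))"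
      using 1 by (auto intro!: derivative_eq_intros DERIV_chain2[OF poly_DERIV] simp: power2_eq_square)
    moreover have "poly P (1 / x) * (exp (- (1 / x)) * (1 / x\<^sup>2)) + (poly (pderiv P) (1 / x) * (- 1 / x\<^sup>2)) * exp (- (1 / x))
        = flat ([:0, 0, 1:] * (P - pderiv P)) x"
      using 1 by (simp add: flat_def field_simps power2_eq_square)
    ultimately have "DERIV (\<lambda>x. poly P (1 / x) * exp (- (1 / x))) x :> flat ([:0, 0, 1:] * (P - pderiv P)) x"
      by simp
    then show ?thesis
      by (rule has_field_derivative_transform_within_open[of _ _ _ "{0<..}"]) (use 1 in \<open>auto simp: flat_def\<close>)
  next
    case 2
    have "DERIV (\<lambda>x. 0) x :> flat ([:0, 0, 1:] * (P - pderiv P)) x"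
      using 2 by (simp add: flat_def)
    then show ?thesis
      by (rule has_field_derivative_transform_within_open[of _ _ _ "{..<0}"]) (use 2 in \<open>auto simp: flat_def\<close>)
  next
    case 3
    have "((\<lambda>h. flat P h / h) \<longlongrightarrow> 0) (at_left 0)"
      by (rule tendsto_eventually) (auto simp: eventually_at_left_field flat_def intro!: exI[of _ "-1"])
    moreover have "((\<lambda>h. flat P h / h) \<longlongrightarrow> 0) (at_right 0)"
    proof -
      \<comment> \<open>With \<open>t = inverse h\<close>, dividing by \<open>h\<close> multiplies
        the polynomial by \<open>t\<close>, hence \<open>[:0, 1:] * P\<close>.\<close>
      have "((\<lambda>h. poly ([:0, 1:] * P) (inverse h) * exp (- inverse h)) \<longlongrightarrow> 0) (at_right 0)"
        by (rule filterlim_compose[OF poly_exp_tendsto_0 filterlim_inverse_at_top_right])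
      moreover have "eventually (\<lambda>h. poly ([:0, 1:] * P) (inverse h) * exp (- inverse h) = flat P h / h) (at_right 0)"
        by (auto simp: eventually_at_right_field flat_def field_simps intro!: exI[of _ 1])
      ultimately show ?thesis by (rule Lim_transform_eventually)
    qed
    ultimately have "((\<lambda>h. flat P h / h) \<longlongrightarrow> 0) (at 0)"
      by (simp add: filterlim_split_at)
    with 3 show ?thesis by (simp add: DERIV_def flat_def)
  qed
qed

lemma smooth_flat: "smooth (\<lambda>x. flat P (a * x $ i + c))"
proof (rule smooth_coinduct[where P="\<lambda>f. \<exists>Q k. f = (\<lambda>x. k * flat Q (a * x $ i + c))"])
  show "\<exists>Q k. (\<lambda>x. flat P (a * x $ i + c)) = (\<lambda>x::plane. k * flat Q (a * x $ i + c))"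
    by (intro exI[of _ P] exI[of _ 1]) auto
next
  fix f :: "plane \<Rightarrow> real" assume "\<exists>Q k. f = (\<lambda>x. k * flat Q (a * x $ i + c))"
  then obtain Q k where f: "f = (\<lambda>x. k * flat Q (a * x $ i + c))" by blast
  define d where "d j x = (k * (if j = i then a else 0)) * flat ([:0, 0, 1:] * (Q - pderiv Q)) (a * x $ i + c)"
    for j :: 2 and x :: plane
  have "(f has_derivative (\<lambda>h. \<Sum>j\<in>UNIV. h $ j * d j x)) (at x)" for x
  proof -
    have "((\<lambda>x. a * x $ i + c) has_derivative (\<lambda>h. a * h $ i)) (at x)"
      by (auto intro!: derivative_eq_intros bounded_linear_imp_has_derivative bounded_linear_vec_nth)
    then have "((\<lambda>x. flat Q (a * x $ i + c)) has_derivative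
        (\<lambda>h. flat ([:0, 0, 1:] * (Q - pderiv Q)) (a * x $ i + c) * (a * h $ i))) (at x)"
      by (rule has_derivative_compose[OF _ flat_DERIV[THEN has_field_derivative_imp_has_derivative]])
    then have "(f has_derivative (\<lambda>h. k * (flat ([:0, 0, 1:] * (Q - pderiv Q)) (a * x $ i + c) * (a * h $ i)))) (at x)"
      unfolding f by (rule has_derivative_mult_right)
    moreover have "(\<Sum>j\<in>UNIV. h $ j * d j x) = k * (flat ([:0, 0, 1:] * (Q - pderiv Q)) (a * x $ i + c) * (a * h $ i))" for h :: plane
    proof -
      have "(\<Sum>j\<in>UNIV. h $ j * d j x) = (\<Sum>j\<in>UNIV. if j = i then h $ i * d i x else 0)"
        by (rule sum.cong) (auto simp: d_def)
      then show ?thesis by (simp add: d_def)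
    qed
    ultimately show ?thesis by simp
  qed
  moreover have "\<exists>Q k. d j = (\<lambda>x. k * flat Q (a * x $ i + c))" for j
    unfolding d_def by blast
  ultimately show "\<exists>d. (\<forall>x. (f has_derivative (\<lambda>h. \<Sum>j\<in>UNIV. h $ j * d j x)) (at x)) \<and>
      (\<forall>j. \<exists>Q k. d j = (\<lambda>x. k * flat Q (a * x $ i + c)))" by blast
qed

text \<open>A product of one-variable factors rather than a radial profile: symmetry of its second
  derivatives is then visible, and \<open>pd_commute\<close> is derived from it. The literal
  coefficients \<open>1\<close> and \<open>-1\<close> match the form of
  \<open>smooth_flat\<close>.\<close>

definition bump :: "plane \<Rightarrow> real" where
  "bump x = (flat 1 (1 * x $ 1 + 1) * flat 1 ((-1) * x $ 1 + 1)) *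
            (flat 1 (1 * x $ 2 + 1) * flat 1 ((-1) * x $ 2 + 1))"

lemma flat1: "flat 1 t \<ge> 0" "t > 0 \<Longrightarrow> flat 1 t > 0" "t \<le> 0 \<Longrightarrow> flat 1 t = 0"
  by (auto simp: flat_def)

lemma norm_plane_le: "norm (x::plane) \<le> \<bar>x $ 1\<bar> + \<bar>x $ 2\<bar>"
  using norm_le_l1_cart[of x] by (simp add: sum_2)

lemma bump_nonneg: "bump x \<ge> 0"
  by (simp add: bump_def flat1(1))

lemma bump_0: "bump 0 > 0"
  by (simp add: bump_def flat1(2))

lemma bump_outside: "norm x > 2 \<Longrightarrow> bump x = 0"
proof -
  assume "norm x > 2"
  then have "\<bar>x $ 1\<bar> > 1 \<or> \<bar>x $ 2\<bar> > 1" using norm_plane_le[of x] by linarith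
  then show ?thesis by (auto simp: bump_def flat1(3) abs_if split: if_splits)
qed

lemma bump_test: "bump \<in> test_functions"
proof -
  have "smooth bump" unfolding bump_def[abs_def] by (intro smooth_mult smooth_flat)
  then show ?thesis unfolding test_iff using bump_outside by blast
qed

lemma AE_eq_continuous:
  fixes f g :: "plane \<Rightarrow> 'b::metric_space"
  assumes "continuous_on UNIV f" "continuous_on UNIV g" "AE x in lebesgue. f x = g x"
  shows "f = g"
proof (rule ccontr)
  assume "f \<noteq> g"
  then have "{x. f x \<noteq> g x} \<noteq> {}" by auto
  moreover have "open {x. f x \<noteq> g x}"
    by (rule open_Collect_neq) (use assms in auto)
  ultimately have "\<not> negligible {x. f x \<noteq> g x}" by (rule open_not_negligible[rotated])
  moreover have "negligible {x. f x \<noteq> g x}"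
  proof -
    from assms(3) obtain N where "N \<in> null_sets lebesgue" "{x\<in>space lebesgue. f x \<noteq> g x} \<subseteq> N"
      unfolding eventually_ae_filter by blast
    then show ?thesis by (auto simp: negligible_iff_null_sets[symmetric] intro: negligible_subset)
  qed
  ultimately show False by simp
qed

lemma borel_imp_lebesgue: "f \<in> borel_measurable borel \<Longrightarrow> f \<in> borel_measurable lebesgue"
  by (rule measurable_completion) simp

lemma integral_pos_continuous:
  fixes f :: "plane \<Rightarrow> real"
  assumes "f \<in> test_functions" "\<And>x. f x \<ge> 0" "f a > 0"
  shows "(\<integral>x. f x \<partial>lborel) > 0"
proof (rule ccontr)
  assume "\<not> ?thesis"
  moreover have "(\<integral>x. f x \<partial>lborel) \<ge> 0" by (simp add: assms(2))
  ultimately have "(\<integral>x. f x \<partial>lborel) = 0" by simp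
  then have "AE x in lborel. f x = 0"
    using integral_nonneg_eq_0_iff_AE[OF test_integrable(1)[OF assms(1)]] assms(2) by auto
  then have "AE x in lebesgue. f x = (\<lambda>x. 0) x" by (intro AE_completion)
  then have "f = (\<lambda>x. 0)"
    by (rule AE_eq_continuous[rotated 2]) (auto intro: test_continuous assms(1))
  with assms(3) show False by simp
qed

text \<open>Scaling by \<open>2 * Suc n\<close> turns the support radius 2 of \<open>bump\<close>
  into \<open>1 / Suc n\<close>; dividing by the integral makes the total mass 1.\<close>

definition moll :: "nat \<Rightarrow> plane \<Rightarrow> real" where
  "moll n x = bump (real (2 * Suc n) *\<^sub>R x) / (\<integral>y. bump (real (2 * Suc n) *\<^sub>R y) \<partial>lborel)"

lemma moll_aux: "(\<lambda>x. bump (real (2 * Suc n) *\<^sub>R x)) \<in> test_functions"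
  "(\<integral>y. bump (real (2 * Suc n) *\<^sub>R y) \<partial>lborel) > 0"
proof -
  show *: "(\<lambda>x. bump (real (2 * Suc n) *\<^sub>R x)) \<in> test_functions"
    using test_affine[OF bump_test, of "real (2 * Suc n)" 0] by simp
  show "(\<integral>y. bump (real (2 * Suc n) *\<^sub>R y) \<partial>lborel) > 0"
    by (rule integral_pos_continuous[OF *, of 0]) (auto simp: bump_nonneg bump_0)
qed

lemma moll_test: "moll n \<in> test_functions"
  using test_cmult[OF moll_aux(1)[of n], of "inverse (\<integral>y. bump (real (2 * Suc n) *\<^sub>R y) \<partial>lborel)"]
  by (simp add: moll_def[abs_def] field_simps)

lemma moll_nonneg: "moll n x \<ge> 0"
  using moll_aux(2)[of n] by (simp add: moll_def bump_nonneg)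

lemma moll_integral: "(\<integral>x. moll n x \<partial>lborel) = 1"
  using moll_aux(2)[of n] by (simp add: moll_def)

lemma moll_outside: "norm x > 1 / real (Suc n) \<Longrightarrow> moll n x = 0"
proof -
  assume "norm x > 1 / real (Suc n)"
  then have "real (2 * Suc n) * norm x > 2" by (simp add: field_simps)
  then have "norm (real (2 * Suc n) *\<^sub>R x) > 2" by (simp only: norm_scaleR)
  then show ?thesis by (simp add: moll_def bump_outside)
qed

lemma lborel_reflect:
  fixes f :: "plane \<Rightarrow> real"
  assumes [measurable]: "f \<in> borel_measurable borel"
  shows "(\<integral>y. f (x - y) \<partial>lborel) = (\<integral>y. f y \<partial>lborel)"
    "(\<integral>\<^sup>+y. ennreal (f (x - y)) \<partial>lborel) = (\<integral>\<^sup>+y. ennreal (f y) \<partial>lborel)"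
    "integrable lborel (\<lambda>y. f (x - y)) = integrable lborel f"
proof -
  have d: "distr lborel borel (\<lambda>y. x - y) = (lborel :: plane measure)"
    using lborel_affine[of "-1" x] by (simp add: density_1)
  show "(\<integral>y. f (x - y) \<partial>lborel) = (\<integral>y. f y \<partial>lborel)"
    by (subst d[symmetric], subst integral_distr) auto
  show "(\<integral>\<^sup>+y. ennreal (f (x - y)) \<partial>lborel) = (\<integral>\<^sup>+y. ennreal (f y) \<partial>lborel)"
    by (subst d[symmetric], subst nn_integral_distr) auto
  show "integrable lborel (\<lambda>y. f (x - y)) = integrable lborel f"
    by (subst (2) d[symmetric], subst integrable_distr_eq) auto
qed

section \<open>Real-valued weak derivatives and convolution with test functions\<close>

definition rL1loc :: "(plane \<Rightarrow> real) \<Rightarrow> bool" where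
  "rL1loc f \<longleftrightarrow> f \<in> borel_measurable lebesgue \<and> (\<forall>R. set_integrable lebesgue (cball 0 R) f)"

text \<open>The real counterpart of \<open>has_weak_partial\<close>. Integrability is asked on balls
  about the origin only, since every compact set lies in one.\<close>

definition rweak :: "2 \<Rightarrow> (plane \<Rightarrow> real) \<Rightarrow> (plane \<Rightarrow> real) \<Rightarrow> bool" where
  "rweak i f g \<longleftrightarrow> rL1loc f \<and> rL1loc g \<and>
     (\<forall>\<eta>\<in>test_functions. (LINT x|lebesgue. pd i \<eta> x * f x) = - (LINT x|lebesgue. \<eta> x * g x))"

definition conv :: "(plane \<Rightarrow> real) \<Rightarrow> (plane \<Rightarrow> real) \<Rightarrow> plane \<Rightarrow> real" where
  "conv k f x = (LINT y|lebesgue. k (x - y) * f y)"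

lemma rL1loc_meas: "rL1loc f \<Longrightarrow> f \<in> borel_measurable lebesgue"
  by (simp add: rL1loc_def)

lemma integral_bound:
  fixes f :: "'a \<Rightarrow> 'b::{banach, second_countable_topology}"
  assumes "integrable M g" "f \<in> borel_measurable M" "AE x in M. norm (f x) \<le> g x"
  shows "integrable M f" "norm (integral\<^sup>L M f) \<le> integral\<^sup>L M g"
proof -
  show i: "integrable M f"
    by (rule Bochner_Integration.integrable_bound[OF assms(1,2)])
      (use assms(3) in eventually_elim, simp)
  have "norm (integral\<^sup>L M f) \<le> (\<integral>x. norm (f x) \<partial>M)" by (rule integral_norm_bound)
  also have "\<dots> \<le> integral\<^sup>L M g"
    by (rule integral_mono_AE) (use i assms in auto)
  finally show "norm (integral\<^sup>L M f) \<le> integral\<^sup>L M g" .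
qed

lemma rL1loc_mult_bound:
  assumes "rL1loc f" "k \<in> borel_measurable lebesgue" "\<And>x. \<bar>k x\<bar> \<le> B" "\<And>x. norm x > R \<Longrightarrow> k x = 0"
  shows "integrable lebesgue (\<lambda>x. k x * f x)"
    "\<bar>LINT x|lebesgue. k x * f x\<bar> \<le> B * (LINT x:cball 0 R|lebesgue. \<bar>f x\<bar>)"
proof -
  have [measurable]: "f \<in> borel_measurable lebesgue" "k \<in> borel_measurable lebesgue"
    using assms by (auto simp: rL1loc_def)
  have "set_integrable lebesgue (cball 0 R) f" using assms by (simp add: rL1loc_def)
  then have "integrable lebesgue (\<lambda>x. norm (indicator (cball 0 R) x *\<^sub>R f x))"
    unfolding set_integrable_def by (rule integrable_norm)
  then have i: "integrable lebesgue (\<lambda>x. indicator (cball 0 R) x *\<^sub>R \<bar>f x\<bar>)"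
    by (rule Bochner_Integration.integrable_cong[THEN iffD1, rotated -1]) (auto simp: abs_mult)
  then have iB: "integrable lebesgue (\<lambda>x. B * (indicator (cball 0 R) x *\<^sub>R \<bar>f x\<bar>))" by simp
  have b: "norm (k x * f x) \<le> B * (indicator (cball 0 R) x *\<^sub>R \<bar>f x\<bar>)" for x
    using assms(3)[of x] assms(4)[of x]
    by (cases "norm x \<le> R") (auto simp: abs_mult intro!: mult_right_mono)
  show "integrable lebesgue (\<lambda>x. k x * f x)"
    by (rule integral_bound(1)[OF iB]) (use b in auto)
  have "\<bar>LINT x|lebesgue. k x * f x\<bar> \<le> (LINT x|lebesgue. B * (indicator (cball 0 R) x *\<^sub>R \<bar>f x\<bar>))"
    using integral_bound(2)[OF iB, of "\<lambda>x. k x * f x"] b by simp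
  then show "\<bar>LINT x|lebesgue. k x * f x\<bar> \<le> B * (LINT x:cball 0 R|lebesgue. \<bar>f x\<bar>)"
    by (simp add: set_lebesgue_integral_def)
qed

lemma test_mult_integrable:
  assumes "\<eta> \<in> test_functions" "rL1loc f" shows "integrable lebesgue (\<lambda>x. \<eta> x * f x)"
proof -
  obtain B where B: "\<And>x. \<bar>\<eta> x\<bar> \<le> B" using test_bounded[OF assms(1)] by blast
  obtain R where R: "\<And>x. norm x > R \<Longrightarrow> \<eta> x = 0" using test_supp[OF assms(1)] by blast
  show ?thesis by (rule rL1loc_mult_bound(1)[OF assms(2) borel_imp_lebesgue[OF test_borel[OF assms(1)]] B R])
qed

lemma continuous_rL1loc:
  assumes "continuous_on UNIV f" shows "rL1loc f"
proof -
  have "set_integrable lebesgue (cball 0 R) f" for R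
  proof -
    have "integrable lborel (\<lambda>x. indicator (cball 0 R) x *\<^sub>R f x)"
      by (rule borel_integrable_compact) (auto intro: continuous_on_subset[OF assms(1)])
    then show ?thesis unfolding set_integrable_def by (subst integrable_completion) auto
  qed
  then show ?thesis using assms by (auto simp: rL1loc_def intro!: borel_imp_lebesgue borel_measurable_continuous_onI)
qed

lemma test_reflect: "k \<in> test_functions \<Longrightarrow> (\<lambda>y. k (x - y)) \<in> test_functions"
  using test_affine[of k "-1" x] by (simp add: algebra_simps)

lemma pd_reflect: "smooth k \<Longrightarrow> pd i (\<lambda>y. k (x - y)) = (\<lambda>y. - pd i k (x - y))"
  using pd_affine[of k i "-1" x] by (simp add: algebra_simps)

lemma bounded_linear_coords: "bounded_linear (\<lambda>h::plane. \<Sum>j\<in>UNIV. h $ j * c j)"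
  by (rule bounded_linear_sum, rule bounded_linear_mult_const, rule bounded_linear_vec_nth)

text \<open>The mean value inequality is applied to \<open>k\<close> minus its linear part at
  \<open>z\<close>. The derivative of that difference is the increment of the gradient, which is
  Lipschitz, hence of order \<open>norm h\<close> on the ball of radius
  \<open>norm h\<close>.\<close>

lemma test_taylor:
  assumes "k \<in> test_functions"
  obtains B where "B > 0"
    "\<And>z h. \<bar>k (z + h) - k z - (\<Sum>j\<in>UNIV. h $ j * pd j k z)\<bar> \<le> B * (norm h)\<^sup>2"
proof -
  obtain B1 where B1: "B1 > 0" "\<And>x y. \<bar>pd 1 k x - pd 1 k y\<bar> \<le> B1 * norm (x - y)"
    using test_mvt[OF test_pd[OF assms]] by blast
  obtain B2 where B2: "B2 > 0" "\<And>x y. \<bar>pd 2 k x - pd 2 k y\<bar> \<le> B2 * norm (x - y)"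
    using test_mvt[OF test_pd[OF assms]] by blast
  have "\<bar>k (z + h) - k z - (\<Sum>j\<in>UNIV. h $ j * pd j k z)\<bar> \<le> (B1 + B2) * (norm h)\<^sup>2" for z h
  proof -
    define g where "g w = k w - (\<Sum>j\<in>UNIV. w $ j * pd j k z)" for w
    have "norm (g (z + h) - g z) \<le> ((B1 + B2) * norm h) * norm (z + h - z)"
    proof (rule differentiable_bound[of "cball z (norm h)"])
      show "(g has_derivative (\<lambda>v. (\<Sum>j\<in>UNIV. v $ j * pd j k w) - (\<Sum>j\<in>UNIV. v $ j * pd j k z)))
          (at w within cball z (norm h))" for w
        unfolding g_def
        by (rule has_derivative_diff[OF has_derivative_at_withinI[OF smooth_has_derivative[OF test_smooth[OF assms]]]
          bounded_linear_imp_has_derivative[OF bounded_linear_coords]])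
      fix w assume w: "w \<in> cball z (norm h)"
      show "onorm (\<lambda>v::plane. (\<Sum>j\<in>UNIV. v $ j * pd j k w) - (\<Sum>j\<in>UNIV. v $ j * pd j k z)) \<le> (B1 + B2) * norm h"
      proof (rule onorm_le)
        fix v :: plane
        have wz: "norm (w - z) \<le> norm h" using w by (simp add: dist_norm norm_minus_commute)
        have "norm ((\<Sum>j\<in>UNIV. v $ j * pd j k w) - (\<Sum>j\<in>UNIV. v $ j * pd j k z))
           = \<bar>v $ 1 * (pd 1 k w - pd 1 k z) + v $ 2 * (pd 2 k w - pd 2 k z)\<bar>"
          by (simp add: sum_2 algebra_simps)
        also have "\<dots> \<le> \<bar>v $ 1\<bar> * \<bar>pd 1 k w - pd 1 k z\<bar> + \<bar>v $ 2\<bar> * \<bar>pd 2 k w - pd 2 k z\<bar>"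
          by (metis abs_mult abs_triangle_ineq)
        also have "\<dots> \<le> norm v * (B1 * norm h) + norm v * (B2 * norm h)"
          by (intro add_mono mult_mono component_le_norm_cart order_trans[OF B1(2)] order_trans[OF B2(2)])
            (use wz B1(1) B2(1) in auto)
        finally show "norm ((\<Sum>j\<in>UNIV. v $ j * pd j k w) - (\<Sum>j\<in>UNIV. v $ j * pd j k z)) \<le> (B1 + B2) * norm h * norm v"
          by (simp add: algebra_simps)
      qed
    qed (auto simp: dist_norm)
    then show ?thesis by (simp add: g_def sum_2 algebra_simps power2_eq_square)
  qed
  then show ?thesis using B1(1) B2(1) by (intro that[of "B1 + B2"]) auto
qed

text \<open>Derivatives fall on the kernel: its Taylor remainder is bounded by a multiple of
  \<open>(norm h)^2\<close> uniformly in the base point, and only the integral of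
  \<open>abs f\<close> over one fixed ball enters.\<close>

lemma conv_has_derivative:
  assumes k: "k \<in> test_functions" and f: "rL1loc f"
  shows "(conv k f has_derivative (\<lambda>h. \<Sum>j\<in>UNIV. h $ j * conv (pd j k) f x)) (at x)"
proof -
  obtain B where B: "B > 0" "\<And>z h. \<bar>k (z + h) - k z - (\<Sum>j\<in>UNIV. h $ j * pd j k z)\<bar> \<le> B * (norm h)\<^sup>2"
    using test_taylor[OF k] by blast
  obtain R where R: "R > 0" "\<And>x. norm x > R \<Longrightarrow> k x = 0" using test_supp[OF k] by blast
  have R': "norm x > R \<Longrightarrow> pd j k x = 0" for x j
    using pd_zero_outside[of R k x j] R(2) by blast
  \<comment> \<open>For every \<open>y\<close> within distance 1 of \<open>x\<close>, the kernel
    \<open>k (y - s)\<close> vanishes once \<open>norm s > S\<close>.\<close>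
  define S where "S = norm x + 1 + R"
  define M where "M = (LINT y:cball 0 S|lebesgue. \<bar>f y\<bar>)"
  have M: "M \<ge> 0" unfolding M_def set_lebesgue_integral_def by (intro integral_nonneg_AE) auto
  have bnd: "\<bar>conv k f y - conv k f x - (\<Sum>j\<in>UNIV. (y - x) $ j * conv (pd j k) f x)\<bar> \<le> (B * M) * (norm (y - x))\<^sup>2"
    if "norm (y - x) < 1" for y
  proof -
    define q where "q s = k (y - s) - k (x - s) - (\<Sum>j\<in>UNIV. (y - x) $ j * pd j k (x - s))" for s
    have i: "integrable lebesgue (\<lambda>s. k (y - s) * f s)" "integrable lebesgue (\<lambda>s. k (x - s) * f s)"
      "\<And>j. integrable lebesgue (\<lambda>s. pd j k (x - s) * f s)"
      using k by (auto intro!: test_mult_integrable f test_reflect test_pd)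
    have "conv k f y - conv k f x - (\<Sum>j\<in>UNIV. (y - x) $ j * conv (pd j k) f x) = (LINT s|lebesgue. q s * f s)"
    proof -
      have "(LINT s|lebesgue. q s * f s) = (LINT s|lebesgue. k (y - s) * f s - k (x - s) * f s -
          ((y - x) $ 1 * (pd 1 k (x - s) * f s) + (y - x) $ 2 * (pd 2 k (x - s) * f s)))"
        by (rule Bochner_Integration.integral_cong) (auto simp: q_def sum_2 algebra_simps)
      also have "\<dots> = (LINT s|lebesgue. k (y - s) * f s) - (LINT s|lebesgue. k (x - s) * f s) -
          ((y - x) $ 1 * (LINT s|lebesgue. pd 1 k (x - s) * f s) + (y - x) $ 2 * (LINT s|lebesgue. pd 2 k (x - s) * f s))"
        using i by (simp del: vector_minus_component)
      finally show ?thesis by (simp add: conv_def sum_2)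
    qed
    moreover have "\<bar>LINT s|lebesgue. q s * f s\<bar> \<le> (B * (norm (y - x))\<^sup>2) * M"
      unfolding M_def
    proof (rule rL1loc_mult_bound(2)[OF f])
      show "\<bar>q s\<bar> \<le> B * (norm (y - x))\<^sup>2" for s
        using B(2)[of "x - s" "y - x"] by (simp add: q_def algebra_simps)
      show "q \<in> borel_measurable lebesgue"
        unfolding q_def sum_2
        using test_borel[OF test_reflect[OF k]] test_borel[OF test_reflect[OF test_pd[OF k]]]
        by (intro borel_imp_lebesgue) (intro borel_measurable_diff borel_measurable_add borel_measurable_times borel_measurable_const; blast)
      show "q s = 0" if "norm s > S" for s
      proof -
        have "norm (x - s) > R" using \<open>norm s > S\<close> norm_triangle_ineq2[of s x] by (simp add: S_def norm_minus_commute)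
        moreover have "norm (y - s) > R"
        proof -
          have "norm y \<le> norm x + 1" using \<open>norm (y - x) < 1\<close> norm_triangle_ineq2[of y x] by linarith
          then show ?thesis using \<open>norm s > S\<close> norm_triangle_ineq2[of s y] by (simp add: S_def norm_minus_commute)
        qed
        ultimately show ?thesis by (simp add: q_def R(2) R')
      qed
    qed
    ultimately show ?thesis by (simp add: algebra_simps)
  qed
  show ?thesis
    unfolding has_derivative_at_alt
  proof (intro conjI allI impI)
    show "bounded_linear (\<lambda>h::plane. \<Sum>j\<in>UNIV. h $ j * conv (pd j k) f x)"
      by (rule bounded_linear_coords)
    fix e :: real assume e: "e > 0"
    define d where "d = min 1 (e / (B * M + 1))"
    have d: "d > 0" using e B M by (simp add: d_def add_nonneg_pos)
    moreover have "norm (conv k f y - conv k f x - (\<Sum>j\<in>UNIV. (y - x) $ j * conv (pd j k) f x)) \<le> e * norm (y - x)"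
      if "norm (y - x) < d" for y
    proof -
      have BM: "B * M \<ge> 0" using B M by simp
      have "B * M * norm (y - x) \<le> (B * M + 1) * d"
        using that BM by (intro mult_mono) auto
      also have "\<dots> \<le> (B * M + 1) * (e / (B * M + 1))"
        using BM by (intro mult_left_mono) (auto simp: d_def)
      also have "\<dots> = e" using BM by simp
      finally have "B * M * norm (y - x) \<le> e" .
      then have "(B * M) * (norm (y - x))\<^sup>2 \<le> e * norm (y - x)"
        by (simp add: power2_eq_square mult.assoc[symmetric] mult_right_mono)
      moreover have "norm (y - x) < 1" using that by (simp add: d_def)
      ultimately show ?thesis using bnd[of y] by simp
    qed
    ultimately show "\<exists>d>0. \<forall>y. norm (y - x) < d \<longrightarrow>
      norm (conv k f y - conv k f x - (\<Sum>j\<in>UNIV. (y - x) $ j * conv (pd j k) f x)) \<le> e * norm (y - x)" by blast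
  qed
qed

lemma conv_smooth:
  assumes "k \<in> test_functions" "rL1loc f" shows "smooth (conv k f)"
proof (rule smooth_coinduct[where P="\<lambda>g. \<exists>k\<in>test_functions. g = conv k f"])
  show "\<exists>k'\<in>test_functions. conv k f = conv k' f" using assms by blast
next
  fix g assume "\<exists>k\<in>test_functions. g = conv k f"
  then obtain k where k: "k \<in> test_functions" "g = conv k f" by blast
  show "\<exists>d. (\<forall>x. (g has_derivative (\<lambda>h. \<Sum>j\<in>UNIV. h $ j * d j x)) (at x)) \<and>
      (\<forall>i. \<exists>k\<in>test_functions. d i = conv k f)"
    by (rule exI[of _ "\<lambda>j. conv (pd j k) f"])
      (use k conv_has_derivative[OF k(1) assms(2)] test_pd[OF k(1)] in auto)
qed

lemma pd_conv: "k \<in> test_functions \<Longrightarrow> rL1loc f \<Longrightarrow> pd j (conv k f) = conv (pd j k) f"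
  by (intro ext pd_eq_sumI conv_has_derivative)

text \<open>The weak derivative is tested with the reflected kernel \<open>k (x - y)\<close>; the
  sign from the reflection cancels the sign of the integration by parts.\<close>

lemma conv_weak:
  assumes "rweak i f g" "k \<in> test_functions"
  shows "conv (pd i k) f = conv k g"
proof
  fix x
  have "(LINT y|lebesgue. pd i (\<lambda>y. k (x - y)) y * f y) = - (LINT y|lebesgue. k (x - y) * g y)"
    using assms test_reflect by (auto simp: rweak_def)
  then show "conv (pd i k) f x = conv k g x"
    by (simp add: pd_reflect[OF test_smooth[OF assms(2)]] conv_def)
qed

lemma conv_outside:
  assumes "\<And>x. norm x > R \<Longrightarrow> k x = 0" "\<And>x. norm x > S \<Longrightarrow> f x = 0" "norm x > R + S"
  shows "conv k f x = 0"
proof -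
  have "k (x - y) * f y = 0" for y
    using assms norm_triangle_ineq2[of x y] by (cases "norm y > S") auto
  then have "(\<lambda>y. k (x - y) * f y) = (\<lambda>y. 0)" by auto
  then show ?thesis by (simp add: conv_def)
qed

lemma conv_test:
  assumes "k \<in> test_functions" "rL1loc f" "\<And>x. norm x > S \<Longrightarrow> f x = 0"
  shows "conv k f \<in> test_functions"
proof -
  obtain R where "\<And>x. norm x > R \<Longrightarrow> k x = 0" using test_supp[OF assms(1)] by blast
  then show ?thesis
    unfolding test_iff using conv_smooth[OF assms(1,2)] conv_outside[of R k S f] assms(3) by blast
qed

lemma moll_shift_integral: "(LINT y|lebesgue. moll n (x - y)) = 1"
  using lborel_reflect(1)[OF test_borel[OF moll_test], of n x] moll_integral[of n]
  by (subst lborel_lebesgue_integral) (auto intro: test_borel test_reflect moll_test)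

text \<open>\<open>moll n\<close> is a probability density on the ball of radius
  \<open>1 / Suc n\<close>, so the convolution averages values of \<open>f\<close> that all lie
  within \<open>e\<close> of \<open>c\<close>.\<close>

lemma moll_conv_approx:
  assumes f: "rL1loc f" and e: "\<And>y. norm (x - y) \<le> 1 / real (Suc n) \<Longrightarrow> \<bar>f y - c\<bar> \<le> e"
  shows "\<bar>conv (moll n) f x - c\<bar> \<le> e"
proof -
  have i: "integrable lebesgue (\<lambda>y. moll n (x - y))" "integrable lebesgue (\<lambda>y. moll n (x - y) * f y)"
    by (intro test_integrable test_reflect moll_test, intro test_mult_integrable test_reflect moll_test f)
  have "conv (moll n) f x - c = (LINT y|lebesgue. moll n (x - y) * f y) - (LINT y|lebesgue. moll n (x - y) * c)"
    by (simp add: conv_def moll_shift_integral)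
  also have "\<dots> = (LINT y|lebesgue. moll n (x - y) * f y - moll n (x - y) * c)"
    using i by (intro Bochner_Integration.integral_diff[symmetric]) auto
  also have "\<bar>\<dots>\<bar> \<le> (LINT y|lebesgue. moll n (x - y) * e)"
  proof -
    have "norm (moll n (x - y) * f y - moll n (x - y) * c) \<le> moll n (x - y) * e" for y
    proof (cases "norm (x - y) \<le> 1 / real (Suc n)")
      case True
      have "norm (moll n (x - y) * f y - moll n (x - y) * c) = moll n (x - y) * \<bar>f y - c\<bar>"
        using moll_nonneg[of n "x - y"] by (simp add: right_diff_distrib[symmetric] abs_mult)
      also have "\<dots> \<le> moll n (x - y) * e"
        by (intro mult_left_mono e True moll_nonneg)
      finally show ?thesis .
    qed (simp add: moll_outside)
    then show ?thesis
      using integral_bound(2)[of lebesgue "\<lambda>y. moll n (x - y) * e" "\<lambda>y. moll n (x - y) * f y - moll n (x - y) * c"] i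
      by auto
  qed
  also have "\<dots> = e" by (simp add: moll_shift_integral)
  finally show ?thesis .
qed

lemma moll_uniform:
  assumes g: "continuous_on UNIV g" "\<And>x. norm x > R \<Longrightarrow> g x = 0" and e: "e > 0"
  shows "\<exists>N. \<forall>n\<ge>N. \<forall>x. \<bar>conv (moll n) g x - g x\<bar> \<le> e"
proof -
  \<comment> \<open>Mollification moves points by at most 1. Points of norm at most
    \<open>R + 1\<close> stay in the ball of radius \<open>R + 2\<close>, and around points farther
    out \<open>g\<close> vanishes.\<close>
  have "uniformly_continuous_on (cball 0 (R+2)) g"
    by (intro compact_uniformly_continuous continuous_on_subset[OF g(1)]) auto
  then obtain d where d: "d > 0" "\<And>x y. x \<in> cball 0 (R+2) \<Longrightarrow> y \<in> cball 0 (R+2) \<Longrightarrow> dist y x < d \<Longrightarrow> dist (g y) (g x) < e"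
    unfolding uniformly_continuous_on_def using e by metis
  obtain N where N: "1 / real (Suc N) < d" using d(1) nat_approx_posE by blast
  have "\<bar>conv (moll n) g x - g x\<bar> \<le> e" if "n \<ge> N" for n x
  proof (rule moll_conv_approx[OF continuous_rL1loc[OF g(1)]])
    fix y assume xy: "norm (x - y) \<le> 1 / real (Suc n)"
    also have "\<dots> \<le> 1 / real (Suc N)" using that by (simp add: frac_le)
    finally have dd: "norm (x - y) < d" using N by simp
    have one: "norm (x - y) \<le> 1" using order_trans[OF xy, of 1] by simp
    show "\<bar>g y - g x\<bar> \<le> e"
    proof (cases "norm x \<le> R + 1")
      case True
      then have "norm y \<le> R + 2" using one norm_triangle_ineq2[of y x] by (simp add: norm_minus_commute)
      then show ?thesis using d(2)[of x y] True dd by (simp add: dist_norm norm_minus_commute)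
    next
      case False
      then have "norm y > R" using one norm_triangle_ineq2[of x y] by simp
      then show ?thesis using False g(2) e by simp
    qed
  qed
  then show ?thesis by blast
qed

text \<open>The ball has radius 2 and the mollifier radius 1, which yields the value 1 on the unit
  ball and 0 beyond radius 3.\<close>

definition chi :: "plane \<Rightarrow> real" where
  "chi = conv (moll 0) (indicator (cball 0 2))"

lemma chi_aux: "rL1loc (indicator (cball 0 2))"
proof -
  have "integrable lborel (indicator (cball 0 R \<inter> cball 0 2) :: plane \<Rightarrow> real)" for R
    using emeasure_bounded_finite[of "cball (0::plane) R \<inter> cball 0 2"]
    by (intro integrable_real_indicator) (auto simp: bounded_Int)
  then have "integrable lebesgue (indicator (cball 0 R \<inter> cball 0 2) :: plane \<Rightarrow> real)" for R
    by (subst integrable_completion) auto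
  then show ?thesis
    unfolding rL1loc_def set_integrable_def by (auto simp: indicator_inter_arith[symmetric] intro!: borel_imp_lebesgue borel_measurable_indicator)
qed

lemma chi_test: "chi \<in> test_functions"
  unfolding chi_def by (rule conv_test[OF moll_test chi_aux, of 2]) (auto simp: indicator_def)

lemma chi_1: "norm x \<le> 1 \<Longrightarrow> chi x = 1"
proof -
  assume x: "norm x \<le> 1"
  have "\<bar>conv (moll 0) (indicator (cball 0 2)) x - 1\<bar> \<le> 0"
  proof (rule moll_conv_approx[OF chi_aux])
    fix y assume "norm (x - y) \<le> 1 / real (Suc 0)"
    then have "norm y \<le> 2" using x norm_triangle_ineq2[of y x] by (simp add: norm_minus_commute)
    then show "\<bar>indicator (cball 0 2) y - 1\<bar> \<le> (0::real)" by simp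
  qed
  then show ?thesis by (simp add: chi_def)
qed

lemma chi_bounds: "0 \<le> chi x" "chi x \<le> 1"
proof -
  \<comment> \<open>The values 0 and 1 of the indicator both have distance 1/2 from 1/2, so one
    averaging estimate gives both bounds.\<close>
  have "\<bar>conv (moll 0) (indicator (cball 0 2)) x - 1/2\<bar> \<le> 1/2"
    by (rule moll_conv_approx[OF chi_aux]) (auto simp: indicator_def)
  then show "0 \<le> chi x" "chi x \<le> 1" unfolding chi_def by linarith+
qed

lemma chi_outside: "norm x > 3 \<Longrightarrow> chi x = 0"
  unfolding chi_def by (rule conv_outside[of 1 _ 2]) (auto simp: moll_outside)

section \<open>Cutoffs, the fundamental lemma and symmetry of second derivatives\<close>

text \<open>Used at both ends of the scale: large \<open>R\<close> cuts off at infinity, small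
  \<open>R\<close> isolates the origin.\<close>

definition chiR :: "real \<Rightarrow> plane \<Rightarrow> real" where "chiR R x = chi ((1 / R) *\<^sub>R x)"

lemma chiR_test: "R > 0 \<Longrightarrow> chiR R \<in> test_functions"
  using test_affine[OF chi_test, of "1 / R" 0] by (simp add: chiR_def[abs_def])

lemma chiR_1: "R > 0 \<Longrightarrow> norm x \<le> R \<Longrightarrow> chiR R x = 1"
  unfolding chiR_def by (rule chi_1) (simp add: field_simps)

lemma chiR_outside: "R > 0 \<Longrightarrow> norm x > 3 * R \<Longrightarrow> chiR R x = 0"
  unfolding chiR_def by (rule chi_outside) (simp add: field_simps)

lemma chiR_bounds: "0 \<le> chiR R x" "chiR R x \<le> 1"
  by (simp_all add: chiR_def chi_bounds)

lemma chiR_tendsto: "(\<lambda>n. chiR (real (Suc n)) x) \<longlonglongrightarrow> 1"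
proof (rule tendsto_eventually)
  obtain N :: nat where "norm x \<le> real N" using real_arch_simple by blast
  then show "eventually (\<lambda>n. chiR (real (Suc n)) x = 1) sequentially"
    by (intro eventually_sequentiallyI[of N] chiR_1) auto
qed

text \<open>Mollifying \<open>g\<close> gives test functions that converge uniformly with supports
  in one fixed ball; the error is at most \<open>e\<close> times the integral of
  \<open>abs f\<close> over that ball.\<close>

lemma orthogonal_continuous:
  assumes f: "rL1loc f" and z: "\<And>\<eta>. \<eta> \<in> test_functions \<Longrightarrow> (LINT x|lebesgue. \<eta> x * f x) = 0"
    and g: "continuous_on UNIV g" "\<And>x. norm x > R \<Longrightarrow> g x = 0"
  shows "(LINT x|lebesgue. g x * f x) = 0"
proof -
  define M where "M = (LINT x:cball 0 (R + 1)|lebesgue. \<bar>f x\<bar>)"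
  have M: "M \<ge> 0" unfolding M_def set_lebesgue_integral_def by (intro integral_nonneg_AE) auto
  obtain B where B: "\<And>x. \<bar>g x\<bar> \<le> B" using continuous_csupp_bounded[OF g] by blast
  have gi: "integrable lebesgue (\<lambda>x. g x * f x)"
    by (rule rL1loc_mult_bound(1)[OF f borel_imp_lebesgue[OF borel_measurable_continuous_onI[OF g(1)]] B g(2)])
  have le: "\<bar>LINT x|lebesgue. g x * f x\<bar> \<le> e * M" if e: "e > 0" for e
  proof -
    obtain n where n: "\<And>x. \<bar>conv (moll n) g x - g x\<bar> \<le> e"
      using moll_uniform[OF g e] by blast
    have t: "conv (moll n) g \<in> test_functions"
      by (rule conv_test[OF moll_test continuous_rL1loc[OF g(1)] g(2)])
    have out: "conv (moll n) g x - g x = 0" if "norm x > R + 1" for x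
    proof -
      have "conv (moll n) g x = 0"
      proof (rule conv_outside[of 1 _ R])
        show "moll n x = 0" if "norm x > 1" for x
          using that by (intro moll_outside) (auto intro: le_less_trans[rotated])
      qed (use g(2) that in auto)
      then show ?thesis using g(2)[of x] that by simp
    qed
    have "\<bar>LINT x|lebesgue. (conv (moll n) g x - g x) * f x\<bar> \<le> e * M"
      unfolding M_def
      by (rule rL1loc_mult_bound(2)[OF f _ n out])
        (intro borel_imp_lebesgue borel_measurable_diff test_borel[OF t] borel_measurable_continuous_onI[OF g(1)])
    moreover have "(LINT x|lebesgue. (conv (moll n) g x - g x) * f x) = - (LINT x|lebesgue. g x * f x)"
      using test_mult_integrable[OF t f] gi z[OF t] by (simp add: left_diff_distrib)
    ultimately show ?thesis by simp
  qed
  have "\<bar>LINT x|lebesgue. g x * f x\<bar> \<le> 0"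
  proof (rule field_le_epsilon)
    fix e :: real assume "e > 0"
    then have "\<bar>LINT x|lebesgue. g x * f x\<bar> \<le> (e / (M + 1)) * M" using M by (intro le) auto
    also have "\<dots> \<le> e" using M \<open>e > 0\<close> by (simp add: field_simps)
    finally show "\<bar>LINT x|lebesgue. g x * f x\<bar> \<le> 0 + e" by simp
  qed
  then show ?thesis by simp
qed

lemma measurable_limit_continuous:
  fixes f :: "plane \<Rightarrow> real"
  assumes "f \<in> borel_measurable lebesgue"
  obtains h where "\<And>n. continuous_on UNIV (h n)" "AE x in lebesgue. (\<lambda>n. h n x) \<longlonglongrightarrow> f x"
proof -
  have "f measurable_on UNIV"
    using lebesgue_measurable_imp_measurable_on[OF assms] by simp
  then obtain N h where N: "negligible N" "\<And>n. continuous_on UNIV (h n)"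
    "\<And>x. x \<notin> N \<Longrightarrow> (\<lambda>n. h n x) \<longlonglongrightarrow> f x"
    unfolding measurable_on_def by auto
  then have "AE x in lebesgue. (\<lambda>n. h n x) \<longlonglongrightarrow> f x"
    by (intro AE_I'[of N]) (auto simp: negligible_iff_null_sets)
  with N(2) show ?thesis by (rule that)
qed

text \<open>The ideal test function is \<open>sgn f\<close>. It is an a.e. limit of continuous
  functions, to which orthogonality extends by \<open>orthogonal_continuous\<close>; in the limit
  \<open>chiR R * abs f\<close> has integral zero.\<close>

lemma fundamental_test:
  assumes f: "rL1loc f" and z: "\<And>\<eta>. \<eta> \<in> test_functions \<Longrightarrow> (LINT x|lebesgue. \<eta> x * f x) = 0"
  shows "AE x in lebesgue. f x = 0"
proof -
  have [measurable]: "f \<in> borel_measurable lebesgue" using f by (rule rL1loc_meas)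
  obtain h where h: "\<And>n. continuous_on UNIV (h n)" "AE x in lebesgue. (\<lambda>n. h n x) \<longlonglongrightarrow> sgn (f x)"
    by (rule measurable_limit_continuous[of "\<lambda>x. sgn (f x)"]) auto
  have "AE x in lebesgue. norm x \<le> R \<longrightarrow> f x = 0" if R: "R > 0" for R
  proof -
    \<comment> \<open>Clipping to [-1, 1] supplies the dominating function and does not disturb the
      limit, because \<open>sgn\<close> takes values in [-1, 1].\<close>
    define G where "G n x = chiR R x * max (-1) (min 1 (h n x))" for n x
    have Gc: "continuous_on UNIV (G n)" for n
      unfolding G_def by (intro continuous_intros test_continuous chiR_test R h)
    have Go: "G n x = 0" if "norm x > 3 * R" for n x
      using chiR_outside[OF R that] by (simp add: G_def)
    have Gz: "(LINT x|lebesgue. G n x * f x) = 0" for n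
      by (rule orthogonal_continuous[OF f z Gc Go])
    have [measurable]: "G n \<in> borel_measurable lebesgue" for n
      by (intro borel_imp_lebesgue borel_measurable_continuous_onI Gc)
    have [measurable]: "chiR R \<in> borel_measurable lebesgue"
      by (intro borel_imp_lebesgue test_borel chiR_test R)
    have i: "integrable lebesgue (\<lambda>x. chiR R x * \<bar>f x\<bar>)"
      using integrable_norm[OF test_mult_integrable[OF chiR_test[OF R] f]]
      by (simp add: abs_mult chiR_bounds)
    have "(\<lambda>n. LINT x|lebesgue. G n x * f x) \<longlonglongrightarrow> (LINT x|lebesgue. chiR R x * \<bar>f x\<bar>)"
    proof (rule integral_dominated_convergence[OF _ _ i])
      show "AE x in lebesgue. (\<lambda>n. G n x * f x) \<longlonglongrightarrow> chiR R x * \<bar>f x\<bar>"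
        using h(2)
      proof eventually_elim
        case (elim x)
        have "(\<lambda>n. G n x * f x) \<longlonglongrightarrow> chiR R x * max (-1) (min 1 (sgn (f x))) * f x"
          unfolding G_def by (intro tendsto_intros elim)
        also have "chiR R x * max (-1) (min 1 (sgn (f x))) * f x = chiR R x * \<bar>f x\<bar>"
          by (auto simp: sgn_if)
        finally show ?case .
      qed
      show "AE x in lebesgue. norm (G n x * f x) \<le> chiR R x * \<bar>f x\<bar>" for n
      proof (rule AE_I2)
        fix x
        have "\<bar>max (-1) (min 1 (h n x))\<bar> \<le> 1" by auto
        then show "norm (G n x * f x) \<le> chiR R x * \<bar>f x\<bar>"
          using chiR_bounds(1)[of R x]
          by (simp add: G_def abs_mult mult_left_le mult_right_mono)
      qed
    qed auto
    with Gz have "(LINT x|lebesgue. chiR R x * \<bar>f x\<bar>) = 0" by (simp add: LIMSEQ_const_iff)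
    then have "AE x in lebesgue. chiR R x * \<bar>f x\<bar> = 0"
      using integral_nonneg_eq_0_iff_AE[OF i] by (simp add: chiR_bounds)
    then show ?thesis by eventually_elim (use chiR_1[OF R] in auto)
  qed
  then have "AE x in lebesgue. \<forall>n. norm x \<le> real (Suc n) \<longrightarrow> f x = 0"
    by (subst AE_all_countable) auto
  then show ?thesis
  proof eventually_elim
    case (elim x)
    obtain N :: nat where "norm x \<le> real N" using real_arch_simple by blast
    then show ?case using elim[rule_format, of N] by simp
  qed
qed

lemma rL1loc_cmult: "rL1loc f \<Longrightarrow> rL1loc (\<lambda>x. c * f x)"
  by (auto simp: rL1loc_def)

lemma rL1loc_add: "rL1loc f \<Longrightarrow> rL1loc g \<Longrightarrow> rL1loc (\<lambda>x. f x + g x)"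
  unfolding rL1loc_def by auto

lemma rL1loc_diff: "rL1loc f \<Longrightarrow> rL1loc g \<Longrightarrow> rL1loc (\<lambda>x. f x - g x)"
  unfolding rL1loc_def by auto

lemma rweak_smooth: assumes "smooth f" shows "rweak i f (pd i f)"
proof -
  have [measurable]: "f \<in> borel_measurable borel" "pd i f \<in> borel_measurable borel"
    using assms by (auto intro!: borel_measurable_continuous_onI smooth_continuous smooth_pd)
  have "(LINT x|lebesgue. pd i \<eta> x * f x) = - (LINT x|lebesgue. \<eta> x * pd i f x)" if "\<eta> \<in> test_functions" for \<eta>
  proof -
    have [measurable]: "\<eta> \<in> borel_measurable borel" "pd i \<eta> \<in> borel_measurable borel"
      using that by (auto intro: test_borel test_pd)
    show ?thesis using integral_by_parts[OF assms that, of i]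
      by (simp add: lborel_lebesgue_integral mult.commute)
  qed
  then show ?thesis using assms
    by (auto simp: rweak_def intro!: continuous_rL1loc smooth_continuous smooth_pd)
qed

lemma pd_zero_invariant:
  assumes "smooth f" "\<And>x t. f (x + t *\<^sub>R axis i 1) = f x"
  shows "pd i f x = 0"
proof -
  have "((\<lambda>t. f (x + t *\<^sub>R axis i 1)) has_derivative (\<lambda>t. \<Sum>j\<in>UNIV. (t *\<^sub>R axis i 1 :: plane) $ j * pd j f (x + 0 *\<^sub>R axis i 1))) (at 0)"
    by (rule has_derivative_compose[where g=f, OF _ smooth_has_derivative[OF assms(1)]])
      (auto intro!: derivative_eq_intros)
  then have "((\<lambda>t::real. f x) has_derivative (\<lambda>t. \<Sum>j\<in>UNIV. (t *\<^sub>R axis i 1 :: plane) $ j * pd j f x)) (at 0)"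
    by (simp add: assms(2))
  then have "(\<lambda>t::real. \<Sum>j\<in>UNIV. (t *\<^sub>R axis i 1 :: plane) $ j * pd j f x) = (\<lambda>t. 0)"
    by (rule has_derivative_unique) simp
  from fun_cong[OF this, of 1] show ?thesis by (simp add: axis_sum)
qed

text \<open>\<open>bump\<close> is \<open>P * Q\<close> with \<open>P\<close> depending on the first
  and \<open>Q\<close> on the second coordinate only, so both orders of the mixed partial give
  \<open>pd 1 P * pd 2 Q\<close>.\<close>

lemma bump_pd_commute: "pd i (pd j bump) = pd j (pd i bump)"
proof -
  define P where "P x = flat 1 (1 * x $ 1 + 1) * flat 1 ((-1) * x $ 1 + 1)" for x :: plane
  define Q where "Q x = flat 1 (1 * x $ 2 + 1) * flat 1 ((-1) * x $ 2 + 1)" for x :: plane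
  have s: "smooth P" "smooth Q" unfolding P_def Q_def by (intro smooth_mult smooth_flat)+
  have b: "bump = (\<lambda>x. P x * Q x)" by (auto simp: bump_def P_def Q_def)
  \<comment> \<open>Translation invariance passes to partials, which also settles the iterated
    partials in \<open>P2\<close> and \<open>Q1\<close>.\<close>
  have inv: "pd k f (x + a) = pd k f x" if "smooth f" "\<And>x. f (x + a) = f x" for k f and x a :: plane
  proof -
    have "(\<lambda>x. f (1 *\<^sub>R x + a)) = f" using that(2) by simp
    then have "pd k f = (\<lambda>x. 1 * pd k f (1 *\<^sub>R x + a))" using pd_affine[OF that(1), of k 1 a] by simp
    from fun_cong[OF this, of x] show ?thesis by simp
  qed
  have Pi: "P (x + t *\<^sub>R axis 2 1) = P x" and Qi: "Q (x + t *\<^sub>R axis 1 1) = Q x" for x t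
    by (simp_all add: P_def Q_def axis_def)
  have P2: "pd 2 P = (\<lambda>x. 0)" "pd 2 (pd 1 P) = (\<lambda>x. 0)"
    by (auto intro!: ext pd_zero_invariant smooth_pd s Pi inv)
  have Q1: "pd 1 Q = (\<lambda>x. 0)" "pd 1 (pd 2 Q) = (\<lambda>x. 0)"
    by (auto intro!: ext pd_zero_invariant smooth_pd s Qi inv)
  have "pd 2 (pd 1 bump) = pd 1 (pd 2 bump)"
    by (simp add: b pd_mult s smooth_pd P2 Q1)
  then show ?thesis using exhaust_2[of i] exhaust_2[of j] by auto
qed

lemma moll_pd_commute: "pd i (pd j (moll n)) = pd j (pd i (moll n))"
proof -
  define C where "C = inverse (\<integral>y. bump (real (2 * Suc n) *\<^sub>R y) \<partial>lborel)"
  have m: "moll n = (\<lambda>x. C * bump (real (2 * Suc n) *\<^sub>R x + 0))"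
    by (auto simp: moll_def C_def field_simps)
  have s: "smooth (\<lambda>x. f (real (2 * Suc n) *\<^sub>R x + 0))" if "smooth f" for f
    using that by (rule smooth_affine)
  show ?thesis
    unfolding m
    by (simp only: pd_cmult pd_affine s smooth_cmult smooth_pd test_smooth[OF bump_test])
      (simp only: bump_pd_commute[of i j])
qed

text \<open>Clear for the product function \<open>bump\<close>; convolution with its rescalings transfers it to every
  smooth function.\<close>

lemma pd_commute:
  assumes f: "smooth f" shows "pd i (pd j f) = pd j (pd i f)"
proof
  fix x
  have c: "conv (moll n) (pd i (pd j f)) = conv (moll n) (pd j (pd i f))" for n
  proof -
    \<comment> \<open>Both partials move onto the mollifier, in reversed order, where symmetry is
      already known.\<close>
    have *: "conv (moll n) (pd a (pd b f)) = conv (pd b (pd a (moll n))) f" for a b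
      using conv_weak[OF rweak_smooth[OF smooth_pd[OF f]] moll_test]
        conv_weak[OF rweak_smooth[OF f] test_pd[OF moll_test]] by metis
    show ?thesis by (simp add: * moll_pd_commute[of j i])
  qed
  have lim: "(\<lambda>n. conv (moll n) g x) \<longlonglongrightarrow> g x" if g: "continuous_on UNIV g" for g
  proof (rule LIMSEQ_I)
    fix r :: real assume "r > 0"
    then have "r / 2 > 0" by simp
    moreover have "isCont g x" using g by (simp add: continuous_on_eq_continuous_at)
    ultimately obtain d where d: "d > 0" "\<And>y. dist y x < d \<Longrightarrow> dist (g y) (g x) < r / 2"
      unfolding continuous_at_eps_delta by metis
    obtain N where N: "1 / real (Suc N) < d" using d(1) nat_approx_posE by blast
    have "norm (conv (moll n) g x - g x) < r" if "n \<ge> N" for n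
    proof -
      have "\<bar>conv (moll n) g x - g x\<bar> \<le> r / 2"
      proof (rule moll_conv_approx[OF continuous_rL1loc[OF g]])
        fix y assume "norm (x - y) \<le> 1 / real (Suc n)"
        also have "\<dots> \<le> 1 / real (Suc N)" using that by (simp add: frac_le)
        finally show "\<bar>g y - g x\<bar> \<le> r / 2"
          using d(2)[of y] N by (simp add: dist_norm norm_minus_commute less_imp_le)
      qed
      then show ?thesis using \<open>r > 0\<close> by simp
    qed
    then show "\<exists>no. \<forall>n\<ge>no. norm (conv (moll n) g x - g x) < r" by blast
  qed
  have "(\<lambda>n. conv (moll n) (pd i (pd j f)) x) \<longlonglongrightarrow> pd i (pd j f) x"
    "(\<lambda>n. conv (moll n) (pd j (pd i f)) x) \<longlonglongrightarrow> pd j (pd i f) x"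
    by (auto intro!: lim smooth_continuous smooth_pd f)
  then show "pd i (pd j f) x = pd j (pd i f) x"
    unfolding c by (rule LIMSEQ_unique)
qed

text \<open>Two integrations by parts turn the integral of the squared mixed partial into that of
  the product of the two pure second partials. The squared Laplacian therefore integrates to the sum
  of the integrals of all four squared second partials.\<close>

lemma hessian_le_laplace:
  assumes t: "\<eta> \<in> test_functions"
  shows "(\<integral>x. (pd i (pd j \<eta>) x)\<^sup>2 \<partial>lborel) \<le> (\<integral>x. (laplace \<eta> x)\<^sup>2 \<partial>lborel)"
proof -
  have s: "smooth \<eta>" using t by (rule test_smooth)
  define I where "I i j = (\<integral>x. (pd i (pd j \<eta>) x)\<^sup>2 \<partial>lborel)" for i j
  have int: "integrable lborel (\<lambda>x. f x * g x)" if "f \<in> test_functions" "g \<in> test_functions" for f g :: "plane \<Rightarrow> real"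
    using that by (intro test_integrable(1) test_mult test_smooth)
  have tt: "pd a (pd b \<eta>) \<in> test_functions" for a b by (intro test_pd t)
  have "I 1 2 = (\<integral>x. pd 1 (pd 2 \<eta>) x * pd 1 (pd 2 \<eta>) x \<partial>lborel)"
    by (simp add: I_def power2_eq_square)
  also have "\<dots> = - (\<integral>x. pd 2 \<eta> x * pd 1 (pd 1 (pd 2 \<eta>)) x \<partial>lborel)"
    by (intro integral_by_parts smooth_pd s test_pd t)
  also have "pd 1 (pd 1 (pd 2 \<eta>)) = pd 2 (pd 1 (pd 1 \<eta>))"
    by (metis pd_commute s smooth_pd)
  also have "- (\<integral>x. pd 2 \<eta> x * pd 2 (pd 1 (pd 1 \<eta>)) x \<partial>lborel) = (\<integral>x. pd 2 (pd 2 \<eta>) x * pd 1 (pd 1 \<eta>) x \<partial>lborel)"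
    by (simp add: integral_by_parts smooth_pd s test_pd t)
  finally have I12: "I 1 2 = (\<integral>x. pd 2 (pd 2 \<eta>) x * pd 1 (pd 1 \<eta>) x \<partial>lborel)" .
  have I21: "I 2 1 = I 1 2" unfolding I_def by (subst pd_commute[OF s]) (rule refl)
  have nn: "I a b \<ge> 0" for a b by (simp add: I_def)
  have "(\<integral>x. (laplace \<eta> x)\<^sup>2 \<partial>lborel) = (\<integral>x. pd 1 (pd 1 \<eta>) x * pd 1 (pd 1 \<eta>) x
      + (pd 2 (pd 2 \<eta>) x * pd 2 (pd 2 \<eta>) x + 2 * (pd 2 (pd 2 \<eta>) x * pd 1 (pd 1 \<eta>) x)) \<partial>lborel)"
    by (rule Bochner_Integration.integral_cong) (auto simp: laplace_def sum_2 power2_eq_square algebra_simps)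
  also have "\<dots> = I 1 1 + (I 2 2 + 2 * I 1 2)"
    unfolding I12 using int[OF tt[of 1 1] tt[of 1 1]] int[OF tt[of 2 2] tt[of 2 2]] int[OF tt[of 2 2] tt[of 1 1]]
    by (simp add: I_def power2_eq_square)
  finally have L: "(\<integral>x. (laplace \<eta> x)\<^sup>2 \<partial>lborel) = I 1 1 + (I 2 2 + 2 * I 1 2)" .
  have "I i j \<le> I 1 1 + (I 2 2 + 2 * I 1 2)"
    using nn[of 1 1] nn[of 2 2] nn[of 1 2] I21 exhaust_2[of i] exhaust_2[of j] by auto
  then show ?thesis unfolding L by (simp add: I_def)
qed

section \<open>Square integrable functions\<close>

definition rL2 :: "(plane \<Rightarrow> real) \<Rightarrow> bool" where
  "rL2 f \<longleftrightarrow> f \<in> borel_measurable lebesgue \<and> integrable lebesgue (\<lambda>x. (f x)\<^sup>2)"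

text \<open>The squared norm, so that few square roots enter; the triangle inequality becomes
  \<open>sq_add_le2\<close>, the source of the factors 2 and 4 below. The Bochner integral of a
  non-integrable function is 0 by default, so bounds on \<open>sq\<close> are paired with
  \<open>rL2\<close> facts.\<close>

definition sq :: "(plane \<Rightarrow> real) \<Rightarrow> real" where
  "sq f = (LINT x|lebesgue. (f x)\<^sup>2)"

lemma rL2D: "rL2 f \<Longrightarrow> f \<in> borel_measurable lebesgue" "rL2 f \<Longrightarrow> integrable lebesgue (\<lambda>x. (f x)\<^sup>2)"
  by (auto simp: rL2_def)

lemma rL2_bound:
  assumes "integrable lebesgue g" "f \<in> borel_measurable lebesgue" "AE x in lebesgue. (f x)\<^sup>2 \<le> g x"
  shows "rL2 f" "sq f \<le> integral\<^sup>L lebesgue g"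
proof -
  have [measurable]: "f \<in> borel_measurable lebesgue" by fact
  note ib = integral_bound[OF assms(1), of "\<lambda>x. (f x)\<^sup>2"]
  show "rL2 f" unfolding rL2_def using assms by (auto intro!: ib(1))
  have "norm (sq f) \<le> integral\<^sup>L lebesgue g"
    unfolding sq_def using assms(3) by (intro ib(2)) auto
  then show "sq f \<le> integral\<^sup>L lebesgue g" by simp
qed

lemma sq_nonneg: "sq f \<ge> 0" by (simp add: sq_def)

lemma rL2_cmult: "rL2 f \<Longrightarrow> rL2 (\<lambda>x. c * f x)"
  by (auto simp: rL2_def power_mult_distrib)

lemma sq_cmult: "sq (\<lambda>x. c * f x) = c\<^sup>2 * sq f"
  by (simp add: sq_def power_mult_distrib)

lemma sq_add_le2: "(a + b)\<^sup>2 \<le> 2 * a\<^sup>2 + 2 * (b::real)\<^sup>2"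
  using zero_le_power2[of "a - b"] by (simp add: power2_eq_square algebra_simps)

lemma rL2_add:
  assumes "rL2 f" "rL2 g"
  shows "rL2 (\<lambda>x. f x + g x)" "sq (\<lambda>x. f x + g x) \<le> 2 * sq f + 2 * sq g"
proof -
  have i: "integrable lebesgue (\<lambda>x. 2 * (f x)\<^sup>2 + 2 * (g x)\<^sup>2)"
    using assms by (auto simp: rL2_def)
  have m: "(\<lambda>x. f x + g x) \<in> borel_measurable lebesgue" using assms by (auto simp: rL2_def)
  have b: "AE x in lebesgue. (f x + g x)\<^sup>2 \<le> 2 * (f x)\<^sup>2 + 2 * (g x)\<^sup>2" by (simp add: sq_add_le2)
  show "rL2 (\<lambda>x. f x + g x)" by (rule rL2_bound(1)[OF i m b])
  have "sq (\<lambda>x. f x + g x) \<le> (LINT x|lebesgue. 2 * (f x)\<^sup>2 + 2 * (g x)\<^sup>2)" by (rule rL2_bound(2)[OF i m b])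
  then show "sq (\<lambda>x. f x + g x) \<le> 2 * sq f + 2 * sq g"
    using assms by (simp add: rL2_def sq_def)
qed

lemma rL2_diff:
  assumes "rL2 f" "rL2 g"
  shows "rL2 (\<lambda>x. f x - g x)" "sq (\<lambda>x. f x - g x) \<le> 2 * sq f + 2 * sq g"
  using rL2_add[OF assms(1) rL2_cmult[OF assms(2), of "-1"]] sq_cmult[of "-1" g] by auto

lemma rL2_mult_integrable:
  assumes "rL2 f" "rL2 g" shows "integrable lebesgue (\<lambda>x. f x * g x)"
proof (rule integral_bound(1))
  show "integrable lebesgue (\<lambda>x. (f x)\<^sup>2 + (g x)\<^sup>2)" using assms by (auto simp: rL2_def)
  show "(\<lambda>x. f x * g x) \<in> borel_measurable lebesgue" using assms by (auto simp: rL2_def)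
  have "\<bar>a * b\<bar> \<le> a\<^sup>2 + b\<^sup>2" for a b :: real
  proof -
    have "2 * (\<bar>a\<bar> * \<bar>b\<bar>) \<le> a\<^sup>2 + b\<^sup>2" using sum_squares_bound[of "\<bar>a\<bar>" "\<bar>b\<bar>"] by simp
    moreover have "0 \<le> \<bar>a\<bar> * \<bar>b\<bar>" by simp
    ultimately show ?thesis unfolding abs_mult by linarith
  qed
  then show "AE x in lebesgue. norm (f x * g x) \<le> (f x)\<^sup>2 + (g x)\<^sup>2" by simp
qed

lemma Cauchy_Schwarz_integral:
  assumes "rL2 f" "rL2 g"
  shows "(LINT x|lebesgue. f x * g x)\<^sup>2 \<le> sq f * sq g"
proof -
  define A B C where "A = sq f" and "B = (LINT x|lebesgue. f x * g x)" and "C = sq g"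
  have q: "0 \<le> A - 2 * t * B + t\<^sup>2 * C" for t
  proof -
    have "0 \<le> (LINT x|lebesgue. (f x - t * g x)\<^sup>2)" by simp
    also have "\<dots> = (LINT x|lebesgue. (f x)\<^sup>2 - 2 * t * (f x * g x) + t\<^sup>2 * (g x)\<^sup>2)"
      by (rule Bochner_Integration.integral_cong) (auto simp: power2_eq_square algebra_simps)
    also have "\<dots> = A - 2 * t * B + t\<^sup>2 * C"
      using assms rL2_mult_integrable[OF assms] by (simp add: A_def B_def C_def sq_def rL2_def)
    finally show ?thesis .
  qed
  have C0: "C \<ge> 0" by (simp add: C_def sq_nonneg)
  show ?thesis
  proof (cases "C = 0")
    case True
    have "B = 0"
    proof (rule ccontr)
      assume "B \<noteq> 0"
      \<comment> \<open>For \<open>C = 0\<close> the quadratic is linear in \<open>t\<close>, and at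
        this value it equals \<open>-1\<close>.\<close>
      then show False using q[of "(A + 1) / (2 * B)"] True by simp
    qed
    then show ?thesis by (simp add: B_def C_def[symmetric] True)
  next
    case False
    with C0 have "C > 0" by simp
    \<comment> \<open>The minimiser of the quadratic in \<open>t\<close>.\<close>
    then show ?thesis using q[of "B / C"]
      by (simp add: A_def[symmetric] B_def[symmetric] C_def[symmetric] power2_eq_square field_simps)
  qed
qed

lemma rL2_rL1loc: assumes "rL2 f" shows "rL1loc f"
proof -
  have [measurable]: "f \<in> borel_measurable lebesgue" using assms by (rule rL2D)
  have "set_integrable lebesgue (cball 0 R) f" for R :: real
    unfolding set_integrable_def
  proof (rule integral_bound(1))
    have "integrable lborel (indicator (cball 0 R) :: plane \<Rightarrow> real)"
      using emeasure_bounded_finite[of "cball (0::plane) R"] by (intro integrable_real_indicator) auto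
    then have "integrable lebesgue (indicator (cball 0 R) :: plane \<Rightarrow> real)"
      by (subst integrable_completion) auto
    then show "integrable lebesgue (\<lambda>x. indicator (cball 0 R) x + (f x)\<^sup>2)"
      using rL2D(2)[OF assms] by (intro Bochner_Integration.integrable_add)
    have m: "(indicator (cball 0 R) :: plane \<Rightarrow> real) \<in> borel_measurable lebesgue"
      by (intro borel_imp_lebesgue borel_measurable_indicator) auto
    show "(\<lambda>x. indicator (cball 0 R) x *\<^sub>R f x) \<in> borel_measurable lebesgue"
      by (intro borel_measurable_scaleR m) simp
    have "\<bar>a\<bar> \<le> 1 + a\<^sup>2" for a :: real
      using sum_squares_bound[of "\<bar>a\<bar>" 1] zero_le_power2[of a] by simp
    then show "AE x in lebesgue. norm (indicator (cball 0 R) x *\<^sub>R f x) \<le> indicator (cball 0 R) x + (f x)\<^sup>2"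
      by (auto simp: indicator_def)
  qed
  then show ?thesis using assms by (auto simp: rL1loc_def rL2_def)
qed

lemma test_rL2: "\<eta> \<in> test_functions \<Longrightarrow> rL2 \<eta>"
  unfolding rL2_def using test_mult[OF test_smooth, of \<eta> \<eta>]
  by (auto simp: power2_eq_square intro!: borel_imp_lebesgue test_borel test_integrable)

lemma continuous_csupp_rL2:
  assumes "continuous_on UNIV g" "\<And>x. norm x > R \<Longrightarrow> g x = 0" shows "rL2 g"
  unfolding rL2_def
  by (intro conjI borel_imp_lebesgue borel_measurable_continuous_onI assms(1) continuous_csupp_integrable(2)[of _ R])
    (auto intro!: continuous_intros assms simp: assms(2))

lemma rL2_bounded_mult:
  assumes "rL2 f" "k \<in> borel_measurable lebesgue" "\<And>x. \<bar>k x\<bar> \<le> B"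
  shows "rL2 (\<lambda>x. k x * f x)" "sq (\<lambda>x. k x * f x) \<le> B\<^sup>2 * sq f"
proof -
  have i: "integrable lebesgue (\<lambda>x. B\<^sup>2 * (f x)\<^sup>2)" using assms by (auto simp: rL2_def)
  have m: "(\<lambda>x. k x * f x) \<in> borel_measurable lebesgue" using assms by (auto simp: rL2_def)
  have "(k x)\<^sup>2 \<le> B\<^sup>2" for x using power_mono[OF assms(3)[of x], of 2] by simp
  then have b: "AE x in lebesgue. (k x * f x)\<^sup>2 \<le> B\<^sup>2 * (f x)\<^sup>2"
    by (auto simp: power_mult_distrib intro!: mult_right_mono)
  show "rL2 (\<lambda>x. k x * f x)" by (rule rL2_bound(1)[OF i m b])
  show "sq (\<lambda>x. k x * f x) \<le> B\<^sup>2 * sq f" using rL2_bound(2)[OF i m b] by (simp add: sq_def)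
qed

section \<open>Fubini for Lebesgue measure, and mollification in L2\<close>

lemma sigma_finite_lebesgue: "sigma_finite_measure (lebesgue :: 'a::euclidean_space measure)"
proof
  obtain A :: "'a set set" where A: "countable A" "A \<subseteq> sets lborel" "\<Union>A = space lborel"
    "\<forall>a\<in>A. emeasure lborel a \<noteq> \<infinity>"
    using sigma_finite_measure.sigma_finite_countable[OF sigma_finite_lborel] by blast
  then show "\<exists>A. countable A \<and> A \<subseteq> sets (lebesgue :: 'a measure) \<and> \<Union>A = space lebesgue \<and> (\<forall>a\<in>A. emeasure lebesgue a \<noteq> \<infinity>)"
    by (intro exI[of _ A]) (auto simp: subset_eq)
qed

interpretation LL: pair_sigma_finite "lebesgue :: plane measure" "lebesgue :: plane measure"
  by (simp add: pair_sigma_finite_def sigma_finite_lebesgue)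

text \<open>The coordinates are first read as maps into the Borel sigma-algebra, where subtraction
  is measurable; this is why \<open>k\<close> is taken Borel rather than Lebesgue
  measurable.\<close>

lemma measurable_diff_pair:
  assumes "k \<in> borel_measurable borel"
  shows "(\<lambda>z. k (fst z - snd z)) \<in> borel_measurable (lebesgue \<Otimes>\<^sub>M (lebesgue :: plane measure))"
proof -
  have id: "(\<lambda>x::plane. x) \<in> measurable lebesgue borel" by (rule measurable_completion) simp
  have "fst \<in> measurable (lebesgue \<Otimes>\<^sub>M (lebesgue :: plane measure)) (borel :: plane measure)"
    "snd \<in> measurable (lebesgue \<Otimes>\<^sub>M (lebesgue :: plane measure)) (borel :: plane measure)"
    using measurable_compose[OF measurable_fst id] measurable_compose[OF measurable_snd id] by auto
  then have "(\<lambda>z. fst z - snd z) \<in> measurable (lebesgue \<Otimes>\<^sub>M (lebesgue :: plane measure)) (borel :: plane measure)"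
    by (rule borel_measurable_diff)
  from measurable_compose[OF this assms] show ?thesis .
qed

text \<open>Jensen's inequality bounds the square of an average by the average of the squares. After
  integration and exchange of order, the weight \<open>moll n (x - y)\<close> has integral 1 in
  \<open>x\<close> as well.\<close>

lemma conv_moll_rL2:
  assumes f: "rL2 f"
  shows "rL2 (conv (moll n) f)" "sq (conv (moll n) f) \<le> sq f"
proof -
  define F where "F x = (LINT y|lebesgue. moll n (x - y) * (f y)\<^sup>2)" for x
  have fm [measurable]: "f \<in> borel_measurable lebesgue" using f by (rule rL2D)
  have mm [measurable]: "moll n \<in> borel_measurable borel" by (rule test_borel[OF moll_test])
  have f1: "rL1loc f" by (rule rL2_rL1loc[OF f])
  have f2: "rL1loc (\<lambda>x. (f x)\<^sup>2)"
    unfolding rL1loc_def set_integrable_def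
  proof (intro conjI allI)
    fix R :: real
    show "integrable lebesgue (\<lambda>x. indicator (cball 0 R) x *\<^sub>R (f x)\<^sup>2)"
      by (rule integrable_mult_indicator) (use f in \<open>auto simp: rL2_def\<close>)
  qed simp
  have i0: "integrable lebesgue (\<lambda>y. moll n (x - y))" for x by (intro test_integrable test_reflect moll_test)
  have i1: "integrable lebesgue (\<lambda>y. moll n (x - y) * f y)" for x
    by (intro test_mult_integrable test_reflect moll_test f1)
  have i2: "integrable lebesgue (\<lambda>y. moll n (x - y) * (f y)\<^sup>2)" for x
    by (intro test_mult_integrable test_reflect moll_test f2)
  have J: "(conv (moll n) f x)\<^sup>2 \<le> F x" for x
  proof -
    define m where "m = conv (moll n) f x"
    \<comment> \<open>Jensen as nonnegativity of a variance: \<open>m\<close> is the mean of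
      \<open>f\<close> for the weight \<open>moll n (x - y)\<close>.\<close>
    have "0 \<le> (LINT y|lebesgue. moll n (x - y) * (f y - m)\<^sup>2)"
      by (intro integral_nonneg_AE) (auto simp: moll_nonneg)
    also have "\<dots> = (LINT y|lebesgue. moll n (x - y) * (f y)\<^sup>2 - 2 * m * (moll n (x - y) * f y) + m\<^sup>2 * moll n (x - y))"
      by (rule Bochner_Integration.integral_cong) (auto simp: power2_eq_square algebra_simps)
    also have "\<dots> = F x - 2 * m * m + m\<^sup>2"
      using i0[of x] i1[of x] i2[of x] by (simp add: F_def m_def conv_def moll_shift_integral)
    finally show ?thesis by (simp add: m_def power2_eq_square)
  qed
  have "(\<integral>\<^sup>+x. ennreal (F x) \<partial>lebesgue) = (\<integral>\<^sup>+x. \<integral>\<^sup>+y. ennreal (moll n (x - y) * (f y)\<^sup>2) \<partial>lebesgue \<partial>lebesgue)"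
    unfolding F_def by (intro nn_integral_cong nn_integral_eq_integral[symmetric] i2) (auto simp: moll_nonneg)
  also have "\<dots> = (\<integral>\<^sup>+y. \<integral>\<^sup>+x. ennreal (moll n (x - y) * (f y)\<^sup>2) \<partial>lebesgue \<partial>lebesgue)"
  proof -
    note measurable_diff_pair[measurable]
    have "(\<lambda>z. ennreal (moll n (fst z - snd z) * (f (snd z))\<^sup>2)) \<in> borel_measurable (lebesgue \<Otimes>\<^sub>M (lebesgue :: plane measure))"
      by measurable
    then show ?thesis
      using LL.Fubini[of "\<lambda>(x, y). ennreal (moll n (x - y) * (f y)\<^sup>2)"] by (simp add: case_prod_beta')
  qed
  also have "\<dots> = (\<integral>\<^sup>+y. ennreal ((f y)\<^sup>2) \<partial>lebesgue)"
  proof (rule nn_integral_cong)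
    fix y
    have i: "integrable lebesgue (\<lambda>x. moll n (x - y))"
      using test_integrable(2)[OF test_affine[OF moll_test[of n], of 1 "-y"]] by simp
    have "(LINT x|lebesgue. moll n (x - y)) = 1"
      using lborel_translation[OF mm, of "-y"] moll_integral[of n]
      by (subst lborel_lebesgue_integral) auto
    then have "(LINT x|lebesgue. moll n (x - y) * (f y)\<^sup>2) = (f y)\<^sup>2" by simp
    moreover have "(\<integral>\<^sup>+x. ennreal (moll n (x - y) * (f y)\<^sup>2) \<partial>lebesgue) = ennreal (LINT x|lebesgue. moll n (x - y) * (f y)\<^sup>2)"
      by (rule nn_integral_eq_integral) (use i in \<open>auto simp: moll_nonneg\<close>)
    ultimately show "(\<integral>\<^sup>+x. ennreal (moll n (x - y) * (f y)\<^sup>2) \<partial>lebesgue) = ennreal ((f y)\<^sup>2)"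
      by (simp only:)
  qed
  also have "\<dots> = ennreal (sq f)"
    unfolding sq_def by (rule nn_integral_eq_integral) (use f in \<open>auto simp: rL2_def\<close>)
  finally have eq: "(\<integral>\<^sup>+x. ennreal (F x) \<partial>lebesgue) = ennreal (sq f)" .
  have cm [measurable]: "conv (moll n) f \<in> borel_measurable lebesgue"
    by (intro borel_imp_lebesgue borel_measurable_continuous_onI smooth_continuous conv_smooth moll_test f1)
  have le: "(\<integral>\<^sup>+x. ennreal ((conv (moll n) f x)\<^sup>2) \<partial>lebesgue) \<le> ennreal (sq f)"
    unfolding eq[symmetric] by (intro nn_integral_mono ennreal_leI J)
  have i: "integrable lebesgue (\<lambda>x. (conv (moll n) f x)\<^sup>2)"
    by (rule integrableI_bounded) (use le in \<open>auto intro: le_less_trans\<close>)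
  then show "rL2 (conv (moll n) f)" by (simp add: rL2_def)
  have "ennreal (sq (conv (moll n) f)) \<le> ennreal (sq f)"
    using le nn_integral_eq_integral[OF i] by (simp add: sq_def)
  then show "sq (conv (moll n) f) \<le> sq f" by (simp add: sq_nonneg)
qed

lemma sq_tendsto_dominated:
  assumes "integrable lebesgue w" "\<And>n. F n \<in> borel_measurable lebesgue"
    "AE x in lebesgue. (\<lambda>n. F n x) \<longlonglongrightarrow> 0" "\<And>n. AE x in lebesgue. (F n x)\<^sup>2 \<le> w x"
  shows "(\<lambda>n. sq (F n)) \<longlonglongrightarrow> 0"
proof -
  have [measurable]: "F n \<in> borel_measurable lebesgue" for n by fact
  have "(\<lambda>n. LINT x|lebesgue. (F n x)\<^sup>2) \<longlonglongrightarrow> (LINT x::plane|lebesgue. (0::real))"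
  proof (rule integral_dominated_convergence[OF _ _ assms(1)])
    show "AE x in lebesgue. (\<lambda>n. (F n x)\<^sup>2) \<longlonglongrightarrow> 0"
      using assms(3) by eventually_elim (auto intro!: tendsto_eq_intros)
    show "AE x in lebesgue. norm ((F n x)\<^sup>2) \<le> w x" for n using assms(4)[of n] by simp
  qed auto
  then show ?thesis by (simp add: sq_def)
qed

text \<open>First \<open>f\<close> is truncated in value and in space by \<open>clip k\<close> and
  \<open>c k\<close>; then, inside the clip, it is replaced by continuous functions converging a.e.,
  for which the truncation provides the majorant. Each error is below \<open>e / 4\<close>, and
  \<open>rL2_add\<close> doubles both.\<close>

lemma rL2_dense:
  assumes f: "rL2 f" and e: "e > 0"
  obtains g R where "continuous_on UNIV g" "\<And>x. norm x > R \<Longrightarrow> g x = 0" "sq (\<lambda>x. f x - g x) < e"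
proof -
  have fm [measurable]: "f \<in> borel_measurable lebesgue" using f by (rule rL2D)
  obtain h where h: "\<And>n. continuous_on UNIV (h n)" "AE x in lebesgue. (\<lambda>n. h n x) \<longlonglongrightarrow> f x"
    using measurable_limit_continuous[OF fm] by blast
  define clip where "clip k t = max (- real k) (min (real k) t)" for k and t :: real
  define c where "c k = chiR (real (Suc k))" for k
  have ct: "c k \<in> test_functions" for k unfolding c_def by (rule chiR_test) simp
  have [measurable]: "c k \<in> borel_measurable lebesgue" for k by (intro borel_imp_lebesgue test_borel ct)
  have clipc: "continuous_on UNIV (clip k)" for k unfolding clip_def by (intro continuous_intros)
  have [measurable]: "clip k \<in> borel_measurable borel" for k by (intro borel_measurable_continuous_onI clipc)
  have "(\<lambda>k. sq (\<lambda>x. f x - c k x * clip k (f x))) \<longlonglongrightarrow> 0"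
  proof (rule sq_tendsto_dominated[OF rL2D(2)[OF f]])
    show "AE x in lebesgue. (\<lambda>k. f x - c k x * clip k (f x)) \<longlonglongrightarrow> 0"
    proof (rule AE_I2)
      fix x
      obtain N :: nat where N: "\<bar>f x\<bar> \<le> real N" using real_arch_simple by blast
      have "(\<lambda>k. f x - c k x * f x) \<longlonglongrightarrow> f x - 1 * f x"
        unfolding c_def by (intro tendsto_intros chiR_tendsto)
      moreover have "eventually (\<lambda>k. f x - c k x * f x = f x - c k x * clip k (f x)) sequentially"
        by (rule eventually_sequentiallyI[of N]) (use N in \<open>auto simp: clip_def\<close>)
      ultimately show "(\<lambda>k. f x - c k x * clip k (f x)) \<longlonglongrightarrow> 0"
        by (simp add: Lim_transform_eventually)
    qed
    show "AE x in lebesgue. (f x - c k x * clip k (f x))\<^sup>2 \<le> (f x)\<^sup>2" for k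
    proof (rule AE_I2)
      fix x
      have c01: "0 \<le> c k x" "c k x \<le> 1" by (auto simp: c_def chiR_bounds)
      have "\<bar>f x - c k x * clip k (f x)\<bar> \<le> \<bar>f x\<bar>"
      proof (cases "f x \<ge> 0")
        case True
        then have "0 \<le> clip k (f x)" "clip k (f x) \<le> f x" by (auto simp: clip_def)
        then have "0 \<le> c k x * clip k (f x)" "c k x * clip k (f x) \<le> f x"
          using c01 mult_left_le_one_le[of "clip k (f x)" "c k x"] by auto
        then show ?thesis using True by simp
      next
        case False
        then have n: "0 \<le> - clip k (f x)" "- clip k (f x) \<le> - f x" by (auto simp: clip_def)
        have "0 \<le> c k x * (- clip k (f x))" using c01 n by (intro mult_nonneg_nonneg)
        moreover have "c k x * (- clip k (f x)) \<le> - f x"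
          using c01 n mult_left_le_one_le[of "- clip k (f x)" "c k x"] by linarith
        ultimately show ?thesis using False by simp
      qed
      then show "(f x - c k x * clip k (f x))\<^sup>2 \<le> (f x)\<^sup>2" by (simp add: abs_le_square_iff)
    qed
  qed measurable
  then have "eventually (\<lambda>k. sq (\<lambda>x. f x - c k x * clip k (f x)) < e / 4) sequentially"
    by (rule order_tendstoD) (use e in auto)
  then obtain k where k: "sq (\<lambda>x. f x - c k x * clip k (f x)) < e / 4"
    by (auto simp: eventually_sequentially)
  have hm [measurable]: "h n \<in> borel_measurable lebesgue" for n
    by (intro borel_imp_lebesgue borel_measurable_continuous_onI h)
  have "(\<lambda>n. sq (\<lambda>x. c k x * clip k (f x) - c k x * clip k (h n x))) \<longlonglongrightarrow> 0"
  proof (rule sq_tendsto_dominated)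
    show "integrable lebesgue (\<lambda>x. (2 * real k)\<^sup>2 * (c k x)\<^sup>2)"
      using rL2D(2)[OF test_rL2[OF ct[of k]]] by simp
    show "AE x in lebesgue. (\<lambda>n. c k x * clip k (f x) - c k x * clip k (h n x)) \<longlonglongrightarrow> 0"
      using h(2)
    proof eventually_elim
      case (elim x)
      have "(\<lambda>n. clip k (h n x)) \<longlonglongrightarrow> clip k (f x)"
        unfolding clip_def by (intro tendsto_intros elim)
      then have "(\<lambda>n. c k x * clip k (f x) - c k x * clip k (h n x)) \<longlonglongrightarrow> c k x * clip k (f x) - c k x * clip k (f x)"
        by (intro tendsto_intros)
      then show ?case by simp
    qed
    show "AE x in lebesgue. (c k x * clip k (f x) - c k x * clip k (h n x))\<^sup>2 \<le> (2 * real k)\<^sup>2 * (c k x)\<^sup>2" for n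
    proof (rule AE_I2)
      fix x
      have "\<bar>clip k (f x) - clip k (h n x)\<bar> \<le> 2 * real k" by (auto simp: clip_def)
      then have "(clip k (f x) - clip k (h n x))\<^sup>2 \<le> (2 * real k)\<^sup>2"
        using power_mono[of "\<bar>clip k (f x) - clip k (h n x)\<bar>" "2 * real k" 2] by simp
      then have "(clip k (f x) - clip k (h n x))\<^sup>2 * (c k x)\<^sup>2 \<le> (2 * real k)\<^sup>2 * (c k x)\<^sup>2"
        by (intro mult_right_mono) auto
      then show "(c k x * clip k (f x) - c k x * clip k (h n x))\<^sup>2 \<le> (2 * real k)\<^sup>2 * (c k x)\<^sup>2"
        by (simp add: right_diff_distrib[symmetric] power_mult_distrib mult.commute)
    qed
  qed measurable
  then have "eventually (\<lambda>n. sq (\<lambda>x. c k x * clip k (f x) - c k x * clip k (h n x)) < e / 4) sequentially"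
    by (rule order_tendstoD) (use e in auto)
  then obtain n where n: "sq (\<lambda>x. c k x * clip k (f x) - c k x * clip k (h n x)) < e / 4"
    by (auto simp: eventually_sequentially)
  have cb: "rL2 (\<lambda>x. v x * c k x)" if "v \<in> borel_measurable lebesgue" "\<And>x. \<bar>v x\<bar> \<le> real k" for v
    by (rule rL2_bounded_mult(1)[OF test_rL2[OF ct] that])
  have r1: "rL2 (\<lambda>x. c k x * clip k (f x))" and r2: "rL2 (\<lambda>x. c k x * clip k (h n x))"
    using cb[of "\<lambda>x. clip k (f x)"] cb[of "\<lambda>x. clip k (h n x)"] by (auto simp: mult.commute clip_def)
  show ?thesis
  proof (rule that)
    show "continuous_on UNIV (\<lambda>x. c k x * clip k (h n x))"
      unfolding clip_def by (intro continuous_intros h test_continuous ct)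
    show "c k x * clip k (h n x) = 0" if "norm x > 3 * real (Suc k)" for x
      using chiR_outside[OF _ that] by (simp add: c_def)
    have "sq (\<lambda>x. (f x - c k x * clip k (f x)) + (c k x * clip k (f x) - c k x * clip k (h n x)))
      \<le> 2 * sq (\<lambda>x. f x - c k x * clip k (f x)) + 2 * sq (\<lambda>x. c k x * clip k (f x) - c k x * clip k (h n x))"
      by (intro rL2_add(2) rL2_diff f r1 r2)
    then show "sq (\<lambda>x. f x - c k x * clip k (h n x)) < e" using k n by simp
  qed
qed

lemma conv_moll_diff:
  assumes "rL1loc f" "rL1loc g" "k \<in> test_functions"
  shows "conv k (\<lambda>x. f x - g x) x = conv k f x - conv k g x"
  using test_mult_integrable[OF test_reflect[OF assms(3)] assms(1), of x]
    test_mult_integrable[OF test_reflect[OF assms(3)] assms(2), of x]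
  by (simp add: conv_def right_diff_distrib)

lemma ind_rL2: "rL2 (indicator (cball 0 R))"
proof -
  have "integrable lborel (indicator (cball 0 R) :: plane \<Rightarrow> real)"
    using emeasure_bounded_finite[of "cball (0::plane) R"] by (intro integrable_real_indicator) auto
  then have "integrable lebesgue (indicator (cball 0 R) :: plane \<Rightarrow> real)"
    by (subst integrable_completion) auto
  moreover have "(\<lambda>x. (indicator (cball 0 R) x)\<^sup>2) = (indicator (cball 0 R) :: plane \<Rightarrow> real)"
    by (auto simp: indicator_def)
  moreover have "(indicator (cball 0 R) :: plane \<Rightarrow> real) \<in> borel_measurable lebesgue"
    by (intro borel_imp_lebesgue borel_measurable_indicator) simp
  ultimately show ?thesis by (simp only: rL2_def)
qed

lemma conv_moll_L2:
  assumes f: "rL2 f"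
  shows "(\<lambda>n. sq (\<lambda>x. conv (moll n) f x - f x)) \<longlonglongrightarrow> 0"
proof (rule LIMSEQ_I)
  fix r :: real assume r: "r > 0"
  \<comment> \<open>The three errors below enter with weights 2, 4 and 4, which makes
    \<open>10 * r / 16 < r\<close> in total.\<close>
  obtain g R where g: "continuous_on UNIV g" "\<And>x. norm x > R \<Longrightarrow> g x = 0"
    and gf: "sq (\<lambda>x. f x - g x) < r / 16"
    using rL2_dense[OF f, of "r / 16"] r by auto
  have g2: "rL2 g" by (rule continuous_csupp_rL2[OF g])
  define A where "A = sq (indicator (cball 0 (R+1)))"
  have A: "A \<ge> 0" by (simp add: A_def sq_nonneg)
  \<comment> \<open>\<open>A\<close> is the area of the enlarged support. A uniform error
    \<open>e\<close> contributes at most \<open>e^2 * A\<close> to the squared norm; the summand 1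
    guards the division.\<close>
  define e where "e = sqrt (r / (16 * (A + 1)))"
  have e: "e > 0" "e\<^sup>2 * A \<le> r / 16"
  proof -
    show "e > 0" using r A by (simp add: e_def)
    have "e\<^sup>2 * A = r / 16 * (A / (A + 1))" using r A by (simp add: e_def)
    also have "\<dots> \<le> r / 16 * 1" using r A by (intro mult_left_mono) auto
    finally show "e\<^sup>2 * A \<le> r / 16" by simp
  qed
  obtain N where N: "\<And>n x. n \<ge> N \<Longrightarrow> \<bar>conv (moll n) g x - g x\<bar> \<le> e"
    using moll_uniform[OF g e(1)] by blast
  have "norm (sq (\<lambda>x. conv (moll n) f x - f x) - 0) < r" if n: "n \<ge> N" for n
  proof -
    have l: "rL1loc f" "rL1loc g" by (auto intro: rL2_rL1loc f g2)
    have fg: "rL2 (\<lambda>x. f x - g x)" by (intro rL2_diff f g2)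
    define a where "a = conv (moll n) (\<lambda>x. f x - g x)"
    define b where "b x = conv (moll n) g x - g x" for x
    have a: "rL2 a" "sq a < r / 16" unfolding a_def using conv_moll_rL2[OF fg, of n] gf by auto
    have b1: "rL2 b" unfolding b_def by (intro rL2_diff conv_moll_rL2 g2)
    have b2: "sq b \<le> r / 16"
    proof -
      have out: "b x = 0" if "x \<notin> cball 0 (R+1)" for x
      proof -
        from that have x: "norm x > R + 1" by (simp add: dist_norm)
        have "conv (moll n) g x = 0"
        proof (rule conv_outside[of 1 _ R])
          show "moll n x = 0" if "norm x > 1" for x
            using that by (intro moll_outside le_less_trans[OF _ that]) auto
        qed (use g(2) x in auto)
        then show ?thesis using g(2)[of x] x by (simp add: b_def)
      qed
      have "\<bar>b x\<bar> \<le> e * indicator (cball 0 (R+1)) x" for x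
        using N[OF n, of x] out[of x] e(1) by (cases "x \<in> cball 0 (R+1)") (auto simp: b_def)
      then have "(b x)\<^sup>2 \<le> (e * indicator (cball 0 (R+1)) x)\<^sup>2" for x
        using power_mono[of "\<bar>b x\<bar>" _ 2] by fastforce
      then have "AE x in lebesgue. (b x)\<^sup>2 \<le> (e * indicator (cball 0 (R+1)) x)\<^sup>2" by (intro AE_I2)
      then have "sq b \<le> (LINT x::plane|lebesgue. (e * indicator (cball 0 (R+1)) x)\<^sup>2)"
        by (rule rL2_bound(2)[OF rL2D(2)[OF rL2_cmult[OF ind_rL2]] rL2D(1)[OF b1]])
      also have "\<dots> = e\<^sup>2 * A" unfolding A_def sq_cmult[symmetric] by (simp add: sq_def)
      finally show ?thesis using e(2) by simp
    qed
    have "sq (\<lambda>x. conv (moll n) f x - f x) = sq (\<lambda>x. a x + (b x - (f x - g x)))"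
      by (simp add: a_def b_def conv_moll_diff[OF l moll_test])
    moreover have "\<dots> \<le> 2 * sq a + 2 * sq (\<lambda>x. b x - (f x - g x))"
      by (intro rL2_add(2) a rL2_diff b1 fg)
    moreover have "sq (\<lambda>x. b x - (f x - g x)) \<le> 2 * sq b + 2 * sq (\<lambda>x. f x - g x)"
      by (intro rL2_diff(2) b1 fg)
    ultimately have "sq (\<lambda>x. conv (moll n) f x - f x) < r" using a b2 gf r by linarith
    then show ?thesis by (simp add: sq_nonneg)
  qed
  then show "\<exists>no. \<forall>n\<ge>no. norm (sq (\<lambda>x. conv (moll n) f x - f x) - 0) < r" by blast
qed

text \<open>Fatou's lemma; it lets bounds found for smooth approximations pass to a.e.
  limits.\<close>

lemma rL2_fatou:
  assumes "\<And>k. rL2 (G k)" "\<And>k. sq (G k) \<le> C" "g \<in> borel_measurable lebesgue"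
    "AE x in lebesgue. (\<lambda>k. G k x) \<longlonglongrightarrow> g x"
  shows "rL2 g" "sq g \<le> C"
proof -
  have [measurable]: "g \<in> borel_measurable lebesgue" "\<And>k. G k \<in> borel_measurable lebesgue"
    using assms by (auto intro: rL2D)
  have C: "C \<ge> 0" using assms(2)[of 0] sq_nonneg[of "G 0"] by linarith
  have "(\<integral>\<^sup>+x. ennreal ((g x)\<^sup>2) \<partial>lebesgue) = (\<integral>\<^sup>+x. liminf (\<lambda>k. ennreal ((G k x)\<^sup>2)) \<partial>lebesgue)"
  proof (rule nn_integral_cong_AE)
    show "AE x in lebesgue. ennreal ((g x)\<^sup>2) = liminf (\<lambda>k. ennreal ((G k x)\<^sup>2))"
      using assms(4)
    proof eventually_elim
      case (elim x)
      have "(\<lambda>k. ennreal ((G k x)\<^sup>2)) \<longlonglongrightarrow> ennreal ((g x)\<^sup>2)"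
        by (intro tendsto_ennrealI tendsto_intros elim)
      then show ?case by (rule lim_imp_Liminf[OF sequentially_bot, symmetric])
    qed
  qed
  also have "\<dots> \<le> liminf (\<lambda>k. \<integral>\<^sup>+x. ennreal ((G k x)\<^sup>2) \<partial>lebesgue)"
    by (rule nn_integral_liminf) measurable
  also have "\<dots> \<le> ennreal C"
  proof -
    have "(\<integral>\<^sup>+x. ennreal ((G k x)\<^sup>2) \<partial>lebesgue) \<le> ennreal C" for k
      using nn_integral_eq_integral[OF rL2D(2)[OF assms(1)[of k]]] assms(2)[of k]
      by (simp add: sq_def ennreal_leI)
    then show ?thesis by (intro Liminf_le) auto
  qed
  finally have le: "(\<integral>\<^sup>+x. ennreal ((g x)\<^sup>2) \<partial>lebesgue) \<le> ennreal C" .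
  have i: "integrable lebesgue (\<lambda>x. (g x)\<^sup>2)"
    by (rule integrableI_bounded) (use le in \<open>auto intro: le_less_trans\<close>)
  then show "rL2 g" by (simp add: rL2_def)
  have "ennreal (sq g) \<le> ennreal C"
    using le nn_integral_eq_integral[OF i] by (simp add: sq_def)
  then show "sq g \<le> C" using C by simp
qed

section \<open>Local square integrability and completeness\<close>

definition loc :: "real \<Rightarrow> (plane \<Rightarrow> real) \<Rightarrow> plane \<Rightarrow> real" where
  "loc R f x = indicator (cball 0 R) x * f x"

lemma loc_meas: "f \<in> borel_measurable lebesgue \<Longrightarrow> loc R f \<in> borel_measurable lebesgue"
  unfolding loc_def[abs_def] using rL2D(1)[OF ind_rL2] by (intro borel_measurable_times)

lemma loc_mono:
  assumes "rL2 (loc S f)" "R \<le> S" "f \<in> borel_measurable lebesgue"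
  shows "rL2 (loc R f)" "sq (loc R f) \<le> sq (loc S f)"
proof -
  have "AE x in lebesgue. (loc R f x)\<^sup>2 \<le> (loc S f x)\<^sup>2"
    using assms(2) by (auto simp: loc_def indicator_def)
  then show "rL2 (loc R f)" "sq (loc R f) \<le> sq (loc S f)"
    using rL2_bound[OF rL2D(2)[OF assms(1)] loc_meas[OF assms(3)]] by (auto simp: sq_def)
qed

lemma continuous_loc_rL2: assumes "continuous_on UNIV f" shows "rL2 (loc R f)"
proof -
  have "compact (f ` cball 0 R)" by (intro compact_continuous_image continuous_on_subset[OF assms]) auto
  then obtain B where B: "\<forall>y\<in>f ` cball 0 R. norm y \<le> B" using compact_imp_bounded bounded_iff by metis
  have b: "\<bar>f x\<bar> \<le> B" if "norm x \<le> R" for x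
  proof -
    have "f x \<in> f ` cball 0 R" using that by (simp add: dist_norm)
    with B have "norm (f x) \<le> B" by blast
    then show ?thesis by simp
  qed
  have "(loc R f x)\<^sup>2 \<le> (B * indicator (cball 0 R) x)\<^sup>2" for x
    using b[of x] power_mono[of "\<bar>f x\<bar>" B 2] by (auto simp: loc_def indicator_def dist_norm)
  then show ?thesis
    by (intro rL2_bound(1)[OF rL2D(2)[OF rL2_cmult[OF ind_rL2, of B R]]]
        loc_meas borel_imp_lebesgue borel_measurable_continuous_onI assms) auto
qed

text \<open>Along a subsequence the increments have \<open>sq\<close> at most \<open>(1/4)^k\<close>
  on the ball of radius \<open>k\<close>. Cauchy-Schwarz makes their integrals over any fixed ball
  summable, so the subsequence converges a.e.; Fatou's lemma then gives local L2 convergence of the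
  whole sequence.\<close>

lemma L2loc_complete:
  assumes F: "\<And>n. continuous_on UNIV (F n)"
    and Cauchy: "\<And>R e. e > 0 \<Longrightarrow> \<exists>N. \<forall>m\<ge>N. \<forall>n\<ge>N. sq (loc R (\<lambda>x. F m x - F n x)) \<le> e"
  obtains h where "h \<in> borel_measurable lebesgue" "\<And>R. rL2 (loc R h)"
    "\<And>R. (\<lambda>n. sq (loc R (\<lambda>x. F n x - h x))) \<longlonglongrightarrow> 0"
proof -
  have "\<forall>k::nat. \<exists>N. \<forall>m\<ge>N. \<forall>n\<ge>N. sq (loc (real k) (\<lambda>x. F m x - F n x)) \<le> (1/4) ^ k"
    by (intro allI Cauchy) simp
  then obtain N where N: "\<And>k m n. m \<ge> N k \<Longrightarrow> n \<ge> N k \<Longrightarrow> sq (loc (real k) (\<lambda>x. F m x - F n x)) \<le> (1/4) ^ k"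
    by metis
  \<comment> \<open>Adding up the thresholds makes \<open>r\<close> increasing and places
    \<open>r k\<close> above both \<open>N k\<close> and \<open>k\<close>.\<close>
  define r where "r k = k + (\<Sum>j\<le>k. N j)" for k
  have rN: "r k \<ge> N k" for k unfolding r_def by (simp add: member_le_sum trans_le_add2)
  have rS: "r (Suc k) \<ge> r k" for k by (simp add: r_def)
  have rk: "r k \<ge> k" for k by (simp add: r_def)
  have Fm [measurable]: "F n \<in> borel_measurable lebesgue" for n
    by (intro borel_imp_lebesgue borel_measurable_continuous_onI F)
  define d where "d k x = \<bar>F (r (Suc k)) x - F (r k) x\<bar>" for k x
  have dc: "continuous_on UNIV (d k)" for k unfolding d_def by (intro continuous_intros F)
  have dm: "d k \<in> borel_measurable lebesgue" for k by (intro borel_imp_lebesgue borel_measurable_continuous_onI dc)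
  have sd: "sq (loc (real K) (d k)) \<le> (1/4) ^ k" if "k \<ge> K" for k K
  proof -
    have "sq (loc (real K) (d k)) \<le> sq (loc (real k) (d k))"
      by (rule loc_mono(2)[OF continuous_loc_rL2[OF dc] _ dm]) (use that in simp)
    also have "\<dots> = sq (loc (real k) (\<lambda>x. F (r (Suc k)) x - F (r k) x))"
      by (simp add: sq_def loc_def d_def power_mult_distrib)
    also have "\<dots> \<le> (1/4) ^ k" using rN[of k] rS[of k] by (intro N) auto
    finally show ?thesis .
  qed
  have conv: "AE x in lebesgue. x \<in> cball 0 (real K) \<longrightarrow> convergent (\<lambda>k. F (r k) x)" for K
  proof -
    define A where "A = sq (indicator (cball 0 (real K)))"
    have A: "A \<ge> 0" by (simp add: A_def sq_nonneg)
    have [measurable]: "loc (real K) (d k) \<in> borel_measurable lebesgue" for k by (intro loc_meas dm)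
    have ii: "indicator (cball 0 (real K)) x * loc (real K) (d k) x = loc (real K) (d k) x" for k x
      by (auto simp: loc_def indicator_def)
    have int: "integrable lebesgue (loc (real K) (d k))" for k
      using rL2_mult_integrable[OF ind_rL2[of "real K"] continuous_loc_rL2[OF dc[of k], of "real K"]]
      by (simp add: ii)
    have nn: "loc (real K) (d k) x \<ge> 0" for k x by (simp add: loc_def d_def)
    have le: "(LINT x|lebesgue. loc (real K) (d k) x) \<le> (A + 1) * (1/2) ^ k" if "k \<ge> K" for k
    proof (rule power2_le_imp_le)
      have "(LINT x|lebesgue. loc (real K) (d k) x)\<^sup>2 \<le> A * sq (loc (real K) (d k))"
        using Cauchy_Schwarz_integral[OF ind_rL2[of "real K"] continuous_loc_rL2[OF dc[of k], of "real K"]]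
        by (simp add: ii A_def)
      also have "\<dots> \<le> (A + 1)\<^sup>2 * (1/4) ^ k"
      proof (intro mult_mono sd that)
        have "A * 1 \<le> (A + 1) * (A + 1)" using A by (intro mult_mono) auto
        then show "A \<le> (A + 1)\<^sup>2" by (simp add: power2_eq_square)
      qed (auto simp: sq_nonneg)
      also have "\<dots> = ((A + 1) * (1/2) ^ k)\<^sup>2"
        by (simp add: power_mult_distrib power2_eq_square[of "(1/2)^k"] power_mult_distrib[symmetric])
      finally show "(LINT x|lebesgue. loc (real K) (d k) x)\<^sup>2 \<le> ((A + 1) * (1/2) ^ k)\<^sup>2" .
      show "0 \<le> (A + 1) * (1/2) ^ k" using A by simp
    qed
    have "(\<integral>\<^sup>+x. (\<Sum>k. ennreal (loc (real K) (d (k + K)) x)) \<partial>lebesgue)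
        = (\<Sum>k. \<integral>\<^sup>+x. ennreal (loc (real K) (d (k + K)) x) \<partial>lebesgue)"
      by (rule nn_integral_suminf) measurable
    also have "\<dots> = (\<Sum>k. ennreal (LINT x|lebesgue. loc (real K) (d (k + K)) x))"
      by (intro suminf_cong nn_integral_eq_integral int) (auto simp: nn)
    also have "\<dots> \<le> (\<Sum>k. ennreal ((A + 1) * (1/2) ^ k))"
    proof (intro suminf_le ennreal_leI)
      fix k
      have "(LINT x|lebesgue. loc (real K) (d (k + K)) x) \<le> (A + 1) * (1/2) ^ (k + K)" by (rule le) simp
      also have "\<dots> \<le> (A + 1) * (1/2) ^ k" using A by (intro mult_left_mono power_decreasing) auto
      finally show "(LINT x|lebesgue. loc (real K) (d (k + K)) x) \<le> (A + 1) * (1/2) ^ k" .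
    qed auto
    also have "\<dots> = ennreal (\<Sum>k. (A + 1) * (1/2) ^ k)"
      using A by (intro suminf_ennreal2 summable_mult summable_geometric) auto
    finally have fin: "(\<integral>\<^sup>+x. (\<Sum>k. ennreal (loc (real K) (d (k + K)) x)) \<partial>lebesgue) \<noteq> \<infinity>"
      by (auto simp: top_unique)
    have "AE x in lebesgue. (\<Sum>k. ennreal (loc (real K) (d (k + K)) x)) \<noteq> \<infinity>"
      by (rule nn_integral_PInf_AE[OF _ fin]) measurable
    then show ?thesis
    proof eventually_elim
      case (elim x)
      show ?case
      proof
        assume x: "x \<in> cball 0 (real K)"
        have "summable (\<lambda>k. loc (real K) (d (k + K)) x)"
          using elim nn by (intro summable_suminf_not_top) auto
        then have "summable (\<lambda>k. \<bar>F (r (Suc (k + K))) x - F (r (k + K)) x\<bar>)"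
          using x by (simp add: loc_def d_def)
        then have "summable (\<lambda>k. F (r (Suc k + K)) x - F (r (k + K)) x)"
          by (simp add: summable_rabs_cancel)
        then have "convergent (\<lambda>n. \<Sum>k<n. F (r (Suc k + K)) x - F (r (k + K)) x)"
          by (simp add: summable_iff_convergent)
        then have "convergent (\<lambda>n. F (r (n + K)) x - F (r (0 + K)) x)"
          by (simp only: sum_lessThan_telescope[where f="\<lambda>k. F (r (k + K)) x"])
        then have "convergent (\<lambda>n. F (r (n + K)) x)"
          using convergent_add[OF _ convergent_const, of "\<lambda>n. F (r (n + K)) x - F (r (0 + K)) x" "F (r (0 + K)) x"] by simp
        then show "convergent (\<lambda>k. F (r k) x)"
          using convergent_ignore_initial_segment by blast
      qed
    qed
  qed
  have cAE: "AE x in lebesgue. convergent (\<lambda>k. F (r k) x)"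
  proof -
    have "AE x in lebesgue. \<forall>K. x \<in> cball 0 (real K) \<longrightarrow> convergent (\<lambda>k. F (r k) x)"
      using conv by (subst AE_all_countable) auto
    then show ?thesis
    proof eventually_elim
      case (elim x)
      obtain K :: nat where "norm x \<le> real K" using real_arch_simple by blast
      then show ?case using elim[rule_format, of K] by (simp add: dist_norm)
    qed
  qed
  \<comment> \<open>\<open>lim\<close> is unspecified where the subsequence diverges, which happens
    only on a null set.\<close>
  define h where "h x = lim (\<lambda>k. F (r k) x)" for x
  have hm [measurable]: "h \<in> borel_measurable lebesgue"
    unfolding h_def by (rule borel_measurable_lim_metric) measurable
  have hl: "AE x in lebesgue. (\<lambda>k. F (r k) x) \<longlonglongrightarrow> h x"
    using cAE by eventually_elim (simp add: h_def convergent_LIMSEQ_iff)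
  have est: "rL2 (loc R (\<lambda>x. F n x - h x)) \<and> sq (loc R (\<lambda>x. F n x - h x)) \<le> e"
    if M: "\<And>m n. m \<ge> M \<Longrightarrow> n \<ge> M \<Longrightarrow> sq (loc R (\<lambda>x. F m x - F n x)) \<le> e" and n: "n \<ge> M" for R e n M
  proof -
    have a: "rL2 (loc R (\<lambda>x. F n x - F (r (k + M)) x))" for k
      by (intro continuous_loc_rL2 continuous_intros F)
    have b: "sq (loc R (\<lambda>x. F n x - F (r (k + M)) x)) \<le> e" for k
      using rk[of "k + M"] n by (intro M) auto
    have c: "AE x in lebesgue. (\<lambda>k. loc R (\<lambda>x. F n x - F (r (k + M)) x) x) \<longlonglongrightarrow> loc R (\<lambda>x. F n x - h x) x"
      using hl
    proof eventually_elim
      case (elim x)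
      then have "(\<lambda>k. F (r (k + M)) x) \<longlonglongrightarrow> h x" by (rule LIMSEQ_ignore_initial_segment)
      then show ?case unfolding loc_def by (intro tendsto_intros)
    qed
    have m: "loc R (\<lambda>x. F n x - h x) \<in> borel_measurable lebesgue" by (intro loc_meas) measurable
    show ?thesis using rL2_fatou[OF a b m c] by blast
  qed
  show ?thesis
  proof (rule that[OF hm])
    fix R
    obtain M where M: "\<And>m n. m \<ge> M \<Longrightarrow> n \<ge> M \<Longrightarrow> sq (loc R (\<lambda>x. F m x - F n x)) \<le> 1"
      using Cauchy[of 1 R] by auto
    have "rL2 (loc R (\<lambda>x. F M x - h x))" using est[OF M, of M] by auto
    then have "rL2 (\<lambda>x. loc R (F M) x - loc R (\<lambda>x. F M x - h x) x)"
      by (rule rL2_diff(1)[OF continuous_loc_rL2[OF F]])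
    then show "rL2 (loc R h)" by (simp add: loc_def[abs_def] algebra_simps)
    show "(\<lambda>n. sq (loc R (\<lambda>x. F n x - h x))) \<longlonglongrightarrow> 0"
    proof (rule LIMSEQ_I)
      fix e :: real assume "e > 0"
      then obtain M where "\<And>m n. m \<ge> M \<Longrightarrow> n \<ge> M \<Longrightarrow> sq (loc R (\<lambda>x. F m x - F n x)) \<le> e / 2"
        using Cauchy[of "e / 2" R] by auto
      from est[OF this] have "\<forall>n\<ge>M. sq (loc R (\<lambda>x. F n x - h x)) \<le> e / 2" by blast
      then show "\<exists>no. \<forall>n\<ge>no. norm (sq (loc R (\<lambda>x. F n x - h x)) - 0) < e"
        using \<open>e > 0\<close> by (intro exI[of _ M]) (auto simp: sq_nonneg intro: le_less_trans)
    qed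
  qed
qed

section \<open>Sobolev embedding of the plane\<close>

definition vec2 :: "real \<Rightarrow> real \<Rightarrow> plane" where
  "vec2 a b = a *\<^sub>R axis 1 1 + b *\<^sub>R axis 2 1"

lemma vec2_nth [simp]: "vec2 a b $ 1 = a" "vec2 a b $ 2 = b"
  by (simp_all add: vec2_def axis_def)

lemma Basis_plane: "(Basis :: plane set) = {axis 1 1, axis 2 1}"
  by (auto simp: Basis_vec_def UNIV_2)

lemma axis_ne: "(axis 1 1 :: plane) \<noteq> axis 2 1"
  by (simp add: axis_eq_axis)

lemma vec2_borel [measurable]: "(\<lambda>z. vec2 (fst z) (snd z)) \<in> borel_measurable (lborel \<Otimes>\<^sub>M lborel)"
  unfolding vec2_def by measurable

text \<open>A Borel measure with the right values on boxes is Lebesgue measure. The product form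
  gives the iterated integrals behind \<open>gagliardo\<close> and the Gaussian
  computations.\<close>

lemma lborel_plane: "lborel = distr (lborel \<Otimes>\<^sub>M lborel) borel (\<lambda>z. vec2 (fst z) (snd z))"
proof (rule lborel_eqI)
  fix l u :: plane assume lu: "\<And>b. b \<in> Basis \<Longrightarrow> l \<bullet> b \<le> u \<bullet> b"
  then have le: "l $ 1 \<le> u $ 1" "l $ 2 \<le> u $ 2"
    using lu[of "axis 1 1"] lu[of "axis 2 1"] by (auto simp: Basis_plane inner_axis)
  have "(\<lambda>z. vec2 (fst z) (snd z)) -` box l u \<inter> space (lborel \<Otimes>\<^sub>M lborel)
      = {l $ 1 <..< u $ 1} \<times> {l $ 2 <..< u $ 2}"
    by (auto simp: mem_box Basis_plane inner_axis space_pair_measure)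
  then have "emeasure (distr (lborel \<Otimes>\<^sub>M lborel) borel (\<lambda>z. vec2 (fst z) (snd z))) (box l u)
      = emeasure (lborel \<Otimes>\<^sub>M lborel) ({l $ 1 <..< u $ 1} \<times> {l $ 2 <..< u $ 2})"
    by (subst emeasure_distr) auto
  also have "\<dots> = emeasure lborel {l $ 1 <..< u $ 1} * emeasure lborel {l $ 2 <..< u $ 2}"
    by (rule lborel.emeasure_pair_measure_Times) auto
  also have "\<dots> = ennreal ((u $ 1 - l $ 1) * (u $ 2 - l $ 2))"
    using le by (simp add: ennreal_mult)
  also have "(u $ 1 - l $ 1) * (u $ 2 - l $ 2) = (\<Prod>b\<in>Basis. (u - l) \<bullet> b)"
    by (simp add: Basis_plane axis_ne inner_axis)
  finally show "emeasure (distr (lborel \<Otimes>\<^sub>M lborel) borel (\<lambda>z. vec2 (fst z) (snd z))) (box l u)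
      = ennreal (\<Prod>b\<in>Basis. (u - l) \<bullet> b)" .
qed simp

lemma nn_integral_plane:
  assumes [measurable]: "f \<in> borel_measurable borel"
  shows "(\<integral>\<^sup>+x. f x \<partial>lborel) = (\<integral>\<^sup>+a. \<integral>\<^sup>+b. f (vec2 a b) \<partial>lborel \<partial>lborel)"
    "(\<integral>\<^sup>+x. f x \<partial>lborel) = (\<integral>\<^sup>+b. \<integral>\<^sup>+a. f (vec2 a b) \<partial>lborel \<partial>lborel)"
proof -
  have m: "(\<lambda>z. f (vec2 (fst z) (snd z))) \<in> borel_measurable (lborel \<Otimes>\<^sub>M lborel)" by measurable
  have *: "(\<integral>\<^sup>+x. f x \<partial>lborel) = (\<integral>\<^sup>+z. f (vec2 (fst z) (snd z)) \<partial>(lborel \<Otimes>\<^sub>M lborel))"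
    by (subst lborel_plane, subst nn_integral_distr) auto
  show "(\<integral>\<^sup>+x. f x \<partial>lborel) = (\<integral>\<^sup>+a. \<integral>\<^sup>+b. f (vec2 a b) \<partial>lborel \<partial>lborel)"
    unfolding * using lborel.nn_integral_fst[OF m] by simp
  show "(\<integral>\<^sup>+x. f x \<partial>lborel) = (\<integral>\<^sup>+b. \<integral>\<^sup>+a. f (vec2 a b) \<partial>lborel \<partial>lborel)"
    unfolding * using lborel_pair.nn_integral_snd[OF m] by simp
qed

lemma line_bound:
  fixes f f' :: "real \<Rightarrow> real"
  assumes "\<And>s. DERIV f s :> f' s" "continuous_on UNIV f'" "\<And>s. \<bar>s\<bar> > R \<Longrightarrow> f s = 0"
  shows "ennreal \<bar>f a\<bar> \<le> (\<integral>\<^sup>+s. ennreal \<bar>f' s\<bar> \<partial>lborel)"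
proof -
  \<comment> \<open>Any point to the left of both \<open>a\<close> and the support can serve as base
    point for the fundamental theorem of calculus.\<close>
  define L where "L = - (\<bar>R\<bar> + \<bar>a\<bar> + 1)"
  have L: "L \<le> a" "f L = 0" by (auto simp: L_def intro!: assms(3))
  have I: "integrable lborel (\<lambda>x. indicat_real {L..a} x *\<^sub>R f' x)"
    by (rule borel_integrable_compact) (auto intro: continuous_on_subset[OF assms(2)])
  have "(LBINT x. indicat_real {L..a} x *\<^sub>R f' x) = f a - f L"
    by (rule integral_FTC_atLeastAtMost[OF L(1)])
      (auto intro!: continuous_on_subset[OF assms(2)] has_field_derivative_at_within[OF assms(1)]
        simp: has_real_derivative_iff_has_vector_derivative[symmetric])
  then have "ennreal \<bar>f a\<bar> = ennreal (norm (LBINT x. indicat_real {L..a} x *\<^sub>R f' x))"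
    by (simp add: L)
  also have "\<dots> \<le> (\<integral>\<^sup>+x. ennreal (norm (indicat_real {L..a} x *\<^sub>R f' x)) \<partial>lborel)"
    by (rule integral_norm_bound_ennreal[OF I])
  also have "\<dots> \<le> (\<integral>\<^sup>+s. ennreal \<bar>f' s\<bar> \<partial>lborel)"
    by (intro nn_integral_mono ennreal_leI) (auto simp: indicator_def)
  finally show ?thesis .
qed

lemma DERIV_vec2:
  assumes "smooth f"
  shows "DERIV (\<lambda>s. f (vec2 s b)) s :> pd 1 f (vec2 s b)"
    "DERIV (\<lambda>s. f (vec2 b s)) s :> pd 2 f (vec2 b s)"
proof -
  have "((\<lambda>s. vec2 s b) has_derivative (\<lambda>t. t *\<^sub>R axis 1 1)) (at s)"
    "((\<lambda>s. vec2 b s) has_derivative (\<lambda>t. t *\<^sub>R axis 2 1)) (at s)"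
    unfolding vec2_def by (auto intro!: derivative_eq_intros)
  from this[THEN has_derivative_compose[OF _ smooth_has_derivative[OF assms]]]
  show "DERIV (\<lambda>s. f (vec2 s b)) s :> pd 1 f (vec2 s b)"
    "DERIV (\<lambda>s. f (vec2 b s)) s :> pd 2 f (vec2 b s)"
    by (auto simp: has_field_derivative_def sum_2 axis_def mult.commute elim!: has_derivative_eq_rhs)
qed

lemma norm_vec2: "\<bar>a\<bar> \<le> norm (vec2 a b)" "\<bar>b\<bar> \<le> norm (vec2 a b)"
  using component_le_norm_cart[of "vec2 a b" 1] component_le_norm_cart[of "vec2 a b" 2] by auto

lemma continuous_vec2: "continuous_on UNIV (\<lambda>s. vec2 s b)" "continuous_on UNIV (\<lambda>s. vec2 b s)"
  unfolding vec2_def by (auto intro!: continuous_intros)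

text \<open>Integrating \<open>pd 1\<close> along horizontal lines bounds \<open>abs \<eta>\<close>
  by a function of the second coordinate alone; integrating \<open>pd 2\<close> along vertical lines
  bounds it by a function of the first alone. The product bounds the square, and its double integral
  factorises.\<close>

lemma gagliardo:
  assumes t: "\<eta> \<in> test_functions"
  shows "sq \<eta> \<le> (LINT x|lebesgue. \<bar>pd 1 \<eta> x\<bar>) * (LINT x|lebesgue. \<bar>pd 2 \<eta> x\<bar>)"
proof -
  have s: "smooth \<eta>" using t by (rule test_smooth)
  have [measurable]: "\<eta> \<in> borel_measurable borel" "\<And>i. pd i \<eta> \<in> borel_measurable borel"
    using t by (auto intro: test_borel test_pd)
  obtain R where R: "\<And>x. norm x > R \<Longrightarrow> \<eta> x = 0" using test_supp[OF t] by blast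
  define A1 where "A1 b = (\<integral>\<^sup>+s. ennreal \<bar>pd 1 \<eta> (vec2 s b)\<bar> \<partial>lborel)" for b
  define A2 where "A2 a = (\<integral>\<^sup>+s. ennreal \<bar>pd 2 \<eta> (vec2 a s)\<bar> \<partial>lborel)" for a
  have [measurable]: "(\<lambda>z. ennreal \<bar>pd 1 \<eta> (vec2 (snd z) (fst z))\<bar>) \<in> borel_measurable (lborel \<Otimes>\<^sub>M lborel)"
    "(\<lambda>z. ennreal \<bar>pd 2 \<eta> (vec2 (fst z) (snd z))\<bar>) \<in> borel_measurable (lborel \<Otimes>\<^sub>M lborel)"
    unfolding vec2_def by measurable
  have m1: "A1 \<in> borel_measurable lborel" unfolding A1_def
    using lborel.borel_measurable_nn_integral[of "\<lambda>b s. ennreal \<bar>pd 1 \<eta> (vec2 s b)\<bar>" lborel] by (simp add: case_prod_beta')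
  have m2: "A2 \<in> borel_measurable lborel" unfolding A2_def
    using lborel.borel_measurable_nn_integral[of "\<lambda>a s. ennreal \<bar>pd 2 \<eta> (vec2 a s)\<bar>" lborel] by (simp add: case_prod_beta')
  have b1: "ennreal \<bar>\<eta> (vec2 a b)\<bar> \<le> A1 b" for a b
    unfolding A1_def
  proof (rule line_bound[where f="\<lambda>s. \<eta> (vec2 s b)" and a=a and R=R])
    show "DERIV (\<lambda>s. \<eta> (vec2 s b)) s :> pd 1 \<eta> (vec2 s b)" for s by (rule DERIV_vec2(1)[OF s])
    show "continuous_on UNIV (\<lambda>s. pd 1 \<eta> (vec2 s b))"
      by (rule continuous_on_compose2[OF smooth_continuous[OF smooth_pd[OF s]] continuous_vec2(1)]) auto
    show "\<eta> (vec2 s b) = 0" if "\<bar>s\<bar> > R" for s using that norm_vec2(1)[of s b] by (intro R) simp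
  qed
  have b2: "ennreal \<bar>\<eta> (vec2 a b)\<bar> \<le> A2 a" for a b
    unfolding A2_def
  proof (rule line_bound[where f="\<lambda>s. \<eta> (vec2 a s)" and a=b and R=R])
    show "DERIV (\<lambda>s. \<eta> (vec2 a s)) s :> pd 2 \<eta> (vec2 a s)" for s by (rule DERIV_vec2(2)[OF s])
    show "continuous_on UNIV (\<lambda>s. pd 2 \<eta> (vec2 a s))"
      by (rule continuous_on_compose2[OF smooth_continuous[OF smooth_pd[OF s]] continuous_vec2(2)]) auto
    show "\<eta> (vec2 a s) = 0" if "\<bar>s\<bar> > R" for s using that norm_vec2(2)[of s a] by (intro R) simp
  qed
  have "ennreal (sq \<eta>) = (\<integral>\<^sup>+x. ennreal ((\<eta> x)\<^sup>2) \<partial>lborel)"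
    unfolding sq_def using nn_integral_eq_integral[OF rL2D(2)[OF test_rL2[OF t]]] by (simp add: nn_integral_completion)
  also have "\<dots> = (\<integral>\<^sup>+a. \<integral>\<^sup>+b. ennreal ((\<eta> (vec2 a b))\<^sup>2) \<partial>lborel \<partial>lborel)"
    by (rule nn_integral_plane(1)) measurable
  also have "\<dots> \<le> (\<integral>\<^sup>+a. \<integral>\<^sup>+b. A2 a * A1 b \<partial>lborel \<partial>lborel)"
  proof (intro nn_integral_mono)
    fix a b
    have "ennreal ((\<eta> (vec2 a b))\<^sup>2) = ennreal \<bar>\<eta> (vec2 a b)\<bar> * ennreal \<bar>\<eta> (vec2 a b)\<bar>"
      by (simp add: ennreal_mult[symmetric] power2_eq_square abs_mult[symmetric])
    also have "\<dots> \<le> A2 a * A1 b" by (intro mult_mono b1 b2) auto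
    finally show "ennreal ((\<eta> (vec2 a b))\<^sup>2) \<le> A2 a * A1 b" .
  qed
  also have "\<dots> = (\<integral>\<^sup>+a. A2 a \<partial>lborel) * (\<integral>\<^sup>+b. A1 b \<partial>lborel)"
    using m1 m2 by (simp add: nn_integral_cmult nn_integral_multc)
  also have "(\<integral>\<^sup>+a. A2 a \<partial>lborel) = (\<integral>\<^sup>+x. ennreal \<bar>pd 2 \<eta> x\<bar> \<partial>lborel)"
    unfolding A2_def by (rule nn_integral_plane(1)[symmetric]) measurable
  also have "(\<integral>\<^sup>+b. A1 b \<partial>lborel) = (\<integral>\<^sup>+x. ennreal \<bar>pd 1 \<eta> x\<bar> \<partial>lborel)"
    unfolding A1_def by (rule nn_integral_plane(2)[symmetric]) measurable
  finally have le: "ennreal (sq \<eta>) \<le> (\<integral>\<^sup>+x. ennreal \<bar>pd 2 \<eta> x\<bar> \<partial>lborel) * (\<integral>\<^sup>+x. ennreal \<bar>pd 1 \<eta> x\<bar> \<partial>lborel)" .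
  have e: "(\<integral>\<^sup>+x. ennreal \<bar>pd i \<eta> x\<bar> \<partial>lborel) = ennreal (LINT x|lebesgue. \<bar>pd i \<eta> x\<bar>)" for i
    using nn_integral_eq_integral[OF integrable_abs[OF test_integrable(2)[OF test_pd[OF t]]], of i]
    by (simp add: nn_integral_completion)
  have "ennreal (sq \<eta>) \<le> ennreal ((LINT x|lebesgue. \<bar>pd 1 \<eta> x\<bar>) * (LINT x|lebesgue. \<bar>pd 2 \<eta> x\<bar>))"
    using le unfolding e by (simp add: ennreal_mult mult.commute)
  then show ?thesis by (subst (asm) ennreal_le_iff) auto
qed

lemma test_power: "\<zeta> \<in> test_functions \<Longrightarrow> m > 0 \<Longrightarrow> (\<lambda>x. \<zeta> x ^ m) \<in> test_functions"
  by (cases m) (auto intro: test_mult[OF smooth_power] test_smooth simp: mult.commute[of _ "\<zeta> _ ^ _"])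

lemma pd_power:
  assumes "smooth \<zeta>" shows "pd i (\<lambda>x. \<zeta> x ^ Suc m) = (\<lambda>x. real (Suc m) * (\<zeta> x ^ m * pd i \<zeta> x))"
proof (induction m)
  case (Suc m)
  have "pd i (\<lambda>x. \<zeta> x * \<zeta> x ^ Suc m) = (\<lambda>x. \<zeta> x * pd i (\<lambda>x. \<zeta> x ^ Suc m) x + pd i \<zeta> x * \<zeta> x ^ Suc m)"
    by (rule pd_mult[OF assms smooth_power[OF assms]])
  then show ?case unfolding Suc.IH by (simp add: algebra_simps)
qed simp

text \<open>\<open>gagliardo\<close> for the power \<open>Suc m\<close> of \<open>\<zeta>\<close>:
  its partials are multiples of \<open>\<zeta> ^ m * pd i \<zeta>\<close>, and Cauchy-Schwarz
  separates the two factors. Each step raises the exponent by one.\<close>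

lemma sobolev_step:
  assumes t: "\<zeta> \<in> test_functions" and m: "m > 0" and D: "\<And>i. sq (pd i \<zeta>) \<le> D"
  shows "sq (\<lambda>x. \<zeta> x ^ Suc m) \<le> (real (Suc m))\<^sup>2 * D * sq (\<lambda>x. \<zeta> x ^ m)"
proof -
  define K where "K = (real (Suc m))\<^sup>2 * D * sq (\<lambda>x. \<zeta> x ^ m)"
  define P where "P i = (LINT x|lebesgue. \<bar>pd i (\<lambda>x. \<zeta> x ^ Suc m) x\<bar>)" for i
  have abs_rL2: "rL2 (\<lambda>x. \<bar>f x\<bar>)" if "rL2 f" for f using that by (auto simp: rL2_def)
  have "(P i)\<^sup>2 \<le> K" for i
  proof -
    have "P i = (LINT x|lebesgue. real (Suc m) * (\<bar>\<zeta> x ^ m\<bar> * \<bar>pd i \<zeta> x\<bar>))"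
      unfolding P_def pd_power[OF test_smooth[OF t]] by (simp only: abs_mult abs_of_nat)
    also have "\<dots> = real (Suc m) * (LINT x|lebesgue. \<bar>\<zeta> x ^ m\<bar> * \<bar>pd i \<zeta> x\<bar>)" by simp
    finally have "(P i)\<^sup>2 = (real (Suc m))\<^sup>2 * (LINT x|lebesgue. \<bar>\<zeta> x ^ m\<bar> * \<bar>pd i \<zeta> x\<bar>)\<^sup>2"
      by (simp only: power_mult_distrib)
    also have "\<dots> \<le> (real (Suc m))\<^sup>2 * (sq (\<lambda>x. \<bar>\<zeta> x ^ m\<bar>) * sq (\<lambda>x. \<bar>pd i \<zeta> x\<bar>))"
      by (intro mult_left_mono Cauchy_Schwarz_integral abs_rL2 test_rL2 test_power test_pd t m) auto
    also have "\<dots> = (real (Suc m))\<^sup>2 * (sq (\<lambda>x. \<zeta> x ^ m) * sq (pd i \<zeta>))" by (simp add: sq_def)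
    also have "\<dots> \<le> K" unfolding K_def mult.assoc
      using D[of i] by (intro mult_left_mono) (auto simp: sq_nonneg mult.commute[of D] intro!: mult_left_mono)
    finally show ?thesis .
  qed
  moreover have Pnn: "P i \<ge> 0" for i by (simp add: P_def)
  moreover have Kn: "K \<ge> 0" using \<open>\<And>i. (P i)\<^sup>2 \<le> K\<close>[of 1] zero_le_power2[of "P 1"] by linarith
  ultimately have "P i \<le> sqrt K" for i by (simp add: real_le_rsqrt)
  then have "P 1 * P 2 \<le> sqrt K * sqrt K" using Pnn Kn by (intro mult_mono) auto
  then have "P 1 * P 2 \<le> K" using Kn by simp
  moreover have "sq (\<lambda>x. \<zeta> x ^ Suc m) \<le> P 1 * P 2"
    unfolding P_def by (rule gagliardo[OF test_power[OF t]]) simp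
  ultimately show ?thesis by (simp add: K_def)
qed

text \<open>The constant is uniform over all test functions with the given bounds, so it survives
  the limit in \<open>sobolev\<close>.\<close>

lemma sobolev_bound:
  "\<exists>C. \<forall>\<zeta>\<in>test_functions. sq \<zeta> \<le> D \<longrightarrow> (\<forall>i. sq (pd i \<zeta>) \<le> D) \<longrightarrow> sq (\<lambda>x. \<zeta> x ^ Suc m) \<le> C"
proof (induction m)
  case 0
  show ?case by (intro exI[of _ D]) auto
next
  case (Suc m)
  then obtain C where C: "\<And>\<zeta>. \<zeta> \<in> test_functions \<Longrightarrow> sq \<zeta> \<le> D \<Longrightarrow> \<forall>i. sq (pd i \<zeta>) \<le> D \<Longrightarrow> sq (\<lambda>x. \<zeta> x ^ Suc m) \<le> C"
    by blast
  show ?case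
  proof (intro exI[of _ "(real (Suc (Suc m)))\<^sup>2 * D * C"] ballI impI)
    fix \<zeta> assume t: "\<zeta> \<in> test_functions" and a: "sq \<zeta> \<le> D" and b: "\<forall>i. sq (pd i \<zeta>) \<le> D"
    have "D \<ge> 0" using a sq_nonneg[of \<zeta>] by linarith
    have "sq (\<lambda>x. \<zeta> x ^ Suc (Suc m)) \<le> (real (Suc (Suc m)))\<^sup>2 * D * sq (\<lambda>x. \<zeta> x ^ Suc m)"
      by (rule sobolev_step[OF t]) (use b in auto)
    also have "\<dots> \<le> (real (Suc (Suc m)))\<^sup>2 * D * C"
      using C[OF t a b] \<open>D \<ge> 0\<close> by (intro mult_left_mono) auto
    finally show "sq (\<lambda>x. \<zeta> x ^ Suc (Suc m)) \<le> (real (Suc (Suc m)))\<^sup>2 * D * C" .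
  qed
qed

text \<open>Scaling: each derivative of \<open>chiR R\<close> costs a factor \<open>1 / R\<close>,
  and one \<open>B\<close> serves all radii.\<close>

lemma pd_chiR_bound:
  obtains B where "B > 0" "\<And>R i x. R > 0 \<Longrightarrow> \<bar>pd i (chiR R) x\<bar> \<le> B / R"
    "\<And>R x. R > 0 \<Longrightarrow> \<bar>laplace (chiR R) x\<bar> \<le> B / R\<^sup>2"
proof -
  have "\<forall>i. \<exists>B. \<forall>x. \<bar>pd i chi x\<bar> \<le> B" using test_bounded[OF test_pd[OF chi_test]] by meson
  then obtain B where B: "\<And>i x. \<bar>pd i chi x\<bar> \<le> B i" by metis
  obtain B' where B': "B' > 0" "\<And>x. \<bar>laplace chi x\<bar> \<le> B'" using test_bounded[OF test_laplace[OF chi_test]] by blast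
  define b where "b = \<bar>B 1\<bar> + \<bar>B 2\<bar> + B'"
  have Bb: "B i \<le> b" for i using exhaust_2[of i] B'(1) by (auto simp: b_def)
  show ?thesis
  proof (rule that[of b])
    show "b > 0" using B' by (simp add: b_def add_nonneg_pos)
    fix R :: real and x assume R: "R > 0"
    show "\<bar>pd i (chiR R) x\<bar> \<le> b / R" for i
      using pd_affine[OF test_smooth[OF chi_test], of i "1 / R" 0] order_trans[OF B[of i "x /\<^sub>R R"] Bb[of i]] R
      by (simp add: chiR_def[abs_def] abs_mult divide_right_mono inverse_eq_divide)
    have "\<bar>laplace chi y\<bar> \<le> b" for y using B'(2)[of y] by (simp add: b_def)
    from this[of "x /\<^sub>R R"] show "\<bar>laplace (chiR R) x\<bar> \<le> b / R\<^sup>2"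
      using laplace_affine[OF test_smooth[OF chi_test], of "1 / R" 0 x] R
      by (simp add: chiR_def[abs_def] abs_mult power_divide divide_right_mono inverse_eq_divide)
  qed
qed

lemma sq_AE_subseq:
  assumes "\<And>n. rL2 (F n)" "(\<lambda>n. sq (F n)) \<longlonglongrightarrow> 0"
  obtains r :: "nat \<Rightarrow> nat" where "strict_mono r" "AE x in lebesgue. (\<lambda>n. F (r n) x) \<longlonglongrightarrow> 0"
proof -
  have "(\<lambda>n. \<integral>x. norm ((F n x)\<^sup>2) \<partial>lebesgue) \<longlonglongrightarrow> 0" using assms(2) by (simp add: sq_def)
  from tendsto_L1_AE_subseq[OF rL2D(2)[OF assms(1)] this]
  obtain r :: "nat \<Rightarrow> nat" where r: "strict_mono r" "AE x in lebesgue. (\<lambda>n. (F (r n) x)\<^sup>2) \<longlonglongrightarrow> 0" by blast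
  have "AE x in lebesgue. (\<lambda>n. F (r n) x) \<longlonglongrightarrow> 0"
    using r(2)
  proof eventually_elim
    case (elim x)
    from tendsto_real_sqrt[OF elim] have "(\<lambda>n. \<bar>F (r n) x\<bar>) \<longlonglongrightarrow> 0" by simp
    then show ?case by (simp add: tendsto_rabs_zero_iff)
  qed
  with r(1) show ?thesis by (rule that)
qed

text \<open>Mollified and cut off, \<open>f\<close> becomes a sequence of test functions with values
  and gradients bounded in L2. \<open>sobolev_bound\<close> is uniform on it, and Fatou's lemma
  along an a.e. convergent subsequence carries the bound to \<open>f\<close>.\<close>

lemma sobolev:
  assumes f: "rL2 f" and g: "\<And>i. rweak i f (g i)" "\<And>i. rL2 (g i)"
  shows "rL2 (\<lambda>x. f x ^ Suc m)"
proof -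
  have f1: "rL1loc f" by (rule rL2_rL1loc[OF f])
  obtain B where B: "B > 0" "\<And>R i x. R > 0 \<Longrightarrow> \<bar>pd i (chiR R) x\<bar> \<le> B / R"
    using pd_chiR_bound by metis
  define c where "c n = chiR (real (Suc n))" for n
  have ct: "c n \<in> test_functions" for n unfolding c_def by (rule chiR_test) simp
  have cB: "\<bar>pd i (c n) x\<bar> \<le> B" for i n x
  proof -
    have "B / real (Suc n) \<le> B / 1" using B(1) by (intro divide_left_mono) auto
    then show ?thesis using B(2)[of "real (Suc n)" i x] by (simp add: c_def)
  qed
  have c1: "\<bar>c n x\<bar> \<le> 1" for n x using chiR_bounds[of "real (Suc n)" x] by (simp add: c_def)
  define z where "z n x = c n x * conv (moll n) f x" for n x
  have zt: "z n \<in> test_functions" for n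
    unfolding z_def using test_mult[OF conv_smooth[OF moll_test f1] ct, of n n] by (simp add: mult.commute)
  \<comment> \<open>By the product rule the gradient of \<open>z n\<close> costs at most
    \<open>2 * sq (g i) + 2 * B^2 * sq f\<close>; the extra \<open>sq f\<close> covers
    \<open>z n\<close> itself.\<close>
  define D where "D = sq f + 2 * (\<Sum>i\<in>UNIV. sq (g i)) + 2 * B\<^sup>2 * sq f"
  have zD: "sq (z n) \<le> D" for n
  proof -
    have "sq (z n) \<le> 1\<^sup>2 * sq (conv (moll n) f)"
      unfolding z_def by (rule rL2_bounded_mult(2)[OF conv_moll_rL2(1)[OF f] borel_imp_lebesgue[OF test_borel[OF ct]] c1])
    also have "\<dots> \<le> sq f" using conv_moll_rL2(2)[OF f] by simp
    also have "\<dots> \<le> D" by (simp add: D_def sum_nonneg sq_nonneg)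
    finally show ?thesis .
  qed
  have zD': "sq (pd i (z n)) \<le> D" for n i
  proof -
    have p: "pd i (z n) = (\<lambda>x. c n x * conv (moll n) (g i) x + pd i (c n) x * conv (moll n) f x)"
      unfolding z_def using pd_mult[OF test_smooth[OF ct] conv_smooth[OF moll_test f1]]
      by (simp add: pd_conv[OF moll_test f1] conv_weak[OF g(1) moll_test])
    have a: "rL2 (\<lambda>x. c n x * conv (moll n) (g i) x)"
        "sq (\<lambda>x. c n x * conv (moll n) (g i) x) \<le> 1\<^sup>2 * sq (conv (moll n) (g i))"
      by (rule rL2_bounded_mult[OF conv_moll_rL2(1)[OF g(2)] borel_imp_lebesgue[OF test_borel[OF ct]] c1])+
    have b: "rL2 (\<lambda>x. pd i (c n) x * conv (moll n) f x)"
        "sq (\<lambda>x. pd i (c n) x * conv (moll n) f x) \<le> B\<^sup>2 * sq (conv (moll n) f)"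
      by (rule rL2_bounded_mult[OF conv_moll_rL2(1)[OF f] borel_imp_lebesgue[OF test_borel[OF test_pd[OF ct]]] cB])+
    have "sq (pd i (z n)) \<le> 2 * sq (\<lambda>x. c n x * conv (moll n) (g i) x) + 2 * sq (\<lambda>x. pd i (c n) x * conv (moll n) f x)"
      unfolding p by (rule rL2_add(2)[OF a(1) b(1)])
    also have "\<dots> \<le> 2 * sq (g i) + 2 * (B\<^sup>2 * sq f)"
    proof -
      have "sq (\<lambda>x. c n x * conv (moll n) (g i) x) \<le> sq (g i)" using a(2) conv_moll_rL2(2)[OF g(2)[of i], of n] by simp
      moreover have "sq (\<lambda>x. pd i (c n) x * conv (moll n) f x) \<le> B\<^sup>2 * sq f"
        using b(2) mult_left_mono[OF conv_moll_rL2(2)[OF f, of n], of "B\<^sup>2"] by simp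
      ultimately show ?thesis by linarith
    qed
    also have "\<dots> \<le> D"
    proof -
      have "sq (g i) \<le> (\<Sum>i\<in>UNIV. sq (g i))" by (rule member_le_sum) (auto simp: sq_nonneg)
      then show ?thesis using sq_nonneg[of f] by (simp add: D_def)
    qed
    finally show ?thesis .
  qed
  obtain C where C: "\<And>n. sq (\<lambda>x. z n x ^ Suc m) \<le> C"
    using sobolev_bound[of D m] zt zD zD' by meson
  obtain r :: "nat \<Rightarrow> nat" where r: "strict_mono r" "AE x in lebesgue. (\<lambda>n. conv (moll (r n)) f x - f x) \<longlonglongrightarrow> 0"
    using sq_AE_subseq[OF rL2_diff(1)[OF conv_moll_rL2(1)[OF f] f] conv_moll_L2[OF f]] by blast
  have lim: "AE x in lebesgue. (\<lambda>n. z (r n) x ^ Suc m) \<longlonglongrightarrow> f x ^ Suc m"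
    using r(2)
  proof eventually_elim
    case (elim x)
    then have "(\<lambda>n. conv (moll (r n)) f x) \<longlonglongrightarrow> f x" by (simp add: LIM_zero_iff)
    moreover have "(\<lambda>n. c (r n) x) \<longlonglongrightarrow> 1"
      using LIMSEQ_subseq_LIMSEQ[OF chiR_tendsto r(1)] by (simp add: c_def comp_def)
    ultimately have "(\<lambda>n. (c (r n) x * conv (moll (r n)) f x) ^ Suc m) \<longlonglongrightarrow> (1 * f x) ^ Suc m"
      by (intro tendsto_intros)
    then show ?case by (simp add: z_def)
  qed
  have [measurable]: "f \<in> borel_measurable lebesgue" by (rule rL2D(1)[OF f])
  have mf: "(\<lambda>x. f x ^ Suc m) \<in> borel_measurable lebesgue" by measurable
  show ?thesis
    by (rule rL2_fatou(1)[OF test_rL2[OF test_power[OF zt]] C mf lim]) simp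
qed

section \<open>The Green function and the heat kernel\<close>

lemma borel_nth [measurable]: "(\<lambda>x::plane. x $ i) \<in> borel_measurable borel"
  by (intro borel_measurable_continuous_onI continuous_intros)

lemma borel_cosh [measurable]: "(cosh :: real \<Rightarrow> real) \<in> borel_measurable borel"
  by (intro borel_measurable_continuous_onI continuous_intros)

text \<open>The exponential is split into two equal factors. \<open>cosh s >= 1\<close> turns one
  into \<open>exp (- r / 2)\<close>, the decay at infinity; \<open>exp (- y) <= y powr (- e)\<close>
  with \<open>cosh s >= exp s / 2\<close> turns the other into the integrable
  \<open>exp (- e * s)\<close>. The free exponent \<open>e\<close> makes the singularity at 0 as
  weak a power as desired.\<close>

lemma K0_decay:
  assumes r: "r > 0" and e: "e > 0" "e \<le> 1"
  shows "set_integrable lborel {0<..} (\<lambda>s. exp (- r * cosh s))"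
    "bessel_K0 r \<le> exp (- r / 2) * (r / 4) powr (- e) / e"
    "bessel_K0 r \<ge> 0"
proof -
  define C where "C = exp (- r / 2) * (r / 4) powr (- e)"
  have C: "C \<ge> 0" by (simp add: C_def)
  have pw: "exp (- y) \<le> y powr (- e)" if "y > 0" for y :: real
  proof -
    have "y powr e \<le> exp y"
    proof (cases "y \<le> 1")
      case True
      then have "y powr e \<le> 1" using that e by (intro powr_le1) auto
      also have "1 \<le> exp y" using that by simp
      finally show ?thesis .
    next
      case False
      then have "y powr e \<le> y powr 1" using e by (intro powr_mono) auto
      also have "y powr 1 = y" using that by simp
      also have "y \<le> exp y" using exp_ge_add_one_self[of y] by linarith
      finally show ?thesis .
    qed
    then have "inverse (exp y) \<le> inverse (y powr e)" using that by (intro le_imp_inverse_le) auto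
    then show ?thesis by (simp add: exp_minus powr_minus)
  qed
  have bd: "exp (- r * cosh s) \<le> C * exp (- e * s)" for s
  proof -
    have "exp (- r * cosh s) = exp (- (r/2 * cosh s)) * exp (- (r/2 * cosh s))"
      by (simp add: exp_add[symmetric])
    also have "\<dots> \<le> exp (- r / 2) * ((r / 4) powr (- e) * exp (- e * s))"
    proof (intro mult_mono)
      show "exp (- (r / 2 * cosh s)) \<le> exp (- r / 2)"
        using r cosh_real_ge_1[of s] by simp
      have "r / 4 * exp s \<le> r / 2 * cosh s" using r by (simp add: cosh_def field_simps)
      then have "exp (- (r / 2 * cosh s)) \<le> exp (- (r / 4 * exp s))" by simp
      also have "\<dots> \<le> (r / 4 * exp s) powr (- e)" by (rule pw) (use r in simp)
      also have "\<dots> = (r / 4) powr (- e) * exp (- e * s)"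
      proof -
        have "exp s powr (- e) = exp (- e * s)" by (simp add: powr_def)
        then show ?thesis using powr_mult[of "r / 4" "exp s" "- e"] r by simp
      qed
      finally show "exp (- (r / 2 * cosh s)) \<le> (r / 4) powr (- e) * exp (- e * s)" .
    qed auto
    finally show ?thesis by (simp add: C_def mult.assoc)
  qed
  have E: "(\<integral>\<^sup>+x. ennreal (exp (- e * x)) * indicator {0..} x \<partial>lborel) = ennreal (0 - (- 1 / e))"
  proof (rule nn_integral_FTC_atLeast[where F="\<lambda>x. - exp (- e * x) / e", THEN trans])
    show "DERIV (\<lambda>x. - exp (- e * x) / e) x :> exp (- e * x)" for x
      using e by (auto intro!: derivative_eq_intros)
    have "((\<lambda>x. exp (- (e * x))) \<longlongrightarrow> 0) at_top"
      by (rule filterlim_compose[OF exp_at_bot])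
        (use e in \<open>auto intro!: filterlim_uminus_at_top[THEN iffD1] filterlim_tendsto_pos_mult_at_top[of _ e] filterlim_ident\<close>)
    from tendsto_mult[OF tendsto_const this, of "- 1 / e"]
    show "((\<lambda>x. - exp (- e * x) / e) \<longlongrightarrow> 0) at_top" by simp
  qed auto
  have hb: "has_bochner_integral lborel (\<lambda>s. indicator {0<..} s *\<^sub>R exp (- e * s)) (1 / e)"
  proof (rule has_bochner_integral_nn_integral)
    have "(\<integral>\<^sup>+x. ennreal (indicator {0<..} x *\<^sub>R exp (- e * x)) \<partial>lborel)
      = (\<integral>\<^sup>+x. ennreal (exp (- e * x)) * indicator {0..} x \<partial>lborel)"
      by (rule nn_integral_cong_AE) (use AE_lborel_singleton[of "0::real"] in \<open>eventually_elim, auto simp: indicator_def\<close>)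
    then show "(\<integral>\<^sup>+x. ennreal (indicator {0<..} x *\<^sub>R exp (- e * x)) \<partial>lborel) = ennreal (1 / e)"
      using E by simp
  qed (use e in auto)
  have iE: "integrable lborel (\<lambda>s. C * (indicator {0<..} s *\<^sub>R exp (- e * s)))"
    using hb by (intro integrable_mult_right) (auto simp: has_bochner_integral_iff)
  have m: "(\<lambda>s. indicator {0<..} s *\<^sub>R exp (- r * cosh s)) \<in> borel_measurable lborel"
    by measurable
  have b: "AE s in lborel. norm (indicator {0<..} s *\<^sub>R exp (- r * cosh s)) \<le> C * (indicator {0<..} s *\<^sub>R exp (- e * s))"
    using bd by (auto simp: indicator_def)
  show "set_integrable lborel {0<..} (\<lambda>s. exp (- r * cosh s))"
    unfolding set_integrable_def by (rule integral_bound(1)[OF iE m b])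
  have "norm (bessel_K0 r) \<le> (\<integral>s. C * (indicator {0<..} s *\<^sub>R exp (- e * s)) \<partial>lborel)"
    unfolding bessel_K0_def set_lebesgue_integral_def by (rule integral_bound(2)[OF iE m b])
  also have "\<dots> = C * (1 / e)" using hb by (simp add: has_bochner_integral_iff)
  finally show "bessel_K0 r \<le> exp (- r / 2) * (r / 4) powr (- e) / e" by (simp add: C_def)
  show "bessel_K0 r \<ge> 0"
    unfolding bessel_K0_def set_lebesgue_integral_def by (intro integral_nonneg_AE) auto
qed

text \<open>The heat kernel of the plane at time \<open>t\<close>.\<close>

definition hk :: "real \<Rightarrow> plane \<Rightarrow> real" where
  "hk t x = exp (- ((norm x)\<^sup>2 / (4 * t))) / (4 * pi * t)"

definition Gr :: "real \<Rightarrow> plane \<Rightarrow> real" where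
  "Gr l x = bessel_K0 (sqrt l * norm x) / (2 * pi)"

lemma green_Gr: "green l x = of_real (Gr l x)"
  by (simp add: green_def Gr_def)

lemma hk_nonneg: "t > 0 \<Longrightarrow> hk t x \<ge> 0"
  by (simp add: hk_def)

lemma hk_borel [measurable]: "(\<lambda>z. hk (fst z) (snd z)) \<in> borel_measurable (lborel \<Otimes>\<^sub>M lborel)"
  unfolding hk_def by measurable

text \<open>The substitution \<open>t = t0 * exp s\<close> symmetrises the exponent:
  \<open>l * t + (norm x)^2 / (4 * t)\<close> becomes \<open>r * cosh s\<close>, while
  \<open>dt / t = ds\<close> absorbs the factor \<open>1 / t\<close> of \<open>hk\<close>. The
  integral over the line is twice the half-line integral in \<open>bessel_K0\<close>.\<close>

lemma Gr_heat:
  assumes l: "l > 0" and x: "x \<noteq> 0"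
  shows "set_integrable lborel {0<..} (\<lambda>t. exp (- l * t) * hk t x)"
    "Gr l x = (LINT t:{0<..}|lborel. exp (- l * t) * hk t x)"
proof -
  define r where "r = sqrt l * norm x"
  have r: "r > 0" using l x by (simp add: r_def)
  \<comment> \<open>The time at which the two terms of the exponent are equal.\<close>
  define t0 where "t0 = norm x / (2 * sqrt l)"
  have t0: "t0 > 0" using l x by (simp add: t0_def)
  have lt0: "l * t0 = r / 2"
    using l real_sqrt_mult_self[of l] by (simp add: t0_def r_def field_simps)
  have nt0: "(norm x)\<^sup>2 / (4 * t0) = r / 2" using x l by (simp add: t0_def r_def power2_eq_square field_simps)
  define f where "f t = exp (- l * t) * hk t x" for t
  define g where "g s = t0 * exp s" for s
  define h where "h s = exp (- r * cosh s)" for s :: real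
  have fg: "f (g s) * g s = h s / (4 * pi)" for s
  proof -
    have "l * (t0 * exp s) + (norm x)\<^sup>2 / (4 * (t0 * exp s)) = r / 2 * exp s + r / 2 * exp (- s)"
    proof -
      have a: "(norm x)\<^sup>2 / (4 * (t0 * exp s)) = (norm x)\<^sup>2 / (4 * t0) * exp (- s)"
        by (simp add: exp_minus field_simps)
      have b: "l * (t0 * exp s) = (l * t0) * exp s" by simp
      show ?thesis unfolding a b lt0 nt0 by (rule refl)
    qed
    also have "\<dots> = r * cosh s" by (simp add: cosh_def field_simps)
    finally have e: "l * (t0 * exp s) + (norm x)\<^sup>2 / (4 * (t0 * exp s)) = r * cosh s" .
    define T where "T = t0 * exp s"
    have "T > 0" using t0 by (simp add: T_def)
    then have "f T * T = exp (- l * T) * exp (- ((norm x)\<^sup>2 / (4 * T))) / (4 * pi)"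
      by (simp add: f_def hk_def)
    also have "\<dots> = exp (- (l * T + (norm x)\<^sup>2 / (4 * T))) / (4 * pi)"
      by (simp add: exp_add[symmetric])
    finally have "f (g s) * g s = exp (- (l * (t0 * exp s) + (norm x)\<^sup>2 / (4 * (t0 * exp s)))) / (4 * pi)"
      by (simp add: T_def g_def)
    then show ?thesis unfolding e by (simp add: h_def)
  qed
  define h1 where "h1 s = indicator {0<..} s *\<^sub>R h s" for s
  have h1i: "integrable lborel h1"
    using K0_decay(1)[OF r, of 1] by (simp add: h1_def[abs_def] h_def set_integrable_def)
  have h1i': "integrable lborel (\<lambda>s. h1 (- s))" "(\<integral>s. h1 (- s) \<partial>lborel) = integral\<^sup>L lborel h1"
    using lborel_integrable_real_affine[OF h1i, of "-1" 0] lborel_integral_real_affine[of "-1" h1 0] by auto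
  have hsum: "AE s in lborel. h s = h1 s + h1 (- s)"
    using AE_lborel_singleton[of "0::real"] by eventually_elim (auto simp: h1_def h_def indicator_def)
  have hm: "h \<in> borel_measurable lborel" unfolding h_def by measurable
  have hi: "integrable lborel h" "integral\<^sup>L lborel h = 2 * integral\<^sup>L lborel h1"
  proof -
    have s: "integrable lborel (\<lambda>s. h1 s + h1 (- s))" using h1i h1i' by simp
    show "integrable lborel h"
      using integrable_cong_AE[OF hm borel_measurable_integrable[OF s] hsum] s by simp
    have "integral\<^sup>L lborel h = (\<integral>s. h1 s + h1 (- s) \<partial>lborel)"
      by (rule integral_cong_AE[OF hm borel_measurable_integrable[OF s] hsum])
    then show "integral\<^sup>L lborel h = 2 * integral\<^sup>L lborel h1" using h1i h1i' by simp
  qed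
  have sub: "set_integrable lborel (einterval 0 \<infinity>) f \<and>
    (LBINT t=0..\<infinity>. f t) = (LBINT s=-\<infinity>..\<infinity>. f (g s) * g s)"
  proof -
    have d: "DERIV g s :> g s" for s unfolding g_def by (auto intro!: derivative_eq_intros)
    have cf: "isCont f (g s)" for s
      unfolding f_def hk_def using t0 by (auto intro!: continuous_intros simp: g_def)
    have cg: "isCont g s" for s unfolding g_def by (intro continuous_intros)
    have fn: "0 \<le> f (g s)" for s using t0 by (auto simp: f_def g_def intro!: mult_nonneg_nonneg hk_nonneg)
    have gn: "0 \<le> g s" for s using t0 by (simp add: g_def)
    have "(g \<longlongrightarrow> t0 * 0) at_bot" unfolding g_def by (intro tendsto_intros exp_at_bot)
    then have lA: "((ereal \<circ> g \<circ> real_of_ereal) \<longlongrightarrow> 0) (at_right (- \<infinity>))"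
      by (simp add: ereal_tendsto_simps zero_ereal_def)
    have "filterlim g at_top at_top"
      unfolding g_def by (intro filterlim_tendsto_pos_mult_at_top[OF tendsto_const t0] exp_at_top)
    then have lB: "((ereal \<circ> g \<circ> real_of_ereal) \<longlongrightarrow> \<infinity>) (at_left \<infinity>)"
      by (simp add: ereal_tendsto_simps)
    have ii: "set_integrable lborel (einterval (- \<infinity>) \<infinity>) (\<lambda>s. f (g s) * g s)"
      using hi(1) by (simp add: fg set_integrable_def)
    show ?thesis
      using interval_integral_substitution_nonneg[of "-\<infinity>" \<infinity> g g f, OF _ d cf cg fn gn lA lB ii] by simp
  qed
  show "set_integrable lborel {0<..} (\<lambda>t. exp (- l * t) * hk t x)"
    using conjunct1[OF sub] by (simp add: f_def[abs_def] zero_ereal_def einterval_def greaterThan_def)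
  have "(LINT t:{0<..}|lborel. f t) = (LBINT t=0..\<infinity>. f t)"
    by (simp add: interval_lebesgue_integral_def zero_ereal_def einterval_def greaterThan_def)
  also have "\<dots> = integral\<^sup>L lborel h / (4 * pi)"
    unfolding conjunct2[OF sub] by (simp add: fg interval_lebesgue_integral_def set_lebesgue_integral_def)
  also have "\<dots> = Gr l x"
    unfolding hi(2) by (simp add: Gr_def bessel_K0_def r_def[symmetric] set_lebesgue_integral_def h1_def[abs_def] h_def)
  finally show "Gr l x = (LINT t:{0<..}|lborel. exp (- l * t) * hk t x)" by (simp add: f_def)
qed

lemma Gr_borel [measurable]: "Gr l \<in> borel_measurable borel"
proof -
  have "(\<lambda>z. indicator {0<..} (snd z) *\<^sub>R exp (- fst z * cosh (snd z))) \<in> borel_measurable (lborel \<Otimes>\<^sub>M (lborel :: real measure))"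
    by measurable
  then have "bessel_K0 \<in> borel_measurable lborel"
    unfolding bessel_K0_def set_lebesgue_integral_def
    using lborel.borel_measurable_lebesgue_integral[of "\<lambda>r t. indicator {0<..} t *\<^sub>R exp (- r * cosh t)" lborel]
    by (simp add: case_prod_beta')
  then have [measurable]: "bessel_K0 \<in> borel_measurable borel" by simp
  show ?thesis unfolding Gr_def by measurable
qed

lemma Gr_nonneg: "l > 0 \<Longrightarrow> Gr l x \<ge> 0"
  unfolding Gr_def bessel_K0_def set_lebesgue_integral_def
  by (intro divide_nonneg_nonneg integral_nonneg_AE) auto

lemma AE_nonzero: "AE x::plane in lborel. x \<noteq> 0" "AE x::plane in lebesgue. x \<noteq> 0"
proof -
  show "AE x::plane in lborel. x \<noteq> 0" by (rule AE_lborel_singleton)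
  then show "AE x::plane in lebesgue. x \<noteq> 0" by (rule AE_completion)
qed

text \<open>With \<open>p\<close> and \<open>q\<close> the square roots of the absolute values of
  the coordinates, \<open>p * q <= norm x\<close> and \<open>p + q <= a * norm x + 1 / a\<close>.
  This dominates the function by a product of functions of one coordinate each.\<close>

lemma exp_over_norm_integrable:
  assumes a: "a > 0"
  shows "integrable lborel (\<lambda>x::plane. exp (- a * norm x) / norm x)"
proof -
  \<comment> \<open>Integrable on the half-line because \<open>- 2 * exp (- sqrt s)\<close> is an
    antiderivative.\<close>
  define f where "f s = indicator {0<..} s *\<^sub>R (exp (- sqrt s) / sqrt s)" for s :: real
  have [measurable]: "f \<in> borel_measurable borel" unfolding f_def by measurable
  have "set_integrable lborel (einterval 0 \<infinity>) (\<lambda>s. exp (- sqrt s) / sqrt s)"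
  proof (rule interval_integral_FTC_nonneg(1)[where F="\<lambda>s. - 2 * exp (- sqrt s)" and A="-2" and B=0])
    show "DERIV (\<lambda>s. - 2 * exp (- sqrt s)) s :> exp (- sqrt s) / sqrt s" if "0 < ereal s" for s
      using that by (auto intro!: derivative_eq_intros simp: zero_ereal_def field_simps)
    show "isCont (\<lambda>s. exp (- sqrt s) / sqrt s) s" if "0 < ereal s" for s
      using that by (auto intro!: continuous_intros simp: zero_ereal_def)
    show "AE x in lborel. 0 < ereal x \<longrightarrow> ereal x < \<infinity> \<longrightarrow> 0 \<le> exp (- sqrt x) / sqrt x"
      by (auto simp: zero_ereal_def)
    have "((\<lambda>s. - 2 * exp (- sqrt s)) \<longlongrightarrow> - 2 * exp (- sqrt 0)) (at_right 0)"
      by (intro tendsto_intros)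
    then show "(((\<lambda>s. - 2 * exp (- sqrt s)) \<circ> real_of_ereal) \<longlongrightarrow> -2) (at_right 0)"
      by (simp add: ereal_tendsto_simps zero_ereal_def)
    have "((\<lambda>s. exp (- sqrt s)) \<longlongrightarrow> 0) at_top"
      by (rule filterlim_compose[OF exp_at_bot]) (simp add: filterlim_uminus_at_top[symmetric] sqrt_at_top)
    from tendsto_mult[OF tendsto_const this, of "-2"]
    have "((\<lambda>s. - 2 * exp (- sqrt s)) \<longlongrightarrow> 0) at_top" by simp
    then show "(((\<lambda>s. - 2 * exp (- sqrt s)) \<circ> real_of_ereal) \<longlongrightarrow> 0) (at_left \<infinity>)"
      by (simp add: ereal_tendsto_simps)
  qed auto
  then have fi: "integrable lborel f"
    by (simp add: f_def[abs_def] set_integrable_def zero_ereal_def einterval_def greaterThan_def)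
  have fn: "f s \<ge> 0" for s by (auto simp: f_def indicator_def)
  define k where "k s = f s + f (- s)" for s
  have km [measurable]: "k \<in> borel_measurable borel" unfolding k_def by measurable
  have ki: "integrable lborel k"
    unfolding k_def using fi lborel_integrable_real_affine[OF fi, of "-1" 0] by simp
  have kn: "k s \<ge> 0" for s by (simp add: k_def fn)
  have kk: "(\<integral>\<^sup>+s. ennreal (k s) \<partial>lborel) = ennreal (integral\<^sup>L lborel k)"
    by (rule nn_integral_eq_integral[OF ki]) (simp add: kn)
  have pl: "integrable lborel (\<lambda>x::plane. exp (1 / a) * (k (x $ 1) * k (x $ 2)))"
  proof (rule integrable_mult_right, rule integrableI_bounded)
    show "(\<lambda>x::plane. k (x $ 1) * k (x $ 2)) \<in> borel_measurable lborel" by measurable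
    have "(\<integral>\<^sup>+x. ennreal (norm (k ((x::plane) $ 1) * k (x $ 2))) \<partial>lborel)
        = (\<integral>\<^sup>+a. \<integral>\<^sup>+b. ennreal (k a) * ennreal (k b) \<partial>lborel \<partial>lborel)"
    proof -
      have "(\<lambda>x::plane. ennreal (norm (k (x $ 1) * k (x $ 2)))) \<in> borel_measurable borel" by measurable
      from nn_integral_plane(1)[OF this] show ?thesis by (simp add: abs_mult kn ennreal_mult)
    qed
    also have "\<dots> = ennreal (integral\<^sup>L lborel k) * ennreal (integral\<^sup>L lborel k)"
      by (simp add: nn_integral_cmult nn_integral_multc kk)
    also have "\<dots> < \<infinity>" by (simp add: ennreal_mult_less_top)
    finally show "(\<integral>\<^sup>+x. ennreal (norm (k ((x::plane) $ 1) * k (x $ 2))) \<partial>lborel) < \<infinity>" .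
  qed
  have ax: "AE x::plane in lborel. x $ i \<noteq> 0" for i
  proof -
    have "{x::plane. x $ i = 0} \<in> null_sets lborel"
      using negligible_standard_hyperplane_cart[of i]
      by (simp add: negligible_iff_null_sets null_sets_completion_iff)
    from AE_not_in[OF this] show ?thesis by simp
  qed
  show ?thesis
  proof (rule integral_bound(1)[OF pl])
    show "AE x::plane in lborel. norm (exp (- a * norm x) / norm x) \<le> exp (1 / a) * (k (x $ 1) * k (x $ 2))"
      using ax[of 1] ax[of 2]
    proof eventually_elim
      case (elim x)
      have kv: "k s = exp (- sqrt \<bar>s\<bar>) / sqrt \<bar>s\<bar>" if "s \<noteq> 0" for s
        using that by (auto simp: k_def f_def indicator_def abs_if)
      define p q where "p = sqrt \<bar>x $ 1\<bar>" and "q = sqrt \<bar>x $ 2\<bar>"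
      have pq: "p > 0" "q > 0" "p\<^sup>2 \<le> norm x" "q\<^sup>2 \<le> norm x"
        using elim component_le_norm_cart[of x] by (auto simp: p_def q_def)
      have n: "norm x > 0" using elim by auto
      have pqn: "p * q \<le> norm x"
      proof (rule power2_le_imp_le)
        have "p\<^sup>2 * q\<^sup>2 \<le> norm x * norm x" using pq by (intro mult_mono) auto
        then show "(p * q)\<^sup>2 \<le> (norm x)\<^sup>2"
          by (simp only: power_mult_distrib power2_eq_square[of "norm x"])
      qed simp
      have am: "s \<le> a / 2 * s\<^sup>2 + 1 / (2 * a)" for s :: real
        using zero_le_power2[of "a * s - 1"] a by (simp add: power2_eq_square field_simps)
      have "p + q \<le> a * norm x + 1 / a"
      proof -
        have "p + q \<le> a / 2 * p\<^sup>2 + a / 2 * q\<^sup>2 + 1 / a" using am[of p] am[of q] by (simp add: field_simps)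
        also have "\<dots> \<le> a / 2 * norm x + a / 2 * norm x + 1 / a"
          using pq a by (intro add_mono mult_left_mono) auto
        finally show ?thesis by simp
      qed
      then have "exp (- a * norm x) \<le> exp (1 / a + (- p + - q))" by simp
      also have "\<dots> = exp (1 / a) * (exp (- p) * exp (- q))" by (simp only: exp_add)
      finally have "exp (- a * norm x) / norm x \<le> exp (1 / a) * (exp (- p) * exp (- q)) / (p * q)"
        using pqn pq by (intro frac_le) auto
      then show ?case using n kv[OF elim(1)] kv[OF elim(2)] by (simp add: p_def q_def)
    qed
  qed measurable
qed

text \<open>Powers of the bound in \<open>K0_decay\<close> may be as singular as
  \<open>1 / norm x\<close> and remain integrable in the plane; at infinity the exponential absorbs
  the weight.\<close>

lemma Gr_weighted_power:
  assumes l: "l > 0" and m: "m > 0"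
  shows "integrable lebesgue (\<lambda>x. (1 + norm x)\<^sup>2 * Gr l x ^ (2 * m))"
proof -
  define a where "a = sqrt l"
  \<comment> \<open>Chosen so that the power \<open>2 * m\<close> of
    \<open>(r / 4) powr (- e)\<close> is \<open>4 / r\<close>.\<close>
  define e where "e = 1 / real (2 * m)"
  \<comment> \<open>The power decays like \<open>exp (- 4 * c * norm x)\<close> and the weight costs
    \<open>exp (2 * c * norm x)\<close>, which leaves \<open>exp (- 2 * c * norm x)\<close>.\<close>
  define c where "c = real m * a / 4"
  define C where "C = (1 + 1 / c)\<^sup>2 * (4 / (a * e ^ (2 * m)))"
  have a: "a > 0" using l by (simp add: a_def)
  have e: "e > 0" "e \<le> 1" using m by (auto simp: e_def)
  have c: "c > 0" using a m by (simp add: c_def)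
  have i: "integrable lebesgue (\<lambda>x::plane. C * (exp (- (2 * c) * norm x) / norm x))"
    using exp_over_norm_integrable[of "2 * c"] c
    by (intro integrable_mult_right) (subst integrable_completion, auto)
  have b: "AE x in lebesgue. norm ((1 + norm x)\<^sup>2 * Gr l x ^ (2 * m)) \<le> C * (exp (- (2 * c) * norm x) / norm x)"
    using AE_nonzero(2)
  proof eventually_elim
    case (elim x)
    define r where "r = a * norm x"
    have r: "r > 0" using a elim by (simp add: r_def)
    have K: "bessel_K0 r \<ge> 0" "bessel_K0 r \<le> exp (- r / 2) * (r / 4) powr (- e) / e"
      using K0_decay[OF r e] by auto
    have "Gr l x ^ (2 * m) \<le> bessel_K0 r ^ (2 * m)"
    proof (rule power_mono)
      have "Gr l x = bessel_K0 r / (2 * pi)" by (simp add: Gr_def r_def a_def)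
      also have "\<dots> \<le> bessel_K0 r / 1" using K pi_gt3 by (intro divide_left_mono) auto
      finally show "Gr l x \<le> bessel_K0 r" by simp
    qed (rule Gr_nonneg[OF l])
    also have "\<dots> \<le> (exp (- r / 2) * (r / 4) powr (- e) / e) ^ (2 * m)"
      by (intro power_mono K)
    also have "\<dots> = exp (- r / 2) ^ (2 * m) * ((r / 4) powr (- e)) ^ (2 * m) / e ^ (2 * m)"
      by (simp only: power_mult_distrib power_divide)
    also have "((r / 4) powr (- e)) ^ (2 * m) = 4 / r"
    proof -
      have "((r / 4) powr (- e)) ^ (2 * m) = (r / 4) powr (- e * real (2 * m))"
        using r by (subst powr_power) (auto simp: mult.commute)
      also have "- e * real (2 * m) = - 1" using m by (simp add: e_def)
      finally show ?thesis using r by (simp add: powr_minus)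
    qed
    also have "exp (- r / 2) ^ (2 * m) = exp (- (4 * c) * norm x)"
      by (simp add: exp_of_nat_mult[symmetric] c_def r_def)
    finally have G: "Gr l x ^ (2 * m) \<le> exp (- (4 * c) * norm x) * (4 / r) / e ^ (2 * m)" .
    have "1 + norm x \<le> (1 + 1 / c) * exp (c * norm x)"
    proof -
      have "1 + norm x \<le> (1 + 1 / c) * (1 + c * norm x)" using c by (simp add: field_simps)
      also have "\<dots> \<le> (1 + 1 / c) * exp (c * norm x)"
        using c exp_ge_add_one_self[of "c * norm x"] by (intro mult_left_mono) auto
      finally show ?thesis .
    qed
    then have "(1 + norm x)\<^sup>2 \<le> ((1 + 1 / c) * exp (c * norm x))\<^sup>2" by (intro power_mono) auto
    then have "(1 + norm x)\<^sup>2 * Gr l x ^ (2 * m)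
        \<le> ((1 + 1 / c) * exp (c * norm x))\<^sup>2 * (exp (- (4 * c) * norm x) * (4 / r) / e ^ (2 * m))"
      by (intro mult_mono G) auto
    also have "\<dots> = (1 + 1 / c)\<^sup>2 * ((exp (c * norm x) * exp (c * norm x)) * exp (- (4 * c) * norm x)) * (4 / r) / e ^ (2 * m)"
      by (simp add: power2_eq_square)
    also have "(exp (c * norm x) * exp (c * norm x)) * exp (- (4 * c) * norm x) = exp (- (2 * c) * norm x)"
      by (simp only: exp_add[symmetric]) simp
    also have "(1 + 1 / c)\<^sup>2 * exp (- (2 * c) * norm x) * (4 / r) / e ^ (2 * m) = C * (exp (- (2 * c) * norm x) / norm x)"
      by (simp add: C_def r_def mult_ac)
    finally show ?case by (simp add: Gr_nonneg[OF l])
  qed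
  show ?thesis
    by (rule integral_bound(1)[OF i _ b]) (intro borel_imp_lebesgue, measurable)
qed

lemma Gr_lebesgue [measurable]: "Gr l \<in> borel_measurable lebesgue"
  by (intro borel_imp_lebesgue Gr_borel)

lemma Gr_weighted_rL2:
  assumes "l > 0" shows "rL2 (\<lambda>x. (1 + norm x) * Gr l x)"
proof -
  have "(\<lambda>x. ((1 + norm x) * Gr l x)\<^sup>2) = (\<lambda>x. (1 + norm x)\<^sup>2 * Gr l x ^ (2 * 1))"
    by (simp add: power_mult_distrib)
  moreover have "(\<lambda>x. (1 + norm x) * Gr l x) \<in> borel_measurable lebesgue"
    by (intro borel_imp_lebesgue) measurable
  ultimately show ?thesis using Gr_weighted_power[OF assms, of 1] by (simp only: rL2_def)
qed

lemma Gr_power_rL2: assumes "l > 0" "m > 0" shows "rL2 (\<lambda>x. Gr l x ^ m)"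
proof (rule rL2_bound(1)[OF Gr_weighted_power[OF assms]])
  show "AE x in lebesgue. (Gr l x ^ m)\<^sup>2 \<le> (1 + norm x)\<^sup>2 * Gr l x ^ (2 * m)"
  proof (rule AE_I2)
    fix x :: plane
    have "1\<^sup>2 \<le> (1 + norm x)\<^sup>2" by (intro power_mono) auto
    then have "1 * Gr l x ^ (2 * m) \<le> (1 + norm x)\<^sup>2 * Gr l x ^ (2 * m)" by (intro mult_right_mono) auto
    then show "(Gr l x ^ m)\<^sup>2 \<le> (1 + norm x)\<^sup>2 * Gr l x ^ (2 * m)"
      by (simp add: power_mult[symmetric] mult.commute)
  qed
qed measurable

lemma Gr_rL2: "l > 0 \<Longrightarrow> rL2 (Gr l)"
  using Gr_power_rL2[of l 1] by simp

section \<open>The heat kernel, its semigroup and the fundamental solution\<close>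

lemma norm_vec2_sq: "(norm (vec2 a b))\<^sup>2 = a\<^sup>2 + b\<^sup>2"
  by (simp add: norm_vec_def L2_set_def sum_2)

text \<open>In coordinates the kernel is a product of two normal densities of variance
  \<open>2 * t\<close>.\<close>

lemma hk_integral:
  assumes t: "t > 0"
  shows "integrable lborel (hk t)" "(\<integral>x. hk t x \<partial>lborel) = 1"
proof -
  define nd where "nd = normal_density 0 (sqrt (2 * t))"
  have v: "hk t (vec2 a b) = nd a * nd b" for a b
  proof -
    have "sqrt (4 * (pi * t)) * sqrt (4 * (pi * t)) = 4 * (pi * t)" using t by simp
    moreover have "exp (- ((a\<^sup>2 + b\<^sup>2) / (4 * t))) = exp (- (a\<^sup>2 / (4 * t))) * exp (- (b\<^sup>2 / (4 * t)))"
      by (simp add: exp_add[symmetric] add_divide_distrib)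
    ultimately show ?thesis
      using t by (simp add: hk_def nd_def normal_density_def norm_vec2_sq mult_ac)
  qed
  have nn: "nd a \<ge> 0" for a by (simp add: nd_def)
  have [measurable]: "nd \<in> borel_measurable borel" by (simp add: nd_def)
  have N: "(\<integral>\<^sup>+a. ennreal (nd a) \<partial>lborel) = 1"
    using nn_integral_eq_integral[of lborel nd] t nn by (simp add: nd_def)
  have m [measurable]: "hk t \<in> borel_measurable borel" unfolding hk_def by measurable
  have "(\<lambda>x. ennreal (hk t x)) \<in> borel_measurable borel" by measurable
  from nn_integral_plane(1)[OF this]
  have I: "(\<integral>\<^sup>+x. ennreal (hk t x) \<partial>lborel) = 1"
    by (simp add: v ennreal_mult nn nn_integral_cmult nn_integral_multc N)
  show i: "integrable lborel (hk t)"
    by (rule integrableI_nonneg) (use I t in \<open>auto simp: hk_nonneg\<close>)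
  have "ennreal (\<integral>x. hk t x \<partial>lborel) = 1"
    using nn_integral_eq_integral[OF i] I t by (simp add: hk_nonneg)
  then show "(\<integral>x. hk t x \<partial>lborel) = 1" by simp
qed

text \<open>For \<open>y = norm x / sqrt t\<close>, the inequality
  \<open>y <= 2 * exp (y^2 / 8)\<close> trades the factor \<open>norm x\<close> for
  \<open>sqrt t\<close>, at the price of doubling the time.\<close>

lemma hk_moment:
  assumes t: "t > 0"
  shows "norm x * hk t x \<le> 4 * sqrt t * hk (2 * t) x"
proof -
  define y where "y = norm x / sqrt t"
  have y: "norm x = y * sqrt t" "y \<ge> 0" using t by (auto simp: y_def)
  have y2: "(norm x)\<^sup>2 / t = y\<^sup>2" using t by (simp add: y_def power_divide)
  have "y \<le> 2 * (1 + y\<^sup>2 / 8)" using zero_le_power2[of "y / 2 - 1"] by (simp add: power2_eq_square field_simps)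
  also have "\<dots> \<le> 2 * exp (y\<^sup>2 / 8)" by (intro mult_left_mono exp_ge_add_one_self) auto
  finally have "y * exp (- (y\<^sup>2 / 4)) \<le> 2 * exp (y\<^sup>2 / 8) * exp (- (y\<^sup>2 / 4))" by (intro mult_right_mono) auto
  also have "\<dots> = 2 * exp (- (y\<^sup>2 / 8))" by (simp add: mult.assoc exp_add[symmetric])
  finally have le: "y * exp (- (y\<^sup>2 / 4)) \<le> 2 * exp (- (y\<^sup>2 / 8))" .
  have h1: "hk t x = exp (- (y\<^sup>2 / 4)) / (4 * pi * t)" using y2 by (simp add: hk_def divide_divide_eq_left mult.commute flip: y2)
  have h2: "hk (2 * t) x = exp (- (y\<^sup>2 / 8)) / (8 * pi * t)" using y2 by (simp add: hk_def mult.commute flip: y2)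
  have "norm x * hk t x = sqrt t * (y * exp (- (y\<^sup>2 / 4))) / (4 * pi * t)" by (simp add: h1 y(1))
  also have "\<dots> \<le> sqrt t * (2 * exp (- (y\<^sup>2 / 8))) / (4 * pi * t)"
    using t by (intro divide_right_mono mult_left_mono le) auto
  also have "\<dots> = 4 * sqrt t * hk (2 * t) x" using t by (simp add: h2)
  finally show ?thesis .
qed

lemma smooth_coord: "smooth (\<lambda>x. x $ i)"
proof -
  have "((\<lambda>x::plane. x $ i) has_derivative (\<lambda>h. \<Sum>j\<in>UNIV. h $ j * (if j = i then 1 else 0))) (at x)" for x
  proof -
    have "(\<lambda>h::plane. \<Sum>j\<in>UNIV. h $ j * (if j = i then 1 else 0)) = (\<lambda>h. h $ i)"
      using exhaust_2[of i] by (auto simp: sum_2)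
    then show ?thesis by (simp add: bounded_linear_imp_has_derivative bounded_linear_vec_nth)
  qed
  then have "C_class (Suc k) (\<lambda>x. x $ i)" for k
    by (rule C_class_SucI[where d="\<lambda>j x. if j = i then 1 else 0"]) (rule C_class_const)
  then show ?thesis unfolding smooth_def using C_class_SucD by blast
qed

lemma hk_has_derivative:
  assumes t: "t > 0"
  shows "(hk t has_derivative (\<lambda>h. \<Sum>j\<in>UNIV. h $ j * ((- 1 / (2 * t)) * x $ j * hk t x))) (at x)"
proof -
  define E where "E s = exp (- (s / (4 * t))) / (4 * pi * t)" for s
  have hE: "hk t = (\<lambda>x. E (x \<bullet> x))" by (auto simp: hk_def E_def power2_norm_eq_inner)
  have D1: "DERIV E (x \<bullet> x) :> - 1 / (4 * t) * E (x \<bullet> x)"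
    unfolding E_def using t by (auto intro!: derivative_eq_intros)
  have D2: "((\<lambda>x. x \<bullet> x) has_derivative (\<lambda>h. 2 * (x \<bullet> h))) (at x)"
    by (auto intro!: derivative_eq_intros simp: inner_commute)
  have "((\<lambda>x. E (x \<bullet> x)) has_derivative (\<lambda>h. (- 1 / (4 * t) * E (x \<bullet> x)) * (2 * (x \<bullet> h)))) (at x)"
    by (rule has_derivative_compose[OF D2 D1[THEN has_field_derivative_imp_has_derivative]])
  then show ?thesis
    unfolding hE by (rule has_derivative_eq_rhs) (use t in \<open>auto simp: inner_vec_def sum_2 field_simps\<close>)
qed

lemma hk_smooth: assumes t: "t > 0" shows "smooth (hk t)"
proof -
  have "C_class k (hk t)" for k
  proof (induction k)
    case 0
    show ?case using has_derivative_continuous[OF hk_has_derivative[OF t]]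
      by (simp add: continuous_at_imp_continuous_on)
  next
    case (Suc k)
    show ?case
    proof (rule C_class_SucI[OF hk_has_derivative[OF t]])
      show "C_class k (\<lambda>x. - 1 / (2 * t) * x $ i * hk t x)" for i
        using smooth_coord[of i] Suc by (intro C_class_mult C_class_const) (auto simp: smooth_def)
    qed
  qed
  then show ?thesis by (simp add: smooth_def)
qed

lemma pd_hk: "t > 0 \<Longrightarrow> pd i (hk t) = (\<lambda>x. (- 1 / (2 * t)) * x $ i * hk t x)"
  by (intro ext pd_eq_sumI hk_has_derivative)

lemma laplace_hk:
  assumes t: "t > 0"
  shows "laplace (hk t) x = ((norm x)\<^sup>2 / (4 * t\<^sup>2) - 1 / t) * hk t x"
proof -
  have pc: "pd i (\<lambda>x. x $ i) = (\<lambda>x. 1)" for i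
  proof
    fix x :: plane
    have "pd i (\<lambda>x. x $ i) x = (axis i 1 :: plane) $ i"
      by (rule pd_eqI) (simp add: bounded_linear_imp_has_derivative bounded_linear_vec_nth)
    then show "pd i (\<lambda>x. x $ i) x = 1" by simp
  qed
  have c: "pd i (pd i (hk t)) x = ((x $ i)\<^sup>2 / (4 * t\<^sup>2) - 1 / (2 * t)) * hk t x" for i
  proof -
    have "pd i (pd i (hk t)) = pd i (\<lambda>x. (- 1 / (2 * t)) * (x $ i * hk t x))"
      by (simp add: pd_hk[OF t] mult.assoc)
    also have "\<dots> = (\<lambda>x. (- 1 / (2 * t)) * (x $ i * pd i (hk t) x + 1 * hk t x))"
      by (subst pd_cmult) (auto intro!: smooth_mult smooth_coord hk_smooth t simp: pd_mult smooth_coord hk_smooth t pc)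
    finally show ?thesis using t by (simp add: pd_hk[OF t] power2_eq_square field_simps)
  qed
  have n: "(norm x)\<^sup>2 = (x $ 1)\<^sup>2 + (x $ 2)\<^sup>2"
    by (simp add: norm_vec_def L2_set_def sum_2)
  show ?thesis
    unfolding laplace_def sum_2 c n using t by (simp add: field_simps)
qed

text \<open>The heat equation, by comparing the two explicit expressions.\<close>

lemma hk_DERIV:
  assumes t: "t > 0" shows "DERIV (\<lambda>t. hk t x) t :> laplace (hk t) x"
proof -
  have "DERIV (\<lambda>t. exp (- ((norm x)\<^sup>2 / (4 * t))) / (4 * pi * t)) t :>
     (exp (- ((norm x)\<^sup>2 / (4 * t))) * ((norm x)\<^sup>2 / (4 * t\<^sup>2)) * (4 * pi * t) - exp (- ((norm x)\<^sup>2 / (4 * t))) * (4 * pi)) / (4 * pi * t)\<^sup>2"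
    using t by (auto intro!: derivative_eq_intros simp: power2_eq_square field_simps)
  also have "(exp (- ((norm x)\<^sup>2 / (4 * t))) * ((norm x)\<^sup>2 / (4 * t\<^sup>2)) * (4 * pi * t) - exp (- ((norm x)\<^sup>2 / (4 * t))) * (4 * pi)) / (4 * pi * t)\<^sup>2
      = laplace (hk t) x"
    unfolding laplace_hk[OF t] using t by (simp add: hk_def power2_eq_square field_simps)
  finally show ?thesis by (simp add: hk_def)
qed

text \<open>The heat semigroup applied to \<open>\<eta>\<close>, evaluated at the origin. Other
  points are reached by reflecting and shifting the test function.\<close>

definition Pt :: "(plane \<Rightarrow> real) \<Rightarrow> real \<Rightarrow> real" where
  "Pt \<eta> t = (\<integral>x. hk t x * \<eta> x \<partial>lborel)"

lemma Pt_bound: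
  assumes t: "t > 0" and \<eta>: "\<eta> \<in> borel_measurable borel" "\<And>x. \<bar>\<eta> x\<bar> \<le> B"
  shows "integrable lborel (\<lambda>x. hk t x * \<eta> x)" "\<bar>Pt \<eta> t\<bar> \<le> B"
proof -
  have [measurable]: "hk t \<in> borel_measurable borel" "\<eta> \<in> borel_measurable borel"
    using \<eta> by (auto intro!: borel_measurable_continuous_onI smooth_continuous hk_smooth t)
  have i: "integrable lborel (\<lambda>x. B * hk t x)" using hk_integral(1)[OF t] by simp
  have b: "AE x in lborel. norm (hk t x * \<eta> x) \<le> B * hk t x"
    using \<eta>(2) hk_nonneg[OF t] by (auto simp: abs_mult mult.commute intro!: mult_right_mono)
  have m: "(\<lambda>x. hk t x * \<eta> x) \<in> borel_measurable lborel" by measurable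
  show "integrable lborel (\<lambda>x. hk t x * \<eta> x)" by (rule integral_bound(1)[OF i m b])
  show "\<bar>Pt \<eta> t\<bar> \<le> B"
    using integral_bound(2)[OF i m b] hk_integral(2)[OF t] by (simp add: Pt_def)
qed

text \<open>The Lipschitz bound on \<open>\<eta>\<close> and \<open>hk_moment\<close> give the
  explicit rate \<open>4 * B * sqrt t\<close>.\<close>

lemma Pt_limit:
  assumes \<eta>: "\<eta> \<in> test_functions"
  shows "((\<lambda>t. Pt \<eta> t) \<longlongrightarrow> \<eta> 0) (at_right 0)"
proof -
  obtain B where B: "B > 0" "\<And>x y. \<bar>\<eta> x - \<eta> y\<bar> \<le> B * norm (x - y)" using test_mvt[OF \<eta>] by blast
  obtain B' where B': "\<And>x. \<bar>\<eta> x\<bar> \<le> B'" using test_bounded[OF \<eta>] by blast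
  have \<eta>m [measurable]: "\<eta> \<in> borel_measurable borel" by (rule test_borel[OF \<eta>])
  have le: "\<bar>Pt \<eta> t - \<eta> 0\<bar> \<le> 4 * B * sqrt t" if t: "t > 0" for t
  proof -
    have [measurable]: "hk t \<in> borel_measurable borel"
      by (auto intro!: borel_measurable_continuous_onI smooth_continuous hk_smooth t)
    have i: "integrable lborel (\<lambda>x. (4 * B * sqrt t) * hk (2 * t) x)" using hk_integral(1)[of "2 * t"] t by simp
    have b: "AE x in lborel. norm (hk t x * \<eta> x - hk t x * \<eta> 0) \<le> (4 * B * sqrt t) * hk (2 * t) x"
    proof (rule AE_I2)
      fix x
      have "norm (hk t x * \<eta> x - hk t x * \<eta> 0) = hk t x * \<bar>\<eta> x - \<eta> 0\<bar>"
        using hk_nonneg[OF t, of x] by (simp add: right_diff_distrib[symmetric] abs_mult)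
      also have "\<dots> \<le> hk t x * (B * norm x)" using B(2)[of x 0] hk_nonneg[OF t] by (intro mult_left_mono) auto
      also have "\<dots> = B * (norm x * hk t x)" by simp
      also have "\<dots> \<le> B * (4 * sqrt t * hk (2 * t) x)" using hk_moment[OF t] B(1) by (intro mult_left_mono) auto
      finally show "norm (hk t x * \<eta> x - hk t x * \<eta> 0) \<le> (4 * B * sqrt t) * hk (2 * t) x" by simp
    qed
    have m: "(\<lambda>x. hk t x * \<eta> x - hk t x * \<eta> 0) \<in> borel_measurable lborel" by measurable
    have "norm (\<integral>x. hk t x * \<eta> x - hk t x * \<eta> 0 \<partial>lborel) \<le> (\<integral>x. (4 * B * sqrt t) * hk (2 * t) x \<partial>lborel)"
      by (rule integral_bound(2)[OF i m b])
    also have "\<dots> = 4 * B * sqrt t" using hk_integral(2)[of "2 * t"] t by simp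
    also have "(\<integral>x. hk t x * \<eta> x - hk t x * \<eta> 0 \<partial>lborel) = Pt \<eta> t - \<eta> 0"
      using Pt_bound(1)[OF t \<eta>m B'] hk_integral[OF t] by (simp add: Pt_def)
    finally show ?thesis by simp
  qed
  have "((\<lambda>t. Pt \<eta> t - \<eta> 0) \<longlongrightarrow> 0) (at_right 0)"
  proof (rule Lim_null_comparison)
    show "\<forall>\<^sub>F t in at_right 0. norm (Pt \<eta> t - \<eta> 0) \<le> 4 * B * sqrt t"
      using le by (auto simp: eventually_at_right_field intro!: exI[of _ 1])
    have "((\<lambda>t. 4 * B * sqrt t) \<longlongrightarrow> 4 * B * sqrt 0) (at_right 0)" by (intro tendsto_intros)
    then show "((\<lambda>t. 4 * B * sqrt t) \<longlongrightarrow> 0) (at_right 0)" by simp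
  qed
  then show ?thesis by (rule LIM_zero_cancel)
qed

text \<open>The support of \<open>\<eta>\<close> lies in a box, where differentiation under the
  integral is allowed. The heat equation turns the time derivative into
  \<open>laplace (hk t)\<close>, and integration by parts moves the Laplacian to
  \<open>\<eta>\<close>.\<close>

lemma Pt_DERIV:
  assumes \<eta>: "\<eta> \<in> test_functions" and t: "t > 0"
  shows "DERIV (Pt \<eta>) t :> Pt (laplace \<eta>) t"
proof -
  obtain R where R: "R > 0" "\<And>x. norm x > R \<Longrightarrow> \<eta> x = 0" using test_supp[OF \<eta>] by blast
  obtain a b :: plane where ab: "cball 0 R \<subseteq> cbox a b"
    using bounded_subset_cbox_symmetric[OF bounded_cball] by metis
  have out: "\<eta> x = 0" if "x \<notin> cbox a b" for x
    using that ab R(2)[of x] by (auto simp: subset_eq dist_norm not_le[symmetric])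
  have int: "integral (cbox a b) (\<lambda>x. f x * \<eta> x) = (\<integral>x. f x * \<eta> x \<partial>lborel)" if "smooth f" for f
  proof -
    have "integrable lborel (\<lambda>x. f x * \<eta> x)" by (intro test_integrable test_mult that \<eta>)
    from integral_lborel[OF this] have "integral UNIV (\<lambda>x. f x * \<eta> x) = (\<integral>x. f x * \<eta> x \<partial>lborel)" .
    moreover have "integral UNIV (\<lambda>x. f x * \<eta> x) = integral (cbox a b) (\<lambda>x. f x * \<eta> x)"
      by (subst integral_restrict_UNIV[symmetric]) (auto intro!: integral_cong simp: out)
    ultimately show ?thesis by simp
  qed
  have "((\<lambda>t. integral (cbox a b) (\<lambda>x. hk t x * \<eta> x)) has_field_derivative
      integral (cbox a b) (\<lambda>x. laplace (hk t) x * \<eta> x)) (at t within {0<..})"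
  proof (rule leibniz_rule_field_derivative)
    show "((\<lambda>t. hk t x * \<eta> x) has_field_derivative laplace (hk s) x * \<eta> x) (at s within {0<..})"
      if "s \<in> {0<..}" for s x
      by (rule has_field_derivative_at_within[OF DERIV_cmult_right[OF hk_DERIV]]) (use that in simp)
    show "(\<lambda>x. hk s x * \<eta> x) integrable_on cbox a b" if "s \<in> {0<..}" for s
      using that by (intro integrable_continuous continuous_on_mult smooth_continuous[OF hk_smooth] test_continuous[OF \<eta>]) simp
    have "continuous_on ({0<..} \<times> cbox a b) (\<lambda>z. ((norm (snd z))\<^sup>2 / (4 * (fst z)\<^sup>2) - 1 / fst z) * hk (fst z) (snd z) * \<eta> (snd z))"
      unfolding hk_def
      by (intro continuous_on_mult continuous_on_diff continuous_on_divide continuous_on_power continuous_on_norm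
          continuous_on_exp continuous_on_minus continuous_on_const continuous_on_fst continuous_on_snd continuous_on_id
          continuous_on_compose2[OF test_continuous[OF \<eta>, of UNIV] continuous_on_snd[OF continuous_on_id]]) auto
    then show "continuous_on ({0<..} \<times> cbox a b) (\<lambda>(s, x). laplace (hk s) x * \<eta> x)"
      by (rule continuous_on_eq) (auto simp: laplace_hk)
  qed (use t in auto)
  then have "((\<lambda>t. integral (cbox a b) (\<lambda>x. hk t x * \<eta> x)) has_field_derivative
      integral (cbox a b) (\<lambda>x. laplace (hk t) x * \<eta> x)) (at t)"
    using t by (simp add: at_within_open[of t "{0<..}"])
  also have "integral (cbox a b) (\<lambda>x. laplace (hk t) x * \<eta> x) = (\<integral>x. laplace (hk t) x * \<eta> x \<partial>lborel)"
    by (intro int smooth_laplace hk_smooth t)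
  also have "\<dots> = Pt (laplace \<eta>) t"
  proof -
    have s: "smooth (hk t)" "smooth (pd i (hk t))" for i by (auto intro: hk_smooth t smooth_pd)
    have ti: "integrable lborel (\<lambda>x. f x * g x)" if "smooth f" "g \<in> test_functions" for f g
      using that by (intro test_integrable test_mult)
    have "(\<integral>x. pd i (pd i (hk t)) x * \<eta> x \<partial>lborel) = (\<integral>x. hk t x * pd i (pd i \<eta>) x \<partial>lborel)" for i
      by (simp add: integral_by_parts s \<eta> test_pd)
    moreover have "(\<integral>x. laplace (hk t) x * \<eta> x \<partial>lborel)
        = (\<integral>x. pd 1 (pd 1 (hk t)) x * \<eta> x \<partial>lborel) + (\<integral>x. pd 2 (pd 2 (hk t)) x * \<eta> x \<partial>lborel)"
      using ti[OF smooth_pd[OF s(2)] \<eta>] by (simp add: laplace_def sum_2 distrib_right)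
    moreover have "Pt (laplace \<eta>) t
        = (\<integral>x. hk t x * pd 1 (pd 1 \<eta>) x \<partial>lborel) + (\<integral>x. hk t x * pd 2 (pd 2 \<eta>) x \<partial>lborel)"
      using ti[OF s(1) test_pd[OF test_pd[OF \<eta>]]] by (simp add: Pt_def laplace_def sum_2 distrib_left)
    ultimately show ?thesis by simp
  qed
  finally have D: "((\<lambda>t. integral (cbox a b) (\<lambda>x. hk t x * \<eta> x)) has_field_derivative Pt (laplace \<eta>) t) (at t)" .
  show ?thesis
    by (rule has_field_derivative_transform_within_open[OF D, of "{0<..}"])
      (use t int hk_smooth in \<open>auto simp: Pt_def\<close>)
qed

lemma measurable_LINT_Ioi:
  fixes k :: "real \<Rightarrow> plane \<Rightarrow> real"
  assumes [measurable]: "(\<lambda>z. k (snd z) (fst z)) \<in> borel_measurable (lborel \<Otimes>\<^sub>M lborel)"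
  shows "(\<lambda>x. LINT t:{0<..}|lborel. k t x) \<in> borel_measurable lborel"
proof -
  have "(\<lambda>z. indicator {0<..} (snd z) *\<^sub>R k (snd z) (fst z)) \<in> borel_measurable (lborel \<Otimes>\<^sub>M lborel)"
    by measurable
  then have "case_prod (\<lambda>x t. indicator {0<..} t *\<^sub>R k t x) \<in> borel_measurable (lborel \<Otimes>\<^sub>M lborel)"
    by (simp only: case_prod_beta')
  from lborel.borel_measurable_lebesgue_integral[OF this] show ?thesis
    by (simp only: set_lebesgue_integral_def)
qed

text \<open>The kernel is dominated by \<open>M x\<close> times the integrand of
  \<open>Gr_heat\<close>, so the absolute double integral is at most the integral of
  \<open>M * Gr l\<close>; this justifies exchanging the order.\<close>

lemma heat_superposition:
  fixes k :: "real \<Rightarrow> plane \<Rightarrow> real"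
  assumes l: "l > 0"
    and km [measurable]: "(\<lambda>z. k (fst z) (snd z)) \<in> borel_measurable (lborel \<Otimes>\<^sub>M lborel)"
    and b: "\<And>t x. t > 0 \<Longrightarrow> \<bar>k t x\<bar> \<le> M x * (exp (- l * t) * hk t x)"
    and M0: "\<And>x. M x \<ge> 0" and Mm [measurable]: "M \<in> borel_measurable borel"
    and Mi: "integrable lborel (\<lambda>x. M x * Gr l x)"
  shows "(\<integral>x. (LINT t:{0<..}|lborel. k t x) \<partial>lborel) = (LINT t:{0<..}|lborel. (\<integral>x. k t x \<partial>lborel))"
    "x \<noteq> 0 \<Longrightarrow> \<bar>LINT t:{0<..}|lborel. k t x\<bar> \<le> M x * Gr l x"
proof -
  define F where "F t x = indicator {0<..} t *\<^sub>R k t x" for t x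
  have b': "norm (F t x) \<le> indicator {0<..} t *\<^sub>R (M x * (exp (- l * t) * hk t x))" for t x
    using b[of t x] by (auto simp: F_def indicator_def)
  have Fm [measurable]: "(\<lambda>z. F (fst z) (snd z)) \<in> borel_measurable (lborel \<Otimes>\<^sub>M lborel)"
    unfolding F_def by measurable
  have Fx [measurable]: "(\<lambda>t. F t x) \<in> borel_measurable lborel" for x
  proof -
    have "(\<lambda>t. (t, x)) \<in> measurable lborel (lborel \<Otimes>\<^sub>M lborel)" by measurable
    from measurable_compose[OF this Fm] show ?thesis by simp
  qed
  have G: "integrable lborel (\<lambda>t. indicator {0<..} t *\<^sub>R (M x * (exp (- l * t) * hk t x)))"
    "(\<integral>t. indicator {0<..} t *\<^sub>R (M x * (exp (- l * t) * hk t x)) \<partial>lborel) = M x * Gr l x" if "x \<noteq> 0" for x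
  proof -
    have e: "indicator {0<..} t *\<^sub>R (M x * (exp (- l * t) * hk t x)) = M x * (indicator {0<..} t *\<^sub>R (exp (- l * t) * hk t x))" for t
      by simp
    show "integrable lborel (\<lambda>t. indicator {0<..} t *\<^sub>R (M x * (exp (- l * t) * hk t x)))"
      unfolding e using Gr_heat(1)[OF l that] unfolding set_integrable_def by (rule integrable_mult_right)
    show "(\<integral>t. indicator {0<..} t *\<^sub>R (M x * (exp (- l * t) * hk t x)) \<partial>lborel) = M x * Gr l x"
      unfolding e using Gr_heat(2)[OF l that] by (simp add: set_lebesgue_integral_def)
  qed
  show "\<bar>LINT t:{0<..}|lborel. k t x\<bar> \<le> M x * Gr l x" if "x \<noteq> 0" for x
    using integral_bound(2)[OF G(1)[OF that] Fx[of x]] b'[of _ x] G(2)[OF that]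
    by (simp add: set_lebesgue_integral_def F_def)
  have "(\<integral>\<^sup>+z. ennreal (norm (F (fst z) (snd z))) \<partial>(lborel \<Otimes>\<^sub>M lborel))
      = (\<integral>\<^sup>+x. \<integral>\<^sup>+t. ennreal (norm (F t x)) \<partial>lborel \<partial>lborel)"
  proof -
    have "(\<lambda>z. ennreal (norm (F (fst z) (snd z)))) \<in> borel_measurable (lborel \<Otimes>\<^sub>M lborel)" by measurable
    from lborel_pair.nn_integral_snd[OF this] show ?thesis by simp
  qed
  also have "\<dots> \<le> (\<integral>\<^sup>+x. ennreal (M x * Gr l x) \<partial>lborel)"
  proof (rule nn_integral_mono_AE)
    show "AE x in lborel. (\<integral>\<^sup>+t. ennreal (norm (F t x)) \<partial>lborel) \<le> ennreal (M x * Gr l x)"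
      using AE_nonzero(1)
    proof eventually_elim
      case (elim x)
      have "(\<integral>\<^sup>+t. ennreal (norm (F t x)) \<partial>lborel) \<le> (\<integral>\<^sup>+t. ennreal (indicator {0<..} t *\<^sub>R (M x * (exp (- l * t) * hk t x))) \<partial>lborel)"
        by (intro nn_integral_mono ennreal_leI b')
      also have "\<dots> = ennreal (M x * Gr l x)"
        unfolding G(2)[OF elim, symmetric]
        by (rule nn_integral_eq_integral[OF G(1)[OF elim]])
          (auto simp: indicator_def M0 intro!: mult_nonneg_nonneg hk_nonneg)
      finally show ?case .
    qed
  qed
  also have "\<dots> < \<infinity>"
    using nn_integral_eq_integral[OF Mi] M0 Gr_nonneg[OF l] by simp
  finally have "integrable (lborel \<Otimes>\<^sub>M lborel) (\<lambda>z. F (fst z) (snd z))"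
    by (intro integrableI_bounded Fm)
  then have "integrable (lborel \<Otimes>\<^sub>M lborel) (case_prod F)" by (simp add: case_prod_beta')
  from lborel_pair.Fubini_integral[OF this]
  have "(\<integral>x. \<integral>t. F t x \<partial>lborel \<partial>lborel) = (\<integral>t. \<integral>x. F t x \<partial>lborel \<partial>lborel)" .
  then show "(\<integral>x. (LINT t:{0<..}|lborel. k t x) \<partial>lborel) = (LINT t:{0<..}|lborel. (\<integral>x. k t x \<partial>lborel))"
    by (simp add: set_lebesgue_integral_def F_def)
qed

lemma rL2_mult_lborel:
  assumes "rL2 f" "rL2 g" "f \<in> borel_measurable borel" "g \<in> borel_measurable borel"
  shows "integrable lborel (\<lambda>x. f x * g x)"
  using rL2_mult_integrable[OF assms(1,2)] assms(3,4)
  by (subst (asm) integrable_completion) auto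

lemma hk_pair_test:
  assumes "\<zeta> \<in> borel_measurable borel"
  shows "(\<lambda>z. exp (- l * fst z) * hk (fst z) (snd z) * \<zeta> (snd z)) \<in> borel_measurable (lborel \<Otimes>\<^sub>M lborel)"
  using assms by measurable

lemma Gr_test_heat:
  assumes l: "l > 0" and \<zeta>: "\<zeta> \<in> test_functions"
  shows "(\<integral>x. Gr l x * \<zeta> x \<partial>lborel) = (LINT t:{0<..}|lborel. exp (- l * t) * Pt \<zeta> t)"
proof -
  have \<zeta>m [measurable]: "\<zeta> \<in> borel_measurable borel" by (rule test_borel[OF \<zeta>])
  have abs2: "rL2 (\<lambda>x. \<bar>\<zeta> x\<bar>)" using test_rL2[OF \<zeta>] by (auto simp: rL2_def)
  have e1: "(\<integral>x. Gr l x * \<zeta> x \<partial>lborel) = (\<integral>x. (LINT t:{0<..}|lborel. exp (- l * t) * hk t x * \<zeta> x) \<partial>lborel)"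
  proof (rule integral_cong_AE)
    show "(\<lambda>x. LINT t:{0<..}|lborel. exp (- l * t) * hk t x * \<zeta> x) \<in> borel_measurable lborel"
      by (rule measurable_LINT_Ioi) (unfold hk_def, measurable)
    show "AE x in lborel. Gr l x * \<zeta> x = (LINT t:{0<..}|lborel. exp (- l * t) * hk t x * \<zeta> x)"
      using AE_nonzero(1) by eventually_elim (simp add: Gr_heat(2)[OF l])
  qed measurable
  also have "\<dots> = (LINT t:{0<..}|lborel. (\<integral>x. exp (- l * t) * hk t x * \<zeta> x \<partial>lborel))"
  proof (rule heat_superposition(1)[OF l hk_pair_test[OF \<zeta>m], where M="\<lambda>x. \<bar>\<zeta> x\<bar>"])
    show "integrable lborel (\<lambda>x. \<bar>\<zeta> x\<bar> * Gr l x)"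
      by (rule rL2_mult_lborel[OF abs2 Gr_rL2[OF l]]) measurable
    show "\<bar>exp (- l * t) * hk t x * \<zeta> x\<bar> \<le> \<bar>\<zeta> x\<bar> * (exp (- l * t) * hk t x)" if "t > 0" for t x
      using hk_nonneg[OF that, of x] by (simp add: abs_mult)
  qed auto
  also have "\<dots> = (LINT t:{0<..}|lborel. exp (- l * t) * Pt \<zeta> t)"
    by (simp add: Pt_def mult.assoc)
  finally show ?thesis .
qed

lemma exp_tendsto_0: "l > 0 \<Longrightarrow> ((\<lambda>t::real. exp (- (l * t))) \<longlongrightarrow> 0) at_top"
  by (rule filterlim_compose[OF exp_at_bot])
    (auto intro!: filterlim_uminus_at_top[THEN iffD1] filterlim_tendsto_pos_mult_at_top[of _ l] filterlim_ident)

lemma exp_Ioi_integrable: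
  assumes l: "l > 0" shows "set_integrable lborel {0<..} (\<lambda>t::real. exp (- l * t))"
proof -
  have "set_integrable lborel (einterval 0 \<infinity>) (\<lambda>t. exp (- l * t))"
  proof (rule interval_integral_FTC_nonneg(1)[where F="\<lambda>t. - exp (- l * t) / l" and A="- 1 / l" and B=0])
    show "DERIV (\<lambda>t. - exp (- l * t) / l) t :> exp (- l * t)" for t
      using l by (auto intro!: derivative_eq_intros)
    have "((\<lambda>t. - exp (- l * t) / l) \<longlongrightarrow> - exp (- l * 0) / l) (at_right 0)"
      using l by (intro tendsto_intros) auto
    then show "(((\<lambda>t. - exp (- l * t) / l) \<circ> real_of_ereal) \<longlongrightarrow> - 1 / l) (at_right 0)"
      by (simp add: ereal_tendsto_simps zero_ereal_def)
    from tendsto_mult[OF tendsto_const exp_tendsto_0[OF l], of "- 1 / l"]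
    show "(((\<lambda>t. - exp (- l * t) / l) \<circ> real_of_ereal) \<longlongrightarrow> 0) (at_left \<infinity>)"
      by (simp add: ereal_tendsto_simps)
  qed (auto intro!: continuous_intros)
  then show ?thesis by (simp add: zero_ereal_def einterval_def greaterThan_def)
qed

lemma exp_Pt_isCont:
  "\<zeta> \<in> test_functions \<Longrightarrow> t > 0 \<Longrightarrow> isCont (\<lambda>t. exp (- l * t) * Pt \<zeta> t) t"
  by (intro continuous_intros DERIV_isCont[OF Pt_DERIV])

lemma exp_Pt_integrable:
  assumes l: "l > 0" and \<zeta>: "\<zeta> \<in> test_functions"
  shows "set_integrable lborel {0<..} (\<lambda>t. exp (- l * t) * Pt \<zeta> t)"
proof -
  obtain B where B: "\<And>x. \<bar>\<zeta> x\<bar> \<le> B" using test_bounded[OF \<zeta>] by blast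
  show ?thesis
    unfolding set_integrable_def
  proof (rule integral_bound(1))
  show "integrable lborel (\<lambda>t. B * (indicator {0<..} t *\<^sub>R exp (- l * t)))"
    using exp_Ioi_integrable[OF l] unfolding set_integrable_def by (rule integrable_mult_right)
  have "(\<lambda>t. indicator {0<..} t *\<^sub>R (exp (- l * t) * Pt \<zeta> t)) \<in> borel_measurable borel"
    by (rule borel_measurable_continuous_on_indicator[OF _ continuous_at_imp_continuous_on], simp,
      intro ballI exp_Pt_isCont[OF \<zeta>], simp)
  then show "(\<lambda>t. indicator {0<..} t *\<^sub>R (exp (- l * t) * Pt \<zeta> t)) \<in> borel_measurable lborel"
    unfolding measurable_lborel2 .
  have "\<bar>exp (- l * t) * Pt \<zeta> t\<bar> \<le> B * exp (- l * t)" if "t > 0" for t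
    using mult_left_mono[OF Pt_bound(2)[OF that test_borel[OF \<zeta>] B], of "exp (- l * t)"]
    by (simp add: abs_mult mult.commute)
  then show "AE t in lborel. norm (indicator {0<..} t *\<^sub>R (exp (- l * t) * Pt \<zeta> t)) \<le> B * (indicator {0<..} t *\<^sub>R exp (- l * t))"
    by (auto simp: indicator_def)
  qed
qed

text \<open>By \<open>Pt_DERIV\<close>, \<open>exp (- l * t) * Pt \<zeta> t\<close> is the
  derivative of \<open>- (exp (- l * t) * Pt \<eta> t)\<close>. The integral over all times is thus
  a difference of boundary values, which are \<open>- \<eta> 0\<close> at time 0 and 0 at
  infinity.\<close>

lemma Gr_fundamental:
  assumes l: "l > 0" and \<eta>: "\<eta> \<in> test_functions"
  shows "(LINT x|lebesgue. Gr l x * (l * \<eta> x - laplace \<eta> x)) = \<eta> 0"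
proof -
  define \<zeta> where "\<zeta> x = l * \<eta> x - laplace \<eta> x" for x
  have \<zeta>: "\<zeta> \<in> test_functions" unfolding \<zeta>_def by (intro test_diff test_cmult test_laplace \<eta>)
  have L\<eta>: "laplace \<eta> \<in> test_functions" by (rule test_laplace[OF \<eta>])
  obtain B1 where B1: "\<And>x. \<bar>\<eta> x\<bar> \<le> B1" using test_bounded[OF \<eta>] by blast
  obtain B2 where B2: "\<And>x. \<bar>laplace \<eta> x\<bar> \<le> B2" using test_bounded[OF L\<eta>] by blast
  have P\<zeta>: "Pt \<zeta> t = l * Pt \<eta> t - Pt (laplace \<eta>) t" if t: "t > 0" for t
    using Pt_bound(1)[OF t test_borel[OF \<eta>] B1] Pt_bound(1)[OF t test_borel[OF L\<eta>] B2]
    by (simp add: Pt_def \<zeta>_def right_diff_distrib mult.left_commute[of _ l])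
  have "(LBINT t=0..\<infinity>. exp (- l * t) * Pt \<zeta> t) = 0 - (- \<eta> 0)"
  proof (rule interval_integral_FTC_integrable[where F="\<lambda>t. - (exp (- l * t) * Pt \<eta> t)"])
    show "((\<lambda>t. - (exp (- l * t) * Pt \<eta> t)) has_vector_derivative exp (- l * t) * Pt \<zeta> t) (at t)"
      if "0 < ereal t" for t
    proof -
      have t: "t > 0" using that by (simp add: zero_ereal_def)
      have "DERIV (\<lambda>t. - (exp (- l * t) * Pt \<eta> t)) t :> - (exp (- l * t) * Pt (laplace \<eta>) t + (exp (- l * t) * (- l)) * Pt \<eta> t)"
        by (rule derivative_eq_intros Pt_DERIV[OF \<eta> t] refl)+ simp
      then show ?thesis
        by (simp add: has_real_derivative_iff_has_vector_derivative[symmetric] P\<zeta>[OF t] algebra_simps)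
    qed
    show "isCont (\<lambda>t. exp (- l * t) * Pt \<zeta> t) t" if "0 < ereal t" for t
      using that by (intro exp_Pt_isCont \<zeta>) (simp add: zero_ereal_def)
    show "set_integrable lborel (einterval 0 \<infinity>) (\<lambda>t. exp (- l * t) * Pt \<zeta> t)"
      using exp_Pt_integrable[OF l \<zeta>] by (simp add: zero_ereal_def einterval_def greaterThan_def)
    have "((\<lambda>t. - (exp (- l * t) * Pt \<eta> t)) \<longlongrightarrow> - (exp (- l * 0) * \<eta> 0)) (at_right 0)"
      by (intro tendsto_intros Pt_limit \<eta>)
    then show "(((\<lambda>t. - (exp (- l * t) * Pt \<eta> t)) \<circ> real_of_ereal) \<longlongrightarrow> - \<eta> 0) (at_right 0)"
      by (simp add: ereal_tendsto_simps zero_ereal_def)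
    have "((\<lambda>t. - (exp (- l * t) * Pt \<eta> t)) \<longlongrightarrow> 0) at_top"
    proof (rule Lim_null_comparison)
      show "\<forall>\<^sub>F t in at_top. norm (- (exp (- l * t) * Pt \<eta> t)) \<le> B1 * exp (- (l * t))"
        using eventually_gt_at_top[of 0]
      proof eventually_elim
        case (elim t)
        show ?case using mult_left_mono[OF Pt_bound(2)[OF elim test_borel[OF \<eta>] B1], of "exp (- l * t)"]
          by (simp add: abs_mult mult.commute)
      qed
      from tendsto_mult[OF tendsto_const exp_tendsto_0[OF l], of B1]
      show "((\<lambda>t. B1 * exp (- (l * t))) \<longlongrightarrow> 0) at_top" by simp
    qed
    then show "(((\<lambda>t. - (exp (- l * t) * Pt \<eta> t)) \<circ> real_of_ereal) \<longlongrightarrow> 0) (at_left \<infinity>)"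
      by (simp add: ereal_tendsto_simps)
  qed auto
  then have "(LINT t:{0<..}|lborel. exp (- l * t) * Pt \<zeta> t) = \<eta> 0"
    by (simp add: interval_lebesgue_integral_def zero_ereal_def einterval_def greaterThan_def)
  then have e: "(\<integral>x. Gr l x * \<zeta> x \<partial>lborel) = \<eta> 0" using Gr_test_heat[OF l \<zeta>] by simp
  have [measurable]: "\<zeta> \<in> borel_measurable borel" by (rule test_borel[OF \<zeta>])
  have "(\<lambda>x. Gr l x * \<zeta> x) \<in> borel_measurable borel" by measurable
  from lborel_lebesgue_integral[OF this] e show ?thesis by (simp only: \<zeta>_def)
qed

lemma laplace_reflect: "smooth \<eta> \<Longrightarrow> laplace (\<lambda>y. \<eta> (x - y)) y = laplace \<eta> (x - y)"
  using laplace_affine[of \<eta> "-1" x y] by (simp add: algebra_simps)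

text \<open>A test function is the convolution of \<open>Gr l\<close> with \<open>l * \<eta> - laplace \<eta>\<close>.\<close>

lemma test_sup_bound:
  assumes l: "l > 0" and \<eta>: "\<eta> \<in> test_functions"
  shows "(\<eta> x)\<^sup>2 \<le> sq (Gr l) * sq (\<lambda>y. l * \<eta> y - laplace \<eta> y)"
proof -
  define \<zeta> where "\<zeta> y = l * \<eta> y - laplace \<eta> y" for y
  have \<zeta>: "\<zeta> \<in> test_functions" unfolding \<zeta>_def by (intro test_diff test_cmult test_laplace \<eta>)
  have "\<eta> x = (LINT y|lebesgue. Gr l y * \<zeta> (x - y))"
    using Gr_fundamental[OF l test_reflect[OF \<eta>, of x]] by (simp add: laplace_reflect test_smooth \<eta> \<zeta>_def)
  then have "(\<eta> x)\<^sup>2 \<le> sq (Gr l) * sq (\<lambda>y. \<zeta> (x - y))"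
    using Cauchy_Schwarz_integral[OF Gr_rL2[OF l] test_rL2[OF test_reflect[OF \<zeta>]], of x] by simp
  also have "sq (\<lambda>y. \<zeta> (x - y)) = sq \<zeta>"
  proof -
    have [measurable]: "\<zeta> \<in> borel_measurable borel" by (rule test_borel[OF \<zeta>])
    have "sq (\<lambda>y. \<zeta> (x - y)) = (\<integral>y. (\<zeta> (x - y))\<^sup>2 \<partial>lborel)"
      unfolding sq_def by (rule lborel_lebesgue_integral) measurable
    also have "\<dots> = (\<integral>y. (\<zeta> y)\<^sup>2 \<partial>lborel)" by (rule lborel_reflect(1)[of "\<lambda>y. (\<zeta> y)\<^sup>2"]) measurable
    also have "\<dots> = sq \<zeta>"
      unfolding sq_def by (rule lborel_lebesgue_integral[symmetric]) measurable
    finally show ?thesis .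
  qed
  finally show ?thesis by (simp add: \<zeta>_def[abs_def])
qed

text \<open>The factor \<open>t\<close> gained by subtracting two exponentials later cancels the
  \<open>1 / t\<close> in the gradient of the heat kernel.\<close>

lemma exp_diff_bound:
  fixes a b m t :: real
  assumes "0 < m" "m \<le> a" "m \<le> b" "t > 0"
  shows "\<bar>exp (- a * t) - exp (- b * t)\<bar> \<le> \<bar>a - b\<bar> * t * exp (- m * t)"
proof -
  have *: "exp (- a * t) - exp (- b * t) \<le> (b - a) * t * exp (- m * t)" if "a \<le> b" "m \<le> a" for a b
  proof -
    have "exp (- a * t) - exp (- b * t) = exp (- a * t) * (1 - exp (- (b - a) * t))"
    proof -
      have "exp (- a * t) * exp (- (b - a) * t) = exp (- a * t + - (b - a) * t)" by (rule exp_add[symmetric])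
      also have "- a * t + - (b - a) * t = - b * t" by (simp add: algebra_simps)
      finally show ?thesis by (simp add: right_diff_distrib)
    qed
    also have "\<dots> \<le> exp (- a * t) * ((b - a) * t)"
    proof (intro mult_left_mono)
      show "1 - exp (- (b - a) * t) \<le> (b - a) * t"
        using exp_ge_add_one_self[of "- (b - a) * t"] by (simp add: algebra_simps)
    qed simp
    also have "\<dots> \<le> exp (- m * t) * ((b - a) * t)"
      using that assms(4) by (intro mult_right_mono) auto
    finally show ?thesis by (simp add: mult.commute)
  qed
  show ?thesis
  proof (cases "a \<le> b")
    case True
    then have "exp (- b * t) \<le> exp (- a * t)" using assms by simp
    then show ?thesis using *[OF True assms(2)] True by simp
  next
    case False
    then have "exp (- a * t) \<le> exp (- b * t)" using assms by simp
    then show ?thesis using *[of b a] False assms by simp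
  qed
qed

text \<open>Near the origin the gradient of a single Green function has size
  \<open>1 / norm x\<close>, not square integrable in the plane. In the heat integral of the
  difference, the gradient of \<open>hk t\<close> brings \<open>norm x / (2 * t)\<close> and
  \<open>exp_diff_bound\<close> brings \<open>t\<close>, so the gradient is dominated by a multiple
  of \<open>norm x * Gr w x\<close>.\<close>

lemma Gr_diff_weak:
  assumes l: "l > 0" and m: "m > 0"
  obtains g where "rL2 g" "rweak i (\<lambda>x. Gr l x - Gr m x) g"
proof -
  define c where "c t = exp (- l * t) - exp (- m * t)" for t
  define w where "w = min l m"
  have w: "w > 0" "w \<le> l" "w \<le> m" using l m by (auto simp: w_def)
  define K where "K t x = c t * ((- 1 / (2 * t)) * x $ i * hk t x)" for t x
  define g where "g x = (LINT t:{0<..}|lborel. K t x)" for x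
  define A where "A = \<bar>l - m\<bar> / 2"
  have A: "A \<ge> 0" by (simp add: A_def)
  have Km [measurable]: "(\<lambda>z. K (fst z) (snd z)) \<in> borel_measurable (lborel \<Otimes>\<^sub>M lborel)"
    unfolding K_def c_def by measurable
  have Kb: "\<bar>K t x\<bar> \<le> (A * norm x) * (exp (- w * t) * hk t x)" if t: "t > 0" for t x
  proof -
    have "\<bar>K t x\<bar> = \<bar>c t\<bar> * (1 / (2 * t) * \<bar>x $ i\<bar> * hk t x)"
      using t hk_nonneg[OF t, of x] by (simp add: K_def abs_mult)
    also have "\<dots> \<le> (\<bar>l - m\<bar> * t * exp (- w * t)) * (1 / (2 * t) * norm x * hk t x)"
      using t hk_nonneg[OF t, of x] component_le_norm_cart[of x i] exp_diff_bound[OF w t]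
      by (intro mult_mono mult_right_mono mult_left_mono) (auto simp: c_def)
    also have "\<dots> = (A * norm x) * (exp (- w * t) * hk t x)" using t by (simp add: A_def)
    finally show ?thesis .
  qed
  have wr: "rL2 (\<lambda>x. (1 + norm x) * Gr w x)" by (rule Gr_weighted_rL2[OF w(1)])
  have xr: "rL2 (\<lambda>x. norm x * Gr w x)"
  proof (rule rL2_bound(1)[OF rL2D(2)[OF wr]])
    show "(\<lambda>x. norm x * Gr w x) \<in> borel_measurable lebesgue" by (intro borel_imp_lebesgue) measurable
    have "norm x * Gr w x \<le> (1 + norm x) * Gr w x" for x :: plane
      using Gr_nonneg[OF w(1), of x] by (intro mult_right_mono) auto
    then show "AE x in lebesgue. (norm x * Gr w x)\<^sup>2 \<le> ((1 + norm x) * Gr w x)\<^sup>2"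
      using Gr_nonneg[OF w(1)] by (intro AE_I2 power_mono) auto
  qed
  have gb: "\<bar>g x\<bar> \<le> A * (norm x * Gr w x)" if "x \<noteq> 0" for x
  proof -
    \<comment> \<open>\<open>heat_superposition\<close> asks for a majorant integrable over the
      plane; restricting the kernel to the single point \<open>x\<close> makes this trivial.\<close>
    have "\<bar>LINT t:{0<..}|lborel. indicator {x} y *\<^sub>R K t y\<bar> \<le> (A * norm y * indicator {x} y) * Gr w y" if "y \<noteq> 0" for y
    proof (rule heat_superposition(2)[OF w(1) _ _ _ _ _ that])
      show "(\<lambda>z. indicator {x} (snd z) *\<^sub>R K (fst z) (snd z)) \<in> borel_measurable (lborel \<Otimes>\<^sub>M lborel)" by measurable
      show "\<bar>indicator {x} y *\<^sub>R K t y\<bar> \<le> (A * norm y * indicator {x} y) * (exp (- w * t) * hk t y)" if "t > 0" for t y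
        using Kb[OF that, of y] by (auto simp: indicator_def)
      have "(\<lambda>y. (A * norm y * indicator {x} y) * Gr w y) = (\<lambda>y. (A * norm x * Gr w x) * indicator {x} y)"
        by (auto simp: indicator_def)
      then show "integrable lborel (\<lambda>y. (A * norm y * indicator {x} y) * Gr w y)" by simp
    qed (use A in auto)
    from this[OF \<open>x \<noteq> 0\<close>] show ?thesis by (simp add: g_def)
  qed
  have gm: "g \<in> borel_measurable borel"
  proof -
    have "g \<in> borel_measurable lborel"
      unfolding g_def by (rule measurable_LINT_Ioi) (unfold K_def c_def hk_def, measurable)
    then show ?thesis by simp
  qed
  have g2: "rL2 g"
  proof (rule rL2_bound(1)[OF rL2D(2)[OF rL2_cmult[OF xr, of A]] borel_imp_lebesgue[OF gm]])
    show "AE x in lebesgue. (g x)\<^sup>2 \<le> (A * (norm x * Gr w x))\<^sup>2"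
      using AE_nonzero(2)
    proof eventually_elim
      case (elim x)
      show ?case using power_mono[OF gb[OF elim], of 2] by simp
    qed
  qed
  have D2: "rL2 (\<lambda>x. Gr l x - Gr m x)" by (intro rL2_diff Gr_rL2 l m)
  have "(LINT x|lebesgue. pd i \<eta> x * (Gr l x - Gr m x)) = - (LINT x|lebesgue. \<eta> x * g x)"
    if \<eta>: "\<eta> \<in> test_functions" for \<eta>
  proof -
    have p: "pd i \<eta> \<in> test_functions" by (rule test_pd[OF \<eta>])
    have [measurable]: "\<eta> \<in> borel_measurable borel" "pd i \<eta> \<in> borel_measurable borel"
      by (auto intro: test_borel \<eta> p)
    have gi: "integrable lborel (\<lambda>x. Gr a x * pd i \<eta> x)" if "a > 0" for a
      by (rule rL2_mult_lborel[OF Gr_rL2[OF that] test_rL2[OF p]]) measurable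
    have iH: "set_integrable lborel {0<..} (\<lambda>t. exp (- a * t) * Pt (pd i \<eta>) t)" if "a > 0" for a
      by (rule exp_Pt_integrable[OF that p])
    have "(LINT x|lebesgue. pd i \<eta> x * (Gr l x - Gr m x)) = (\<integral>x. Gr l x * pd i \<eta> x - Gr m x * pd i \<eta> x \<partial>lborel)"
    proof -
      have "(\<lambda>x. pd i \<eta> x * (Gr l x - Gr m x)) \<in> borel_measurable borel" by measurable
      from lborel_lebesgue_integral[OF this] show ?thesis by (simp add: algebra_simps)
    qed
    also have "\<dots> = (\<integral>x. Gr l x * pd i \<eta> x \<partial>lborel) - (\<integral>x. Gr m x * pd i \<eta> x \<partial>lborel)"
      using gi l m by simp
    also have "\<dots> = (LINT t:{0<..}|lborel. exp (- l * t) * Pt (pd i \<eta>) t - exp (- m * t) * Pt (pd i \<eta>) t)"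
      using iH[OF l] iH[OF m] by (simp add: Gr_test_heat l m p)
    also have "\<dots> = (LINT t:{0<..}|lborel. - (\<integral>x. K t x * \<eta> x \<partial>lborel))"
    proof (rule set_lebesgue_integral_cong)
      show "\<forall>t. t \<in> {0<..} \<longrightarrow> exp (- l * t) * Pt (pd i \<eta>) t - exp (- m * t) * Pt (pd i \<eta>) t = - (\<integral>x. K t x * \<eta> x \<partial>lborel)"
      proof safe
        fix t :: real assume "t > 0"
        have "(\<integral>x. K t x * \<eta> x \<partial>lborel) = (\<integral>x. c t * (pd i (hk t) x * \<eta> x) \<partial>lborel)"
          by (rule Bochner_Integration.integral_cong) (auto simp: K_def pd_hk[OF \<open>t > 0\<close>])
        also have "\<dots> = c t * (\<integral>x. pd i (hk t) x * \<eta> x \<partial>lborel)" by simp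
        also have "\<dots> = - (c t * Pt (pd i \<eta>) t)"
          using integral_by_parts[OF hk_smooth[OF \<open>t > 0\<close>] \<eta>, of i] by (simp add: Pt_def)
        finally show "exp (- l * t) * Pt (pd i \<eta>) t - exp (- m * t) * Pt (pd i \<eta>) t = - (\<integral>x. K t x * \<eta> x \<partial>lborel)"
          by (simp add: c_def left_diff_distrib)
      qed
    qed simp
    also have "\<dots> = - (LINT t:{0<..}|lborel. (\<integral>x. K t x * \<eta> x \<partial>lborel))"
      by (simp add: set_lebesgue_integral_def)
    also have "(LINT t:{0<..}|lborel. (\<integral>x. K t x * \<eta> x \<partial>lborel)) = (\<integral>x. (LINT t:{0<..}|lborel. K t x * \<eta> x) \<partial>lborel)"
    proof (rule heat_superposition(1)[OF w(1), where M="\<lambda>x. A * norm x * \<bar>\<eta> x\<bar>", symmetric])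
      show "(\<lambda>z. K (fst z) (snd z) * \<eta> (snd z)) \<in> borel_measurable (lborel \<Otimes>\<^sub>M lborel)" by measurable
      show "\<bar>K t x * \<eta> x\<bar> \<le> A * norm x * \<bar>\<eta> x\<bar> * (exp (- w * t) * hk t x)" if "t > 0" for t x
        using mult_right_mono[OF Kb[OF that, of x], of "\<bar>\<eta> x\<bar>"] by (simp add: abs_mult mult_ac)
      have "rL2 (\<lambda>x. \<bar>\<eta> x\<bar>)" using test_rL2[OF \<eta>] by (auto simp: rL2_def)
      from rL2_mult_lborel[OF this rL2_cmult[OF xr, of A]]
      show "integrable lborel (\<lambda>x. A * norm x * \<bar>\<eta> x\<bar> * Gr w x)" by (simp add: mult_ac)
    qed (use A in auto)
    also have "\<dots> = (\<integral>x. \<eta> x * g x \<partial>lborel)" by (simp add: g_def mult.commute)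
    also have "\<dots> = (LINT x|lebesgue. \<eta> x * g x)"
    proof -
      have [measurable]: "g \<in> borel_measurable borel" by (rule gm)
      have "(\<lambda>x. \<eta> x * g x) \<in> borel_measurable borel" by measurable
      from lborel_lebesgue_integral[OF this] show ?thesis by (rule sym)
    qed
    finally show ?thesis .
  qed
  then have "rweak i (\<lambda>x. Gr l x - Gr m x) g"
    by (simp add: rweak_def rL2_rL1loc D2 g2)
  with g2 show ?thesis by (rule that)
qed

section \<open>Interior regularity for the screened Poisson equation\<close>

text \<open>\<open>moll n\<close> has radius at most 1, so on the ball of radius \<open>S\<close>
  only values of \<open>F\<close> in the ball of radius \<open>S + 1\<close> are seen. This
  localises L2 approximation.\<close>

lemma conv_loc:
  assumes "norm x \<le> S"
  shows "conv (moll n) F x = conv (moll n) (loc (S + 1) F) x"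
proof -
  have "moll n (x - y) * F y = moll n (x - y) * loc (S + 1) F y" for y
  proof (cases "norm (x - y) \<le> 1")
    case True
    then have "norm y \<le> S + 1" using assms norm_triangle_ineq2[of y x] by (simp add: norm_minus_commute)
    then show ?thesis by (simp add: loc_def dist_norm)
  next
    case False
    have "1 / real (Suc n) \<le> 1" by simp
    then have "moll n (x - y) = 0" using False by (intro moll_outside) linarith
    then show ?thesis by simp
  qed
  then have "(\<lambda>y. moll n (x - y) * F y) = (\<lambda>y. moll n (x - y) * loc (S + 1) F y)" by (rule ext)
  then show ?thesis by (simp only: conv_def)
qed

lemma loc_rL1loc:
  assumes "F \<in> borel_measurable lebesgue" "\<And>R. rL2 (loc R F)" shows "rL1loc F"
proof -
  have "set_integrable lebesgue (cball 0 R) F" for R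
  proof -
    have "set_integrable lebesgue (cball 0 R) (loc R F)"
      using rL2_rL1loc[OF assms(2)[of R]] by (simp add: rL1loc_def)
    moreover have "(\<lambda>x. indicator (cball 0 R) x *\<^sub>R loc R F x) = (\<lambda>x. indicator (cball 0 R) x *\<^sub>R F x)"
      by (auto simp: loc_def indicator_def)
    ultimately show ?thesis by (simp only: set_integrable_def)
  qed
  with assms(1) show ?thesis by (simp add: rL1loc_def)
qed

lemma pd_cong_ball:
  assumes "\<And>y. norm y < R \<Longrightarrow> f y = g y" "norm x < R" "smooth g"
  shows "pd i f x = pd i g x"
proof -
  have "(f has_derivative (\<lambda>h. \<Sum>j\<in>UNIV. h $ j * pd j g x)) (at x)"
    by (rule has_derivative_transform_within_open[OF smooth_has_derivative[OF assms(3)], of "ball 0 R"])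
      (use assms in \<open>auto simp: dist_norm\<close>)
  then show ?thesis by (rule pd_eq_sumI)
qed

text \<open>Cauchy-Schwarz on a ball containing the support of \<open>\<eta>\<close>.\<close>

lemma LINT_test_tendsto:
  assumes \<eta>: "\<eta> \<in> test_functions" and R: "\<And>x. norm x > R \<Longrightarrow> \<eta> x = 0"
    and u: "\<And>n. rL2 (loc R (u n))" "rL2 (loc R v)" and lim: "(\<lambda>n. sq (loc R (\<lambda>x. u n x - v x))) \<longlonglongrightarrow> 0"
  shows "(\<lambda>n. LINT x|lebesgue. \<eta> x * u n x) \<longlonglongrightarrow> (LINT x|lebesgue. \<eta> x * v x)"
proof -
  have l: "\<eta> x * w x = \<eta> x * loc R w x" for w x
    using R[of x] by (cases "norm x \<le> R") (auto simp: loc_def dist_norm)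
  have i: "integrable lebesgue (\<lambda>x. \<eta> x * u n x)" "integrable lebesgue (\<lambda>x. \<eta> x * v x)" for n
    unfolding l[of _ "u n"] l[of _ v] by (intro rL2_mult_integrable test_rL2 \<eta> u)+
  have ld: "loc R (\<lambda>x. u n x - v x) = (\<lambda>x. loc R (u n) x - loc R v x)" for n
    by (auto simp: loc_def right_diff_distrib)
  have d2: "rL2 (loc R (\<lambda>x. u n x - v x))" for n unfolding ld by (intro rL2_diff u)
  have b: "((LINT x|lebesgue. \<eta> x * u n x) - (LINT x|lebesgue. \<eta> x * v x))\<^sup>2 \<le> sq \<eta> * sq (loc R (\<lambda>x. u n x - v x))" for n
  proof -
    have "(LINT x|lebesgue. \<eta> x * u n x) - (LINT x|lebesgue. \<eta> x * v x) = (LINT x|lebesgue. \<eta> x * (u n x - v x))"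
      using i by (simp add: right_diff_distrib)
    also have "\<dots> = (LINT x|lebesgue. \<eta> x * loc R (\<lambda>x. u n x - v x) x)" by (simp only: l[of _ "\<lambda>x. u n x - v x"])
    finally show ?thesis using Cauchy_Schwarz_integral[OF test_rL2[OF \<eta>] d2[of n]] by simp
  qed
  have "(\<lambda>n. sq \<eta> * sq (loc R (\<lambda>x. u n x - v x))) \<longlonglongrightarrow> sq \<eta> * 0" by (intro tendsto_intros lim)
  then have s: "(\<lambda>n. sqrt (sq \<eta> * sq (loc R (\<lambda>x. u n x - v x)))) \<longlonglongrightarrow> 0"
    using tendsto_real_sqrt by fastforce
  have "(\<lambda>n. (LINT x|lebesgue. \<eta> x * u n x) - (LINT x|lebesgue. \<eta> x * v x)) \<longlonglongrightarrow> 0"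
    by (rule Lim_null_comparison[OF always_eventually s]) (use b in \<open>auto intro: real_le_rsqrt\<close>)
  then show ?thesis by (rule LIM_zero_cancel)
qed

text \<open>\<open>cutT R F (grad f) f\<close> is \<open>(l - laplace) (chiR R * f)\<close> whenever \<open>(l - laplace) f = F\<close>.\<close>

definition cutT :: "real \<Rightarrow> (plane \<Rightarrow> real) \<Rightarrow> (2 \<Rightarrow> plane \<Rightarrow> real) \<Rightarrow> (plane \<Rightarrow> real) \<Rightarrow> plane \<Rightarrow> real" where
  "cutT R a b c x = chiR R x * a x - 2 * (\<Sum>i\<in>UNIV. pd i (chiR R) x * b i x) - laplace (chiR R) x * c x"

lemma cutT_diff:
  "cutT R a b c x - cutT R a' b' c' x = cutT R (\<lambda>x. a x - a' x) (\<lambda>i x. b i x - b' i x) (\<lambda>x. c x - c' x) x"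
  by (simp add: cutT_def sum_2 algebra_simps)

lemma cutT_bound:
  assumes R: "R > 0"
  obtains C where "\<And>a b c. a \<in> borel_measurable lebesgue \<Longrightarrow> rL2 (loc (3 * R) a) \<Longrightarrow> (\<And>i. rL2 (b i)) \<Longrightarrow> rL2 c \<Longrightarrow>
    rL2 (cutT R a b c) \<and> sq (cutT R a b c) \<le> 2 * sq (loc (3 * R) a) + C * (sq (b 1) + sq (b 2) + sq c)"
proof -
  obtain B where B: "B > 0" "\<And>R i x. R > 0 \<Longrightarrow> \<bar>pd i (chiR R) x\<bar> \<le> B / R"
    "\<And>R x. R > 0 \<Longrightarrow> \<bar>laplace (chiR R) x\<bar> \<le> B / R\<^sup>2" using pd_chiR_bound by metis
  define K where "K = B / R + B / R\<^sup>2"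
  have K0: "B / R \<ge> 0" "B / R\<^sup>2 \<ge> 0" using B R by auto
  have K: "\<bar>pd i (chiR R) x\<bar> \<le> K" "\<bar>laplace (chiR R) x\<bar> \<le> K" for i x
    using B(2)[OF R, of i x] B(3)[OF R, of x] K0 by (auto simp: K_def)
  have t: "chiR R \<in> test_functions" by (rule chiR_test[OF R])
  \<comment> \<open>The constant 32 is \<open>2 * 2 * 4 * 2\<close>: three splittings of a sum, each
    doubling, and the square of the factor 2 before the gradient terms.\<close>
  show ?thesis
  proof (rule that[of "32 * K\<^sup>2"])
    fix a c :: "plane \<Rightarrow> real" and b :: "2 \<Rightarrow> plane \<Rightarrow> real"
    assume am: "a \<in> borel_measurable lebesgue" and a: "rL2 (loc (3 * R) a)" and b: "\<And>i. rL2 (b i)" and c: "rL2 c"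
    have e1: "chiR R x * a x = chiR R x * loc (3 * R) a x" for x
      using chiR_outside[OF R, of x] by (cases "norm x \<le> 3 * R") (auto simp: loc_def dist_norm)
    have cb: "\<bar>chiR R x\<bar> \<le> 1" for x using chiR_bounds[of R x] by simp
    have r1: "rL2 (\<lambda>x. chiR R x * a x)" "sq (\<lambda>x. chiR R x * a x) \<le> 1\<^sup>2 * sq (loc (3 * R) a)"
      unfolding e1 by (rule rL2_bounded_mult[OF a borel_imp_lebesgue[OF test_borel[OF t]] cb])+
    have r2: "rL2 (\<lambda>x. pd i (chiR R) x * b i x)" "sq (\<lambda>x. pd i (chiR R) x * b i x) \<le> K\<^sup>2 * sq (b i)" for i
      by (rule rL2_bounded_mult[OF b borel_imp_lebesgue[OF test_borel[OF test_pd[OF t]]] K(1)])+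
    have r3: "rL2 (\<lambda>x. laplace (chiR R) x * c x)" "sq (\<lambda>x. laplace (chiR R) x * c x) \<le> K\<^sup>2 * sq c"
      by (rule rL2_bounded_mult[OF c borel_imp_lebesgue[OF test_borel[OF test_laplace[OF t]]] K(2)])+
    define v where "v x = pd 1 (chiR R) x * b 1 x + pd 2 (chiR R) x * b 2 x" for x
    define w where "w x = 2 * v x + laplace (chiR R) x * c x" for x
    have v: "rL2 v" "sq v \<le> 2 * (K\<^sup>2 * sq (b 1)) + 2 * (K\<^sup>2 * sq (b 2))"
    proof -
      show "rL2 v" unfolding v_def by (rule rL2_add(1)[OF r2(1) r2(1)])
      show "sq v \<le> 2 * (K\<^sup>2 * sq (b 1)) + 2 * (K\<^sup>2 * sq (b 2))"
        using rL2_add(2)[OF r2(1)[of 1] r2(1)[of 2]] r2(2)[of 1] r2(2)[of 2] unfolding v_def by linarith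
    qed
    have w: "rL2 w" "sq w \<le> 2 * (4 * sq v) + 2 * (K\<^sup>2 * sq c)"
    proof -
      show "rL2 w" unfolding w_def by (rule rL2_add(1)[OF rL2_cmult[OF v(1)] r3(1)])
      show "sq w \<le> 2 * (4 * sq v) + 2 * (K\<^sup>2 * sq c)"
        using rL2_add(2)[OF rL2_cmult[OF v(1), of 2] r3(1)] r3(2) sq_cmult[of 2 v] unfolding w_def by simp
    qed
    have T: "cutT R a b c = (\<lambda>x. chiR R x * a x - w x)" by (auto simp: cutT_def w_def v_def sum_2)
    have "sq (cutT R a b c) \<le> 2 * sq (loc (3 * R) a) + 2 * sq w"
      using rL2_diff(2)[OF r1(1) w(1)] r1(2) unfolding T by simp
    also have "2 * sq w \<le> 32 * (K\<^sup>2 * sq (b 1)) + 32 * (K\<^sup>2 * sq (b 2)) + 4 * (K\<^sup>2 * sq c)"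
      using w(2) v(2) by linarith
    also have "\<dots> \<le> 32 * (K\<^sup>2 * sq (b 1)) + 32 * (K\<^sup>2 * sq (b 2)) + 32 * (K\<^sup>2 * sq c)"
      by (simp add: sq_nonneg mult_right_mono)
    finally have "sq (cutT R a b c) \<le> 2 * sq (loc (3 * R) a) + 32 * K\<^sup>2 * (sq (b 1) + sq (b 2) + sq c)"
      by (simp add: algebra_simps)
    moreover have "rL2 (cutT R a b c)" unfolding T by (rule rL2_diff(1)[OF r1(1) w(1)])
    ultimately show "rL2 (cutT R a b c) \<and> sq (cutT R a b c) \<le> 2 * sq (loc (3 * R) a) + 32 * K\<^sup>2 * (sq (b 1) + sq (b 2) + sq c)"
      by blast
  qed
qed

text \<open>The weak equation \<open>(l - laplace) f = F\<close> with \<open>f\<close> globally in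
  \<open>W12\<close> but \<open>F\<close> only locally square integrable, because in the application
  its coefficient grows logarithmically. Every estimate therefore passes through the cutoffs
  \<open>chiR R\<close>.\<close>

locale screened_poisson =
  fixes f :: "plane \<Rightarrow> real" and g :: "2 \<Rightarrow> plane \<Rightarrow> real" and F :: "plane \<Rightarrow> real" and l :: real
  assumes l: "l > 0" and f: "rL2 f" and g: "\<And>i. rL2 (g i)" and w: "\<And>i. rweak i f (g i)"
    and Fm: "F \<in> borel_measurable lebesgue" and F: "\<And>R. rL2 (loc R F)"
    and eq: "\<And>\<eta>. \<eta> \<in> test_functions \<Longrightarrow>
      (LINT x|lebesgue. (l * \<eta> x - laplace \<eta> x) * f x) = (LINT x|lebesgue. \<eta> x * F x)"
begin

definition "fn n = conv (moll n) f"
definition "gn n i = conv (moll n) (g i)"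
definition "Fn n = conv (moll n) F"

lemma f1: "rL1loc f" by (rule rL2_rL1loc[OF f])
lemma F1: "rL1loc F" by (rule loc_rL1loc[OF Fm F])

lemma fn_smooth: "smooth (fn n)" unfolding fn_def by (rule conv_smooth[OF moll_test f1])
lemma gn_smooth: "smooth (gn n i)" unfolding gn_def by (rule conv_smooth[OF moll_test rL2_rL1loc[OF g]])
lemma Fn_smooth: "smooth (Fn n)" unfolding Fn_def by (rule conv_smooth[OF moll_test F1])

lemma pd_fn: "pd i (fn n) = gn n i"
  unfolding fn_def gn_def by (simp add: pd_conv[OF moll_test f1] conv_weak[OF w moll_test])

text \<open>Testing with the reflected mollifier turns the weak equation into a pointwise one for
  the mollified functions.\<close>

lemma fn_eq: "l * fn n x - laplace (fn n) x = Fn n x"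
proof -
  have t: "moll n \<in> test_functions" by (rule moll_test)
  have lap: "laplace (fn n) x = conv (laplace (moll n)) f x"
  proof -
    have "pd i (pd i (fn n)) = conv (pd i (pd i (moll n))) f" for i
      unfolding fn_def by (simp add: pd_conv f1 t test_pd)
    then have "laplace (fn n) x = conv (pd 1 (pd 1 (moll n))) f x + conv (pd 2 (pd 2 (moll n))) f x"
      by (simp add: laplace_def sum_2)
    also have "\<dots> = conv (laplace (moll n)) f x"
      using test_mult_integrable[OF test_reflect[OF test_pd[OF test_pd[OF t]]] f1]
      by (simp add: conv_def laplace_def sum_2 distrib_right)
    finally show ?thesis .
  qed
  have "l * fn n x - laplace (fn n) x
      = (LINT y|lebesgue. (l * moll n (x - y) - laplace (\<lambda>y. moll n (x - y)) y) * f y)"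
    using test_mult_integrable[OF test_reflect[OF t] f1, of x] test_mult_integrable[OF test_reflect[OF test_laplace[OF t]] f1, of x]
    unfolding lap by (simp add: fn_def conv_def laplace_reflect test_smooth t left_diff_distrib mult.assoc)
  also have "\<dots> = Fn n x"
    unfolding Fn_def conv_def by (rule eq[OF test_reflect[OF t]])
  finally show ?thesis .
qed

lemma cut_fn:
  assumes R: "R > 0"
  shows "l * (chiR R x * fn n x) - laplace (\<lambda>x. chiR R x * fn n x) x = cutT R (Fn n) (gn n) (fn n) x"
  unfolding cutT_def fn_eq[symmetric] pd_fn[symmetric]
  by (simp add: laplace_mult test_smooth[OF chiR_test[OF R]] fn_smooth algebra_simps)

lemma cut_test: "R > 0 \<Longrightarrow> (\<lambda>x. chiR R x * fn n x) \<in> test_functions"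
  using test_mult[OF fn_smooth chiR_test] by (simp add: mult.commute)

lemma fn_rL2: "rL2 (fn n)" "rL2 (gn n i)" "rL2 (loc R (Fn n))"
  unfolding fn_def gn_def
  by (rule conv_moll_rL2[OF f] conv_moll_rL2[OF g] continuous_loc_rL2[OF smooth_continuous[OF Fn_smooth]])+

lemma Fn_tendsto: "(\<lambda>n. sq (loc R (\<lambda>x. Fn n x - F x))) \<longlonglongrightarrow> 0"
proof (rule tendsto_sandwich[OF _ _ tendsto_const conv_moll_L2[OF F[of "R + 1"]]])
  show "\<forall>\<^sub>F n in sequentially. sq (loc R (\<lambda>x. Fn n x - F x)) \<le> sq (\<lambda>x. conv (moll n) (loc (R + 1) F) x - loc (R + 1) F x)"
  proof (rule always_eventually, rule allI)
    fix n
    have d: "rL2 (\<lambda>x. conv (moll n) (loc (R + 1) F) x - loc (R + 1) F x)"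
      by (intro rL2_diff conv_moll_rL2 F)
    have "AE x in lebesgue. (loc R (\<lambda>x. Fn n x - F x) x)\<^sup>2 \<le> (conv (moll n) (loc (R + 1) F) x - loc (R + 1) F x)\<^sup>2"
    proof (rule AE_I2)
      fix x
      show "(loc R (\<lambda>x. Fn n x - F x) x)\<^sup>2 \<le> (conv (moll n) (loc (R + 1) F) x - loc (R + 1) F x)\<^sup>2"
        using conv_loc[of x R n F] by (cases "norm x \<le> R") (auto simp: loc_def[of R] loc_def[of "R+1" F x] dist_norm Fn_def)
    qed
    moreover have "loc R (\<lambda>x. Fn n x - F x) \<in> borel_measurable lebesgue"
      by (intro loc_meas borel_measurable_diff Fm borel_imp_lebesgue borel_measurable_continuous_onI smooth_continuous[OF Fn_smooth])
    ultimately show "sq (loc R (\<lambda>x. Fn n x - F x)) \<le> sq (\<lambda>x. conv (moll n) (loc (R + 1) F) x - loc (R + 1) F x)"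
      using rL2_bound(2)[OF rL2D(2)[OF d]] by (simp add: sq_def)
  qed
qed (auto simp: sq_nonneg)

text \<open>\<open>W R\<close> is formally \<open>(l - laplace) (chiR R * f)\<close>. It contains
  \<open>f\<close> and its first derivatives only, so it is square integrable before any second
  derivative is known.\<close>

definition "Wn R n = cutT R (Fn n) (gn n) (fn n)"
definition "W R = cutT R F g f"

lemma W_rL2: "R > 0 \<Longrightarrow> rL2 (Wn R n)" "R > 0 \<Longrightarrow> rL2 (W R)"
proof -
  assume R: "R > 0"
  obtain C where C: "\<And>a b c. a \<in> borel_measurable lebesgue \<Longrightarrow> rL2 (loc (3 * R) a) \<Longrightarrow> (\<And>i. rL2 (b i)) \<Longrightarrow> rL2 c \<Longrightarrow>
    rL2 (cutT R a b c) \<and> sq (cutT R a b c) \<le> 2 * sq (loc (3 * R) a) + C * (sq (b 1) + sq (b 2) + sq c)"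
    using cutT_bound[OF R] by blast
  show "rL2 (Wn R n)" unfolding Wn_def
    using C[of "Fn n" "gn n" "fn n", OF borel_imp_lebesgue[OF borel_measurable_continuous_onI[OF smooth_continuous[OF Fn_smooth]]] fn_rL2(3) fn_rL2(2) fn_rL2(1)] by blast
  show "rL2 (W R)" unfolding W_def using C[of F g f, OF Fm F g f] by blast
qed

text \<open>Global convergence of \<open>fn\<close> and \<open>gn\<close> handles the commutator
  terms, and the cutoff confines \<open>F\<close> to the ball of radius \<open>3 * R\<close>, where
  local convergence is enough.\<close>

lemma W_tendsto:
  assumes R: "R > 0" shows "(\<lambda>n. sq (\<lambda>x. Wn R n x - W R x)) \<longlonglongrightarrow> 0"
proof -
  obtain C where C: "\<And>a b c. a \<in> borel_measurable lebesgue \<Longrightarrow> rL2 (loc (3 * R) a) \<Longrightarrow> (\<And>i. rL2 (b i)) \<Longrightarrow> rL2 c \<Longrightarrow>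
    rL2 (cutT R a b c) \<and> sq (cutT R a b c) \<le> 2 * sq (loc (3 * R) a) + C * (sq (b 1) + sq (b 2) + sq c)"
    using cutT_bound[OF R] by blast
  define d1 d2 d3 where "d1 n = (\<lambda>x. Fn n x - F x)" and "d2 n = (\<lambda>i x. gn n i x - g i x)" and "d3 n = (\<lambda>x. fn n x - f x)" for n
  have e: "(\<lambda>x. Wn R n x - W R x) = cutT R (d1 n) (d2 n) (d3 n)" for n
    by (auto simp: Wn_def W_def cutT_diff d1_def d2_def d3_def)
  have ld: "loc R (d1 n) = (\<lambda>x. loc R (Fn n) x - loc R F x)" for R n
    by (auto simp: loc_def d1_def right_diff_distrib)
  have bd: "sq (cutT R (d1 n) (d2 n) (d3 n)) \<le> 2 * sq (loc (3 * R) (d1 n)) + C * (sq (d2 n 1) + sq (d2 n 2) + sq (d3 n))" for n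
  proof (rule C[THEN conjunct2])
    show "d1 n \<in> borel_measurable lebesgue" unfolding d1_def
      by (intro borel_measurable_diff Fm borel_imp_lebesgue borel_measurable_continuous_onI smooth_continuous[OF Fn_smooth])
    show "rL2 (loc (3 * R) (d1 n))" unfolding ld by (intro rL2_diff fn_rL2 F)
    show "rL2 (d2 n i)" for i unfolding d2_def by (intro rL2_diff fn_rL2 g)
    show "rL2 (d3 n)" unfolding d3_def by (intro rL2_diff fn_rL2 f)
  qed
  have "(\<lambda>n. 2 * sq (loc (3 * R) (d1 n)) + C * (sq (d2 n 1) + sq (d2 n 2) + sq (d3 n))) \<longlonglongrightarrow> 2 * 0 + C * (0 + 0 + 0)"
    unfolding d1_def d2_def d3_def gn_def fn_def
    by (intro tendsto_intros Fn_tendsto conv_moll_L2 g f)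
  then have lim: "(\<lambda>n. 2 * sq (loc (3 * R) (d1 n)) + C * (sq (d2 n 1) + sq (d2 n 2) + sq (d3 n))) \<longlonglongrightarrow> 0" by simp
  show ?thesis unfolding e
    by (rule Lim_null_comparison[OF always_eventually lim]) (use bd in \<open>simp add: sq_nonneg\<close>)
qed

lemma W_Cauchy:
  assumes R: "R > 0" and e: "e > 0"
  shows "\<exists>N. \<forall>m\<ge>N. \<forall>n\<ge>N. sq (\<lambda>x. Wn R m x - Wn R n x) \<le> e"
proof -
  have "eventually (\<lambda>n. sq (\<lambda>x. Wn R n x - W R x) < e / 4) sequentially"
    by (rule order_tendstoD(2)[OF W_tendsto[OF R]]) (use e in simp)
  then obtain N where N: "\<And>n. n \<ge> N \<Longrightarrow> sq (\<lambda>x. Wn R n x - W R x) < e / 4"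
    by (auto simp: eventually_sequentially)
  have "sq (\<lambda>x. Wn R m x - Wn R n x) \<le> e" if "m \<ge> N" "n \<ge> N" for m n
  proof -
    have "sq (\<lambda>x. (Wn R m x - W R x) - (Wn R n x - W R x)) \<le> 2 * sq (\<lambda>x. Wn R m x - W R x) + 2 * sq (\<lambda>x. Wn R n x - W R x)"
      by (intro rL2_diff W_rL2 R)
    then show ?thesis using N[OF that(1)] N[OF that(2)] by simp
  qed
  then show ?thesis by blast
qed

lemma fn_Cauchy:
  assumes e: "e > 0"
  shows "\<exists>N. \<forall>m\<ge>N. \<forall>n\<ge>N. sq (\<lambda>x. fn m x - fn n x) \<le> e"
proof -
  have "eventually (\<lambda>n. sq (\<lambda>x. fn n x - f x) < e / 4) sequentially"
    unfolding fn_def by (rule order_tendstoD(2)[OF conv_moll_L2[OF f]]) (use e in simp)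
  then obtain N where N: "\<And>n. n \<ge> N \<Longrightarrow> sq (\<lambda>x. fn n x - f x) < e / 4"
    by (auto simp: eventually_sequentially)
  have "sq (\<lambda>x. fn m x - fn n x) \<le> e" if "m \<ge> N" "n \<ge> N" for m n
  proof -
    have "sq (\<lambda>x. (fn m x - f x) - (fn n x - f x)) \<le> 2 * sq (\<lambda>x. fn m x - f x) + 2 * sq (\<lambda>x. fn n x - f x)"
      by (intro rL2_diff fn_rL2 f)
    then show ?thesis using N[OF that(1)] N[OF that(2)] by simp
  qed
  then show ?thesis by blast
qed

definition "\<delta> R m n x = chiR R x * fn m x - chiR R x * fn n x"

lemma \<delta>_test: "R > 0 \<Longrightarrow> \<delta> R m n \<in> test_functions"
  unfolding \<delta>_def by (intro test_diff cut_test)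

lemma \<delta>_eq:
  assumes R: "R > 0"
  shows "l * \<delta> R m n x - laplace (\<delta> R m n) x = Wn R m x - Wn R n x"
  using cut_fn[OF R, of x m] cut_fn[OF R, of x n]
    laplace_diff[OF test_smooth[OF cut_test[OF R, of m]] test_smooth[OF cut_test[OF R, of n]], of x]
  by (simp add: \<delta>_def[abs_def] Wn_def right_diff_distrib)

text \<open>\<open>hessian_le_laplace\<close> for the test function \<open>\<delta> S m n\<close>,
  whose Laplacian is \<open>l * \<delta> S m n\<close> minus a difference of two \<open>Wn\<close>;
  both parts are small in L2.\<close>

lemma hessian_Cauchy:
  assumes e: "e > 0"
  shows "\<exists>N. \<forall>m\<ge>N. \<forall>n\<ge>N. sq (loc R (\<lambda>x. pd j (gn m i) x - pd j (gn n i) x)) \<le> e"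
proof -
  \<comment> \<open>Strictly larger than \<open>R\<close>: the ball of radius \<open>R\<close> then
    lies in the open ball where the cutoff is 1, and there the partials of \<open>\<delta>\<close>
    agree with those of the uncut difference.\<close>
  define S where "S = \<bar>R\<bar> + 1"
  have S: "S > 0" by (simp add: S_def)
  obtain N1 where N1: "\<And>m n. m \<ge> N1 \<Longrightarrow> n \<ge> N1 \<Longrightarrow> sq (\<lambda>x. Wn S m x - Wn S n x) \<le> e / 4"
    using W_Cauchy[OF S, of "e / 4"] e by auto
  obtain N2 where N2: "\<And>m n. m \<ge> N2 \<Longrightarrow> n \<ge> N2 \<Longrightarrow> sq (\<lambda>x. fn m x - fn n x) \<le> e / (4 * l\<^sup>2)"
    using fn_Cauchy[of "e / (4 * l\<^sup>2)"] e l by auto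
  have "sq (loc R (\<lambda>x. pd j (gn m i) x - pd j (gn n i) x)) \<le> e" if mn: "m \<ge> max N1 N2" "n \<ge> max N1 N2" for m n
  proof -
    have t: "\<delta> S m n \<in> test_functions" by (rule \<delta>_test[OF S])
    define d where "d x = fn m x - fn n x" for x
    have ds: "smooth d" unfolding d_def by (intro smooth_diff fn_smooth)
    have dd: "\<delta> S m n y = d y" if "norm y < S" for y
      using chiR_1[OF S, of y] that by (simp add: \<delta>_def d_def)
    have p1: "pd i (\<delta> S m n) y = pd i d y" if "norm y < S" for y
      by (rule pd_cong_ball[OF dd that ds])
    have p2: "pd j (pd i (\<delta> S m n)) y = pd j (pd i d) y" if "norm y < S" for y
      by (rule pd_cong_ball[OF p1 that smooth_pd[OF ds]])
    have p3: "pd j (pd i d) y = pd j (gn m i) y - pd j (gn n i) y" for y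
      unfolding d_def by (simp add: pd_diff fn_smooth gn_smooth pd_fn)
    have "AE x in lebesgue. (loc R (\<lambda>x. pd j (gn m i) x - pd j (gn n i) x) x)\<^sup>2 \<le> (pd j (pd i (\<delta> S m n)) x)\<^sup>2"
    proof (rule AE_I2)
      fix x
      show "(loc R (\<lambda>x. pd j (gn m i) x - pd j (gn n i) x) x)\<^sup>2 \<le> (pd j (pd i (\<delta> S m n)) x)\<^sup>2"
        using p2[of x] p3[of x] by (cases "norm x \<le> R") (auto simp: loc_def dist_norm S_def)
    qed
    then have "sq (loc R (\<lambda>x. pd j (gn m i) x - pd j (gn n i) x)) \<le> sq (pd j (pd i (\<delta> S m n)))"
      unfolding sq_def[of "pd j (pd i (\<delta> S m n))"]
      by (rule rL2_bound(2)[OF rL2D(2)[OF test_rL2[OF test_pd[OF test_pd[OF t]]]], rotated])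
        (intro loc_meas borel_measurable_diff borel_imp_lebesgue borel_measurable_continuous_onI smooth_continuous[OF smooth_pd[OF gn_smooth]])
    also have "\<dots> \<le> sq (laplace (\<delta> S m n))"
    proof -
      have "sq h = (\<integral>x. (h x)\<^sup>2 \<partial>lborel)" if "h \<in> test_functions" for h
        unfolding sq_def by (rule lborel_lebesgue_integral) (intro borel_measurable_power test_borel that)
      then show ?thesis using hessian_le_laplace[OF t] by (simp add: test_pd test_laplace t)
    qed
    also have "\<dots> = sq (\<lambda>x. l * \<delta> S m n x - (Wn S m x - Wn S n x))"
      by (simp add: \<delta>_eq[OF S, symmetric])
    also have "\<dots> \<le> 2 * (l\<^sup>2 * sq (\<delta> S m n)) + 2 * sq (\<lambda>x. Wn S m x - Wn S n x)"
      unfolding sq_cmult[symmetric]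
      by (rule rL2_diff(2)[OF rL2_cmult[OF test_rL2[OF t]] rL2_diff(1)[OF W_rL2(1)[OF S] W_rL2(1)[OF S]]])
    also have "\<dots> \<le> 2 * (l\<^sup>2 * (e / (4 * l\<^sup>2))) + 2 * (e / 4)"
    proof (intro add_mono mult_left_mono)
      have "sq (\<delta> S m n) = sq (\<lambda>x. chiR S x * d x)" by (simp add: \<delta>_def[abs_def] d_def right_diff_distrib)
      also have "\<dots> \<le> 1\<^sup>2 * sq d"
        by (rule rL2_bounded_mult(2)[OF _ borel_imp_lebesgue[OF test_borel[OF chiR_test[OF S]]]])
          (unfold d_def, rule rL2_diff(1)[OF fn_rL2(1) fn_rL2(1)], use chiR_bounds[of S] in simp)
      also have "\<dots> \<le> e / (4 * l\<^sup>2)" using N2[of m n] mn by (simp add: d_def[abs_def])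
      finally show "sq (\<delta> S m n) \<le> e / (4 * l\<^sup>2)" .
      show "sq (\<lambda>x. Wn S m x - Wn S n x) \<le> e / 4" using N1[of m n] mn by simp
    qed auto
    also have "\<dots> = e" using l by simp
    finally show ?thesis .
  qed
  then show ?thesis by blast
qed

text \<open>Second derivatives of the mollifications have a local L2 limit \<open>h\<close>, and
  both sides of their integration by parts converge against a compactly supported test
  function.\<close>

lemma second_derivative:
  obtains h where "h \<in> borel_measurable lebesgue" "\<And>R. rL2 (loc R h)" "rweak j (g i) h"
proof -
  obtain h where h: "h \<in> borel_measurable lebesgue" "\<And>R. rL2 (loc R h)"
    "\<And>R. (\<lambda>n. sq (loc R (\<lambda>x. pd j (gn n i) x - h x))) \<longlonglongrightarrow> 0"
    using L2loc_complete[of "\<lambda>n. pd j (gn n i)", OF smooth_continuous[OF smooth_pd[OF gn_smooth]] hessian_Cauchy] by blast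
  have "(LINT x|lebesgue. pd j \<eta> x * g i x) = - (LINT x|lebesgue. \<eta> x * h x)" if \<eta>: "\<eta> \<in> test_functions" for \<eta>
  proof -
    obtain R where R: "\<And>x. norm x > R \<Longrightarrow> \<eta> x = 0" using test_supp[OF \<eta>] by blast
    have R': "\<And>x. norm x > R \<Longrightarrow> pd j \<eta> x = 0" using pd_zero_outside[of R \<eta> _ j] R by blast
    have "(\<lambda>n. LINT x|lebesgue. \<eta> x * pd j (gn n i) x) \<longlonglongrightarrow> (LINT x|lebesgue. \<eta> x * h x)"
      by (rule LINT_test_tendsto[OF \<eta> R continuous_loc_rL2[OF smooth_continuous[OF smooth_pd[OF gn_smooth]]] h(2) h(3)])
    moreover have "(\<lambda>n. LINT x|lebesgue. pd j \<eta> x * gn n i x) \<longlonglongrightarrow> (LINT x|lebesgue. pd j \<eta> x * g i x)"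
    proof (rule LINT_test_tendsto[OF test_pd[OF \<eta>] R' continuous_loc_rL2[OF smooth_continuous[OF gn_smooth]]])
      have lg: "loc R v = (\<lambda>x. indicator (cball 0 R) x * v x)" for v by (auto simp: loc_def)
      have ib: "\<bar>indicator (cball 0 R) x\<bar> \<le> (1::real)" for x :: plane by (simp add: indicator_def)
      show "rL2 (loc R (g i))" unfolding lg by (rule rL2_bounded_mult(1)[OF g rL2D(1)[OF ind_rL2] ib])
      show "(\<lambda>n. sq (loc R (\<lambda>x. gn n i x - g i x))) \<longlonglongrightarrow> 0"
      proof (rule tendsto_sandwich[OF _ _ tendsto_const conv_moll_L2[OF g[of i]]])
        show "\<forall>\<^sub>F n in sequentially. sq (loc R (\<lambda>x. gn n i x - g i x)) \<le> sq (\<lambda>x. conv (moll n) (g i) x - g i x)"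
          unfolding lg gn_def
          using rL2_bounded_mult(2)[OF rL2_diff(1)[OF conv_moll_rL2(1)[OF g] g] rL2D(1)[OF ind_rL2] ib]
          by (intro always_eventually) simp
      qed (auto simp: sq_nonneg)
    qed
    moreover have "(LINT x|lebesgue. pd j \<eta> x * gn n i x) = - (LINT x|lebesgue. \<eta> x * pd j (gn n i) x)" for n
      using rweak_smooth[OF gn_smooth, of j n i] \<eta> by (simp add: rweak_def)
    ultimately have "(\<lambda>n. LINT x|lebesgue. \<eta> x * pd j (gn n i) x) \<longlonglongrightarrow> - (LINT x|lebesgue. pd j \<eta> x * g i x)"
      using tendsto_minus_cancel_left by fastforce
    with \<open>(\<lambda>n. LINT x|lebesgue. \<eta> x * pd j (gn n i) x) \<longlonglongrightarrow> (LINT x|lebesgue. \<eta> x * h x)\<close>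
    have "(LINT x|lebesgue. \<eta> x * h x) = - (LINT x|lebesgue. pd j \<eta> x * g i x)" by (rule LIMSEQ_unique)
    then show ?thesis by simp
  qed
  then have "rweak j (g i) h"
    unfolding rweak_def using rL2_rL1loc[OF g] loc_rL1loc[OF h(1,2)] by blast
  with h(1,2) show ?thesis by (rule that)
qed

text \<open>\<open>test_sup_bound\<close> for \<open>\<delta> R m n\<close> turns the L2 Cauchy
  property of \<open>Wn\<close> into a uniform one.\<close>

lemma fn_uniform:
  assumes R: "R > 0" and e: "e > 0"
  shows "\<exists>N. \<forall>m\<ge>N. \<forall>n\<ge>N. \<forall>x\<in>cball 0 R. dist (fn m x) (fn n x) < e"
proof -
  define G where "G = sq (Gr l)"
  have G: "G \<ge> 0" by (simp add: G_def sq_nonneg)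
  define d where "d = (e / 2)\<^sup>2 / (G + 1)"
  have d: "d > 0" using e G by (simp add: d_def)
  obtain N where N: "\<And>m n. m \<ge> N \<Longrightarrow> n \<ge> N \<Longrightarrow> sq (\<lambda>x. Wn R m x - Wn R n x) \<le> d"
    using W_Cauchy[OF R d] by blast
  have "dist (fn m x) (fn n x) < e" if mn: "m \<ge> N" "n \<ge> N" and x: "x \<in> cball 0 R" for m n x
  proof -
    have "(fn m x - fn n x)\<^sup>2 = (\<delta> R m n x)\<^sup>2"
      using chiR_1[OF R, of x] x by (simp add: \<delta>_def dist_norm)
    also have "\<dots> \<le> G * sq (\<lambda>x. Wn R m x - Wn R n x)"
      using test_sup_bound[OF l \<delta>_test[OF R, of m n], of x] by (simp add: \<delta>_eq[OF R] G_def)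
    also have "\<dots> \<le> (G + 1) * d" using N[OF mn] G d by (intro mult_mono) (auto simp: sq_nonneg)
    also have "\<dots> = (e / 2)\<^sup>2" using G by (simp add: d_def)
    finally have "\<bar>fn m x - fn n x\<bar> \<le> e / 2" using e by (simp add: abs_le_square_iff[symmetric])
    then show ?thesis using e by (simp add: dist_real_def)
  qed
  then show ?thesis by blast
qed

text \<open>The continuous representative of \<open>f\<close>; the limit exists everywhere by local
  uniform convergence.\<close>

definition "\<phi> x = lim (\<lambda>n. fn n x)"

lemma \<phi>_uniform: "R > 0 \<Longrightarrow> uniform_limit (cball 0 R) fn \<phi> sequentially"
proof -
  assume R: "R > 0"
  have "uniformly_Cauchy_on (cball 0 R) fn"
    unfolding uniformly_Cauchy_on_def using fn_uniform[OF R] by blast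
  then have "uniformly_convergent_on (cball 0 R) fn" by (rule Cauchy_uniformly_convergent)
  then show ?thesis unfolding uniformly_convergent_uniform_limit_iff \<phi>_def[abs_def] .
qed

lemma \<phi>_tendsto: "(\<lambda>n. fn n x) \<longlonglongrightarrow> \<phi> x"
  by (rule tendsto_uniform_limitI[OF \<phi>_uniform[of "norm x + 1"]]) (auto simp: dist_norm add_nonneg_pos)

lemma \<phi>_continuous: "continuous_on UNIV \<phi>"
proof -
  have "isCont \<phi> x" for x
  proof -
    have "continuous_on (cball 0 (norm x + 1)) \<phi>"
      by (rule uniform_limit_theorem[OF _ \<phi>_uniform])
        (auto intro!: always_eventually smooth_continuous fn_smooth simp: add_nonneg_pos)
    then have "continuous_on (ball 0 (norm x + 1)) \<phi>" by (rule continuous_on_subset) auto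
    then show ?thesis by (simp add: continuous_on_eq_continuous_at dist_norm)
  qed
  then show ?thesis by (simp add: continuous_at_imp_continuous_on)
qed

lemma \<phi>_AE: "AE x in lebesgue. f x = \<phi> x"
proof -
  obtain r :: "nat \<Rightarrow> nat" where r: "strict_mono r" "AE x in lebesgue. (\<lambda>n. fn (r n) x - f x) \<longlonglongrightarrow> 0"
    using sq_AE_subseq[OF rL2_diff(1)[OF conv_moll_rL2(1)[OF f] f] conv_moll_L2[OF f]] unfolding fn_def by blast
  show ?thesis using r(2)
  proof eventually_elim
    case (elim x)
    then have "(\<lambda>n. fn (r n) x) \<longlonglongrightarrow> f x" by (simp add: LIM_zero_iff)
    moreover have "(\<lambda>n. fn (r n) x) \<longlonglongrightarrow> \<phi> x"
      using LIMSEQ_subseq_LIMSEQ[OF \<phi>_tendsto r(1)] by (simp add: comp_def)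
    ultimately show ?case by (rule LIMSEQ_unique)
  qed
qed

text \<open>The fundamental solution evaluates \<open>chiR R * fn n\<close> at the origin; the limit
  in \<open>n\<close> uses that \<open>Gr l\<close> is square integrable.\<close>

lemma \<phi>_0_cut:
  assumes R: "R > 0" shows "\<phi> 0 = (LINT x|lebesgue. Gr l x * W R x)"
proof -
  have i: "integrable lebesgue (\<lambda>x. Gr l x * Wn R n x)" "integrable lebesgue (\<lambda>x. Gr l x * W R x)" for n
    by (intro rL2_mult_integrable Gr_rL2 l W_rL2 R)+
  have "fn n 0 = (LINT x|lebesgue. Gr l x * Wn R n x)" for n
    using Gr_fundamental[OF l cut_test[OF R, of n]] chiR_1[OF R, of 0] R by (simp add: cut_fn[OF R] Wn_def)
  then have t1: "(\<lambda>n. LINT x|lebesgue. Gr l x * Wn R n x) \<longlonglongrightarrow> \<phi> 0" using \<phi>_tendsto[of 0] by simp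
  have b: "((LINT x|lebesgue. Gr l x * Wn R n x) - (LINT x|lebesgue. Gr l x * W R x))\<^sup>2
      \<le> sq (Gr l) * sq (\<lambda>x. Wn R n x - W R x)" for n
  proof -
    have "(LINT x|lebesgue. Gr l x * Wn R n x) - (LINT x|lebesgue. Gr l x * W R x) = (LINT x|lebesgue. Gr l x * (Wn R n x - W R x))"
      using i by (simp add: right_diff_distrib)
    then show ?thesis
      using Cauchy_Schwarz_integral[OF Gr_rL2[OF l] rL2_diff(1)[OF W_rL2(1)[OF R] W_rL2(2)[OF R]]] by simp
  qed
  have "(\<lambda>n. sq (Gr l) * sq (\<lambda>x. Wn R n x - W R x)) \<longlonglongrightarrow> sq (Gr l) * 0" by (intro tendsto_intros W_tendsto R)
  then have s: "(\<lambda>n. sqrt (sq (Gr l) * sq (\<lambda>x. Wn R n x - W R x))) \<longlonglongrightarrow> 0"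
    using tendsto_real_sqrt by fastforce
  have "(\<lambda>n. (LINT x|lebesgue. Gr l x * Wn R n x) - (LINT x|lebesgue. Gr l x * W R x)) \<longlonglongrightarrow> 0"
    by (rule Lim_null_comparison[OF always_eventually s]) (use b in \<open>auto intro: real_le_rsqrt\<close>)
  then have "(\<lambda>n. LINT x|lebesgue. Gr l x * Wn R n x) \<longlonglongrightarrow> (LINT x|lebesgue. Gr l x * W R x)" by (rule LIM_zero_cancel)
  with t1 show ?thesis by (rule LIMSEQ_unique)
qed

text \<open>As \<open>R\<close> tends to infinity the commutator terms vanish, since derivatives of
  \<open>chiR R\<close> are of order at most \<open>1 / R\<close>, and only \<open>F\<close> is
  left.\<close>

lemma \<phi>_0:
  assumes iF: "integrable lebesgue (\<lambda>x. Gr l x * F x)"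
  shows "\<phi> 0 = (LINT x|lebesgue. Gr l x * F x)"
proof -
  obtain B where B: "B > 0" "\<And>R i x. R > 0 \<Longrightarrow> \<bar>pd i (chiR R) x\<bar> \<le> B / R"
    "\<And>R x. R > 0 \<Longrightarrow> \<bar>laplace (chiR R) x\<bar> \<le> B / R\<^sup>2" using pd_chiR_bound by metis
  \<comment> \<open>A majorant for all radii at least 1, where the derivatives of the cutoff are
    bounded by \<open>B\<close>.\<close>
  define w where "w x = \<bar>Gr l x * F x\<bar> + (2 * B) * (\<bar>Gr l x * g 1 x\<bar> + \<bar>Gr l x * g 2 x\<bar>) + B * \<bar>Gr l x * f x\<bar>" for x
  have iw: "integrable lebesgue w"
    unfolding w_def by (intro Bochner_Integration.integrable_add integrable_mult_right integrable_abs iF rL2_mult_integrable Gr_rL2 l g f)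
  have p: "pd i (chiR (real (Suc k))) x \<in> {- (B / real (Suc k))..B / real (Suc k)}" for i k x
    using B(2)[of "real (Suc k)" i x] by (simp add: abs_le_iff)
  have lim1: "(\<lambda>k. pd i (chiR (real (Suc k))) x) \<longlonglongrightarrow> 0" for i x
  proof (rule Lim_null_comparison)
    show "\<forall>\<^sub>F k in sequentially. norm (pd i (chiR (real (Suc k))) x) \<le> B / real (Suc k)"
      using B(2)[of "real (Suc _)"] by (intro always_eventually) simp
    show "(\<lambda>k. B / real (Suc k)) \<longlonglongrightarrow> 0"
      using tendsto_mult[OF tendsto_const LIMSEQ_inverse_real_of_nat, of B] by (simp add: divide_inverse)
  qed
  have lapB: "\<bar>laplace (chiR (real (Suc k))) x\<bar> \<le> B / real (Suc k)" for k x
  proof -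
    have "B / (real (Suc k))\<^sup>2 \<le> B / real (Suc k)"
    proof (intro divide_left_mono)
      have "real (Suc k) * 1 \<le> real (Suc k) * real (Suc k)" by (intro mult_left_mono) auto
      then show "real (Suc k) \<le> (real (Suc k))\<^sup>2" by (simp only: power2_eq_square) simp
    qed (use B in auto)
    then show ?thesis using B(3)[of "real (Suc k)" x] by simp
  qed
  have lim2: "(\<lambda>k. laplace (chiR (real (Suc k))) x) \<longlonglongrightarrow> 0" for x
  proof (rule Lim_null_comparison)
    show "\<forall>\<^sub>F k in sequentially. norm (laplace (chiR (real (Suc k))) x) \<le> B / real (Suc k)"
      using lapB by (intro always_eventually) simp
    show "(\<lambda>k. B / real (Suc k)) \<longlonglongrightarrow> 0"
      using tendsto_mult[OF tendsto_const LIMSEQ_inverse_real_of_nat, of B] by (simp add: divide_inverse)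
  qed
  have "(\<lambda>k. LINT x|lebesgue. Gr l x * W (real (Suc k)) x) \<longlonglongrightarrow> (LINT x|lebesgue. Gr l x * F x)"
  proof (rule integral_dominated_convergence[OF _ _ iw])
    show "(\<lambda>x. Gr l x * F x) \<in> borel_measurable lebesgue" by (rule borel_measurable_integrable[OF iF])
    show "(\<lambda>x. Gr l x * W (real (Suc k)) x) \<in> borel_measurable lebesgue" for k
      by (intro borel_measurable_times Gr_lebesgue rL2D(1)[OF W_rL2(2)]) simp
    show "AE x in lebesgue. (\<lambda>k. Gr l x * W (real (Suc k)) x) \<longlonglongrightarrow> Gr l x * F x"
    proof (rule AE_I2)
      fix x
      have "(\<lambda>k. W (real (Suc k)) x) \<longlonglongrightarrow> 1 * F x - 2 * (0 * g 1 x + 0 * g 2 x) - 0 * f x"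
        unfolding W_def cutT_def sum_2 by (intro tendsto_intros chiR_tendsto lim1 lim2)
      then show "(\<lambda>k. Gr l x * W (real (Suc k)) x) \<longlonglongrightarrow> Gr l x * F x" by (intro tendsto_intros) simp
    qed
    show "AE x in lebesgue. norm (Gr l x * W (real (Suc k)) x) \<le> w x" for k
    proof (rule AE_I2)
      fix x
      define R where "R = real (Suc k)"
      have BR: "B / R \<le> B" using B(1) by (simp add: R_def field_simps)
      have c: "\<bar>chiR R x\<bar> \<le> 1" using chiR_bounds[of R x] by simp
      have q: "\<bar>pd i (chiR R) x\<bar> \<le> B" for i using B(2)[of R i x] BR by (simp add: R_def)
      have q': "\<bar>laplace (chiR R) x\<bar> \<le> B" using lapB[of k x] BR by (simp add: R_def)
      have m: "\<bar>a * b\<bar> \<le> A * \<bar>b\<bar>" if "\<bar>a\<bar> \<le> A" for a b A :: real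
        using that by (simp add: abs_mult mult_right_mono)
      have tri: "\<bar>a - 2 * (b + c) - d\<bar> \<le> \<bar>a\<bar> + 2 * (\<bar>b\<bar> + \<bar>c\<bar>) + \<bar>d\<bar>" for a b c d :: real by (smt (verit))
      have "\<bar>W R x\<bar> \<le> \<bar>chiR R x * F x\<bar> + 2 * (\<bar>pd 1 (chiR R) x * g 1 x\<bar> + \<bar>pd 2 (chiR R) x * g 2 x\<bar>) + \<bar>laplace (chiR R) x * f x\<bar>"
        unfolding W_def cutT_def sum_2 by (rule tri)
      also have "\<dots> \<le> 1 * \<bar>F x\<bar> + 2 * (B * \<bar>g 1 x\<bar> + B * \<bar>g 2 x\<bar>) + B * \<bar>f x\<bar>"
        by (intro add_mono mult_left_mono m[OF c] m[OF q] m[OF q']) simp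
      finally have "\<bar>Gr l x\<bar> * \<bar>W R x\<bar> \<le> \<bar>Gr l x\<bar> * (1 * \<bar>F x\<bar> + 2 * (B * \<bar>g 1 x\<bar> + B * \<bar>g 2 x\<bar>) + B * \<bar>f x\<bar>)"
        by (rule mult_left_mono) simp
      then show "norm (Gr l x * W (real (Suc k)) x) \<le> w x"
        by (simp add: w_def abs_mult R_def algebra_simps)
    qed
  qed
  moreover have "(LINT x|lebesgue. Gr l x * W (real (Suc k)) x) = \<phi> 0" for k
    by (rule \<phi>_0_cut[symmetric]) simp
  ultimately show ?thesis by (simp add: LIMSEQ_const_iff)
qed

end

section \<open>Weak derivatives of complex functions and point masses\<close>

lemma complex_integrable_iff:
  "integrable M f \<longleftrightarrow> integrable M (\<lambda>x. Re (f x)) \<and> integrable M (\<lambda>x. Im (f x))"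
proof
  assume a: "integrable M (\<lambda>x. Re (f x)) \<and> integrable M (\<lambda>x. Im (f x))"
  then have "integrable M (\<lambda>x. complex_of_real (Re (f x)) + \<i> * complex_of_real (Im (f x)))"
    by (intro Bochner_Integration.integrable_add integrable_mult_right integrable_of_real) auto
  then show "integrable M f" by (simp add: complex_eq[symmetric])
qed auto

lemma complex_integrable_scaleR_iff:
  fixes f :: "'a \<Rightarrow> complex"
  shows "integrable M (\<lambda>x. k x *\<^sub>R f x) \<longleftrightarrow> integrable M (\<lambda>x. k x * Re (f x)) \<and> integrable M (\<lambda>x. k x * Im (f x))"
  by (subst complex_integrable_iff) simp

lemma compact_subset_cball0:
  fixes K :: "plane set"
  assumes "compact K" shows "\<exists>R. K \<subseteq> cball 0 R"
proof -
  obtain R where "\<forall>x\<in>K. norm x \<le> R" using compact_imp_bounded[OF assms] bounded_iff by blast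
  then have "K \<subseteq> cball 0 R" by (auto simp: dist_norm)
  then show ?thesis by blast
qed

lemma meas_Re: "f \<in> borel_measurable M \<Longrightarrow> (\<lambda>x. Re (f x)) \<in> borel_measurable M"
  and meas_Im: "f \<in> borel_measurable M \<Longrightarrow> (\<lambda>x. Im (f x)) \<in> borel_measurable M"
  by (auto simp: borel_measurable_complex_iff)

lemma L1loc_iff: "f \<in> L1loc \<longleftrightarrow> rL1loc (\<lambda>x. Re (f x)) \<and> rL1loc (\<lambda>x. Im (f x))"
proof
  assume f: "f \<in> L1loc"
  then have "set_integrable lebesgue (cball 0 R) f" for R by (auto simp: L1loc_def)
  then show "rL1loc (\<lambda>x. Re (f x)) \<and> rL1loc (\<lambda>x. Im (f x))"
    using f by (auto simp: L1loc_def rL1loc_def set_integrable_def complex_integrable_scaleR_iff intro: meas_Re meas_Im)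
next
  assume a: "rL1loc (\<lambda>x. Re (f x)) \<and> rL1loc (\<lambda>x. Im (f x))"
  have "set_integrable lebesgue K f" if K: "compact K" for K
  proof -
    obtain R where R: "K \<subseteq> cball 0 R"
      using compact_subset_cball0[OF K] by blast
    have "set_integrable lebesgue (cball 0 R) f"
      using a by (auto simp: rL1loc_def set_integrable_def complex_integrable_scaleR_iff)
    then show ?thesis by (rule set_integrable_subset) (use K R in \<open>auto dest: compact_imp_closed\<close>)
  qed
  then show "f \<in> L1loc" using a by (auto simp: L1loc_def rL1loc_def borel_measurable_complex_iff)
qed

lemma L2_iff: "f \<in> L2 \<longleftrightarrow> rL2 (\<lambda>x. Re (f x)) \<and> rL2 (\<lambda>x. Im (f x))"
proof
  assume f: "f \<in> L2"
  then have i: "integrable lebesgue (\<lambda>x. (cmod (f x))\<^sup>2)" and m: "f \<in> borel_measurable lebesgue" by (auto simp: L2_def)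
  have "rL2 (\<lambda>x. Re (f x))"
    by (rule rL2_bound(1)[OF i meas_Re[OF m]]) (simp add: cmod_power2)
  moreover have "rL2 (\<lambda>x. Im (f x))"
    by (rule rL2_bound(1)[OF i meas_Im[OF m]]) (simp add: cmod_power2)
  ultimately show "rL2 (\<lambda>x. Re (f x)) \<and> rL2 (\<lambda>x. Im (f x))" by blast
qed (auto simp: L2_def rL2_def cmod_power2 borel_measurable_complex_iff)

lemma L2_sq:
  assumes "f \<in> L2" shows "rL2 (\<lambda>x. cmod (f x))"
  using assms by (auto simp: L2_def rL2_def)

lemma L2loc_iff: "f \<in> L2loc \<longleftrightarrow> f \<in> borel_measurable lebesgue \<and>
    (\<forall>R. rL2 (loc R (\<lambda>x. Re (f x)))) \<and> (\<forall>R. rL2 (loc R (\<lambda>x. Im (f x))))"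
proof -
  have e: "indicator (cball 0 R) x *\<^sub>R (cmod (f x))\<^sup>2 = (loc R (\<lambda>x. Re (f x)) x)\<^sup>2 + (loc R (\<lambda>x. Im (f x)) x)\<^sup>2" for R x
    by (auto simp: loc_def indicator_def cmod_power2)
  show ?thesis
  proof
    assume f: "f \<in> L2loc"
    then have m: "f \<in> borel_measurable lebesgue" by (simp add: L2loc_def)
    have i: "integrable lebesgue (\<lambda>x. (loc R (\<lambda>x. Re (f x)) x)\<^sup>2 + (loc R (\<lambda>x. Im (f x)) x)\<^sup>2)" for R
      using f unfolding e[symmetric] by (auto simp: L2loc_def set_integrable_def)
    have "rL2 (loc R (\<lambda>x. Re (f x)))" for R
      by (rule rL2_bound(1)[OF i[of R] loc_meas[OF meas_Re[OF m]]]) simp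
    moreover have "rL2 (loc R (\<lambda>x. Im (f x)))" for R
      by (rule rL2_bound(1)[OF i[of R] loc_meas[OF meas_Im[OF m]]]) simp
    ultimately show "f \<in> borel_measurable lebesgue \<and>
      (\<forall>R. rL2 (loc R (\<lambda>x. Re (f x)))) \<and> (\<forall>R. rL2 (loc R (\<lambda>x. Im (f x))))" using m by blast
  next
    assume a: "f \<in> borel_measurable lebesgue \<and> (\<forall>R. rL2 (loc R (\<lambda>x. Re (f x)))) \<and> (\<forall>R. rL2 (loc R (\<lambda>x. Im (f x))))"
    have "set_integrable lebesgue K (\<lambda>x. (cmod (f x))\<^sup>2)" if K: "compact K" for K
    proof -
      obtain R where R: "K \<subseteq> cball 0 R"
        using compact_subset_cball0[OF K] by blast
      have "set_integrable lebesgue (cball 0 R) (\<lambda>x. (cmod (f x))\<^sup>2)"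
        unfolding set_integrable_def e using a by (intro Bochner_Integration.integrable_add rL2D(2)) auto
      then show ?thesis by (rule set_integrable_subset) (use K R in \<open>auto dest: compact_imp_closed\<close>)
    qed
    then show "f \<in> L2loc" using a by (auto simp: L2loc_def)
  qed
qed

lemma L2loc_L1loc: "f \<in> L2loc \<Longrightarrow> f \<in> L1loc"
  by (auto simp: L2loc_iff L1loc_iff intro!: loc_rL1loc meas_Re meas_Im)

lemma L1loc_test:
  assumes "f \<in> L1loc" "\<eta> \<in> test_functions"
  shows "integrable lebesgue (\<lambda>x. \<eta> x *\<^sub>R f x)"
    "Re (LINT x|lebesgue. \<eta> x *\<^sub>R f x) = (LINT x|lebesgue. \<eta> x * Re (f x))"
    "Im (LINT x|lebesgue. \<eta> x *\<^sub>R f x) = (LINT x|lebesgue. \<eta> x * Im (f x))"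
proof -
  show i: "integrable lebesgue (\<lambda>x. \<eta> x *\<^sub>R f x)"
    using assms test_mult_integrable[OF assms(2)]
    by (auto simp: complex_integrable_scaleR_iff L1loc_iff)
  show "Re (LINT x|lebesgue. \<eta> x *\<^sub>R f x) = (LINT x|lebesgue. \<eta> x * Re (f x))"
    "Im (LINT x|lebesgue. \<eta> x *\<^sub>R f x) = (LINT x|lebesgue. \<eta> x * Im (f x))"
    using integral_Re[OF i] integral_Im[OF i] by simp_all
qed

text \<open>Test functions are real, so test integrals split into real and imaginary parts; through
  this equivalence the real theory applies to complex functions.\<close>

lemma has_weak_partial_iff: "has_weak_partial i f g \<longleftrightarrow>
    rweak i (\<lambda>x. Re (f x)) (\<lambda>x. Re (g x)) \<and> rweak i (\<lambda>x. Im (f x)) (\<lambda>x. Im (g x))"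
proof -
  have "(LINT x|lebesgue. pd i \<eta> x *\<^sub>R f x) = - (LINT x|lebesgue. \<eta> x *\<^sub>R g x) \<longleftrightarrow>
     (LINT x|lebesgue. pd i \<eta> x * Re (f x)) = - (LINT x|lebesgue. \<eta> x * Re (g x)) \<and>
     (LINT x|lebesgue. pd i \<eta> x * Im (f x)) = - (LINT x|lebesgue. \<eta> x * Im (g x))"
    if "f \<in> L1loc" "g \<in> L1loc" "\<eta> \<in> test_functions" for \<eta>
    using L1loc_test(2,3)[OF that(1) test_pd[OF that(3), of i]] L1loc_test(2,3)[OF that(2,3)]
    by (simp only: complex_eq_iff uminus_complex.sel)
  then show ?thesis
    unfolding has_weak_partial_def rweak_def L1loc_iff[of f, symmetric] L1loc_iff[of g, symmetric]
    by (auto simp: L1loc_iff)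
qed

lemma rweak_unique:
  assumes "rweak i f g" "rweak i f g'" shows "AE x in lebesgue. g x = g' x"
proof -
  have r: "rL1loc g" "rL1loc g'" using assms by (auto simp: rweak_def)
  have "AE x in lebesgue. g x - g' x = 0"
  proof (rule fundamental_test)
    show "rL1loc (\<lambda>x. g x - g' x)" by (intro rL1loc_diff r)
    fix \<eta> assume \<eta>: "\<eta> \<in> test_functions"
    have "(LINT x|lebesgue. \<eta> x * g x) = (LINT x|lebesgue. \<eta> x * g' x)" using assms \<eta> by (auto simp: rweak_def)
    then show "(LINT x|lebesgue. \<eta> x * (g x - g' x)) = 0"
      using test_mult_integrable[OF \<eta> r(1)] test_mult_integrable[OF \<eta> r(2)] by (simp add: right_diff_distrib)
  qed
  then show ?thesis by eventually_elim simp
qed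

lemma weak_partial_unique:
  assumes "has_weak_partial i f g" "has_weak_partial i f g'" shows "AE x in lebesgue. g x = g' x"
proof -
  have "AE x in lebesgue. Re (g x) = Re (g' x)" "AE x in lebesgue. Im (g x) = Im (g' x)"
    using assms by (auto simp: has_weak_partial_iff intro: rweak_unique)
  then show ?thesis by eventually_elim (simp add: complex_eq_iff)
qed

lemma has_weak_partial_weak_partial: "has_weak_partial i f g \<Longrightarrow> has_weak_partial i f (weak_partial i f)"
  unfolding weak_partial_def using someI[of "\<lambda>g. has_weak_partial i f g" g] .

lemma weak_partial_AE: "has_weak_partial i f g \<Longrightarrow> AE x in lebesgue. weak_partial i f x = g x"
  using has_weak_partial_weak_partial weak_partial_unique by blast

lemma rL1loc_AE:
  assumes "rL1loc f" "AE x in lebesgue. f x = f' x" shows "rL1loc f'"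
proof -
  have m: "f' \<in> borel_measurable lebesgue" using borel_measurable_AE[OF rL1loc_meas[OF assms(1)] assms(2)] .
  have "set_integrable lebesgue (cball 0 R) f'" for R
  proof -
    have i: "integrable lebesgue (\<lambda>x. indicator (cball 0 R) x *\<^sub>R f x)"
      using assms(1) by (simp add: rL1loc_def set_integrable_def)
    have ae: "AE x in lebesgue. indicator (cball 0 R) x *\<^sub>R f x = indicator (cball 0 R) x *\<^sub>R f' x"
      using assms(2) by eventually_elim simp
    have m': "(\<lambda>x. indicator (cball 0 R) x *\<^sub>R f' x) \<in> borel_measurable lebesgue"
      by (rule borel_measurable_AE[OF borel_measurable_integrable[OF i] ae])
    show ?thesis unfolding set_integrable_def
      using integrable_cong_AE[OF borel_measurable_integrable[OF i] m' ae] i by simp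
  qed
  with m show ?thesis by (simp add: rL1loc_def)
qed

lemma LINT_AE_eq:
  fixes f g :: "plane \<Rightarrow> real"
  assumes "f \<in> borel_measurable lebesgue" "AE x in lebesgue. f x = g x"
  shows "(LINT x|lebesgue. f x) = (LINT x|lebesgue. g x)"
  by (rule integral_cong_AE[OF assms(1) borel_measurable_AE[OF assms] assms(2)])

lemma rweak_AE:
  assumes "rweak i f g" "AE x in lebesgue. f x = f' x" "AE x in lebesgue. g x = g' x"
  shows "rweak i f' g'"
proof -
  have l: "rL1loc f" "rL1loc g" using assms by (auto simp: rweak_def)
  have "(LINT x|lebesgue. \<eta> x * f x) = (LINT x|lebesgue. \<eta> x * f' x)" if "\<eta> \<in> test_functions" for \<eta>
    by (rule LINT_AE_eq[OF borel_measurable_integrable[OF test_mult_integrable[OF that l(1)]]])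
      (use assms(2) in \<open>eventually_elim, simp\<close>)
  moreover have "(LINT x|lebesgue. \<eta> x * g x) = (LINT x|lebesgue. \<eta> x * g' x)" if "\<eta> \<in> test_functions" for \<eta>
    by (rule LINT_AE_eq[OF borel_measurable_integrable[OF test_mult_integrable[OF that l(2)]]])
      (use assms(3) in \<open>eventually_elim, simp\<close>)
  ultimately show ?thesis
    using assms l rL1loc_AE[OF l(1) assms(2)] rL1loc_AE[OF l(2) assms(3)] test_pd by (auto simp: rweak_def)
qed

lemma has_weak_partial_AE:
  assumes "has_weak_partial i f g" "AE x in lebesgue. f x = f' x" "AE x in lebesgue. g x = g' x"
  shows "has_weak_partial i f' g'"
proof -
  have "AE x in lebesgue. Re (f x) = Re (f' x)" "AE x in lebesgue. Im (f x) = Im (f' x)"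
    using assms(2) by (eventually_elim, simp)+
  moreover have "AE x in lebesgue. Re (g x) = Re (g' x)" "AE x in lebesgue. Im (g x) = Im (g' x)"
    using assms(3) by (eventually_elim, simp)+
  moreover have "rweak i (\<lambda>x. Re (f x)) (\<lambda>x. Re (g x))" "rweak i (\<lambda>x. Im (f x)) (\<lambda>x. Im (g x))"
    using assms(1) by (auto simp: has_weak_partial_iff)
  ultimately show ?thesis
    unfolding has_weak_partial_iff by (intro conjI) (rule rweak_AE; assumption)+
qed

lemma rweak_add:
  assumes "rweak i f g" "rweak i f' g'" shows "rweak i (\<lambda>x. f x + f' x) (\<lambda>x. g x + g' x)"
proof -
  have l: "rL1loc f" "rL1loc g" "rL1loc f'" "rL1loc g'" using assms by (auto simp: rweak_def)
  have "(LINT x|lebesgue. pd i \<eta> x * (f x + f' x)) = - (LINT x|lebesgue. \<eta> x * (g x + g' x))" if \<eta>: "\<eta> \<in> test_functions" for \<eta>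
    using assms \<eta> test_mult_integrable[OF test_pd[OF \<eta>, of i] l(1)] test_mult_integrable[OF test_pd[OF \<eta>, of i] l(3)]
      test_mult_integrable[OF \<eta> l(2)] test_mult_integrable[OF \<eta> l(4)]
    by (simp add: rweak_def distrib_left)
  then show ?thesis using l by (auto simp: rweak_def intro: rL1loc_add)
qed

lemma rweak_cmult:
  assumes "rweak i f g" shows "rweak i (\<lambda>x. c * f x) (\<lambda>x. c * g x)"
  using assms by (auto simp: rweak_def mult.left_commute[of _ c] intro!: rL1loc_cmult)

lemma has_weak_partial_add:
  "has_weak_partial i f g \<Longrightarrow> has_weak_partial i f' g' \<Longrightarrow> has_weak_partial i (\<lambda>x. f x + f' x) (\<lambda>x. g x + g' x)"
  by (auto simp: has_weak_partial_iff intro: rweak_add)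

lemma has_weak_partial_cmult:
  assumes "has_weak_partial i f g" shows "has_weak_partial i (\<lambda>x. c * f x) (\<lambda>x. c * g x)"
proof -
  have r: "rweak i (\<lambda>x. Re (f x)) (\<lambda>x. Re (g x))" "rweak i (\<lambda>x. Im (f x)) (\<lambda>x. Im (g x))"
    using assms by (auto simp: has_weak_partial_iff)
  show ?thesis
    using rweak_add[OF rweak_cmult[OF r(1), of "Re c"] rweak_cmult[OF r(2), of "- Im c"]]
      rweak_add[OF rweak_cmult[OF r(2), of "Re c"] rweak_cmult[OF r(1), of "Im c"]]
    by (simp add: has_weak_partial_iff)
qed

lemma L2_add: "f \<in> L2 \<Longrightarrow> g \<in> L2 \<Longrightarrow> (\<lambda>x. f x + g x) \<in> L2"
  by (auto simp: L2_iff intro: rL2_add)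

lemma L2_cmult: assumes "f \<in> L2" shows "(\<lambda>x. c * f x) \<in> L2"
  using assms rL2_diff(1)[OF rL2_cmult[of _ "Re c"] rL2_cmult[of _ "Im c"]]
    rL2_add(1)[OF rL2_cmult[of _ "Re c"] rL2_cmult[of _ "Im c"]]
  by (simp add: L2_iff)

lemma L2_AE:
  assumes "f \<in> L2" "AE x in lebesgue. f x = f' x" shows "f' \<in> L2"
proof -
  have m: "f' \<in> borel_measurable lebesgue" using assms borel_measurable_AE by (auto simp: L2_def)
  have i: "integrable lebesgue (\<lambda>x. (cmod (f x))\<^sup>2)" using assms by (simp add: L2_def)
  have "integrable lebesgue (\<lambda>x. (cmod (f' x))\<^sup>2)"
  proof (rule integral_bound(1)[OF i])
    show "AE x in lebesgue. norm ((cmod (f' x))\<^sup>2) \<le> (cmod (f x))\<^sup>2" using assms(2) by eventually_elim simp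
  qed (use m in measurable)
  with m show ?thesis by (simp add: L2_def)
qed

lemma W12_AE:
  assumes "f \<in> W12" "AE x in lebesgue. f x = f' x" shows "f' \<in> W12"
proof -
  have "\<exists>g\<in>L2. has_weak_partial i f' g" for i
  proof -
    obtain g where g: "g \<in> L2" "has_weak_partial i f g" using assms(1) by (auto simp: W12_def)
    have "has_weak_partial i f' g" by (rule has_weak_partial_AE[OF g(2) assms(2)]) simp
    with g(1) show ?thesis by blast
  qed
  moreover have "f' \<in> L2" using assms by (auto simp: W12_def intro: L2_AE)
  ultimately show ?thesis by (simp add: W12_def)
qed

lemma W12_add: "f \<in> W12 \<Longrightarrow> g \<in> W12 \<Longrightarrow> (\<lambda>x. f x + g x) \<in> W12"
  unfolding W12_def by (blast intro: L2_add has_weak_partial_add)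

lemma W12_cmult: "f \<in> W12 \<Longrightarrow> (\<lambda>x. c * f x) \<in> W12"
  unfolding W12_def by (blast intro: L2_cmult has_weak_partial_cmult)

lemma W12_diff: "f \<in> W12 \<Longrightarrow> g \<in> W12 \<Longrightarrow> (\<lambda>x. f x - g x) \<in> W12"
  using W12_add[OF _ W12_cmult[of g "-1"], of f] by simp

lemma W12_weak_partial:
  assumes "f \<in> W12"
  shows "has_weak_partial i f (weak_partial i f)" "weak_partial i f \<in> L2"
proof -
  obtain g where g: "g \<in> L2" "has_weak_partial i f g" using assms by (auto simp: W12_def)
  show "has_weak_partial i f (weak_partial i f)" by (rule has_weak_partial_weak_partial[OF g(2)])
  have "AE x in lebesgue. g x = weak_partial i f x" using weak_partial_AE[OF g(2)] by eventually_elim simp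
  with g(1) show "weak_partial i f \<in> L2" by (rule L2_AE)
qed

lemma test_W12:
  assumes \<eta>: "\<eta> \<in> test_functions"
  shows "(\<lambda>x. complex_of_real (\<eta> x)) \<in> W12"
    "has_weak_partial i (\<lambda>x. complex_of_real (\<eta> x)) (\<lambda>x. complex_of_real (pd i \<eta> x))"
proof -
  have z: "rweak i (\<lambda>x. 0) (\<lambda>x. 0)" for i using rweak_cmult[OF rweak_smooth[OF test_smooth[OF \<eta>]], of i 0] by simp
  show w: "has_weak_partial i (\<lambda>x. complex_of_real (\<eta> x)) (\<lambda>x. complex_of_real (pd i \<eta> x))" for i
    using z by (simp add: has_weak_partial_iff rweak_smooth[OF test_smooth[OF \<eta>]])
  have "(\<lambda>x. complex_of_real (\<zeta> x)) \<in> L2" if "\<zeta> \<in> test_functions" for \<zeta>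
    using test_rL2[OF that] rL2_cmult[OF test_rL2[OF that], of 0] by (simp add: L2_iff)
  then show "(\<lambda>x. complex_of_real (\<eta> x)) \<in> W12"
    unfolding W12_def using w \<eta> test_pd[OF \<eta>] by blast
qed

lemma green_L2: "l > 0 \<Longrightarrow> green l \<in> L2"
  using Gr_rL2[of l] rL2_cmult[OF Gr_rL2[of l], of 0] by (simp add: L2_iff green_Gr)

lemma green_diff_W12:
  assumes "l > 0" "m > 0" shows "(\<lambda>x. green l x - green m x) \<in> W12"
proof -
  have "\<exists>g\<in>L2. has_weak_partial i (\<lambda>x. green l x - green m x) g" for i
  proof -
    obtain g where g: "rL2 g" "rweak i (\<lambda>x. Gr l x - Gr m x) g" using Gr_diff_weak[OF assms] by blast
    have "rweak i (\<lambda>x. 0) (\<lambda>x. 0)" using rweak_cmult[OF g(2), of 0] by simp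
    then show ?thesis
      by (intro bexI[of _ "\<lambda>x. complex_of_real (g x)"])
        (use g rL2_cmult[OF g(1), of 0] in \<open>auto simp: has_weak_partial_iff green_Gr L2_iff\<close>)
  qed
  moreover have "(\<lambda>x. green l x - green m x) \<in> L2"
    using L2_add[OF green_L2[OF assms(1)] L2_cmult[OF green_L2[OF assms(2)], of "-1"]] by simp
  ultimately show ?thesis by (simp add: W12_def)
qed

section \<open>Detecting point masses with shrinking cutoffs\<close>

lemma Gr_laplace:
  assumes "l > 0" "\<eta> \<in> test_functions"
  shows "(LINT x|lebesgue. laplace \<eta> x * Gr l x) = l * (LINT x|lebesgue. \<eta> x * Gr l x) - \<eta> 0"
proof -
  have i: "integrable lebesgue (\<lambda>x. Gr l x * \<eta> x)" "integrable lebesgue (\<lambda>x. Gr l x * laplace \<eta> x)"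
    by (intro rL2_mult_integrable Gr_rL2 test_rL2 test_laplace assms)+
  show ?thesis using Gr_fundamental[OF assms] i by (simp add: right_diff_distrib mult.left_commute[of _ l] mult.commute)
qed

text \<open>In two dimensions the Dirichlet energy of \<open>chiR R\<close> is scale invariant: a
  gradient of order \<open>1 / R\<close> on a disc of area of order \<open>R^2\<close>. It stays
  bounded while the support shrinks, and the integral of \<open>v^2\<close> over the shrinking disc
  tends to 0.\<close>

lemma shrink_L2:
  assumes v: "rL2 v"
  shows "(\<lambda>k. LINT x|lebesgue. pd i (chiR (1 / real (Suc k))) x * v x) \<longlonglongrightarrow> 0"
proof -
  define e where "e k = 1 / real (Suc k)" for k
  have e0: "e k > 0" for k by (simp add: e_def)
  obtain B where B: "B > 0" "\<And>R i x. R > 0 \<Longrightarrow> \<bar>pd i (chiR R) x\<bar> \<le> B / R" using pd_chiR_bound by metis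
  have t: "pd i (chiR (e k)) \<in> test_functions" for k by (intro test_pd chiR_test e0)
  have out: "pd i (chiR (e k)) x = 0" if "norm x > 3 * e k" for x k
    by (rule pd_zero_outside[OF chiR_outside[OF e0] that])
  \<comment> \<open>The area \<open>pi * (3 * e k)^2\<close> of the disc times the bound
    \<open>(B / e k)^2\<close>.\<close>
  have s1: "sq (pd i (chiR (e k))) \<le> 9 * pi * B\<^sup>2" for k
  proof -
    have ae: "AE x in lebesgue. (pd i (chiR (e k)) x)\<^sup>2 \<le> (B / e k)\<^sup>2 * indicator (cball 0 (3 * e k)) x"
    proof (rule AE_I2)
      fix x
      show "(pd i (chiR (e k)) x)\<^sup>2 \<le> (B / e k)\<^sup>2 * indicator (cball 0 (3 * e k)) x"
        using out[of k x] power_mono[OF B(2)[OF e0, of i k x], of 2] by (auto simp: indicator_def dist_norm)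
    qed
    have I: "integrable lebesgue (indicator (cball 0 (3 * e k)) :: plane \<Rightarrow> real)"
      "(LINT x::plane|lebesgue. indicator (cball 0 (3 * e k)) x) = pi * (3 * e k)\<^sup>2"
    proof -
      have "integrable lborel (indicator (cball 0 (3 * e k)) :: plane \<Rightarrow> real)"
        using emeasure_bounded_finite[of "cball (0::plane) (3 * e k)"] by (intro integrable_real_indicator) auto
      then show "integrable lebesgue (indicator (cball 0 (3 * e k)) :: plane \<Rightarrow> real)"
        by (subst integrable_completion) auto
      have "(LINT x::plane|lebesgue. indicator (cball 0 (3 * e k)) x) = measure lborel (cball (0::plane) (3 * e k))"
        by (subst lborel_lebesgue_integral) (auto intro!: borel_measurable_indicator)
      also have "\<dots> = pi * (3 * e k)\<^sup>2"
        using content_cball[of "3 * e k" "0::plane"] e0[of k] by (simp add: unit_ball_vol_2)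
      finally show "(LINT x::plane|lebesgue. indicator (cball 0 (3 * e k)) x) = pi * (3 * e k)\<^sup>2" .
    qed
    have "sq (pd i (chiR (e k))) \<le> (LINT x::plane|lebesgue. (B / e k)\<^sup>2 * indicator (cball 0 (3 * e k)) x)"
      by (rule rL2_bound(2)[OF integrable_mult_right[OF I(1)] borel_imp_lebesgue[OF test_borel[OF t]] ae])
    also have "\<dots> = 9 * pi * B\<^sup>2" using I(2) e0[of k] by (simp add: power_mult_distrib power_divide)
    finally show ?thesis .
  qed
  have s2: "(\<lambda>k. sq (loc (3 * e k) v)) \<longlonglongrightarrow> 0"
  proof (rule sq_tendsto_dominated[OF rL2D(2)[OF v]])
    show "loc (3 * e k) v \<in> borel_measurable lebesgue" for k by (rule loc_meas[OF rL2D(1)[OF v]])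
    show "AE x in lebesgue. (\<lambda>k. loc (3 * e k) v x) \<longlonglongrightarrow> 0"
      using AE_nonzero(2)
    proof eventually_elim
      case (elim x)
      have "(\<lambda>k. 3 * e k) \<longlonglongrightarrow> 3 * 0"
        unfolding e_def using LIMSEQ_inverse_real_of_nat by (intro tendsto_intros) (simp add: inverse_eq_divide)
      then have "eventually (\<lambda>k. 3 * e k < norm x) sequentially" by (rule order_tendstoD(2)) (use elim in simp)
      then show ?case by (intro tendsto_eventually) (auto elim!: eventually_mono simp: loc_def dist_norm)
    qed
    show "AE x in lebesgue. (loc (3 * e k) v x)\<^sup>2 \<le> (v x)\<^sup>2" for k
      by (auto simp: loc_def indicator_def)
  qed
  have lv: "rL2 (loc (3 * e k) v)" for k
    by (rule rL2_bound(1)[OF rL2D(2)[OF v] loc_meas[OF rL2D(1)[OF v]]]) (auto simp: loc_def indicator_def)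
  have b: "(LINT x|lebesgue. pd i (chiR (e k)) x * v x)\<^sup>2 \<le> (9 * pi * B\<^sup>2) * sq (loc (3 * e k) v)" for k
  proof -
    have "(\<lambda>x. pd i (chiR (e k)) x * v x) = (\<lambda>x. pd i (chiR (e k)) x * loc (3 * e k) v x)"
    proof
      fix x show "pd i (chiR (e k)) x * v x = pd i (chiR (e k)) x * loc (3 * e k) v x"
        using out[of k x] by (cases "norm x \<le> 3 * e k") (auto simp: loc_def dist_norm)
    qed
    then have "(LINT x|lebesgue. pd i (chiR (e k)) x * v x)\<^sup>2 \<le> sq (pd i (chiR (e k))) * sq (loc (3 * e k) v)"
      using Cauchy_Schwarz_integral[OF test_rL2[OF t[of k]] lv[of k]] by simp
    also have "\<dots> \<le> (9 * pi * B\<^sup>2) * sq (loc (3 * e k) v)" by (intro mult_right_mono s1 sq_nonneg)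
    finally show ?thesis .
  qed
  have "(\<lambda>k. (9 * pi * B\<^sup>2) * sq (loc (3 * e k) v)) \<longlonglongrightarrow> (9 * pi * B\<^sup>2) * 0" by (intro tendsto_intros s2)
  then have s: "(\<lambda>k. sqrt ((9 * pi * B\<^sup>2) * sq (loc (3 * e k) v))) \<longlonglongrightarrow> 0" using tendsto_real_sqrt by fastforce
  have "(\<lambda>k. LINT x|lebesgue. pd i (chiR (e k)) x * v x) \<longlonglongrightarrow> 0"
    by (rule Lim_null_comparison[OF always_eventually s]) (use b in \<open>auto intro: real_le_rsqrt\<close>)
  then show ?thesis by (simp add: e_def)
qed

lemma shrink_L1:
  assumes v: "rL1loc v"
  shows "(\<lambda>k. LINT x|lebesgue. chiR (1 / real (Suc k)) x * v x) \<longlonglongrightarrow> 0"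
proof -
  have vm: "v \<in> borel_measurable lebesgue" by (rule rL1loc_meas[OF v])
  have i: "integrable lebesgue (\<lambda>x. \<bar>indicator (cball 0 3) x *\<^sub>R v x\<bar>)"
    using v by (intro integrable_abs) (simp add: rL1loc_def set_integrable_def)
  have "(\<lambda>k. LINT x|lebesgue. chiR (1 / real (Suc k)) x * v x) \<longlonglongrightarrow> (LINT x::plane|lebesgue. (0::real))"
  proof (rule integral_dominated_convergence[OF _ _ i])
    show "(\<lambda>x. chiR (1 / real (Suc k)) x * v x) \<in> borel_measurable lebesgue" for k
      by (intro borel_measurable_times vm borel_imp_lebesgue test_borel chiR_test) simp
    show "AE x in lebesgue. (\<lambda>k. chiR (1 / real (Suc k)) x * v x) \<longlonglongrightarrow> 0"
      using AE_nonzero(2)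
    proof eventually_elim
      case (elim x)
      have "(\<lambda>k. 3 * (1 / real (Suc k))) \<longlonglongrightarrow> 3 * 0"
        using LIMSEQ_inverse_real_of_nat by (intro tendsto_intros) (simp add: inverse_eq_divide)
      then have "eventually (\<lambda>k. 3 * (1 / real (Suc k)) < norm x) sequentially"
        by (rule order_tendstoD(2)) (use elim in simp)
      then have "eventually (\<lambda>k. chiR (1 / real (Suc k)) x * v x = 0) sequentially"
      proof eventually_elim
        case (elim k)
        have "chiR (1 / real (Suc k)) x = 0" by (rule chiR_outside[OF _ elim]) simp
        then show ?case by simp
      qed
      then show ?case by (rule tendsto_eventually)
    qed
    show "AE x in lebesgue. norm (chiR (1 / real (Suc k)) x * v x) \<le> \<bar>indicator (cball 0 3) x *\<^sub>R v x\<bar>" for k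
    proof (rule AE_I2)
      fix x
      have e: "1 / real (Suc k) \<le> 1" "1 / real (Suc k) > 0" by auto
      show "norm (chiR (1 / real (Suc k)) x * v x) \<le> \<bar>indicator (cball 0 3) x *\<^sub>R v x\<bar>"
      proof (cases "norm x \<le> 3")
        case True
        then show ?thesis using chiR_bounds[of "1 / real (Suc k)" x] by (simp add: abs_mult dist_norm mult_left_le_one_le)
      next
        case False
        then have "chiR (1 / real (Suc k)) x = 0" using e by (intro chiR_outside[OF e(2)]) linarith
        then show ?thesis by simp
      qed
    qed
  qed simp
  then show ?thesis by simp
qed

text \<open>Cutoffs that shrink to the origin see the point mass but not the function \<open>v\<close>.\<close>

lemma point_mass_zero:
  assumes v: "rL1loc v" and e: "\<And>\<eta>. \<eta> \<in> test_functions \<Longrightarrow> (LINT x|lebesgue. \<eta> x * v x) = c * \<eta> 0"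
  shows "c = 0" "AE x in lebesgue. v x = 0"
proof -
  have "(LINT x|lebesgue. chiR (1 / real (Suc k)) x * v x) = c" for k
    using e[OF chiR_test[of "1 / real (Suc k)"]] chiR_1[of "1 / real (Suc k)" 0] by simp
  with shrink_L1[OF v] show "c = 0" by (simp add: LIMSEQ_const_iff)
  then show "AE x in lebesgue. v x = 0" by (intro fundamental_test[OF v]) (simp add: e)
qed

text \<open>Moving one derivative from the test function to \<open>f\<close> leaves gradients of
  shrinking cutoffs against square integrable functions, which vanish in the limit by
  \<open>shrink_L2\<close>; a point mass would survive.\<close>

lemma point_mass_zero_W12:
  assumes g: "\<And>i. rweak i f (g i)" "\<And>i. rL2 (g i)" and v: "rL1loc v"
    and e: "\<And>\<eta>. \<eta> \<in> test_functions \<Longrightarrow> (LINT x|lebesgue. laplace \<eta> x * f x) = c * \<eta> 0 + (LINT x|lebesgue. \<eta> x * v x)"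
  shows "c = 0"
proof -
  define \<eta> where "\<eta> k = chiR (1 / real (Suc k))" for k
  have t: "\<eta> k \<in> test_functions" for k unfolding \<eta>_def by (rule chiR_test) simp
  have \<eta>0: "\<eta> k 0 = 1" for k unfolding \<eta>_def by (rule chiR_1) auto
  have f: "rL1loc f" using g(1)[of 1] by (simp add: rweak_def)
  have "(LINT x|lebesgue. laplace (\<eta> k) x * f x) = - ((LINT x|lebesgue. pd 1 (\<eta> k) x * g 1 x) + (LINT x|lebesgue. pd 2 (\<eta> k) x * g 2 x))" for k
  proof -
    have "(LINT x|lebesgue. pd i (pd i (\<eta> k)) x * f x) = - (LINT x|lebesgue. pd i (\<eta> k) x * g i x)" for i
      using g(1)[of i] test_pd[OF t] by (auto simp: rweak_def)
    then show ?thesis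
      using test_mult_integrable[OF test_pd[OF test_pd[OF t[of k]]] f]
      by (simp add: laplace_def sum_2 distrib_right)
  qed
  then have "c = - ((LINT x|lebesgue. pd 1 (\<eta> k) x * g 1 x) + (LINT x|lebesgue. pd 2 (\<eta> k) x * g 2 x)) - (LINT x|lebesgue. \<eta> k x * v x)" for k
    using e[OF t[of k]] \<eta>0[of k] by simp
  moreover have "(\<lambda>k. - ((LINT x|lebesgue. pd 1 (\<eta> k) x * g 1 x) + (LINT x|lebesgue. pd 2 (\<eta> k) x * g 2 x)) - (LINT x|lebesgue. \<eta> k x * v x))
      \<longlonglongrightarrow> - (0 + 0) - 0"
    unfolding \<eta>_def by (intro tendsto_intros shrink_L2 g shrink_L1 v)
  ultimately have "(\<lambda>k. c) \<longlonglongrightarrow> 0" by simp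
  then show ?thesis by (simp add: LIMSEQ_const_iff)
qed

section \<open>The energy space\<close>

lemma meas_cmod: "f \<in> borel_measurable M \<Longrightarrow> (\<lambda>x. cmod (f x)) \<in> borel_measurable M"
  by (rule measurable_compose[OF _ borel_measurable_norm])

text \<open>By \<open>Gr_laplace\<close> the Laplacian of \<open>a' * Gr l' - a * Gr l\<close> is a
  function plus \<open>a - a'\<close> times the point mass at 0, while a function with square
  integrable gradient carries no point mass.\<close>

lemma Gr_charge_unique:
  assumes g: "\<And>i. rweak i f (g i)" "\<And>i. rL2 (g i)" and l: "l > 0" "l' > 0"
    and e: "AE x in lebesgue. f x = a' * Gr l' x - a * Gr l x"
  shows "a = a'"
proof -
  define v where "v x = a' * l' * Gr l' x - a * l * Gr l x" for x
  have v: "rL1loc v" unfolding v_def by (intro rL1loc_diff rL1loc_cmult rL2_rL1loc Gr_rL2 l)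
  have f: "rL1loc f" using g(1)[of 1] by (simp add: rweak_def)
  have "a - a' = 0"
  proof (rule point_mass_zero_W12[OF g v])
    fix \<eta> assume \<eta>: "\<eta> \<in> test_functions"
    have i: "integrable lebesgue (\<lambda>x. laplace \<eta> x * Gr m x)" "integrable lebesgue (\<lambda>x. \<eta> x * Gr m x)" if "m > 0" for m
      by (intro rL2_mult_integrable Gr_rL2 test_rL2 test_laplace \<eta> that)+
    have "(LINT x|lebesgue. laplace \<eta> x * f x) = (LINT x|lebesgue. laplace \<eta> x * (a' * Gr l' x - a * Gr l x))"
      by (rule LINT_AE_eq[OF borel_measurable_integrable[OF test_mult_integrable[OF test_laplace[OF \<eta>] f]]])
        (use e in \<open>eventually_elim, simp\<close>)
    also have "\<dots> = (LINT x|lebesgue. a' * (laplace \<eta> x * Gr l' x) - a * (laplace \<eta> x * Gr l x))"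
      by (rule Bochner_Integration.integral_cong) (auto simp: algebra_simps)
    also have "\<dots> = a' * (LINT x|lebesgue. laplace \<eta> x * Gr l' x) - a * (LINT x|lebesgue. laplace \<eta> x * Gr l x)"
      using i l by simp
    also have "\<dots> = (a - a') * \<eta> 0 + (a' * l' * (LINT x|lebesgue. \<eta> x * Gr l' x) - a * l * (LINT x|lebesgue. \<eta> x * Gr l x))"
      unfolding Gr_laplace[OF l(1) \<eta>] Gr_laplace[OF l(2) \<eta>] by (simp add: algebra_simps)
    also have "a' * l' * (LINT x|lebesgue. \<eta> x * Gr l' x) - a * l * (LINT x|lebesgue. \<eta> x * Gr l x)
        = (LINT x|lebesgue. (a' * l') * (\<eta> x * Gr l' x) - (a * l) * (\<eta> x * Gr l x))"
      using i l by simp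
    also have "\<dots> = (LINT x|lebesgue. \<eta> x * v x)"
      by (rule Bochner_Integration.integral_cong) (auto simp: v_def algebra_simps)
    finally show "(LINT x|lebesgue. laplace \<eta> x * f x) = (a - a') * \<eta> 0 + (LINT x|lebesgue. \<eta> x * v x)" .
  qed
  then show ?thesis by simp
qed

lemma charge_unique:
  assumes "\<phi> \<in> W12" "\<phi>' \<in> W12" "l > 0" "l' > 0"
    and e: "AE x in lebesgue. \<phi> x + q * green l x = \<phi>' x + q' * green l' x"
  shows "q = q'"
proof -
  define \<psi> where "\<psi> x = \<phi> x - \<phi>' x" for x
  have \<psi>: "\<psi> \<in> W12" unfolding \<psi>_def by (rule W12_diff[OF assms(1,2)])
  have w: "rweak i (\<lambda>x. Re (\<psi> x)) (\<lambda>x. Re (weak_partial i \<psi> x))" "rweak i (\<lambda>x. Im (\<psi> x)) (\<lambda>x. Im (weak_partial i \<psi> x))"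
    "rL2 (\<lambda>x. Re (weak_partial i \<psi> x))" "rL2 (\<lambda>x. Im (weak_partial i \<psi> x))" for i
    using W12_weak_partial[OF \<psi>, of i] by (auto simp: has_weak_partial_iff L2_iff)
  have "AE x in lebesgue. \<psi> x = q' * green l' x - q * green l x"
    using e by eventually_elim (simp add: \<psi>_def algebra_simps)
  then have "AE x in lebesgue. Re (\<psi> x) = Re q' * Gr l' x - Re q * Gr l x"
    "AE x in lebesgue. Im (\<psi> x) = Im q' * Gr l' x - Im q * Gr l x"
    by (eventually_elim, simp add: green_Gr)+
  then have "Re q = Re q'" "Im q = Im q'"
    using Gr_charge_unique[OF w(1) w(3) assms(3,4)] Gr_charge_unique[OF w(2) w(4) assms(3,4)] by blast+
  then show ?thesis by (simp add: complex_eq_iff)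
qed

lemma charge_eqI:
  assumes "\<phi> \<in> W12" "l > 0" "AE x in lebesgue. u x = \<phi> x + q * green l x"
  shows "charge u = q"
  unfolding charge_def
proof (rule the_equality)
  show "\<exists>\<phi>\<in>W12. \<exists>l>0. AE x in lebesgue. u x = \<phi> x + q * green l x" using assms by blast
  fix q' assume "\<exists>\<phi>\<in>W12. \<exists>l>0. AE x in lebesgue. u x = \<phi> x + q' * green l x"
  then obtain \<phi>' l' where *: "\<phi>' \<in> W12" "l' > 0" "AE x in lebesgue. u x = \<phi>' x + q' * green l' x" by blast
  have "AE x in lebesgue. \<phi>' x + q' * green l' x = \<phi> x + q * green l x"
    using assms(3) *(3) by eventually_elim simp
  then show "q' = q" by (rule charge_unique[OF *(1) assms(1) *(2) assms(2)])
qed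

lemma W12_alphaI:
  assumes "\<phi> \<in> W12" "l > 0" "AE x in lebesgue. u x = \<phi> x + q * green l x"
  shows "u \<in> W12_alpha"
  using assms unfolding W12_alpha_def by blast

text \<open>Passing from the parameter \<open>l\<close> of a given decomposition to \<open>m\<close>
  moves \<open>q * (green l - green m)\<close> into the regular part, where
  \<open>green_diff_W12\<close> admits it.\<close>

lemma regular_part_W12:
  assumes "u \<in> W12_alpha" "m > 0" shows "regular_part m u \<in> W12"
proof -
  obtain \<phi> q l where *: "\<phi> \<in> W12" "l > 0" "AE x in lebesgue. u x = \<phi> x + q * green l x"
    using assms unfolding W12_alpha_def by blast
  have q: "charge u = q" by (rule charge_eqI[OF *])
  have "(\<lambda>x. \<phi> x + q * (green l x - green m x)) \<in> W12"
    by (intro W12_add * W12_cmult green_diff_W12 assms(2))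
  then show ?thesis
    by (rule W12_AE) (use *(3) in \<open>eventually_elim, simp add: regular_part_def q algebra_simps\<close>)
qed

lemma W12_alpha_decomp: "u x = regular_part m u x + charge u * green m x"
  by (simp add: regular_part_def)

lemma W12_alpha_add:
  assumes "u \<in> W12_alpha" "v \<in> W12_alpha"
  shows "(\<lambda>x. u x + c * v x) \<in> W12_alpha" "charge (\<lambda>x. u x + c * v x) = charge u + c * charge v"
proof -
  have w: "(\<lambda>x. regular_part 1 u x + c * regular_part 1 v x) \<in> W12"
    by (intro W12_add W12_cmult regular_part_W12 assms) auto
  have "u x + c * v x = regular_part 1 u x + c * regular_part 1 v x + (charge u + c * charge v) * green 1 x" for x
    by (simp add: regular_part_def algebra_simps)
  then have ae: "AE x in lebesgue. u x + c * v x = (regular_part 1 u x + c * regular_part 1 v x) + (charge u + c * charge v) * green 1 x"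
    by (intro AE_I2)
  show "(\<lambda>x. u x + c * v x) \<in> W12_alpha" by (rule W12_alphaI[OF w _ ae]) simp
  show "charge (\<lambda>x. u x + c * v x) = charge u + c * charge v" by (rule charge_eqI[OF w _ ae]) simp
qed

lemma regular_part_add:
  assumes "u \<in> W12_alpha" "v \<in> W12_alpha"
  shows "regular_part m (\<lambda>x. u x + c * v x) x = regular_part m u x + c * regular_part m v x"
  by (simp add: regular_part_def W12_alpha_add(2)[OF assms] algebra_simps)

lemma zero_W12: "(\<lambda>x. 0) \<in> W12"
  using W12_cmult[OF test_W12(1)[OF chi_test], of 0] by simp

lemma W12_in_alpha:
  assumes "\<phi> \<in> W12" shows "\<phi> \<in> W12_alpha" "charge \<phi> = 0" "regular_part m \<phi> = \<phi>"
proof -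
  have ae: "AE x in lebesgue. \<phi> x = \<phi> x + 0 * green 1 x" by simp
  show "\<phi> \<in> W12_alpha" by (rule W12_alphaI[OF assms _ ae]) simp
  show "charge \<phi> = 0" by (rule charge_eqI[OF assms _ ae]) simp
  then show "regular_part m \<phi> = \<phi>" by (auto simp: regular_part_def)
qed

lemma green_in_alpha:
  assumes "m > 0"
  shows "(\<lambda>x. c * green m x) \<in> W12_alpha" "charge (\<lambda>x. c * green m x) = c"
    "regular_part m (\<lambda>x. c * green m x) = (\<lambda>x. 0)"
proof -
  have ae: "AE x in lebesgue. c * green m x = 0 + c * green m x" by simp
  show "(\<lambda>x. c * green m x) \<in> W12_alpha" by (rule W12_alphaI[OF zero_W12 assms ae])
  show "charge (\<lambda>x. c * green m x) = c" by (rule charge_eqI[OF zero_W12 assms ae])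
  then show "regular_part m (\<lambda>x. c * green m x) = (\<lambda>x. 0)" by (auto simp: regular_part_def)
qed

lemma W12_alpha_L2: assumes "u \<in> W12_alpha" shows "u \<in> L2"
proof -
  have "(\<lambda>x. regular_part 1 u x + charge u * green 1 x) \<in> L2"
    using regular_part_W12[OF assms, of 1] by (intro L2_add L2_cmult green_L2) (auto simp: W12_def)
  then show ?thesis by (simp add: regular_part_def)
qed

section \<open>Higher integrability in the energy space, and elements of
  \<open>X_space\<close>\<close>

lemma W12_sobolev:
  assumes "\<phi> \<in> W12"
  shows "rL2 (\<lambda>x. Re (\<phi> x) ^ Suc m)" "rL2 (\<lambda>x. Im (\<phi> x) ^ Suc m)"
proof -
  have w: "rweak i (\<lambda>x. Re (\<phi> x)) (\<lambda>x. Re (weak_partial i \<phi> x))" "rweak i (\<lambda>x. Im (\<phi> x)) (\<lambda>x. Im (weak_partial i \<phi> x))"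
    "rL2 (\<lambda>x. Re (weak_partial i \<phi> x))" "rL2 (\<lambda>x. Im (weak_partial i \<phi> x))" for i
    using W12_weak_partial[OF assms, of i] by (auto simp: has_weak_partial_iff L2_iff)
  have r: "rL2 (\<lambda>x. Re (\<phi> x))" "rL2 (\<lambda>x. Im (\<phi> x))" using assms by (auto simp: W12_def L2_iff)
  show "rL2 (\<lambda>x. Re (\<phi> x) ^ Suc m)" by (rule sobolev[OF r(1) w(1) w(3)])
  show "rL2 (\<lambda>x. Im (\<phi> x) ^ Suc m)" by (rule sobolev[OF r(2) w(2) w(4)])
qed

lemma power_sum3:
  fixes a b c :: real
  assumes "a \<ge> 0" "b \<ge> 0" "c \<ge> 0"
  shows "(a + b + c) ^ n \<le> 3 ^ n * (a ^ n + b ^ n + c ^ n)"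
proof -
  define M where "M = max a (max b c)"
  have "(a + b + c) ^ n \<le> (3 * M) ^ n" using assms by (intro power_mono) (auto simp: M_def)
  also have "\<dots> = 3 ^ n * M ^ n" by (simp add: power_mult_distrib)
  also have "M ^ n \<le> a ^ n + b ^ n + c ^ n" using assms by (auto simp: M_def max_def)
  finally show ?thesis by simp
qed

text \<open>Sobolev for the regular part and the mild singularity of \<open>Gr\<close> give all even
  powers; \<open>powr_integrable\<close> later interpolates to real exponents from 2 on.\<close>

lemma W12_alpha_power:
  assumes u: "u \<in> W12_alpha" shows "rL2 (\<lambda>x. cmod (u x) ^ Suc m)"
proof -
  define \<phi> where "\<phi> = regular_part 1 u"
  define q where "q = charge u"
  define n where "n = Suc m * 2"
  have \<phi>: "\<phi> \<in> W12" unfolding \<phi>_def by (rule regular_part_W12[OF u]) simp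
  have e: "u x = \<phi> x + q * green 1 x" for x by (simp add: \<phi>_def q_def regular_part_def)
  have um: "u \<in> borel_measurable lebesgue" using W12_alpha_L2[OF u] by (simp add: L2_def)
  define w where "w x = 3 ^ n * ((Re (\<phi> x) ^ Suc m)\<^sup>2 + (Im (\<phi> x) ^ Suc m)\<^sup>2 + (cmod q ^ Suc m * Gr 1 x ^ Suc m)\<^sup>2)" for x
  have iw: "integrable lebesgue w"
    unfolding w_def
    by (intro integrable_mult_right Bochner_Integration.integrable_add rL2D(2) W12_sobolev \<phi> rL2_cmult Gr_power_rL2) auto
  show ?thesis
  proof (rule rL2_bound(1)[OF iw])
    show "(\<lambda>x. cmod (u x) ^ Suc m) \<in> borel_measurable lebesgue"
      by (intro borel_measurable_power meas_cmod um)
    show "AE x in lebesgue. (cmod (u x) ^ Suc m)\<^sup>2 \<le> w x"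
    proof (rule AE_I2)
      fix x
      have "cmod (u x) \<le> cmod (\<phi> x) + cmod q * Gr 1 x"
        unfolding e using norm_triangle_ineq[of "\<phi> x" "q * green 1 x"] Gr_nonneg[of 1 x]
        by (simp add: norm_mult green_Gr)
      also have "\<dots> \<le> \<bar>Re (\<phi> x)\<bar> + \<bar>Im (\<phi> x)\<bar> + cmod q * Gr 1 x"
        using cmod_le[of "\<phi> x"] by simp
      finally have "cmod (u x) ^ n \<le> (\<bar>Re (\<phi> x)\<bar> + \<bar>Im (\<phi> x)\<bar> + cmod q * Gr 1 x) ^ n" by (intro power_mono) auto
      also have "\<dots> \<le> 3 ^ n * (\<bar>Re (\<phi> x)\<bar> ^ n + \<bar>Im (\<phi> x)\<bar> ^ n + (cmod q * Gr 1 x) ^ n)"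
        by (rule power_sum3) (auto intro!: mult_nonneg_nonneg Gr_nonneg)
      also have "\<dots> = w x"
      proof -
        have "\<bar>a\<bar> ^ n = (a ^ Suc m)\<^sup>2" for a :: real
          unfolding n_def power_mult by (simp add: power_abs[symmetric] del: power_Suc)
        moreover have "(cmod q * Gr 1 x) ^ n = (cmod q ^ Suc m * Gr 1 x ^ Suc m)\<^sup>2"
          unfolding n_def power_mult by (simp only: power_mult_distrib)
        ultimately show ?thesis unfolding w_def by (simp only:)
      qed
      finally show "(cmod (u x) ^ Suc m)\<^sup>2 \<le> w x" unfolding n_def power_mult .
    qed
  qed
qed

lemma X_space_meas: "u \<in> X_space \<Longrightarrow> u \<in> borel_measurable lebesgue"
  using W12_alpha_L2 by (auto simp: X_space_def L2_def)

lemma X_space_add: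
  assumes "u \<in> X_space" "v \<in> X_space" shows "(\<lambda>x. u x + c * v x) \<in> X_space"
proof -
  have w: "(\<lambda>x. u x + c * v x) \<in> W12_alpha" using assms by (intro W12_alpha_add) (auto simp: X_space_def)
  have i: "integrable lebesgue (\<lambda>x. 2 * (ln (1 + norm x) * (cmod (u x))\<^sup>2) + 2 * (cmod c)\<^sup>2 * (ln (1 + norm x) * (cmod (v x))\<^sup>2))"
    using assms by (intro Bochner_Integration.integrable_add integrable_mult_right) (auto simp: X_space_def)
  have "integrable lebesgue (\<lambda>x. ln (1 + norm x) * (cmod (u x + c * v x))\<^sup>2)"
  proof (rule integral_bound(1)[OF i])
    have ln: "(\<lambda>x::plane. ln (1 + norm x)) \<in> borel_measurable lebesgue" by (intro borel_imp_lebesgue) measurable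
    show "(\<lambda>x. ln (1 + norm x) * (cmod (u x + c * v x))\<^sup>2) \<in> borel_measurable lebesgue"
      by (intro borel_measurable_times ln borel_measurable_power meas_cmod borel_measurable_add borel_measurable_const X_space_meas assms)
    show "AE x in lebesgue. norm (ln (1 + norm x) * (cmod (u x + c * v x))\<^sup>2)
      \<le> 2 * (ln (1 + norm x) * (cmod (u x))\<^sup>2) + 2 * (cmod c)\<^sup>2 * (ln (1 + norm x) * (cmod (v x))\<^sup>2)"
    proof (rule AE_I2)
      fix x :: plane
      have "(cmod (u x + c * v x))\<^sup>2 \<le> (cmod (u x) + cmod c * cmod (v x))\<^sup>2"
        using norm_triangle_ineq[of "u x" "c * v x"] by (intro power_mono) (auto simp: norm_mult)
      also have "\<dots> \<le> 2 * (cmod (u x))\<^sup>2 + 2 * (cmod c * cmod (v x))\<^sup>2" by (rule sq_add_le2)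
      finally have "ln (1 + norm x) * (cmod (u x + c * v x))\<^sup>2 \<le> ln (1 + norm x) * (2 * (cmod (u x))\<^sup>2 + 2 * (cmod c * cmod (v x))\<^sup>2)"
        by (intro mult_left_mono) auto
      then show "norm (ln (1 + norm x) * (cmod (u x + c * v x))\<^sup>2)
        \<le> 2 * (ln (1 + norm x) * (cmod (u x))\<^sup>2) + 2 * (cmod c)\<^sup>2 * (ln (1 + norm x) * (cmod (v x))\<^sup>2)"
        by (simp add: abs_mult power_mult_distrib algebra_simps)
    qed
  qed
  with w show ?thesis by (simp add: X_space_def)
qed

lemma zero_X: "(\<lambda>x. 0) \<in> X_space"
  using W12_in_alpha(1)[OF zero_W12] by (simp add: X_space_def)

lemma X_space_cmult: "v \<in> X_space \<Longrightarrow> (\<lambda>x. c * v x) \<in> X_space"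
  using X_space_add[OF zero_X, of v c] by simp

lemma test_X: assumes \<eta>: "\<eta> \<in> test_functions" shows "(\<lambda>x. complex_of_real (\<eta> x)) \<in> X_space"
proof -
  obtain R where R: "\<And>x. norm x > R \<Longrightarrow> \<eta> x = 0" using test_supp[OF \<eta>] by blast
  have "integrable lebesgue (\<lambda>x. ln (1 + norm x) * (\<eta> x)\<^sup>2)"
  proof (rule continuous_csupp_integrable(2)[of _ R])
    have "1 + norm x \<noteq> 0" for x :: plane using norm_ge_zero[of x] by linarith
    then show "continuous_on UNIV (\<lambda>x. ln (1 + norm x) * (\<eta> x)\<^sup>2)"
      by (intro continuous_intros test_continuous \<eta>) simp
  qed (simp add: R)
  then show ?thesis using W12_in_alpha(1)[OF test_W12(1)[OF \<eta>]] by (simp add: X_space_def)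
qed

text \<open>The logarithmic weight is below \<open>(1 + norm x)^2\<close>, which
  \<open>Gr_weighted_rL2\<close> already handles.\<close>

lemma green_X: assumes m: "m > 0" shows "green m \<in> X_space"
proof -
  have "integrable lebesgue (\<lambda>x. ln (1 + norm x) * (Gr m x)\<^sup>2)"
  proof (rule integral_bound(1)[OF rL2D(2)[OF Gr_weighted_rL2[OF m]]])
    show "(\<lambda>x. ln (1 + norm x) * (Gr m x)\<^sup>2) \<in> borel_measurable lebesgue" by (intro borel_imp_lebesgue) measurable
    show "AE x in lebesgue. norm (ln (1 + norm x) * (Gr m x)\<^sup>2) \<le> ((1 + norm x) * Gr m x)\<^sup>2"
    proof (rule AE_I2)
      fix x :: plane
      have "ln (1 + norm x) \<le> norm x" by (rule ln_add_one_self_le_self) simp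
      also have "\<dots> \<le> (1 + norm x)\<^sup>2" by (simp add: power2_eq_square algebra_simps)
      finally have "ln (1 + norm x) * (Gr m x)\<^sup>2 \<le> (1 + norm x)\<^sup>2 * (Gr m x)\<^sup>2" by (intro mult_right_mono) auto
      then show "norm (ln (1 + norm x) * (Gr m x)\<^sup>2) \<le> ((1 + norm x) * Gr m x)\<^sup>2"
        by (simp add: power_mult_distrib abs_mult)
    qed
  qed
  moreover have "green m \<in> W12_alpha" using green_in_alpha(1)[OF m, of 1] by simp
  ultimately show ?thesis using Gr_nonneg[OF m] by (simp add: X_space_def green_Gr)
qed

section \<open>Inner products and the form as quadratic polynomials along real lines\<close>

lemma inner_L2_integrable:
  assumes "f \<in> L2" "g \<in> L2" shows "integrable lebesgue (\<lambda>x. cnj (f x) * g x)"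
proof (rule integral_bound(1)[OF rL2_mult_integrable[OF L2_sq[OF assms(1)] L2_sq[OF assms(2)]]])
  have "(\<lambda>x. cnj (f x)) \<in> borel_measurable lebesgue"
    using assms(1) by (auto simp: L2_def borel_measurable_complex_iff)
  then show "(\<lambda>x. cnj (f x) * g x) \<in> borel_measurable lebesgue"
    using assms(2) by (intro borel_measurable_times) (auto simp: L2_def)
qed (simp add: norm_mult)

lemma inner_L2_add_right:
  assumes "f \<in> L2" "g \<in> L2" "h \<in> L2"
  shows "inner_L2 f (\<lambda>x. g x + c * h x) = inner_L2 f g + c * inner_L2 f h"
proof -
  have "inner_L2 f (\<lambda>x. g x + c * h x) = (LINT x|lebesgue. cnj (f x) * g x + c * (cnj (f x) * h x))"
    unfolding inner_L2_def by (rule Bochner_Integration.integral_cong) (auto simp: algebra_simps)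
  then show ?thesis using inner_L2_integrable[OF assms(1,2)] inner_L2_integrable[OF assms(1,3)] by (simp add: inner_L2_def)
qed

lemma inner_L2_cnj: "inner_L2 g f = cnj (inner_L2 f g)"
proof -
  have "cnj (inner_L2 f g) = (LINT x|lebesgue. cnj (cnj (f x) * g x))"
    unfolding inner_L2_def by (rule Bochner_Integration.integral_cnj[symmetric])
  then show ?thesis by (simp add: inner_L2_def mult.commute)
qed

lemma inner_L2_quadratic:
  assumes "f \<in> L2" "g \<in> L2"
  shows "Re (inner_L2 (\<lambda>x. f x + of_real t * g x) (\<lambda>x. f x + of_real t * g x))
    = Re (inner_L2 f f) + 2 * t * Re (inner_L2 f g) + t\<^sup>2 * Re (inner_L2 g g)"
proof -
  define h where "h x = f x + of_real t * g x" for x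
  have h: "h \<in> L2" unfolding h_def by (intro L2_add L2_cmult assms)
  have "inner_L2 h h = inner_L2 h f + of_real t * inner_L2 h g"
    unfolding h_def by (rule inner_L2_add_right[OF h[unfolded h_def] assms])
  also have "inner_L2 h f = cnj (inner_L2 f f + of_real t * inner_L2 f g)"
    unfolding inner_L2_cnj[of h f] unfolding h_def by (simp only: inner_L2_add_right[OF assms(1) assms])
  also have "inner_L2 h g = cnj (inner_L2 g f + of_real t * inner_L2 g g)"
    unfolding inner_L2_cnj[of h g] unfolding h_def by (simp only: inner_L2_add_right[OF assms(2) assms])
  also have "inner_L2 g f = cnj (inner_L2 f g)" by (rule inner_L2_cnj)
  finally show ?thesis unfolding h_def by (simp add: algebra_simps power2_eq_square)
qed

lemma inner_L2_AE:
  assumes "f \<in> L2" "g \<in> L2" "AE x in lebesgue. f x = f' x" "AE x in lebesgue. g x = g' x"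
  shows "inner_L2 f g = inner_L2 f' g'"
  unfolding inner_L2_def
proof (rule integral_cong_AE)
  show ae: "AE x in lebesgue. cnj (f x) * g x = cnj (f' x) * g' x" using assms(3,4) by eventually_elim simp
  show m: "(\<lambda>x. cnj (f x) * g x) \<in> borel_measurable lebesgue"
    by (rule borel_measurable_integrable[OF inner_L2_integrable[OF assms(1,2)]])
  show "(\<lambda>x. cnj (f' x) * g' x) \<in> borel_measurable lebesgue"
    by (rule borel_measurable_integrable[OF inner_L2_integrable[OF L2_AE[OF assms(1,3)] L2_AE[OF assms(2,4)]]])
qed

lemma inner_grad_eq:
  assumes "a \<in> W12" "b \<in> W12"
  shows "inner_grad a b = (\<Sum>i\<in>UNIV. inner_L2 (weak_partial i a) (weak_partial i b))"
  unfolding inner_grad_def inner_L2_def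
  by (rule Bochner_Integration.integral_sum) (intro inner_L2_integrable W12_weak_partial assms)

lemma inner_grad_quadratic:
  assumes a: "a \<in> W12" and b: "b \<in> W12"
  shows "Re (inner_grad (\<lambda>x. a x + of_real t * b x) (\<lambda>x. a x + of_real t * b x))
    = Re (inner_grad a a) + 2 * t * Re (inner_grad a b) + t\<^sup>2 * Re (inner_grad b b)"
proof -
  define h where "h x = a x + of_real t * b x" for x
  have h: "h \<in> W12" unfolding h_def by (intro W12_add W12_cmult a b)
  have "AE x in lebesgue. weak_partial i h x = weak_partial i a x + of_real t * weak_partial i b x" for i
    unfolding h_def by (intro weak_partial_AE has_weak_partial_add has_weak_partial_cmult W12_weak_partial a b)
  then have "inner_L2 (weak_partial i h) (weak_partial i h)
     = inner_L2 (\<lambda>x. weak_partial i a x + of_real t * weak_partial i b x) (\<lambda>x. weak_partial i a x + of_real t * weak_partial i b x)" for i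
    by (intro inner_L2_AE W12_weak_partial h)
  then have "Re (inner_L2 (weak_partial i h) (weak_partial i h)) = Re (inner_L2 (weak_partial i a) (weak_partial i a))
     + 2 * t * Re (inner_L2 (weak_partial i a) (weak_partial i b)) + t\<^sup>2 * Re (inner_L2 (weak_partial i b) (weak_partial i b))" for i
    by (simp only: inner_L2_quadratic[OF W12_weak_partial(2)[OF a] W12_weak_partial(2)[OF b]])
  then have "Re (inner_grad h h) = Re (inner_grad a a) + 2 * t * Re (inner_grad a b) + t\<^sup>2 * Re (inner_grad b b)"
    by (simp add: inner_grad_eq a b h sum_2 algebra_simps)
  then show ?thesis by (simp only: h_def[abs_def])
qed

text \<open>The parameter at which \<open>H_form\<close> evaluates \<open>H_form_at\<close>.\<close>

definition lam0 :: real where "lam0 = (SOME l. l > 0)"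

lemma lam0: "lam0 > 0"
  unfolding lam0_def by (rule someI[of "\<lambda>l. l > 0" 1]) simp

lemma H_form_quadratic:
  assumes u: "u \<in> W12_alpha" and v: "v \<in> W12_alpha"
  shows "Re (H_form \<alpha> (\<lambda>x. u x + of_real t * v x) (\<lambda>x. u x + of_real t * v x))
    = Re (H_form \<alpha> u u) + 2 * t * Re (H_form \<alpha> u v) + t\<^sup>2 * Re (H_form \<alpha> v v)"
proof -
  note r = regular_part_W12[OF u lam0] regular_part_W12[OF v lam0]
  have r2: "regular_part lam0 u \<in> L2" "regular_part lam0 v \<in> L2" using r by (auto simp: W12_def)
  have rp: "regular_part lam0 (\<lambda>x. u x + of_real t * v x) = (\<lambda>x. regular_part lam0 u x + of_real t * regular_part lam0 v x)"
    by (rule ext, rule regular_part_add[OF u v])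
  have q: "Re (cnj (a + of_real t * b) * (a + of_real t * b)) = Re (cnj a * a) + 2 * t * Re (cnj a * b) + t\<^sup>2 * Re (cnj b * b)" for a b
    by (simp add: power2_eq_square algebra_simps)
  have f: "Re (H_form \<alpha> f g) = Re (inner_grad (regular_part lam0 f) (regular_part lam0 g))
     + lam0 * (Re (inner_L2 (regular_part lam0 f) (regular_part lam0 g)) - Re (inner_L2 f g))
     + (\<alpha> + theta lam0) * Re (cnj (charge f) * charge g)" for f g
  proof -
    have H: "H_form \<alpha> f g = inner_grad (regular_part lam0 f) (regular_part lam0 g)
     + of_real lam0 * (inner_L2 (regular_part lam0 f) (regular_part lam0 g) - inner_L2 f g)
     + of_real (\<alpha> + theta lam0) * (cnj (charge f) * charge g)"
      by (simp add: H_form_def H_form_at_def lam0_def mult.assoc)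
    show ?thesis unfolding H by simp
  qed
  show ?thesis
    unfolding f rp W12_alpha_add(2)[OF u v] q inner_grad_quadratic[OF r] inner_L2_quadratic[OF r2]
      inner_L2_quadratic[OF W12_alpha_L2[OF u] W12_alpha_L2[OF v]]
    by (simp only: distrib_left right_diff_distrib) (simp add: algebra_simps)
qed

section \<open>Differentiating the energy along lines\<close>

definition lw :: "plane \<Rightarrow> real" where "lw x = ln (1 + norm x)"

text \<open>Square integrable, and at least \<open>- ln (norm z)\<close> on the unit ball.\<close>

definition Nk :: "plane \<Rightarrow> real" where "Nk z = 4 * exp (- norm z / 2) / sqrt (norm z)"

text \<open>The three integrability conditions answer the three terms of
  \<open>ln_kernel_bound\<close>: \<open>f\<close> for \<open>lw x\<close>, \<open>lw * f\<close>
  for \<open>lw y\<close>, and \<open>rL2\<close> for the singular part \<open>Nk\<close>.\<close>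

definition dens :: "(plane \<Rightarrow> real) \<Rightarrow> bool" where
  "dens f \<longleftrightarrow> f \<in> borel_measurable lebesgue \<and> integrable lebesgue f \<and>
     integrable lebesgue (\<lambda>x. lw x * f x) \<and> rL2 f"

definition pot :: "(plane \<Rightarrow> real) \<Rightarrow> plane \<Rightarrow> real" where
  "pot g x = (LINT y|lebesgue. ln (norm (x - y)) * g y)"

lemma lw_nonneg: "lw x \<ge> 0" by (simp add: lw_def)

lemma lw_borel [measurable]: "lw \<in> borel_measurable borel" unfolding lw_def by measurable

lemma lw_meas: "lw \<in> borel_measurable lebesgue" by (intro borel_imp_lebesgue lw_borel)

lemma Nk_borel [measurable]: "Nk \<in> borel_measurable borel" unfolding Nk_def by measurable

lemma Nk_nonneg: "Nk z \<ge> 0" by (simp add: Nk_def)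

lemma Nk_rL2: "rL2 Nk"
proof -
  have e: "(Nk z)\<^sup>2 = 16 * (exp (- 1 * norm z) / norm z)" for z
  proof -
    have "(exp (- norm z / 2))\<^sup>2 = exp (- 1 * norm z)"
      by (simp add: power2_eq_square exp_add[symmetric])
    moreover have "(sqrt (norm z))\<^sup>2 = norm z" by simp
    ultimately show ?thesis unfolding Nk_def power_divide power_mult_distrib by simp
  qed
  have "integrable lebesgue (\<lambda>z::plane. 16 * (exp (- 1 * norm z) / norm z))"
    by (intro integrable_mult_right) (subst integrable_completion, auto intro: exp_over_norm_integrable[of 1, simplified])
  then show ?thesis unfolding rL2_def e using borel_imp_lebesgue[OF Nk_borel] by blast
qed

lemma Nk_shift: "rL2 (\<lambda>y. Nk (x - y))" "sq (\<lambda>y. Nk (x - y)) = sq Nk"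
proof -
  have i: "integrable lborel (\<lambda>y. (Nk y)\<^sup>2)"
    using rL2D(2)[OF Nk_rL2] by (subst (asm) integrable_completion) (measurable)
  have m: "(\<lambda>y. (Nk (x - y))\<^sup>2) \<in> borel_measurable lborel" by measurable
  have "integrable lborel (\<lambda>y. (Nk (x - y))\<^sup>2)"
    using lborel_reflect(3)[of "\<lambda>y. (Nk y)\<^sup>2" x] i by simp
  then have "integrable lebesgue (\<lambda>y. (Nk (x - y))\<^sup>2)" using integrable_completion[OF m] by blast
  moreover have "(\<lambda>y. Nk (x - y)) \<in> borel_measurable lebesgue" by (intro borel_imp_lebesgue) measurable
  ultimately show "rL2 (\<lambda>y. Nk (x - y))" unfolding rL2_def by blast
  have "sq (\<lambda>y. Nk (x - y)) = (\<integral>y. (Nk (x - y))\<^sup>2 \<partial>lborel)"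
    unfolding sq_def by (rule lborel_lebesgue_integral) measurable
  also have "\<dots> = (\<integral>y. (Nk y)\<^sup>2 \<partial>lborel)" by (rule lborel_reflect(1)[of "\<lambda>y. (Nk y)\<^sup>2"]) measurable
  also have "\<dots> = sq Nk" unfolding sq_def by (rule lborel_lebesgue_integral[symmetric]) measurable
  finally show "sq (\<lambda>y. Nk (x - y)) = sq Nk" .
qed

text \<open>At distance at least 1, \<open>norm (x - y) <= (1 + norm x) * (1 + norm y)\<close>
  distributes the growth over both points; at smaller distance \<open>Nk\<close> dominates the
  singularity.\<close>

lemma ln_kernel_bound: "\<bar>ln (norm (x - y :: plane))\<bar> \<le> lw x + lw y + Nk (x - y)"
proof -
  define r where "r = norm (x - y)"
  have r0: "r \<ge> 0" by (simp add: r_def)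
  consider "r \<ge> 1" | "0 < r" "r < 1" | "r = 0" using r0 by linarith
  then have "\<bar>ln r\<bar> \<le> lw x + lw y + Nk (x - y)"
  proof cases
    case 1
    have "r \<le> norm x + norm y" unfolding r_def by (rule norm_triangle_ineq4)
    also have "\<dots> \<le> (1 + norm x) * (1 + norm y)" by (simp add: algebra_simps)
    finally have "ln r \<le> ln ((1 + norm x) * (1 + norm y))" using 1 by (intro ln_mono) auto
    also have "\<dots> = lw x + lw y" unfolding lw_def by (rule ln_mult_pos) (auto intro: add_pos_nonneg)
    finally show ?thesis using 1 Nk_nonneg[of "x - y"] by simp
  next
    case 2
    have s: "sqrt r > 0" using 2 by simp
    \<comment> \<open>Taking a square root first makes \<open>ln z <= z - 1\<close> produce the
      square integrable \<open>1 / sqrt r\<close>; the factor 4 in \<open>Nk\<close> pays for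
      \<open>exp (- r / 2) >= 1 / 2\<close>.\<close>
    have "- ln r = 2 * ln (inverse (sqrt r))"
      using 2 by (simp add: ln_inverse ln_sqrt)
    also have "\<dots> \<le> 2 * (inverse (sqrt r) - 1)" using s by (intro mult_left_mono ln_le_minus_one) auto
    also have "\<dots> \<le> 4 * (1 / 2) / sqrt r" by (simp add: inverse_eq_divide)
    also have "\<dots> \<le> 4 * exp (- r / 2) / sqrt r"
    proof (intro divide_right_mono mult_left_mono)
      have "1 / 2 \<le> 1 + - r / 2" using 2 by simp
      also have "\<dots> \<le> exp (- r / 2)" by (rule exp_ge_add_one_self)
      finally show "1 / 2 \<le> exp (- r / 2)" .
    qed (use s in auto)
    finally have "- ln r \<le> Nk (x - y)" by (simp add: Nk_def r_def)
    moreover have "ln r \<le> 0" using 2 by simp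
    ultimately show ?thesis using lw_nonneg[of x] lw_nonneg[of y] by linarith
  next
    \<comment> \<open>Here \<open>ln 0 = 0\<close> by convention.\<close>
    case 3
    then show ?thesis using lw_nonneg[of x] lw_nonneg[of y] Nk_nonneg[of "x - y"] by simp
  qed
  then show ?thesis by (simp add: r_def)
qed

lemma dens_bound:
  assumes "dens g" "f \<in> borel_measurable lebesgue" "\<And>x. \<bar>f x\<bar> \<le> g x"
  shows "dens f"
proof -
  have g: "integrable lebesgue g" "integrable lebesgue (\<lambda>x. lw x * g x)" "rL2 g" using assms(1) by (auto simp: dens_def)
  have "integrable lebesgue f" by (rule integral_bound(1)[OF g(1) assms(2)]) (use assms(3) in simp)
  moreover have "integrable lebesgue (\<lambda>x. lw x * f x)"
    by (rule integral_bound(1)[OF g(2) borel_measurable_times[OF lw_meas assms(2)]])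
      (use assms(3) lw_nonneg in \<open>auto simp: abs_mult intro!: mult_left_mono\<close>)
  moreover have "rL2 f"
  proof (rule rL2_bound(1)[OF rL2D(2)[OF g(3)] assms(2)], rule AE_I2)
    fix x show "(f x)\<^sup>2 \<le> (g x)\<^sup>2" using power_mono[OF assms(3)[of x], of 2] by simp
  qed
  ultimately show ?thesis using assms(2) by (simp add: dens_def)
qed

lemma dens_add: assumes "dens f" "dens g" shows "dens (\<lambda>x. f x + c * g x)"
  using assms unfolding dens_def distrib_left mult.left_commute[of _ c]
  by (intro conjI borel_measurable_add borel_measurable_times borel_measurable_const
      Bochner_Integration.integrable_add integrable_mult_right rL2_add(1) rL2_cmult) auto

lemma dens_abs: assumes "dens f" shows "dens (\<lambda>x. \<bar>f x\<bar>)"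
proof -
  have "integrable lebesgue (\<lambda>x. \<bar>lw x * f x\<bar>)" using assms by (intro integrable_abs) (simp add: dens_def)
  then have "integrable lebesgue (\<lambda>x. lw x * \<bar>f x\<bar>)" by (simp add: abs_mult lw_nonneg)
  then show ?thesis using assms by (auto simp: dens_def rL2_def intro: borel_measurable_abs integrable_abs)
qed

lemma ln_kernel_meas: "(\<lambda>y. ln (norm (x - y :: plane))) \<in> borel_measurable lebesgue"
  by (intro borel_imp_lebesgue) measurable

text \<open>\<open>ln_kernel_bound\<close> is integrated against \<open>abs g\<close>; the singular
  part is estimated by Cauchy-Schwarz, and only the term \<open>lw x\<close> depends on
  \<open>x\<close>.\<close>

lemma pot_integrable:
  assumes g: "dens g"
  shows "integrable lebesgue (\<lambda>y. ln (norm (x - y)) * g y)"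
    "(LINT y|lebesgue. \<bar>ln (norm (x - y)) * g y\<bar>) \<le>
      ((LINT y|lebesgue. \<bar>g y\<bar>) + (LINT y|lebesgue. lw y * \<bar>g y\<bar>) + sqrt (sq Nk * sq g)) * (1 + lw x)"
proof -
  have ga: "dens (\<lambda>y. \<bar>g y\<bar>)" by (rule dens_abs[OF g])
  have gm: "g \<in> borel_measurable lebesgue" using g by (simp add: dens_def)
  have i: "integrable lebesgue (\<lambda>y. \<bar>g y\<bar>)" "integrable lebesgue (\<lambda>y. lw y * \<bar>g y\<bar>)" "rL2 (\<lambda>y. \<bar>g y\<bar>)"
    using ga by (auto simp: dens_def)
  have iN: "integrable lebesgue (\<lambda>y. Nk (x - y) * \<bar>g y\<bar>)" by (rule rL2_mult_integrable[OF Nk_shift(1) i(3)])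
  have iw: "integrable lebesgue (\<lambda>y. lw x * \<bar>g y\<bar> + lw y * \<bar>g y\<bar> + Nk (x - y) * \<bar>g y\<bar>)"
    by (intro Bochner_Integration.integrable_add integrable_mult_right i iN)
  have b: "norm (ln (norm (x - y)) * g y) \<le> lw x * \<bar>g y\<bar> + lw y * \<bar>g y\<bar> + Nk (x - y) * \<bar>g y\<bar>" for y
    using mult_right_mono[OF ln_kernel_bound[of x y], of "\<bar>g y\<bar>"] by (simp add: abs_mult distrib_right)
  have m: "(\<lambda>y. ln (norm (x - y)) * g y) \<in> borel_measurable lebesgue" by (intro borel_measurable_times ln_kernel_meas gm)
  show I: "integrable lebesgue (\<lambda>y. ln (norm (x - y)) * g y)"
    by (rule integral_bound(1)[OF iw m]) (use b in simp)
  define A B C where "A = (LINT y|lebesgue. \<bar>g y\<bar>)" and "B = (LINT y|lebesgue. lw y * \<bar>g y\<bar>)" and "C = sqrt (sq Nk * sq g)"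
  have n: "A \<ge> 0" "B \<ge> 0" "C \<ge> 0" by (auto simp: A_def B_def C_def lw_nonneg sq_nonneg)
  have "(LINT y|lebesgue. \<bar>ln (norm (x - y)) * g y\<bar>) \<le> (LINT y|lebesgue. lw x * \<bar>g y\<bar> + lw y * \<bar>g y\<bar> + Nk (x - y) * \<bar>g y\<bar>)"
    by (intro integral_mono integrable_abs I iw) (use b in simp)
  also have "\<dots> = lw x * A + B + (LINT y|lebesgue. Nk (x - y) * \<bar>g y\<bar>)" using i iN by (simp add: A_def B_def)
  also have "(LINT y|lebesgue. Nk (x - y) * \<bar>g y\<bar>) \<le> C"
  proof -
    have "(LINT y|lebesgue. Nk (x - y) * \<bar>g y\<bar>)\<^sup>2 \<le> sq Nk * sq (\<lambda>y. \<bar>g y\<bar>)"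
      using Cauchy_Schwarz_integral[OF Nk_shift(1) i(3)] by (simp add: Nk_shift(2))
    also have "\<dots> = sq Nk * sq g" by (simp add: sq_def)
    finally show ?thesis unfolding C_def by (rule real_le_rsqrt)
  qed
  also have "lw x * A + B + C \<le> (A + B + C) * (1 + lw x)"
    using n lw_nonneg[of x] by (simp add: algebra_simps)
  finally show "(LINT y|lebesgue. \<bar>ln (norm (x - y)) * g y\<bar>) \<le> ((LINT y|lebesgue. \<bar>g y\<bar>) + (LINT y|lebesgue. lw y * \<bar>g y\<bar>) + sqrt (sq Nk * sq g)) * (1 + lw x)"
    by (simp add: A_def B_def C_def)
qed

lemma pot_bound:
  assumes g: "dens g" obtains K where "K \<ge> 0" "\<And>x. \<bar>pot g x\<bar> \<le> K * (1 + lw x)"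
proof (rule that)
  define K where "K = ((LINT y|lebesgue. \<bar>g y\<bar>) + (LINT y|lebesgue. lw y * \<bar>g y\<bar>) + sqrt (sq Nk * sq g))"
  show "K \<ge> 0" unfolding K_def by (intro add_nonneg_nonneg integral_nonneg_AE) (auto simp: lw_nonneg sq_nonneg)
  show "\<bar>pot g x\<bar> \<le> K * (1 + lw x)" for x
    using integral_abs_bound[of lebesgue "\<lambda>y. ln (norm (x - y)) * g y"] pot_integrable(2)[OF g, of x]
    unfolding pot_def K_def by linarith
qed

lemma kernel_pair_meas:
  assumes "f \<in> borel_measurable lebesgue" "g \<in> borel_measurable lebesgue"
  shows "(\<lambda>z. f (fst z) * (ln (norm (fst z - snd z)) * g (snd z))) \<in> borel_measurable (lebesgue \<Otimes>\<^sub>M (lebesgue :: plane measure))"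
proof -
  have "(\<lambda>z::plane. ln (norm z)) \<in> borel_measurable borel" by measurable
  from measurable_diff_pair[OF this]
  show ?thesis
    by (intro borel_measurable_times measurable_compose[OF measurable_fst assms(1)] measurable_compose[OF measurable_snd assms(2)])
qed

lemma pot_meas: assumes g: "g \<in> borel_measurable lebesgue" shows "pot g \<in> borel_measurable lebesgue"
proof -
  have "case_prod (\<lambda>x y. ln (norm (x - y)) * g y) \<in> borel_measurable (lebesgue \<Otimes>\<^sub>M (lebesgue :: plane measure))"
    using kernel_pair_meas[OF borel_measurable_const[of 1] g] by (simp add: case_prod_beta')
  from sigma_finite_measure.borel_measurable_lebesgue_integral[OF sigma_finite_lebesgue this]
  show ?thesis by (simp add: pot_def[abs_def])
qed

lemma dens_weight_integrable: "dens f \<Longrightarrow> integrable lebesgue (\<lambda>x. K * ((1 + lw x) * f x))"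
  unfolding dens_def distrib_right mult_1 by (intro integrable_mult_right Bochner_Integration.integrable_add) auto

text \<open>The inner absolute integral is at most a multiple of \<open>1 + lw x\<close> by
  \<open>pot_integrable\<close>, and \<open>dens f\<close> makes this integrable against
  \<open>f\<close>.\<close>

lemma pot_pair_integrable:
  assumes f: "dens f" and g: "dens g"
  shows "integrable (lebesgue \<Otimes>\<^sub>M (lebesgue :: plane measure)) (\<lambda>z. f (fst z) * (ln (norm (fst z - snd z)) * g (snd z)))"
proof (rule LL.Fubini_integrable)
  have fm: "f \<in> borel_measurable lebesgue" and gm: "g \<in> borel_measurable lebesgue" using f g by (auto simp: dens_def)
  show m: "(\<lambda>z. f (fst z) * (ln (norm (fst z - snd z)) * g (snd z))) \<in> borel_measurable (lebesgue \<Otimes>\<^sub>M (lebesgue :: plane measure))"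
    by (rule kernel_pair_meas[OF fm gm])
  define K where "K = ((LINT y|lebesgue. \<bar>g y\<bar>) + (LINT y|lebesgue. lw y * \<bar>g y\<bar>) + sqrt (sq Nk * sq g))"
  have e: "(LINT y|lebesgue. norm (f (fst (x, y)) * (ln (norm (fst (x, y) - snd (x, y))) * g (snd (x, y)))))
     = \<bar>f x\<bar> * (LINT y|lebesgue. \<bar>ln (norm (x - y)) * g y\<bar>)" for x
    by (simp add: abs_mult)
  show "integrable lebesgue (\<lambda>x. LINT y|lebesgue. norm (f (fst (x, y)) * (ln (norm (fst (x, y) - snd (x, y))) * g (snd (x, y)))))"
    unfolding e
  proof (rule integral_bound(1)[OF dens_weight_integrable[OF dens_abs[OF f], of K]])
    have "case_prod (\<lambda>x y. \<bar>ln (norm (x - y)) * g y\<bar>) \<in> borel_measurable (lebesgue \<Otimes>\<^sub>M (lebesgue :: plane measure))"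
      using borel_measurable_abs[OF kernel_pair_meas[OF borel_measurable_const[of 1] gm]] by (simp add: case_prod_beta')
    from sigma_finite_measure.borel_measurable_lebesgue_integral[OF sigma_finite_lebesgue this]
    show "(\<lambda>x. \<bar>f x\<bar> * (LINT y|lebesgue. \<bar>ln (norm (x - y)) * g y\<bar>)) \<in> borel_measurable lebesgue"
      by (intro borel_measurable_times borel_measurable_abs fm)
    show "AE x in lebesgue. norm (\<bar>f x\<bar> * (LINT y|lebesgue. \<bar>ln (norm (x - y)) * g y\<bar>)) \<le> K * ((1 + lw x) * \<bar>f x\<bar>)"
    proof (rule AE_I2)
      fix x
      have "\<bar>f x\<bar> * (LINT y|lebesgue. \<bar>ln (norm (x - y)) * g y\<bar>) \<le> \<bar>f x\<bar> * (K * (1 + lw x))"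
        using pot_integrable(2)[OF g, of x] unfolding K_def by (rule mult_left_mono) simp
      then show "norm (\<bar>f x\<bar> * (LINT y|lebesgue. \<bar>ln (norm (x - y)) * g y\<bar>)) \<le> K * ((1 + lw x) * \<bar>f x\<bar>)"
        by (simp add: mult_ac)
    qed
  qed
  show "AE x in lebesgue. integrable lebesgue (\<lambda>y. f (fst (x, y)) * (ln (norm (fst (x, y) - snd (x, y))) * g (snd (x, y))))"
    using pot_integrable(1)[OF g] by (intro AE_I2) simp
qed

section \<open>The logarithmic interaction as a symmetric bilinear form\<close>

definition Bf :: "(plane \<Rightarrow> real) \<Rightarrow> (plane \<Rightarrow> real) \<Rightarrow> real" where
  "Bf f g = (LINT x|lebesgue. f x * pot g x)"

lemma Bf_integrable:
  assumes f: "dens f" and g: "dens g" shows "integrable lebesgue (\<lambda>x. f x * pot g x)"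
  using LL.integrable_fst'[OF pot_pair_integrable[OF f g]] by (simp add: pot_def)

lemma Bf_sym:
  assumes f: "dens f" and g: "dens g" shows "Bf f g = Bf g f"
proof -
  have "integrable (lebesgue \<Otimes>\<^sub>M lebesgue) (case_prod (\<lambda>x y. f x * (ln (norm (x - y)) * g y)))"
    using pot_pair_integrable[OF f g] by (simp add: case_prod_beta')
  from LL.Fubini_integral[OF this]
  have "(LINT y|lebesgue. LINT x|lebesgue. f x * (ln (norm (x - y)) * g y)) = (LINT x|lebesgue. LINT y|lebesgue. f x * (ln (norm (x - y)) * g y))" .
  moreover have "(LINT x|lebesgue. f x * (ln (norm (x - y)) * g y)) = g y * pot f y" for y
  proof -
    have "(LINT x|lebesgue. f x * (ln (norm (x - y)) * g y)) = (LINT x|lebesgue. g y * (ln (norm (y - x)) * f x))"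
      by (rule Bochner_Integration.integral_cong) (auto simp: norm_minus_commute mult_ac)
    then show ?thesis by (simp add: pot_def)
  qed
  ultimately show ?thesis by (simp add: Bf_def pot_def)
qed

lemma Bf_add_left:
  assumes "dens f" "dens g" "dens h" shows "Bf (\<lambda>x. f x + c * g x) h = Bf f h + c * Bf g h"
  using Bf_integrable[OF assms(1,3)] Bf_integrable[OF assms(2,3)]
  by (simp add: Bf_def distrib_right mult.assoc)

text \<open>Shaped for \<open>cmod_sq_expand\<close>: the density of \<open>u + t * v\<close> has
  three terms, with coefficients \<open>s = 2 * t\<close> and \<open>r = t^2\<close>.\<close>

lemma Bf_quadratic:
  assumes f: "dens f" and g: "dens g" and h: "dens h"
  shows "Bf (\<lambda>x. (f x + s * g x) + r * h x) (\<lambda>x. (f x + s * g x) + r * h x)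
    = Bf f f + 2 * s * Bf g f + 2 * r * Bf h f + s\<^sup>2 * Bf g g + 2 * s * r * Bf h g + r\<^sup>2 * Bf h h"
proof -
  define k where "k x = (f x + s * g x) + r * h x" for x
  have fg: "dens (\<lambda>x. f x + s * g x)" by (rule dens_add[OF f g])
  have k: "dens k" unfolding k_def by (rule dens_add[OF fg h])
  have L: "Bf k w = Bf f w + s * Bf g w + r * Bf h w" if w: "dens w" for w
    unfolding k_def by (simp add: Bf_add_left[OF fg h w] Bf_add_left[OF f g w])
  have R: "Bf w k = Bf f w + s * Bf g w + r * Bf h w" if w: "dens w" for w
    using Bf_sym[OF w k] L[OF w] by simp
  have "Bf k k = (Bf f f + s * Bf g f + r * Bf h f) + s * (Bf f g + s * Bf g g + r * Bf h g) + r * (Bf f h + s * Bf g h + r * Bf h h)"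
    unfolding L[OF k] R[OF f] R[OF g] R[OF h] by simp
  also have "Bf f g = Bf g f" by (rule Bf_sym[OF f g])
  also have "Bf f h = Bf h f" by (rule Bf_sym[OF f h])
  also have "Bf g h = Bf h g" by (rule Bf_sym[OF g h])
  finally show ?thesis unfolding k_def by (simp add: algebra_simps power2_eq_square)
qed

lemma X_dens: assumes u: "u \<in> X_space" shows "dens (\<lambda>x. (cmod (u x))\<^sup>2)"
proof -
  have w: "u \<in> W12_alpha" and i: "integrable lebesgue (\<lambda>x. lw x * (cmod (u x))\<^sup>2)" using u by (auto simp: X_space_def lw_def)
  have "rL2 (\<lambda>x. cmod (u x) ^ Suc 1)" by (rule W12_alpha_power[OF w])
  then have r: "rL2 (\<lambda>x. (cmod (u x))\<^sup>2)" by (simp add: numeral_2_eq_2)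
  have "integrable lebesgue (\<lambda>x. (cmod (u x))\<^sup>2)" using W12_alpha_L2[OF w] by (simp add: L2_def)
  then show ?thesis using i r rL2D(1)[OF r] by (simp add: dens_def)
qed

lemma Re_cnj_mult_bound: "\<bar>Re (cnj a * b)\<bar> \<le> (cmod a)\<^sup>2 + (cmod b)\<^sup>2"
proof -
  have "\<bar>Re (cnj a * b)\<bar> \<le> cmod a * cmod b" using abs_Re_le_cmod[of "cnj a * b"] by (simp add: norm_mult)
  moreover have "2 * (cmod a * cmod b) \<le> (cmod a)\<^sup>2 + (cmod b)\<^sup>2" using sum_squares_bound[of "cmod a" "cmod b"] by simp
  moreover have "0 \<le> cmod a * cmod b" by simp
  ultimately show ?thesis by linarith
qed

lemma X_meas_Re_cnj:
  assumes "u \<in> X_space" "v \<in> X_space" shows "(\<lambda>x. Re (cnj (u x) * v x)) \<in> borel_measurable lebesgue"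
proof -
  have "(\<lambda>x. Re (cnj (u x) * v x)) = (\<lambda>x. Re (u x) * Re (v x) + Im (u x) * Im (v x))" by auto
  then show ?thesis using X_space_meas[OF assms(1)] X_space_meas[OF assms(2)]
    by (simp only:) (intro borel_measurable_add borel_measurable_times meas_Re meas_Im)
qed

lemma X_dens_cross:
  assumes u: "u \<in> X_space" and v: "v \<in> X_space" shows "dens (\<lambda>x. Re (cnj (u x) * v x))"
proof (rule dens_bound)
  show "dens (\<lambda>x. (cmod (u x))\<^sup>2 + 1 * (cmod (v x))\<^sup>2)" by (rule dens_add[OF X_dens[OF u] X_dens[OF v]])
qed (use X_meas_Re_cnj[OF u v] Re_cnj_mult_bound in auto)

lemma cmod_sq_expand: "(cmod (a + of_real t * b))\<^sup>2 = (cmod a)\<^sup>2 + 2 * t * Re (cnj a * b) + t\<^sup>2 * (cmod b)\<^sup>2"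
  unfolding cmod_power2 by (simp add: power2_eq_square algebra_simps)

lemma quartic_eq:
  "(LINT x|lebesgue. LINT y|lebesgue. ln (norm (x - y)) * (cmod (u x))\<^sup>2 * (cmod (u y))\<^sup>2)
    = Bf (\<lambda>x. (cmod (u x))\<^sup>2) (\<lambda>x. (cmod (u x))\<^sup>2)"
proof -
  have "(LINT y|lebesgue. ln (norm (x - y)) * (cmod (u x))\<^sup>2 * (cmod (u y))\<^sup>2) = (cmod (u x))\<^sup>2 * pot (\<lambda>x. (cmod (u x))\<^sup>2) x" for x
  proof -
    have "(LINT y|lebesgue. ln (norm (x - y)) * (cmod (u x))\<^sup>2 * (cmod (u y))\<^sup>2) = (LINT y|lebesgue. (cmod (u x))\<^sup>2 * (ln (norm (x - y)) * (cmod (u y))\<^sup>2))"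
      by (rule Bochner_Integration.integral_cong) (auto simp: mult_ac)
    then show ?thesis by (simp add: pot_def)
  qed
  then show ?thesis by (simp add: Bf_def)
qed

text \<open>Along a line the interaction is a polynomial of degree four in \<open>t\<close>, so its
  derivative at 0 is the linear coefficient. The factor 4 combines the symmetry of the form with the
  2 in \<open>2 * t\<close>.\<close>

lemma quartic_DERIV:
  assumes u: "u \<in> X_space" and v: "v \<in> X_space"
  shows "DERIV (\<lambda>t. LINT x|lebesgue. LINT y|lebesgue. ln (norm (x - y)) * (cmod (u x + of_real t * v x))\<^sup>2 * (cmod (u y + of_real t * v y))\<^sup>2) 0
    :> 4 * Bf (\<lambda>x. Re (cnj (u x) * v x)) (\<lambda>x. (cmod (u x))\<^sup>2)"
proof -
  note d = X_dens[OF u] X_dens_cross[OF u v] X_dens[OF v]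
  define c where "c = Bf (\<lambda>x. Re (cnj (u x) * v x)) (\<lambda>x. (cmod (u x))\<^sup>2)"
  define A where "A = Bf (\<lambda>x. (cmod (u x))\<^sup>2) (\<lambda>x. (cmod (u x))\<^sup>2)"
  define B where "B = Bf (\<lambda>x. (cmod (v x))\<^sup>2) (\<lambda>x. (cmod (u x))\<^sup>2)"
  define C where "C = Bf (\<lambda>x. Re (cnj (u x) * v x)) (\<lambda>x. Re (cnj (u x) * v x))"
  define D where "D = Bf (\<lambda>x. (cmod (v x))\<^sup>2) (\<lambda>x. Re (cnj (u x) * v x))"
  define E where "E = Bf (\<lambda>x. (cmod (v x))\<^sup>2) (\<lambda>x. (cmod (v x))\<^sup>2)"
  have e: "(LINT x|lebesgue. LINT y|lebesgue. ln (norm (x - y)) * (cmod (u x + of_real t * v x))\<^sup>2 * (cmod (u y + of_real t * v y))\<^sup>2)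
    = A + 2 * (2 * t) * c + 2 * t\<^sup>2 * B + (2 * t)\<^sup>2 * C + 2 * (2 * t) * t\<^sup>2 * D + (t\<^sup>2)\<^sup>2 * E" for t
    by (rule trans[OF quartic_eq], unfold cmod_sq_expand Bf_quadratic[OF d])
      (simp only: A_def B_def C_def D_def E_def c_def)
  have "DERIV (\<lambda>t. A + 2 * (2 * t) * c + 2 * t\<^sup>2 * B + (2 * t)\<^sup>2 * C + 2 * (2 * t) * t\<^sup>2 * D + (t\<^sup>2)\<^sup>2 * E) 0 :> 4 * c"
    by (auto intro!: derivative_eq_intros)
  then show ?thesis unfolding e c_def .
qed

section \<open>The power nonlinearity\<close>

lemma powr_le_powers:
  assumes "s \<ge> 2" "r \<ge> (0::real)" "s \<le> 2 * real (Suc m)"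
  shows "r powr s \<le> r\<^sup>2 + (r ^ Suc m)\<^sup>2"
proof (cases "r \<le> 1")
  case True
  have "r powr s \<le> r powr 2" using assms True by (intro powr_mono') auto
  also have "\<dots> = r\<^sup>2" using assms by (cases "r = 0") (auto simp: powr_numeral)
  finally show ?thesis using zero_le_power2[of "r ^ Suc m"] by linarith
next
  case False
  then have r: "r > 1" by simp
  have "r powr s \<le> r powr (real (Suc m * 2))" using assms r by (intro powr_mono) auto
  also have "\<dots> = (r ^ Suc m)\<^sup>2" using r by (simp only: powr_realpow[of r "Suc m * 2"] power_mult)
  finally show ?thesis using zero_le_power2[of r] by linarith
qed

text \<open>The square dominates where \<open>r x <= 1\<close>, and a sufficiently high even power
  dominates elsewhere.\<close>

lemma powr_integrable:
  assumes s: "s \<ge> 2" and r: "\<And>x. r x \<ge> 0" and p: "\<And>m. rL2 (\<lambda>x. r x ^ Suc m)"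
  shows "integrable lebesgue (\<lambda>x. r x powr s)"
proof -
  obtain m :: nat where m: "s \<le> real m" using real_arch_simple by blast
  have m2: "s \<le> 2 * real (Suc m)" using m by simp
  have r1: "rL2 r" using p[of 0] by simp
  have i: "integrable lebesgue (\<lambda>x. (r x)\<^sup>2 + (r x ^ Suc m)\<^sup>2)"
    by (intro Bochner_Integration.integrable_add rL2D(2) r1 p)
  show ?thesis
    by (rule integral_bound(1)[OF i powr_real_measurable[OF rL2D(1)[OF r1] borel_measurable_const]], rule AE_I2)
      (use powr_le_powers[OF s r m2] in simp)
qed

lemma X_sum_power:
  assumes "u \<in> W12_alpha" "v \<in> W12_alpha"
  shows "rL2 (\<lambda>x. (cmod (u x) + cmod (v x)) ^ Suc m)"
proof -
  note p = W12_alpha_power[OF assms(1), of m] W12_alpha_power[OF assms(2), of m]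
  have m: "u \<in> borel_measurable lebesgue" "v \<in> borel_measurable lebesgue"
    using W12_alpha_L2[OF assms(1)] W12_alpha_L2[OF assms(2)] by (auto simp: L2_def)
  show ?thesis
  proof (rule rL2_bound(1)[OF rL2D(2)[OF rL2_cmult[OF rL2_add(1)[OF p], of "3 ^ Suc m"]]], goal_cases)
    case 1
    show ?case by (intro borel_measurable_power borel_measurable_add meas_cmod m)
  next
    case 2
    show ?case
    proof (rule AE_I2)
      fix x
      have "(cmod (u x) + cmod (v x)) ^ Suc m \<le> 3 ^ Suc m * (cmod (u x) ^ Suc m + cmod (v x) ^ Suc m)"
        using power_sum3[of "cmod (u x)" "cmod (v x)" 0 "Suc m"] by simp
      then show "((cmod (u x) + cmod (v x)) ^ Suc m)\<^sup>2 \<le> (3 ^ Suc m * (cmod (u x) ^ Suc m + cmod (v x) ^ Suc m))\<^sup>2"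
        by (intro power_mono) auto
    qed
  qed
qed

lemma powr_diff_bound:
  assumes p: "p > 1" and "0 \<le> a" "a \<le> M" "0 \<le> b" "b \<le> (M::real)"
  shows "\<bar>a powr p - b powr p\<bar> \<le> p * M powr (p - 1) * \<bar>a - b\<bar>"
proof -
  have *: "\<bar>b powr p - a powr p\<bar> \<le> p * M powr (p - 1) * \<bar>b - a\<bar>" if ab: "0 \<le> a" "a < b" "b \<le> M" for a b
  proof -
    have D: "DERIV (\<lambda>s. s powr p) s :> p * s powr (p - 1)" if "s > 0" for s
      using that by (rule has_real_derivative_powr)
    have "\<exists>l z. a < z \<and> z < b \<and> DERIV (\<lambda>s. s powr p) z :> l \<and> b powr p - a powr p = (b - a) * l"
    proof (rule MVT[OF ab(2)])
      show "continuous_on {a..b} (\<lambda>s. s powr p)" using ab p by (intro continuous_on_powr' continuous_intros) auto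
      show "(\<lambda>s. s powr p) differentiable (at x)" if "a < x" "x < b" for x
        using D[of x] that ab real_differentiable_def by auto
    qed
    then obtain l z where z: "a < z" "z < b" "DERIV (\<lambda>s. s powr p) z :> l" "b powr p - a powr p = (b - a) * l" by blast
    have l: "l = p * z powr (p - 1)" using DERIV_unique[OF z(3) D] z ab by simp
    have "z powr (p - 1) \<le> M powr (p - 1)" using z ab p by (intro powr_mono2) auto
    then have "(b - a) * (p * z powr (p - 1)) \<le> (b - a) * (p * M powr (p - 1))" using ab p by (intro mult_left_mono) auto
    moreover have "0 \<le> (b - a) * (p * z powr (p - 1))" using ab p by simp
    ultimately show ?thesis using ab by (simp add: z(4) l mult_ac)
  qed
  consider "a < b" | "b < a" | "a = b" by linarith
  then show ?thesis
    by cases (use *[of a b] *[of b a] assms in \<open>auto simp: abs_minus_commute\<close>)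
qed

text \<open>Away from \<open>z = 0\<close> the function is \<open>Q t powr (p / 2)\<close> with
  \<open>Q\<close> quadratic and positive at 0. At \<open>z = 0\<close> the quotient is of order
  \<open>abs t powr (p - 1)\<close> and tends to 0, as the formula predicts.\<close>

lemma cmod_powr_DERIV:
  assumes p: "p > 2"
  shows "DERIV (\<lambda>t. cmod (z + of_real t * w) powr p) 0 :> p * (cmod z powr (p - 2) * Re (cnj z * w))"
proof (cases "z = 0")
  case False
  define c where "c = Re (cnj z * w)"
  define Q where "Q t = (cmod z)\<^sup>2 + 2 * t * c + t\<^sup>2 * (cmod w)\<^sup>2" for t
  have e: "cmod (z + of_real t * w) powr p = Q t powr (p / 2)" for t
  proof -
    have "Q t = (cmod (z + of_real t * w))\<^sup>2" by (simp add: Q_def c_def cmod_sq_expand)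
    then have "Q t = cmod (z + of_real t * w) powr 2" by simp
    then have "Q t powr (p / 2) = cmod (z + of_real t * w) powr (2 * (p / 2))" by (simp only: powr_powr)
    then show ?thesis by simp
  qed
  have Q0: "Q 0 > 0" using False by (simp add: Q_def)
  have "DERIV Q 0 :> 2 * c" unfolding Q_def by (auto intro!: derivative_eq_intros)
  from DERIV_chain2[OF has_real_derivative_powr[OF Q0] this, of "p / 2"]
  have "DERIV (\<lambda>t. Q t powr (p / 2)) 0 :> (p / 2 * Q 0 powr (p / 2 - 1)) * (2 * c)" .
  moreover have "Q 0 powr (p / 2 - 1) = cmod z powr (p - 2)"
  proof -
    have "Q 0 = cmod z powr 2" using False by (simp add: Q_def)
    then have "Q 0 powr (p / 2 - 1) = cmod z powr (2 * (p / 2 - 1))" by (simp only: powr_powr)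
    also have "2 * (p / 2 - 1) = p - 2" by simp
    finally show ?thesis .
  qed
  ultimately show ?thesis unfolding e c_def[symmetric] by (simp add: mult_ac)
next
  case True
  have "((\<lambda>t. (cmod (of_real t * w) powr p) / t) \<longlongrightarrow> 0) (at 0)"
  proof (rule Lim_null_comparison)
    show "\<forall>\<^sub>F t in at 0. norm ((cmod (of_real t * w) powr p) / t) \<le> \<bar>t\<bar> powr (p - 1) * cmod w powr p"
      unfolding eventually_at
    proof (intro exI[of _ 1] conjI ballI impI)
      fix t :: real assume t: "t \<noteq> 0 \<and> dist t 0 < 1"
      have "cmod (of_real t * w) powr p = \<bar>t\<bar> powr p * cmod w powr p" by (simp add: norm_mult powr_mult)
      moreover have "\<bar>t\<bar> powr p = \<bar>t\<bar> powr (p - 1) * \<bar>t\<bar>" using t powr_add[of "\<bar>t\<bar>" "p - 1" 1] by simp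
      ultimately show "norm ((cmod (of_real t * w) powr p) / t) \<le> \<bar>t\<bar> powr (p - 1) * cmod w powr p" using t by (simp add: abs_mult)
    qed simp
    have "((\<lambda>t. \<bar>t\<bar> powr (p - 1) * cmod w powr p) \<longlongrightarrow> \<bar>0\<bar> powr (p - 1) * cmod w powr p) (at 0)"
    proof (intro tendsto_mult tendsto_const)
      have "((\<lambda>t::real. \<bar>t\<bar>) \<longlongrightarrow> 0) (at 0)" using tendsto_rabs[OF tendsto_ident_at, of 0 UNIV] by simp
      from tendsto_powr'[OF this tendsto_const, of "p - 1"] p
      show "((\<lambda>t::real. \<bar>t\<bar> powr (p - 1)) \<longlongrightarrow> \<bar>0\<bar> powr (p - 1)) (at 0)" by simp
    qed
    then show "((\<lambda>t. \<bar>t\<bar> powr (p - 1) * cmod w powr p) \<longlongrightarrow> 0) (at 0)" by simp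
  qed
  then show ?thesis using True by (simp add: DERIV_def)
qed

text \<open>Differentiation under the integral: for \<open>abs t <= 1\<close> the difference
  quotients are dominated by \<open>p * M powr p\<close> with
  \<open>M = cmod u + cmod v\<close>.\<close>

lemma Lp_DERIV:
  assumes u: "u \<in> X_space" and v: "v \<in> X_space" and p: "p > 2"
  shows "integrable lebesgue (\<lambda>x. cmod (u x) powr (p - 2) * Re (cnj (u x) * v x))"
    "DERIV (\<lambda>t. LINT x|lebesgue. cmod (u x + of_real t * v x) powr p) 0
      :> p * (LINT x|lebesgue. cmod (u x) powr (p - 2) * Re (cnj (u x) * v x))"
proof -
  have uw: "u \<in> W12_alpha" "v \<in> W12_alpha" using u v by (auto simp: X_space_def)
  define M where "M x = cmod (u x) + cmod (v x)" for x
  have M0: "M x \<ge> 0" for x by (simp add: M_def)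
  have Mi: "integrable lebesgue (\<lambda>x. M x powr p)"
    by (rule powr_integrable) (use p X_sum_power[OF uw] in \<open>auto simp: M_def\<close>)
  define f where "f t x = cmod (u x + of_real t * v x) powr p" for t x
  define g where "g x = p * (cmod (u x) powr (p - 2) * Re (cnj (u x) * v x))" for x
  have fi: "integrable lebesgue (f t)" for t
  proof -
    have "(\<lambda>x. u x + of_real t * v x) \<in> W12_alpha" by (rule W12_alpha_add(1)[OF uw])
    from powr_integrable[OF _ _ W12_alpha_power[OF this], of p] p show ?thesis by (simp add: f_def[abs_def])
  qed
  have gm: "g \<in> borel_measurable lebesgue"
    unfolding g_def by (intro borel_measurable_times borel_measurable_const powr_real_measurable meas_cmod X_space_meas u X_meas_Re_cnj v)
  have b: "\<bar>(f t x - f 0 x) / t\<bar> \<le> p * M x powr p" if t: "t \<noteq> 0" "\<bar>t\<bar> \<le> 1" for t x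
  proof -
    have n: "cmod (of_real t * v x) = \<bar>t\<bar> * cmod (v x)" by (simp add: norm_mult)
    have tv: "\<bar>t\<bar> * cmod (v x) \<le> cmod (v x)" using t by (intro mult_left_le_one_le) auto
    have le: "cmod (u x + of_real t * v x) \<le> M x"
      using norm_triangle_ineq[of "u x" "of_real t * v x"] n tv by (simp add: M_def)
    have "\<bar>cmod (u x + of_real t * v x) - cmod (u x)\<bar> \<le> \<bar>t\<bar> * cmod (v x)"
      using norm_triangle_ineq3[of "u x + of_real t * v x" "u x"] n by simp
    also have "\<dots> \<le> \<bar>t\<bar> * M x" by (intro mult_left_mono) (auto simp: M_def)
    finally have d: "\<bar>cmod (u x + of_real t * v x) - cmod (u x)\<bar> \<le> \<bar>t\<bar> * M x" .
    have "\<bar>f t x - f 0 x\<bar> \<le> p * M x powr (p - 1) * \<bar>cmod (u x + of_real t * v x) - cmod (u x)\<bar>"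
      using powr_diff_bound[of p "cmod (u x + of_real t * v x)" "M x" "cmod (u x)"] p le by (simp add: f_def M_def)
    also have "\<dots> \<le> p * M x powr (p - 1) * (\<bar>t\<bar> * M x)" using d p by (intro mult_left_mono) auto
    also have "\<dots> = \<bar>t\<bar> * (p * M x powr p)"
    proof -
      have "M x powr p = M x powr (p - 1) * M x"
        using powr_add[of "M x" "p - 1" 1] M0[of x] by (cases "M x = 0") auto
      then show ?thesis by simp
    qed
    finally show ?thesis using t by (simp add: abs_divide divide_le_eq mult.commute)
  qed
  have lim: "(\<lambda>n. (f (X n) x - f 0 x) / X n) \<longlonglongrightarrow> g x" if X: "X \<longlonglongrightarrow> 0" "\<And>n. X n \<noteq> 0" for X x
  proof -
    have "((\<lambda>t. (f t x - f 0 x) / t) \<longlongrightarrow> g x) (at 0)"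
      using cmod_powr_DERIV[OF p, of "u x" "v x"] by (simp add: DERIV_def f_def g_def)
    then show ?thesis using X filterlim_compose[of "\<lambda>t. (f t x - f 0 x) / t" "nhds (g x)" "at 0" X sequentially]
      by (simp add: filterlim_at)
  qed
  have key: "integrable lebesgue g \<and> (\<lambda>n. ((LINT x|lebesgue. f (X n) x) - (LINT x|lebesgue. f 0 x)) / X n) \<longlonglongrightarrow> (LINT x|lebesgue. g x)"
    if X: "X \<longlonglongrightarrow> 0" "\<And>n. X n \<noteq> 0" "\<And>n. \<bar>X n\<bar> \<le> 1" for X
  proof -
    have m: "(\<lambda>x. (f (X n) x - f 0 x) / X n) \<in> borel_measurable lebesgue" for n
      using fi by (intro borel_measurable_divide borel_measurable_diff borel_measurable_const borel_measurable_integrable)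
    have iw: "integrable lebesgue (\<lambda>x. p * M x powr p)" using Mi by simp
    have l: "AE x in lebesgue. (\<lambda>n. (f (X n) x - f 0 x) / X n) \<longlonglongrightarrow> g x" by (intro AE_I2 lim X)
    have bb: "AE x in lebesgue. norm ((f (X n) x - f 0 x) / X n) \<le> p * M x powr p" for n
      using b[OF X(2,3)] by (intro AE_I2) (simp only: real_norm_def)
    have "(\<lambda>n. LINT x|lebesgue. (f (X n) x - f 0 x) / X n) \<longlonglongrightarrow> (LINT x|lebesgue. g x)"
      by (rule integral_dominated_convergence[OF gm m iw l bb])
    moreover have "integrable lebesgue g" by (rule integrable_dominated_convergence[OF gm m iw l bb])
    ultimately show ?thesis using fi by simp
  qed
  have "integrable lebesgue g"
  proof -
    have "(\<lambda>n. 1 / real (Suc n)) \<longlonglongrightarrow> 0" using LIMSEQ_inverse_real_of_nat by (simp add: inverse_eq_divide)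
    from key[OF this] show ?thesis by simp
  qed
  then have "integrable lebesgue (\<lambda>x. inverse p * g x)" by simp
  then show "integrable lebesgue (\<lambda>x. cmod (u x) powr (p - 2) * Re (cnj (u x) * v x))" using p by (simp add: g_def)
  have "((\<lambda>t. ((LINT x|lebesgue. f t x) - (LINT x|lebesgue. f 0 x)) / t) \<longlongrightarrow> (LINT x|lebesgue. g x)) (at 0)"
    unfolding tendsto_at_iff_sequentially
  proof (intro allI impI)
    fix X :: "nat \<Rightarrow> real" assume X: "\<forall>i. X i \<in> UNIV - {0}" "X \<longlonglongrightarrow> 0"
    have "eventually (\<lambda>n. \<bar>X n\<bar> < 1) sequentially"
      by (rule order_tendstoD(2)[OF tendsto_rabs[OF X(2)]]) simp
    then obtain N where N: "\<And>n. n \<ge> N \<Longrightarrow> \<bar>X n\<bar> < 1" by (auto simp: eventually_sequentially)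
    \<comment> \<open>The majorant requires \<open>abs (X n) <= 1\<close>, guaranteed from
      \<open>N\<close> on; hence the shift.\<close>
    have "(\<lambda>n. ((LINT x|lebesgue. f (X (n + N)) x) - (LINT x|lebesgue. f 0 x)) / X (n + N)) \<longlonglongrightarrow> (LINT x|lebesgue. g x)"
      by (rule key[THEN conjunct2]) (use X N LIMSEQ_ignore_initial_segment[OF X(2), of N] in \<open>auto intro: less_imp_le\<close>)
    then have "(\<lambda>n. ((LINT x|lebesgue. f (X n) x) - (LINT x|lebesgue. f 0 x)) / X n) \<longlonglongrightarrow> (LINT x|lebesgue. g x)"
      by (rule LIMSEQ_offset)
    then show "((\<lambda>t. ((LINT x|lebesgue. f t x) - (LINT x|lebesgue. f 0 x)) / t) \<circ> X) \<longlonglongrightarrow> (LINT x|lebesgue. g x)"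
      by (simp add: comp_def)
  qed
  then have "DERIV (\<lambda>t. LINT x|lebesgue. f t x) 0 :> (LINT x|lebesgue. g x)" by (simp add: DERIV_def)
  then show "DERIV (\<lambda>t. LINT x|lebesgue. cmod (u x + of_real t * v x) powr p) 0
      :> p * (LINT x|lebesgue. cmod (u x) powr (p - 2) * Re (cnj (u x) * v x))"
    by (simp add: f_def g_def)
qed

section \<open>Line derivatives of the energy and the Frechet derivative\<close>

lemma energy_DERIV:
  assumes u: "u \<in> X_space" and v: "v \<in> X_space" and p: "p > 2"
  shows "DERIV (\<lambda>t. energy \<alpha> \<beta> p (\<lambda>x. u x + of_real t * v x)) 0 :>
    Re (H_form \<alpha> u v) + (LINT x|lebesgue. Re (cnj (u x) * v x) * pot (\<lambda>x. (cmod (u x))\<^sup>2) x)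
      - \<beta> * (LINT x|lebesgue. cmod (u x) powr (p - 2) * Re (cnj (u x) * v x))"
proof -
  have uw: "u \<in> W12_alpha" "v \<in> W12_alpha" using u v by (auto simp: X_space_def)
  have H: "DERIV (\<lambda>t. Re (H_form \<alpha> (\<lambda>x. u x + of_real t * v x) (\<lambda>x. u x + of_real t * v x))) 0 :> 2 * Re (H_form \<alpha> u v)"
    unfolding H_form_quadratic[OF uw] by (auto intro!: derivative_eq_intros)
  have "DERIV (\<lambda>t. energy \<alpha> \<beta> p (\<lambda>x. u x + of_real t * v x)) 0 :>
     1 / 2 * (2 * Re (H_form \<alpha> u v)) + 1 / 4 * (4 * Bf (\<lambda>x. Re (cnj (u x) * v x)) (\<lambda>x. (cmod (u x))\<^sup>2))
      - \<beta> / p * (p * (LINT x|lebesgue. cmod (u x) powr (p - 2) * Re (cnj (u x) * v x)))"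
    unfolding energy_def
    by (intro DERIV_diff DERIV_add DERIV_cmult H quartic_DERIV u v Lp_DERIV(2) p)
  then show ?thesis using p by (simp add: Bf_def)
qed

lemma norm_X_scale:
  assumes v: "v \<in> X_space" shows "norm_X \<alpha> (\<lambda>x. of_real t * v x) = \<bar>t\<bar> * norm_X \<alpha> v"
proof -
  have vw: "v \<in> W12_alpha" using v by (simp add: X_space_def)
  have e: "(\<lambda>x. v x + of_real (t - 1) * v x) = (\<lambda>x. of_real t * v x)" by (auto simp: algebra_simps)
  have H: "Re (H_form \<alpha> (\<lambda>x. of_real t * v x) (\<lambda>x. of_real t * v x)) = t\<^sup>2 * Re (H_form \<alpha> v v)"
    using H_form_quadratic[OF vw vw, of \<alpha> "t - 1"] unfolding e by (simp add: algebra_simps power2_eq_square)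
  have I: "Re (inner_L2 (\<lambda>x. of_real t * v x) (\<lambda>x. of_real t * v x)) = t\<^sup>2 * Re (inner_L2 v v)"
    using inner_L2_quadratic[OF W12_alpha_L2[OF vw] W12_alpha_L2[OF vw], of "t - 1"] unfolding e
    by (simp add: algebra_simps power2_eq_square)
  have L: "(LINT x|lebesgue. of_real (ln (1 + norm x)) * cnj (of_real t * v x) * (of_real t * v x))
     = of_real (t\<^sup>2) * (LINT x|lebesgue. of_real (ln (1 + norm x)) * cnj (v x) * v x)"
  proof -
    have "(LINT x|lebesgue. of_real (ln (1 + norm x)) * cnj (of_real t * v x) * (of_real t * v x))
      = (LINT x|lebesgue. of_real (t\<^sup>2) * (of_real (ln (1 + norm x)) * cnj (v x) * v x))"
      by (rule Bochner_Integration.integral_cong) (auto simp: power2_eq_square)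
    then show ?thesis by simp
  qed
  have "Re (inner_X \<alpha> (\<lambda>x. of_real t * v x) (\<lambda>x. of_real t * v x)) = t\<^sup>2 * Re (inner_X \<alpha> v v)"
    unfolding inner_X_def inner_W12_alpha_def L using H I by (simp add: algebra_simps)
  then show ?thesis by (simp add: norm_X_def real_sqrt_mult)
qed

text \<open>A Frechet derivative is determined by the derivatives along lines, so the abstract
  functional \<open>T\<close> becomes computable.\<close>

lemma has_X_derivative_DERIV:
  assumes d: "has_X_derivative \<alpha> F T u" and v: "v \<in> X_space"
    and D: "DERIV (\<lambda>t. F (\<lambda>x. u x + of_real t * v x)) 0 :> L"
  shows "T v = L"
proof -
  define N where "N = norm_X \<alpha> v"
  have Tl: "T (\<lambda>x. of_real t * v x) = t * T v" for t
    using d v unfolding has_X_derivative_def by (simp add: scaleR_conv_of_real)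
  have "((\<lambda>t. (F (\<lambda>x. u x + of_real t * v x) - F u) / t) \<longlongrightarrow> T v) (at 0)"
  proof (rule LIM_I)
    fix e :: real assume e: "e > 0"
    \<comment> \<open>\<open>abs N + 1\<close> is positive whatever the value of
      \<open>norm_X\<close>, so the quotients formed with it are safe.\<close>
    define e' where "e' = e / (2 * (\<bar>N\<bar> + 1))"
    have N1: "\<bar>N\<bar> + 1 > 0" by linarith
    have e': "e' > 0" using e N1 by (simp add: e'_def)
    obtain \<delta> where \<delta>: "\<delta> > 0" "\<And>w. w \<in> X_space \<Longrightarrow> norm_X \<alpha> w < \<delta> \<Longrightarrow>
        \<bar>F (\<lambda>x. u x + w x) - F u - T w\<bar> \<le> e' * norm_X \<alpha> w"
      using d e' unfolding has_X_derivative_def by meson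
    have "norm ((F (\<lambda>x. u x + of_real t * v x) - F u) / t - T v) < e"
      if t: "t \<noteq> 0" "\<bar>t\<bar> < \<delta> / (\<bar>N\<bar> + 1)" for t
    proof -
      have nt: "norm_X \<alpha> (\<lambda>x. of_real t * v x) = \<bar>t\<bar> * N" unfolding N_def by (rule norm_X_scale[OF v])
      have "\<bar>t\<bar> * N \<le> \<bar>t\<bar> * (\<bar>N\<bar> + 1)" by (intro mult_left_mono) auto
      also have "\<dots> < \<delta>" using t N1 by (simp add: less_divide_eq)
      finally have "\<bar>F (\<lambda>x. u x + of_real t * v x) - F u - t * T v\<bar> \<le> e' * (\<bar>t\<bar> * N)"
        using \<delta>(2)[OF X_space_cmult[OF v, of "of_real t"]] by (simp add: nt Tl)
      also have "\<dots> \<le> e' * (\<bar>t\<bar> * (\<bar>N\<bar> + 1))" using e' by (intro mult_left_mono) auto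
      also have "\<dots> = \<bar>t\<bar> * (e / 2)"
      proof -
        have "e' * (\<bar>N\<bar> + 1) = e / 2" unfolding e'_def using N1 by (metis divide_divide_eq_left less_numeral_extra(3) nonzero_eq_divide_eq)
        then show ?thesis by (metis mult.left_commute)
      qed
      finally have le: "\<bar>F (\<lambda>x. u x + of_real t * v x) - F u - t * T v\<bar> \<le> \<bar>t\<bar> * (e / 2)" .
      have "(F (\<lambda>x. u x + of_real t * v x) - F u) / t - T v = (F (\<lambda>x. u x + of_real t * v x) - F u - t * T v) / t"
        using t by (simp add: field_simps)
      then have "\<bar>(F (\<lambda>x. u x + of_real t * v x) - F u) / t - T v\<bar> \<le> e / 2"
        using le t by (simp add: abs_divide divide_le_eq mult.commute)
      then show ?thesis using e by simp
    qed
    moreover have "\<delta> / (\<bar>N\<bar> + 1) > 0" using \<delta>(1) N1 by simp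
    ultimately show "\<exists>s>0. \<forall>t. t \<noteq> 0 \<and> norm (t - 0) < s \<longrightarrow> norm ((F (\<lambda>x. u x + of_real t * v x) - F u) / t - T v) < e"
      by (intro exI[of _ "\<delta> / (\<bar>N\<bar> + 1)"]) auto
  qed
  moreover have "((\<lambda>t. (F (\<lambda>x. u x + of_real t * v x) - F u) / t) \<longlongrightarrow> L) (at 0)"
    using D by (simp add: DERIV_def)
  ultimately show ?thesis by (rule LIM_unique)
qed

section \<open>Critical points\<close>

text \<open>Real part for \<open>c = 1\<close> and imaginary part for \<open>c = \<i>\<close>: only the real part of the duality pairing
  is available, so the equation is tested with both \<open>\<eta>\<close> and \<open>\<i> * \<eta>\<close>.\<close>

definition rpart :: "complex \<Rightarrow> complex \<Rightarrow> real" where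
  "rpart c z = Re c * Re z + Im c * Im z"

lemma rpart_eq: "rpart c z = Re (cnj z * c)"
  by (simp add: rpart_def algebra_simps)

lemma rpart_1: "rpart 1 z = Re z" and rpart_ii: "rpart \<i> z = Im z"
  by (simp_all add: rpart_def)

lemma rpart_linear: "rpart c (z + w) = rpart c z + rpart c w" "rpart c (z - w) = rpart c z - rpart c w" "rpart c (- z) = - rpart c z"
  "rpart c (of_real a * z) = a * rpart c z" "rpart c (z * of_real a) = a * rpart c z"
  by (simp_all add: rpart_def algebra_simps)

lemma rL2_rpart: "f \<in> L2 \<Longrightarrow> rL2 (\<lambda>x. rpart c (f x))"
  unfolding rpart_def L2_iff by (intro rL2_add(1) rL2_cmult) auto

lemma rL1loc_rpart: "f \<in> L1loc \<Longrightarrow> rL1loc (\<lambda>x. rpart c (f x))"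
  unfolding rpart_def L1loc_iff by (intro rL1loc_add rL1loc_cmult) auto

lemma rweak_rpart: "has_weak_partial i f g \<Longrightarrow> rweak i (\<lambda>x. rpart c (f x)) (\<lambda>x. rpart c (g x))"
  unfolding rpart_def has_weak_partial_iff by (intro rweak_add rweak_cmult) auto

lemma test_LINT_laplace:
  assumes w: "\<And>i. rweak i f (g i)" and \<eta>: "\<eta> \<in> test_functions"
  shows "(LINT x|lebesgue. laplace \<eta> x * f x) = - (\<Sum>i\<in>UNIV. LINT x|lebesgue. pd i \<eta> x * g i x)"
proof -
  have f: "rL1loc f" using w by (auto simp: rweak_def)
  have "(LINT x|lebesgue. laplace \<eta> x * f x) = (LINT x|lebesgue. (\<Sum>i\<in>UNIV. pd i (pd i \<eta>) x * f x))"
    by (simp add: laplace_def sum_distrib_right)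
  also have "\<dots> = (\<Sum>i\<in>UNIV. LINT x|lebesgue. pd i (pd i \<eta>) x * f x)"
    by (intro Bochner_Integration.integral_sum test_mult_integrable test_pd \<eta> f)
  also have "\<dots> = (\<Sum>i\<in>UNIV. - (LINT x|lebesgue. pd i \<eta> x * g i x))"
    using w test_pd[OF \<eta>] unfolding rweak_def by (intro sum.cong) auto
  finally show ?thesis by (simp add: sum_negf)
qed

text \<open>As \<open>\<eta>\<close> is real, the constant \<open>c\<close> merely selects a real
  component of the gradient; one integration by parts then moves the remaining derivative to
  \<open>\<eta>\<close>.\<close>

lemma inner_grad_test:
  assumes \<phi>: "\<phi> \<in> W12" and \<eta>: "\<eta> \<in> test_functions"
  shows "Re (inner_grad \<phi> (\<lambda>x. c * of_real (\<eta> x))) = - (LINT x|lebesgue. laplace \<eta> x * rpart c (\<phi> x))"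
proof -
  define e where "e x = c * complex_of_real (\<eta> x)" for x
  have ew: "e \<in> W12" unfolding e_def by (intro W12_cmult test_W12 \<eta>)
  have h: "has_weak_partial i e (\<lambda>x. c * of_real (pd i \<eta> x))" for i
    unfolding e_def by (intro has_weak_partial_cmult test_W12 \<eta>)
  have i: "Re (inner_L2 (weak_partial i \<phi>) (weak_partial i e)) = (LINT x|lebesgue. pd i \<eta> x * rpart c (weak_partial i \<phi> x))" for i
  proof -
    have L: "(\<lambda>x. c * complex_of_real (pd i \<eta> x)) \<in> L2"
      using W12_cmult[OF test_W12(1)[OF test_pd[OF \<eta>, of i]], of c] by (simp add: W12_def)
    have "inner_L2 (weak_partial i \<phi>) (weak_partial i e) = inner_L2 (weak_partial i \<phi>) (\<lambda>x. c * of_real (pd i \<eta> x))"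
      by (rule inner_L2_AE) (use W12_weak_partial[OF \<phi>] W12_weak_partial[OF ew] weak_partial_AE[OF h] in auto)
    also have "Re \<dots> = (LINT x|lebesgue. Re (cnj (weak_partial i \<phi> x) * (c * of_real (pd i \<eta> x))))"
      unfolding inner_L2_def by (rule integral_Re[symmetric], rule inner_L2_integrable[OF W12_weak_partial(2)[OF \<phi>] L])
    finally show ?thesis by (simp add: rpart_def algebra_simps)
  qed
  have "Re (inner_grad \<phi> e) = (\<Sum>i\<in>UNIV. LINT x|lebesgue. pd i \<eta> x * rpart c (weak_partial i \<phi> x))"
    by (simp add: inner_grad_eq[OF \<phi> ew] i)
  then show ?thesis
    using test_LINT_laplace[OF rweak_rpart[OF W12_weak_partial(1)[OF \<phi>]] \<eta>, of c] by (simp add: e_def[abs_def])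
qed

lemma inner_grad_zero: "\<phi> \<in> W12 \<Longrightarrow> inner_grad \<phi> (\<lambda>x. 0) = 0"
proof -
  assume \<phi>: "\<phi> \<in> W12"
  have h: "has_weak_partial i (\<lambda>x. 0) (\<lambda>x. 0)" for i
    using has_weak_partial_cmult[OF W12_weak_partial(1)[OF \<phi>], of i 0] by simp
  have "inner_L2 (weak_partial i \<phi>) (weak_partial i (\<lambda>x. 0)) = inner_L2 (weak_partial i \<phi>) (\<lambda>x. 0)" for i
    by (rule inner_L2_AE) (use W12_weak_partial[OF \<phi>] W12_weak_partial[OF zero_W12] weak_partial_AE[OF h] in auto)
  then show ?thesis by (simp add: inner_grad_eq[OF \<phi> zero_W12] inner_L2_def)
qed

lemma L2_L2loc: "f \<in> L2 \<Longrightarrow> f \<in> L2loc"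
proof -
  assume f: "f \<in> L2"
  have "rL2 (loc R g)" if "rL2 g" for R g
    unfolding loc_def[abs_def] by (rule rL2_bounded_mult(1)[OF that rL2D(1)[OF ind_rL2], where B = 1]) (auto simp: indicator_def)
  moreover have "rL2 (\<lambda>x. Re (f x))" "rL2 (\<lambda>x. Im (f x))" using f by (auto simp: L2_iff)
  moreover have "f \<in> borel_measurable lebesgue" using f by (simp add: L2_def)
  ultimately show ?thesis unfolding L2loc_iff by blast
qed

lemma L2loc_cmult:
  assumes "f \<in> L2loc" shows "(\<lambda>x. c * f x) \<in> L2loc"
proof -
  have m: "f \<in> borel_measurable lebesgue" and L: "rL2 (loc R (\<lambda>x. Re (f x)))" "rL2 (loc R (\<lambda>x. Im (f x)))" for R
    using assms by (auto simp: L2loc_iff)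
  have "rL2 (loc R (\<lambda>x. Re (c * f x)))" for R
    using rL2_diff(1)[OF rL2_cmult[OF L(1)] rL2_cmult[OF L(2)], of "Re c" R "Im c" R]
    by (simp add: loc_def[abs_def] algebra_simps)
  moreover have "rL2 (loc R (\<lambda>x. Im (c * f x)))" for R
    using rL2_add(1)[OF rL2_cmult[OF L(2)] rL2_cmult[OF L(1)], of "Re c" R "Im c" R]
    by (simp add: loc_def[abs_def] algebra_simps)
  moreover have "(\<lambda>x. c * f x) \<in> borel_measurable lebesgue" by (intro borel_measurable_times borel_measurable_const m)
  ultimately show ?thesis unfolding L2loc_iff by blast
qed

lemma W22loc_cmult:
  assumes "f \<in> W22loc" shows "(\<lambda>x. c * f x) \<in> W22loc"
  unfolding W22loc_def
proof (intro CollectI conjI allI)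
  show "(\<lambda>x. c * f x) \<in> L2loc" using assms by (intro L2loc_cmult) (auto simp: W22loc_def)
  fix i
  obtain g where g: "g \<in> L2loc" "has_weak_partial i f g" "\<And>j. \<exists>h\<in>L2loc. has_weak_partial j g h"
    using assms unfolding W22loc_def by blast
  show "\<exists>g\<in>L2loc. has_weak_partial i (\<lambda>x. c * f x) g \<and> (\<forall>j. \<exists>h\<in>L2loc. has_weak_partial j g h)"
  proof (rule bexI[of _ "\<lambda>x. c * g x"], intro conjI allI has_weak_partial_cmult g(2))
    show "(\<lambda>x. c * g x) \<in> L2loc" by (rule L2loc_cmult[OF g(1)])
    fix j
    obtain h where "h \<in> L2loc" "has_weak_partial j g h" using g(3) by blast
    then show "\<exists>h\<in>L2loc. has_weak_partial j (\<lambda>x. c * g x) h"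
      by (intro bexI[of _ "\<lambda>x. c * h x"] has_weak_partial_cmult L2loc_cmult)
  qed
qed

lemma continuous_rep_eqI:
  assumes "continuous_on UNIV g" "AE x in lebesgue. f x = g x"
  shows "continuous_rep f = g"
  unfolding continuous_rep_def
proof (rule the_equality)
  show "continuous_on UNIV g \<and> (AE x in lebesgue. f x = g x)" using assms by simp
  fix h assume h: "continuous_on UNIV h \<and> (AE x in lebesgue. f x = h x)"
  then have "AE x in lebesgue. h x = g x" using assms(2) by (auto elim: AE_mp)
  then show "h = g" using AE_eq_continuous[of h g] h assms(1) by blast
qed

text \<open>Scaling the whole decomposition by \<open>c\<close> preserves the boundary condition
  because it is linear; this supplies the orbit of phases of the standing wave.\<close>

lemma dom_decompI:
  assumes "\<phi> \<in> W22loc" "l > 0" "continuous_on UNIV g" "AE x in lebesgue. \<phi> x = g x"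
    "of_real (\<alpha> + theta l) * q = g 0" "AE x in lebesgue. u x = \<phi> x + q * green l x"
  shows "dom_decomp \<alpha> u \<phi> q l"
    "dom_decomp \<alpha> (\<lambda>x. c * u x) (\<lambda>x. c * \<phi> x) (c * q) l"
proof -
  show "dom_decomp \<alpha> u \<phi> q l"
    using assms continuous_rep_eqI[OF assms(3,4)] by (simp add: dom_decomp_def)
  have "continuous_rep (\<lambda>x. c * \<phi> x) = (\<lambda>x. c * g x)"
    by (rule continuous_rep_eqI) (use assms in \<open>auto intro: continuous_on_mult_left elim: AE_mp\<close>)
  moreover have "AE x in lebesgue. c * u x = c * \<phi> x + c * q * green l x"
    using assms(6) by (rule AE_mp) (simp add: algebra_simps)
  ultimately show "dom_decomp \<alpha> (\<lambda>x. c * u x) (\<lambda>x. c * \<phi> x) (c * q) l"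
    using assms(1,2) assms(5)[symmetric] by (simp add: dom_decomp_def W22loc_cmult mult_ac)
qed

lemma W22loc_second:
  assumes "\<phi> \<in> W22loc"
  shows "has_weak_partial i \<phi> (weak_partial i \<phi>)"
    "has_weak_partial j (weak_partial i \<phi>) (weak_partial j (weak_partial i \<phi>))"
proof -
  obtain g where g: "has_weak_partial i \<phi> g" "\<And>j. \<exists>h\<in>L2loc. has_weak_partial j g h"
    using assms unfolding W22loc_def by blast
  show "has_weak_partial i \<phi> (weak_partial i \<phi>)" by (rule has_weak_partial_weak_partial[OF g(1)])
  obtain h where h: "has_weak_partial j g h" using g(2) by blast
  have "AE x in lebesgue. g x = weak_partial i \<phi> x" using weak_partial_AE[OF g(1)] by (rule AE_mp) simp
  from has_weak_partial_AE[OF h this] have "has_weak_partial j (weak_partial i \<phi>) h" by simp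
  then show "has_weak_partial j (weak_partial i \<phi>) (weak_partial j (weak_partial i \<phi>))"
    by (rule has_weak_partial_weak_partial)
qed

lemma weak_laplacian_test:
  assumes \<phi>: "\<phi> \<in> W22loc" and \<eta>: "\<eta> \<in> test_functions"
  shows "rL1loc (\<lambda>x. rpart c (weak_laplacian \<phi> x))"
    "(LINT x|lebesgue. laplace \<eta> x * rpart c (\<phi> x)) = (LINT x|lebesgue. \<eta> x * rpart c (weak_laplacian \<phi> x))"
proof -
  have e: "rpart c (weak_laplacian \<phi> x) = rpart c (weak_partial 1 (weak_partial 1 \<phi>) x) + rpart c (weak_partial 2 (weak_partial 2 \<phi>) x)" for x
    by (simp add: weak_laplacian_def sum_2 rpart_linear)
  have w: "rweak i (\<lambda>x. rpart c (weak_partial i \<phi> x)) (\<lambda>x. rpart c (weak_partial i (weak_partial i \<phi>) x))" for i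
    by (intro rweak_rpart W22loc_second \<phi>)
  then have L: "rL1loc (\<lambda>x. rpart c (weak_partial i (weak_partial i \<phi>) x))" for i by (simp add: rweak_def)
  show "rL1loc (\<lambda>x. rpart c (weak_laplacian \<phi> x))" unfolding e by (intro rL1loc_add L)
  have 1: "(LINT x|lebesgue. pd i \<eta> x * rpart c (weak_partial i \<phi> x)) = - (LINT x|lebesgue. \<eta> x * rpart c (weak_partial i (weak_partial i \<phi>) x))" for i
    using w \<eta> unfolding rweak_def by blast
  have "(LINT x|lebesgue. \<eta> x * rpart c (weak_laplacian \<phi> x)) = (LINT x|lebesgue. \<eta> x * rpart c (weak_partial 1 (weak_partial 1 \<phi>) x))
      + (LINT x|lebesgue. \<eta> x * rpart c (weak_partial 2 (weak_partial 2 \<phi>) x))"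
    unfolding e distrib_left by (intro Bochner_Integration.integral_add test_mult_integrable \<eta> L)
  then show "(LINT x|lebesgue. laplace \<eta> x * rpart c (\<phi> x)) = (LINT x|lebesgue. \<eta> x * rpart c (weak_laplacian \<phi> x))"
    using test_LINT_laplace[OF rweak_rpart[OF W22loc_second(1)[OF \<phi>]] \<eta>, of c] by (simp add: sum_2 1)
qed

locale critical_point =
  fixes \<alpha> \<beta> p \<omega> :: real and u :: "plane \<Rightarrow> complex" and T :: "(plane \<Rightarrow> complex) \<Rightarrow> real"
  assumes p: "p > 2" and u: "u \<in> X_space"
    and T: "has_X_derivative \<alpha> (energy \<alpha> \<beta> p) T u"
    and crit: "\<And>v. v \<in> X_space \<Longrightarrow> T v + \<omega> * Re (inner_L2 u v) = 0"
begin

definition "q = charge u"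
definition "V = pot (\<lambda>x. (cmod (u x))\<^sup>2)"
definition "b x = cmod (u x) powr (p - 2)"
text \<open>All zero-order terms, once the gradient and the \<open>lam0\<close> term of the regular
  part stand on the left: \<open>lam0\<close> comes from \<open>- lam0 * inner_L2 u v\<close> in
  \<open>H_form\<close>, and \<open>V\<close> is minus \<open>log_potential u\<close>, whence its
  sign.\<close>

definition "\<kappa> x = lam0 - V x + \<beta> * b x - \<omega>"
definition "\<psi> = regular_part lam0 u"

lemma ua: "u \<in> W12_alpha" using u by (simp add: X_space_def)

lemma \<psi>_W12: "\<psi> \<in> W12" unfolding \<psi>_def by (rule regular_part_W12[OF ua lam0])

lemma u_eq: "u x = \<psi> x + q * of_real (Gr lam0 x)"
  unfolding \<psi>_def q_def by (subst W12_alpha_decomp[of u x lam0]) (simp add: green_Gr)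

text \<open>\<open>T v\<close> is computed by \<open>energy_DERIV\<close>. The mass, interaction and
  power terms are integrable separately, so they may be merged into one integral with coefficient
  \<open>\<kappa>\<close>.\<close>

lemma euler_lagrange:
  assumes v: "v \<in> X_space"
  shows "integrable lebesgue (\<lambda>x. \<kappa> x * Re (cnj (u x) * v x))"
    "Re (inner_grad \<psi> (regular_part lam0 v)) + lam0 * Re (inner_L2 \<psi> (regular_part lam0 v))
      + (\<alpha> + theta lam0) * Re (cnj q * charge v) = (LINT x|lebesgue. \<kappa> x * Re (cnj (u x) * v x))"
proof -
  define r where "r x = Re (cnj (u x) * v x)" for x
  have va: "v \<in> W12_alpha" using v by (simp add: X_space_def)
  have i1: "integrable lebesgue r" using X_dens_cross[OF u v] by (simp add: dens_def r_def[abs_def])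
  have i2: "integrable lebesgue (\<lambda>x. r x * V x)"
    unfolding r_def V_def by (rule Bf_integrable[OF X_dens_cross[OF u v] X_dens[OF u]])
  have i3: "integrable lebesgue (\<lambda>x. b x * r x)"
    unfolding r_def b_def by (rule Lp_DERIV(1)[OF u v p])
  have i12: "integrable lebesgue (\<lambda>x. (lam0 - \<omega>) * r x - r x * V x)"
    by (intro Bochner_Integration.integrable_diff integrable_mult_right i1 i2)
  have e: "\<kappa> x * r x = ((lam0 - \<omega>) * r x - r x * V x) + \<beta> * (b x * r x)" for x
    by (simp add: \<kappa>_def algebra_simps)
  show "integrable lebesgue (\<lambda>x. \<kappa> x * Re (cnj (u x) * v x))"
    unfolding r_def[symmetric] e by (intro Bochner_Integration.integrable_add i12 integrable_mult_right i3)
  have I: "(LINT x|lebesgue. \<kappa> x * r x) = (lam0 - \<omega>) * (LINT x|lebesgue. r x) - (LINT x|lebesgue. r x * V x)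
      + \<beta> * (LINT x|lebesgue. b x * r x)"
    unfolding e using i1 i2 i3 i12 by simp
  have R: "Re (inner_L2 u v) = (LINT x|lebesgue. r x)"
    unfolding inner_L2_def r_def by (rule integral_Re[symmetric], rule inner_L2_integrable[OF W12_alpha_L2[OF ua] W12_alpha_L2[OF va]])
  have "T v = Re (H_form \<alpha> u v) + (LINT x|lebesgue. r x * V x) - \<beta> * (LINT x|lebesgue. b x * r x)"
    using has_X_derivative_DERIV[OF T v energy_DERIV[OF u v p]] unfolding r_def V_def b_def .
  moreover have "Re (H_form \<alpha> u v) = Re (inner_grad \<psi> (regular_part lam0 v))
      + lam0 * (Re (inner_L2 \<psi> (regular_part lam0 v)) - Re (inner_L2 u v)) + (\<alpha> + theta lam0) * Re (cnj q * charge v)"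
    unfolding H_form_def H_form_at_def lam0_def[symmetric] \<psi>_def[symmetric] q_def[symmetric]
    by (simp add: algebra_simps)
  ultimately show "Re (inner_grad \<psi> (regular_part lam0 v)) + lam0 * Re (inner_L2 \<psi> (regular_part lam0 v))
      + (\<alpha> + theta lam0) * Re (cnj q * charge v) = (LINT x|lebesgue. \<kappa> x * Re (cnj (u x) * v x))"
    using crit[OF v] unfolding r_def[symmetric] I R by (simp add: algebra_simps)
qed

definition "F c x = \<kappa> x * rpart c (u x)"

text \<open>The direction \<open>c * \<eta>\<close> has charge 0 and is its own regular part, so the
  point interaction disappears from the Euler-Lagrange identity.\<close>

lemma weak_equation:
  assumes \<eta>: "\<eta> \<in> test_functions"
  shows "(LINT x|lebesgue. (lam0 * \<eta> x - laplace \<eta> x) * rpart c (\<psi> x)) = (LINT x|lebesgue. \<eta> x * F c x)"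
proof -
  define v where "v x = c * complex_of_real (\<eta> x)" for x
  have vX: "v \<in> X_space" unfolding v_def by (intro X_space_cmult test_X \<eta>)
  have vW: "v \<in> W12" unfolding v_def by (intro W12_cmult test_W12 \<eta>)
  have vL: "v \<in> L2" using vW by (simp add: W12_def)
  have \<psi>L: "\<psi> \<in> L2" using \<psi>_W12 by (simp add: W12_def)
  note i = test_mult_integrable[OF _ rL2_rL1loc[OF rL2_rpart[OF \<psi>L, of c]]]
  have "Re (inner_L2 \<psi> v) = (LINT x|lebesgue. Re (cnj (\<psi> x) * v x))"
    unfolding inner_L2_def by (rule integral_Re[symmetric], rule inner_L2_integrable[OF \<psi>L vL])
  also have "\<dots> = (LINT x|lebesgue. \<eta> x * rpart c (\<psi> x))" by (simp add: v_def rpart_def algebra_simps)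
  finally have 1: "Re (inner_L2 \<psi> v) = (LINT x|lebesgue. \<eta> x * rpart c (\<psi> x))" .
  have "(LINT x|lebesgue. (lam0 * \<eta> x - laplace \<eta> x) * rpart c (\<psi> x))
      = lam0 * (LINT x|lebesgue. \<eta> x * rpart c (\<psi> x)) - (LINT x|lebesgue. laplace \<eta> x * rpart c (\<psi> x))"
    using i[OF \<eta>] i[OF test_laplace[OF \<eta>]] by (simp add: left_diff_distrib mult.assoc)
  moreover have "(LINT x|lebesgue. \<kappa> x * Re (cnj (u x) * v x)) = (LINT x|lebesgue. \<eta> x * F c x)"
    by (rule Bochner_Integration.integral_cong) (simp_all add: v_def F_def rpart_def algebra_simps)
  ultimately show ?thesis
    using euler_lagrange(2)[OF vX] inner_grad_test[OF \<psi>_W12 \<eta>, of c]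
    by (simp add: W12_in_alpha[OF vW] 1 v_def[abs_def, symmetric])
qed

text \<open>The direction \<open>c * green lam0\<close> has zero regular part and charge
  \<open>c\<close>, so only the point interaction survives on the left.\<close>

lemma charge_equation:
  "integrable lebesgue (\<lambda>x. Gr lam0 x * F c x)"
  "(LINT x|lebesgue. Gr lam0 x * F c x) = (\<alpha> + theta lam0) * rpart c q"
proof -
  have vX: "(\<lambda>x. c * green lam0 x) \<in> X_space" by (intro X_space_cmult green_X lam0)
  have e: "\<kappa> x * Re (cnj (u x) * (c * green lam0 x)) = Gr lam0 x * F c x" for x
    by (simp add: green_Gr F_def rpart_def algebra_simps)
  show "integrable lebesgue (\<lambda>x. Gr lam0 x * F c x)" using euler_lagrange(1)[OF vX] unfolding e .
  show "(LINT x|lebesgue. Gr lam0 x * F c x) = (\<alpha> + theta lam0) * rpart c q"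
    using euler_lagrange(2)[OF vX] unfolding e green_in_alpha[OF lam0] inner_grad_zero[OF \<psi>_W12]
    by (simp add: inner_L2_def rpart_eq)
qed

lemma uL2: "u \<in> L2" by (rule W12_alpha_L2[OF ua])

lemma um: "u \<in> borel_measurable lebesgue" by (rule X_space_meas[OF u])

text \<open>The modulus is at most \<open>cmod c * cmod (u x) powr (p - 1)\<close>, and
  \<open>2 * (p - 1) >= 2\<close>, so the higher integrability of \<open>u\<close> applies.\<close>

lemma bu_rL2: "rL2 (\<lambda>x. b x * rpart c (u x))"
proof -
  have m: "(\<lambda>x. b x * rpart c (u x)) \<in> borel_measurable lebesgue"
    unfolding b_def by (intro borel_measurable_times powr_real_measurable borel_measurable_const meas_cmod um rL2D(1)[OF rL2_rpart[OF uL2]])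
  have i: "integrable lebesgue (\<lambda>x. (cmod c)\<^sup>2 * cmod (u x) powr (2 * (p - 1)))"
    by (intro integrable_mult_right powr_integrable W12_alpha_power ua) (use p in auto)
  show ?thesis
  proof (rule rL2_bound(1)[OF i m], rule AE_I2)
    fix x
    have "\<bar>rpart c (u x)\<bar> \<le> cmod (u x) * cmod c"
      unfolding rpart_eq using abs_Re_le_cmod[of "cnj (u x) * c"] by (simp add: norm_mult)
    then have "(rpart c (u x))\<^sup>2 \<le> (cmod (u x) * cmod c)\<^sup>2" by (rule abs_le_square_iff[THEN iffD1, of "rpart c (u x)" "cmod (u x) * cmod c", simplified])
    then have "(b x * rpart c (u x))\<^sup>2 \<le> (b x)\<^sup>2 * (cmod (u x) * cmod c)\<^sup>2"
      unfolding power_mult_distrib by (intro mult_left_mono) auto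
    also have "\<dots> = (cmod c)\<^sup>2 * (b x * cmod (u x))\<^sup>2" by (simp add: power_mult_distrib mult_ac)
    also have "(b x * cmod (u x))\<^sup>2 = cmod (u x) powr (2 * (p - 1))"
    proof (cases "u x = 0")
      case False
      have "b x * cmod (u x) = cmod (u x) powr (p - 1)"
        using False powr_add[of "cmod (u x)" "p - 2" 1] by (simp add: b_def)
      moreover have "(cmod (u x) powr (p - 1))\<^sup>2 = cmod (u x) powr (2 * (p - 1))"
        by (simp add: power2_eq_square flip: powr_add)
      ultimately show ?thesis by simp
    qed simp
    finally show "(b x * rpart c (u x))\<^sup>2 \<le> (cmod c)\<^sup>2 * cmod (u x) powr (2 * (p - 1))" .
  qed
qed

lemma V_meas: "V \<in> borel_measurable lebesgue"
  unfolding V_def by (rule pot_meas) (intro borel_measurable_power meas_cmod um)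

lemma F_meas: "F c \<in> borel_measurable lebesgue"
  unfolding F_def[abs_def] \<kappa>_def b_def
  by (intro borel_measurable_times borel_measurable_diff borel_measurable_add powr_real_measurable borel_measurable_const
      meas_cmod um V_meas rL2D(1)[OF rL2_rpart[OF uL2]])

text \<open>On a ball the logarithmic growth of \<open>V\<close> is bounded, while the power term is
  square integrable on the whole plane.\<close>

lemma F_loc: "rL2 (loc R (F c))"
proof -
  obtain K where K: "K \<ge> 0" "\<And>x. \<bar>V x\<bar> \<le> K * (1 + lw x)"
    using pot_bound[OF X_dens[OF u]] unfolding V_def by blast
  define k where "k x = indicator (cball 0 R) x * (lam0 - V x - \<omega>)" for x :: plane
  have "rL2 (\<lambda>x. k x * rpart c (u x))"
  proof (rule rL2_bounded_mult(1)[OF rL2_rpart[OF uL2]])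
    show "k \<in> borel_measurable lebesgue"
      unfolding k_def[abs_def] by (intro borel_measurable_times borel_measurable_diff V_meas borel_measurable_const rL2D(1)[OF ind_rL2])
    show "\<bar>k x\<bar> \<le> lam0 + K * (1 + ln (1 + \<bar>R\<bar>)) + \<bar>\<omega>\<bar>" for x
    proof (cases "norm x \<le> R")
      case True
      have "lw x \<le> ln (1 + \<bar>R\<bar>)" unfolding lw_def using True by (subst ln_le_cancel_iff) (auto intro: add_pos_nonneg)
      then have "K * (1 + lw x) \<le> K * (1 + ln (1 + \<bar>R\<bar>))" using K(1) by (intro mult_left_mono) auto
      then show ?thesis using K(2)[of x] lam0 True by (simp add: k_def)
    next
      case False
      have "0 \<le> K * (1 + ln (1 + \<bar>R\<bar>))" using K(1) by (intro mult_nonneg_nonneg) auto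
      then show ?thesis using False lam0 by (simp add: k_def)
    qed
  qed
  moreover have "rL2 (\<lambda>x. (indicator (cball 0 R) x * \<beta>) * (b x * rpart c (u x)))"
    by (rule rL2_bounded_mult(1)[OF bu_rL2 borel_measurable_times[OF rL2D(1)[OF ind_rL2] borel_measurable_const], where B = "\<bar>\<beta>\<bar>"])
      (simp add: indicator_def)
  ultimately have "rL2 (\<lambda>x. k x * rpart c (u x) + (indicator (cball 0 R) x * \<beta>) * (b x * rpart c (u x)))" by (rule rL2_add(1))
  moreover have "loc R (F c) = (\<lambda>x. k x * rpart c (u x) + (indicator (cball 0 R) x * \<beta>) * (b x * rpart c (u x)))"
    by (rule ext) (simp add: loc_def F_def k_def \<kappa>_def algebra_simps)
  ultimately show ?thesis by simp
qed

lemma poisson: "screened_poisson (\<lambda>x. rpart c (\<psi> x)) (\<lambda>i x. rpart c (weak_partial i \<psi> x)) (F c) lam0"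
proof
  show "rL2 (\<lambda>x. rpart c (\<psi> x))" using \<psi>_W12 by (intro rL2_rpart) (simp add: W12_def)
qed (intro lam0 rL2_rpart rweak_rpart W12_weak_partial \<psi>_W12 F_meas F_loc weak_equation | assumption)+

lemma \<psi>_W22loc: "\<psi> \<in> W22loc"
  unfolding W22loc_def
proof (intro CollectI conjI allI)
  show "\<psi> \<in> L2loc" using \<psi>_W12 by (intro L2_L2loc) (simp add: W12_def)
  fix i
  show "\<exists>g\<in>L2loc. has_weak_partial i \<psi> g \<and> (\<forall>j. \<exists>h\<in>L2loc. has_weak_partial j g h)"
  proof (rule bexI[of _ "weak_partial i \<psi>"], intro conjI allI W12_weak_partial \<psi>_W12)
    show "weak_partial i \<psi> \<in> L2loc" by (rule L2_L2loc[OF W12_weak_partial(2)[OF \<psi>_W12]])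
    fix j
    obtain h where h: "h \<in> borel_measurable lebesgue" "\<And>R. rL2 (loc R h)" "rweak j (\<lambda>x. Re (weak_partial i \<psi> x)) h"
      using screened_poisson.second_derivative[OF poisson[of 1], of j i] unfolding rpart_1 by blast
    obtain h' where h': "h' \<in> borel_measurable lebesgue" "\<And>R. rL2 (loc R h')" "rweak j (\<lambda>x. Im (weak_partial i \<psi> x)) h'"
      using screened_poisson.second_derivative[OF poisson[of \<i>], of j i] unfolding rpart_ii by blast
    have "(\<lambda>x. Complex (h x) (h' x)) \<in> borel_measurable lebesgue"
      using h(1) h'(1) by (simp add: borel_measurable_complex_iff)
    then show "\<exists>h\<in>L2loc. has_weak_partial j (weak_partial i \<psi>) h"
      by (intro bexI[of _ "\<lambda>x. Complex (h x) (h' x)"]) (use h h' in \<open>simp_all add: L2loc_iff has_weak_partial_iff\<close>)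
  qed
qed

text \<open>Each component of the value at the origin is computed twice: by
  \<open>screened_poisson.\<phi>_0\<close> as the integral of \<open>Gr lam0 * F c\<close>, and by
  \<open>charge_equation\<close> as \<open>\<alpha> + theta lam0\<close> times the component of the
  charge.\<close>

lemma \<psi>_continuous_rep:
  obtains g where "continuous_on UNIV g" "AE x in lebesgue. \<psi> x = g x" "of_real (\<alpha> + theta lam0) * q = g 0"
proof -
  note P = poisson[of 1] and Q = poisson[of \<i>]
  define a where "a = screened_poisson.\<phi> (\<lambda>x. rpart 1 (\<psi> x))"
  define a' where "a' = screened_poisson.\<phi> (\<lambda>x. rpart \<i> (\<psi> x))"
  show ?thesis
  proof (rule that[of "\<lambda>x. Complex (a x) (a' x)"])
    have "continuous_on UNIV a" "continuous_on UNIV a'"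
      unfolding a_def a'_def by (rule screened_poisson.\<phi>_continuous[OF P] screened_poisson.\<phi>_continuous[OF Q])+
    then show "continuous_on UNIV (\<lambda>x. Complex (a x) (a' x))" by (intro continuous_on_Complex) auto
    have "AE x in lebesgue. Re (\<psi> x) = a x" "AE x in lebesgue. Im (\<psi> x) = a' x"
      using screened_poisson.\<phi>_AE[OF P] screened_poisson.\<phi>_AE[OF Q] by (simp_all add: a_def a'_def rpart_1 rpart_ii)
    then show "AE x in lebesgue. \<psi> x = Complex (a x) (a' x)" by eventually_elim (simp add: complex_eq_iff)
    have "a 0 = (\<alpha> + theta lam0) * Re q"
      using screened_poisson.\<phi>_0[OF P charge_equation(1)] charge_equation(2)[of 1] by (simp add: a_def rpart_1)
    moreover have "a' 0 = (\<alpha> + theta lam0) * Im q"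
      using screened_poisson.\<phi>_0[OF Q charge_equation(1)] charge_equation(2)[of \<i>] by (simp add: a'_def rpart_ii)
    ultimately show "of_real (\<alpha> + theta lam0) * q = Complex (a 0) (a' 0)" by (simp add: complex_eq_iff)
  qed
qed

lemma dom: "dom_decomp \<alpha> u \<psi> q lam0" "(\<lambda>x. c * u x) \<in> Dom_neg_Delta \<alpha>"
proof -
  obtain g where g: "continuous_on UNIV g" "AE x in lebesgue. \<psi> x = g x" "of_real (\<alpha> + theta lam0) * q = g 0"
    by (rule \<psi>_continuous_rep)
  have e: "AE x in lebesgue. u x = \<psi> x + q * green lam0 x" by (rule AE_I2) (simp add: u_eq green_Gr)
  note d = dom_decompI[OF \<psi>_W22loc lam0 g e]
  show "dom_decomp \<alpha> u \<psi> q lam0" by (rule d(1))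
  show "(\<lambda>x. c * u x) \<in> Dom_neg_Delta \<alpha>" unfolding Dom_neg_Delta_def using d(2) by blast
qed

text \<open>The distributional equation of \<open>u\<close> itself. It mentions no regular part, so
  it can be compared with any decomposition; the Green part of \<open>u\<close> leaves the point
  mass with weight \<open>rpart c q\<close>.\<close>

lemma u_test:
  assumes \<eta>: "\<eta> \<in> test_functions"
  shows "(LINT x|lebesgue. \<eta> x * F c x) = lam0 * (LINT x|lebesgue. \<eta> x * rpart c (u x))
    - (LINT x|lebesgue. laplace \<eta> x * rpart c (u x)) - rpart c q * \<eta> 0"
proof -
  have iu: "integrable lebesgue (\<lambda>x. \<zeta> x * rpart c (u x))" if "\<zeta> \<in> test_functions" for \<zeta>
    by (rule test_mult_integrable[OF that rL2_rL1loc[OF rL2_rpart[OF uL2]]])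
  have iG: "integrable lebesgue (\<lambda>x. \<zeta> x * Gr lam0 x)" if "\<zeta> \<in> test_functions" for \<zeta>
    by (rule test_mult_integrable[OF that rL2_rL1loc[OF Gr_rL2[OF lam0]]])
  have e: "rpart c (\<psi> x) = rpart c (u x) - rpart c q * Gr lam0 x" for x
    by (simp add: u_eq rpart_linear)
  have I: "(LINT x|lebesgue. \<zeta> x * rpart c (\<psi> x)) = (LINT x|lebesgue. \<zeta> x * rpart c (u x)) - rpart c q * (LINT x|lebesgue. \<zeta> x * Gr lam0 x)"
    if "\<zeta> \<in> test_functions" for \<zeta>
  proof -
    have "(LINT x|lebesgue. \<zeta> x * rpart c (\<psi> x)) = (LINT x|lebesgue. \<zeta> x * rpart c (u x) - rpart c q * (\<zeta> x * Gr lam0 x))"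
      by (simp add: e algebra_simps)
    also have "\<dots> = (LINT x|lebesgue. \<zeta> x * rpart c (u x)) - (LINT x|lebesgue. rpart c q * (\<zeta> x * Gr lam0 x))"
      by (intro Bochner_Integration.integral_diff integrable_mult_right iu iG that)
    finally show ?thesis by simp
  qed
  have "(\<lambda>x. lam0 * \<eta> x - laplace \<eta> x) \<in> test_functions" by (intro test_diff test_cmult test_laplace \<eta>)
  note I' = I[OF this]
  have split: "(LINT x|lebesgue. (lam0 * \<eta> x - laplace \<eta> x) * h x) = lam0 * (LINT x|lebesgue. \<eta> x * h x) - (LINT x|lebesgue. laplace \<eta> x * h x)"
    if "\<And>\<zeta>. \<zeta> \<in> test_functions \<Longrightarrow> integrable lebesgue (\<lambda>x. \<zeta> x * h x)" for h
    using that[OF \<eta>] that[OF test_laplace[OF \<eta>]] by (simp add: left_diff_distrib mult.assoc)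
  note split_u = split[of "\<lambda>x. rpart c (u x)"] and split_G = split[of "Gr lam0"]
  show ?thesis
    unfolding weak_equation[OF \<eta>, of c, symmetric] I' split_u[OF iu, simplified] split_G[OF iG, simplified] Gr_laplace[OF lam0 \<eta>]
    by simp
qed

text \<open>The decomposition may have another parameter and regular part. The multiple of
  \<open>\<eta> 0\<close> left in \<open>P\<close> is the difference of the charges
  \<open>q'\<close> and \<open>q\<close>; \<open>point_mass_zero\<close> then gives
  \<open>v = 0\<close> a.e., which is the equation.\<close>

lemma neg_Delta_rpart:
  assumes d: "dom_decomp \<alpha> u \<phi> q' l"
  shows "AE x in lebesgue. rpart c (- weak_laplacian \<phi> x - q' * of_real l * green l x) = (\<kappa> x - lam0) * rpart c (u x)"
proof -
  have \<phi>: "\<phi> \<in> W22loc" and l: "l > 0" and ue: "AE x in lebesgue. u x = \<phi> x + q' * green l x"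
    using d by (auto simp: dom_decomp_def)
  define L where "L x = rpart c (weak_laplacian \<phi> x)" for x
  have L1: "rL1loc L" unfolding L_def using weak_laplacian_test(1)[OF \<phi> moll_test] by blast
  have G1: "rL1loc (Gr l)" by (rule rL2_rL1loc[OF Gr_rL2[OF l]])
  have F1: "rL1loc (F c)" by (rule loc_rL1loc[OF F_meas F_loc])
  have u1: "rL1loc (\<lambda>x. rpart c (u x))" by (rule rL2_rL1loc[OF rL2_rpart[OF uL2]])
  have \<phi>1: "rL1loc (\<lambda>x. rpart c (\<phi> x))" using \<phi> by (intro rL1loc_rpart L2loc_L1loc) (simp add: W22loc_def)
  define v where "v x = (F c x - lam0 * rpart c (u x)) + (L x + (l * rpart c q') * Gr l x)" for x
  have v1: "rL1loc v" unfolding v_def by (intro rL1loc_add rL1loc_diff rL1loc_cmult F1 u1 L1 G1)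
  have P: "(LINT x|lebesgue. \<eta> x * v x) = (rpart c q' - rpart c q) * \<eta> 0" if \<eta>: "\<eta> \<in> test_functions" for \<eta>
  proof -
    note t = test_mult_integrable[OF \<eta>] test_mult_integrable[OF test_laplace[OF \<eta>]]
    have "(LINT x|lebesgue. \<eta> x * v x) = (LINT x|lebesgue. (\<eta> x * F c x - lam0 * (\<eta> x * rpart c (u x)))
        + (\<eta> x * L x + (l * rpart c q') * (\<eta> x * Gr l x)))"
      by (rule Bochner_Integration.integral_cong) (simp_all add: v_def algebra_simps)
    also have "\<dots> = ((LINT x|lebesgue. \<eta> x * F c x) - lam0 * (LINT x|lebesgue. \<eta> x * rpart c (u x)))
        + ((LINT x|lebesgue. \<eta> x * L x) + (l * rpart c q') * (LINT x|lebesgue. \<eta> x * Gr l x))"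
      using t(1)[OF F1] t(1)[OF u1] t(1)[OF L1] t(1)[OF G1] by simp
    also have "(LINT x|lebesgue. \<eta> x * F c x) = lam0 * (LINT x|lebesgue. \<eta> x * rpart c (u x))
        - (LINT x|lebesgue. laplace \<eta> x * rpart c (u x)) - rpart c q * \<eta> 0" by (rule u_test[OF \<eta>])
    also have "(LINT x|lebesgue. laplace \<eta> x * rpart c (u x)) = (LINT x|lebesgue. laplace \<eta> x * rpart c (\<phi> x) + rpart c q' * (laplace \<eta> x * Gr l x))"
    proof (rule LINT_AE_eq)
      show "(\<lambda>x. laplace \<eta> x * rpart c (u x)) \<in> borel_measurable lebesgue"
        using t(2)[OF u1] by (rule borel_measurable_integrable)
      show "AE x in lebesgue. laplace \<eta> x * rpart c (u x) = laplace \<eta> x * rpart c (\<phi> x) + rpart c q' * (laplace \<eta> x * Gr l x)"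
        using ue by (rule AE_mp) (simp add: green_Gr rpart_linear algebra_simps)
    qed
    also have "\<dots> = (LINT x|lebesgue. laplace \<eta> x * rpart c (\<phi> x)) + rpart c q' * (LINT x|lebesgue. laplace \<eta> x * Gr l x)"
      using t(2)[OF \<phi>1] t(2)[OF G1] by simp
    also have "(LINT x|lebesgue. laplace \<eta> x * rpart c (\<phi> x)) = (LINT x|lebesgue. \<eta> x * L x)"
      unfolding L_def by (rule weak_laplacian_test(2)[OF \<phi> \<eta>])
    also have "(LINT x|lebesgue. laplace \<eta> x * Gr l x) = l * (LINT x|lebesgue. \<eta> x * Gr l x) - \<eta> 0"
      by (rule Gr_laplace[OF l \<eta>])
    finally show ?thesis by (simp add: algebra_simps)
  qed
  have "AE x in lebesgue. v x = 0" by (rule point_mass_zero(2)[OF v1]) (rule P)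
  then show ?thesis
  proof (rule AE_mp, intro AE_I2 impI)
    fix x assume "v x = 0"
    moreover have "rpart c (q' * of_real l * of_real (Gr l x)) = l * rpart c q' * Gr l x" by (simp add: rpart_linear)
    ultimately show "rpart c (- weak_laplacian \<phi> x - q' * of_real l * green l x) = (\<kappa> x - lam0) * rpart c (u x)"
      by (simp add: v_def L_def F_def green_Gr rpart_linear algebra_simps)
  qed
qed

lemma neg_Delta_eq:
  "AE x in lebesgue. neg_Delta \<alpha> u x + of_real \<omega> * u x
    = of_real (log_potential u x) * u x + of_real \<beta> * u x * of_real (cmod (u x) powr (p - 2))"
proof -
  obtain \<phi> q' l where s: "(SOME (\<phi>, q', l). dom_decomp \<alpha> u \<phi> q' l) = (\<phi>, q', l)" by (metis prod_cases3)
  \<comment> \<open>The choice made inside \<open>neg_Delta\<close> is admissible because the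
    decomposition at \<open>lam0\<close> exists; this is all that is known about it.\<close>
  have "case (SOME (\<phi>, q', l). dom_decomp \<alpha> u \<phi> q' l) of (\<phi>, q', l) \<Rightarrow> dom_decomp \<alpha> u \<phi> q' l"
    by (rule someI[of _ "(\<psi>, q, lam0)"]) (use dom(1) in simp)
  then have d: "dom_decomp \<alpha> u \<phi> q' l" unfolding s by simp
  have n: "neg_Delta \<alpha> u x = - weak_laplacian \<phi> x - q' * of_real l * green l x" for x
    unfolding neg_Delta_def s by simp
  have k: "\<kappa> x - lam0 + \<omega> = log_potential u x + \<beta> * cmod (u x) powr (p - 2)" for x
    by (simp add: \<kappa>_def b_def V_def pot_def log_potential_def)
  show ?thesis using neg_Delta_rpart[OF d, of 1] neg_Delta_rpart[OF d, of \<i>]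
  proof eventually_elim
    case (elim x)
    then have "neg_Delta \<alpha> u x = of_real (\<kappa> x - lam0) * u x"
      unfolding n rpart_1 rpart_ii by (simp add: complex_eq_iff)
    then have "neg_Delta \<alpha> u x + of_real \<omega> * u x = of_real (\<kappa> x - lam0 + \<omega>) * u x" by (simp add: algebra_simps)
    then show ?case unfolding k by (simp add: algebra_simps)
  qed
qed

end

theorem proposition1p6:
  fixes \<alpha> \<beta> p c \<omega> :: real
    and u :: "plane \<Rightarrow> complex"
    and dE :: "(plane \<Rightarrow> complex) \<Rightarrow> real"
  assumes "p > 2" and "c > 0"
    and "u \<in> sphere_X c"
    and "has_X_derivative \<alpha> (energy \<alpha> \<beta> p) dE u"
    and "\<forall>v\<in>X_space. dE v + \<omega> * Re (inner_L2 u v) = 0"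
  shows "u \<in> Dom_neg_Delta \<alpha> \<and>
    (\<forall>t::real. (\<lambda>x. exp (\<i> * of_real (\<omega> * t)) * u x) \<in> Dom_neg_Delta \<alpha>) \<and>
    (AE x in lebesgue.
       neg_Delta \<alpha> u x + of_real \<omega> * u x
       = of_real (log_potential u x) * u x
         + of_real \<beta> * u x * of_real (cmod (u x) powr (p - 2)))"
proof -
  interpret critical_point \<alpha> \<beta> p \<omega> u dE
    by unfold_locales (use assms in \<open>auto simp: sphere_X_def\<close>)
  \<comment> \<open>The factor 1 gives membership of \<open>u\<close>, the phases give membership of
    its orbit.\<close>
  show ?thesis using dom(2)[of 1] dom(2) neg_Delta_eq by simp
qed

end
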